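(* Let $\mathbb{B}^3$ be the closed unit ball of $\mathbb{R}^3$. Every orientable free boundary minimal surface $\Sigma$ in $\mathbb{B}^3$ is either a flat disk passing through the origin, in which case its index equals $1$, or has index at least $4$. Moreover, the index of the critical catenoid is exactly $4$, so that the lower bound $4$ is attained.
   Context: A free boundary minimal surface in $\mathbb{B}^3=\{x\in\mathbb{R}^3:\|x\|\le 1\}$ is a compact, connected surface with boundary $\Sigma$, smoothly embedded in $\mathbb{B}^3$, with $\partial\Sigma\subset S^2=\partial\mathbb{B}^3$, which is minimal (zero mean curvature) and which meets $S^2$ orthogonally along $\partial\Sigma$; the last condition is equivalent to saying that along $\partial\Sigma$ the exterior unit conormal $\nu$ of $\Sigma$ equals the position vector $X$. The index of an oriented free boundary minimal surface $\Sigma$ is the maximal dimension of a vector space of smooth real functions on $\Sigma$ (smooth up to the boundary) on which the quadratic form $$Q(u)=\int_\Sigma\left(|\nabla u|^2-|A|^2u^2\right)-\int_{\partial\Sigma}u^2$$ is negative definite, where $|A|^2$ is the squared norm of the second fundamental form (the sum of the squares of the principal curvatures). The critical catenoid is the free boundary minimal surface in $\mathbb{B}^3$ given as the image of $$(s,\theta)\mapsto a\left(\cosh(s)\cos\theta,\cosh(s)\sin\theta,s\right),\quad s\in[-T,T],\ \theta\in[0,2\pi),$$ where $T$ is the unique positive solution of $T\tanh(T)=1$ and $a=\frac{1}{T\cosh(T)}$. *)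

theory Defs
  imports
    "HOL-Analysis.Analysis"
    "HOL-Library.Function_Algebras"
    "HOL-Library.Extended_Nat"
begin

section \<open>Smooth maps\<close>

primrec Ck_on :: "nat \<Rightarrow> 'a::euclidean_space set \<Rightarrow> ('a \<Rightarrow> 'b::real_normed_vector) \<Rightarrow> bool" where
  "Ck_on 0 W f \<longleftrightarrow> continuous_on W f"
| "Ck_on (Suc k) W f \<longleftrightarrow>
     (\<forall>x\<in>W. f differentiable (at x)) \<and> (\<forall>v. Ck_on k W (\<lambda>x. frechet_derivative f (at x) v))"

text \<open>Only meaningful, and only used, for open sets.\<close>

definition smooth_on :: "'a::euclidean_space set \<Rightarrow> ('a \<Rightarrow> 'b::real_normed_vector) \<Rightarrow> bool" where
  "smooth_on W f \<longleftrightarrow> (\<forall>k. Ck_on k W f)"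

definition partial_deriv :: "(real^2 \<Rightarrow> 'b::real_normed_vector) \<Rightarrow> 2 \<Rightarrow> real^2 \<Rightarrow> 'b" where
  "partial_deriv f i y = frechet_derivative f (at y) (axis i 1)"


section \<open>Smoothly embedded surfaces with boundary in three-space\<close>

definition half_plane :: "(real^2) set" where
  "half_plane = {y. 0 \<le> y $ 2}"

text \<open>
  A local parametrization is a smooth immersion \<open>\<psi>\<close> of an open subset \<open>W\<close> of the plane whose
  restriction to \<open>W \<inter> half_plane\<close> is a homeomorphism onto a relatively open subset of \<open>S\<close>.
  Only the values on the half plane lie on \<open>S\<close>; the rest of \<open>W\<close> serves to express smoothness up
  to the boundary.  Parametrizations around interior points have \<open>W\<close> inside the open half plane.
\<close>

definition local_param :: "(real^3) set \<Rightarrow> (real^2) set \<Rightarrow> (real^2 \<Rightarrow> real^3) \<Rightarrow> bool" where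
  "local_param S W \<psi> \<longleftrightarrow>
     open W \<and> smooth_on W \<psi> \<and>
     (\<forall>y\<in>W. inj (frechet_derivative \<psi> (at y))) \<and>
     openin (top_of_set S) (\<psi> ` (W \<inter> half_plane)) \<and>
     (\<exists>\<phi>. homeomorphism (W \<inter> half_plane) (\<psi> ` (W \<inter> half_plane)) \<psi> \<phi>)"

definition embedded_surface :: "(real^3) set \<Rightarrow> bool" where
  "embedded_surface S \<longleftrightarrow>
     (\<forall>p\<in>S. \<exists>W \<psi>. local_param S W \<psi> \<and> p \<in> \<psi> ` (W \<inter> half_plane))"

definition surface_boundary :: "(real^3) set \<Rightarrow> (real^3) set" where
  "surface_boundary S = {p. \<exists>W \<psi> y. local_param S W \<psi> \<and> y \<in> W \<and> y $ 2 = 0 \<and> p = \<psi> y}"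

definition tangent_plane :: "(real^3) set \<Rightarrow> real^3 \<Rightarrow> (real^3) set" where
  "tangent_plane S p =
     {v. \<exists>W \<psi> y. local_param S W \<psi> \<and> y \<in> W \<inter> half_plane \<and> \<psi> y = p \<and>
           v \<in> range (frechet_derivative \<psi> (at y))}"

text \<open>
  Orientability: some atlas has transition maps with positive Jacobian determinant.  The matrix \<open>M\<close>
  below is the Jacobian at \<open>y1\<close> of the transition map from \<open>\<psi>1\<close> to \<open>\<psi>2\<close>.
\<close>

definition orientable_surface :: "(real^3) set \<Rightarrow> bool" where
  "orientable_surface S \<longleftrightarrow>
     (\<exists>\<A>. (\<forall>(W, \<psi>)\<in>\<A>. local_param S W \<psi>) \<and>
          S \<subseteq> (\<Union>(W, \<psi>)\<in>\<A>. \<psi> ` (W \<inter> half_plane)) \<and>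
          (\<forall>(W1, \<psi>1)\<in>\<A>. \<forall>(W2, \<psi>2)\<in>\<A>. \<forall>y1\<in>W1 \<inter> half_plane. \<forall>y2\<in>W2 \<inter> half_plane.
             \<psi>1 y1 = \<psi>2 y2 \<longrightarrow>
             (\<exists>M::real^2^2. 0 < det M \<and>
                (\<forall>v. frechet_derivative \<psi>1 (at y1) v = frechet_derivative \<psi>2 (at y2) (M *v v)))))"

text \<open>
  \<open>\<nu>\<close> is the exterior unit conormal at a boundary point: tangent to the surface, of length one,
  orthogonal to the boundary curve (which is tangent to \<open>\<partial>\<^sub>1\<psi>\<close>), and pointing out of the surface,
  that is, the image of a vector pointing out of the half plane.
\<close>

definition exterior_conormal :: "(real^3) set \<Rightarrow> real^3 \<Rightarrow> real^3 \<Rightarrow> bool" where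
  "exterior_conormal S p \<nu> \<longleftrightarrow>
     (\<exists>W \<psi> y w. local_param S W \<psi> \<and> y \<in> W \<and> y $ 2 = 0 \<and> \<psi> y = p \<and>
        norm \<nu> = 1 \<and> \<nu> \<bullet> partial_deriv \<psi> 1 y = 0 \<and>
        w $ 2 < 0 \<and> \<nu> = frechet_derivative \<psi> (at y) w)"


section \<open>Curvature\<close>

definition first_fundamental_form :: "(real^2 \<Rightarrow> real^3) \<Rightarrow> real^2 \<Rightarrow> real^2^2" where
  "first_fundamental_form \<psi> y = (\<chi> i j. partial_deriv \<psi> i y \<bullet> partial_deriv \<psi> j y)"

definition param_normal :: "(real^2 \<Rightarrow> real^3) \<Rightarrow> real^2 \<Rightarrow> real^3" where
  "param_normal \<psi> y = sgn (cross3 (partial_deriv \<psi> 1 y) (partial_deriv \<psi> 2 y))"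

definition second_fundamental_form :: "(real^2 \<Rightarrow> real^3) \<Rightarrow> real^2 \<Rightarrow> real^2^2" where
  "second_fundamental_form \<psi> y =
     (\<chi> i j. partial_deriv (partial_deriv \<psi> j) i y \<bullet> param_normal \<psi> y)"

text \<open>The eigenvalues of the shape operator are the principal curvatures.\<close>

definition shape_operator :: "(real^2 \<Rightarrow> real^3) \<Rightarrow> real^2 \<Rightarrow> real^2^2" where
  "shape_operator \<psi> y =
     matrix_inv (first_fundamental_form \<psi> y) ** second_fundamental_form \<psi> y"

definition minimal_surface :: "(real^3) set \<Rightarrow> bool" where
  "minimal_surface S \<longleftrightarrow>
     (\<forall>W \<psi>. local_param S W \<psi> \<longrightarrow> (\<forall>y\<in>W \<inter> half_plane. trace (shape_operator \<psi> y) = 0))"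

text \<open>
  The squared norm \<open>g\<^sup>i\<^sup>k g\<^sup>j\<^sup>l h\<^sub>i\<^sub>j h\<^sub>k\<^sub>l\<close> of the second fundamental form is the trace of the square of the
  shape operator, i.e. the sum of the squares of its eigenvalues.  It does not depend on the
  parametrization nor on the sign of the normal.
\<close>

definition second_form_norm2 :: "(real^3) set \<Rightarrow> real^3 \<Rightarrow> real" where
  "second_form_norm2 S p =
     (THE a. \<exists>W \<psi> y. local_param S W \<psi> \<and> y \<in> W \<inter> half_plane \<and> \<psi> y = p \<and>
        a = trace (shape_operator \<psi> y ** shape_operator \<psi> y))"


section \<open>Area and length measures\<close>

text \<open>
  The area measure of \<open>S\<close>, as a Borel measure on three-space concentrated on \<open>S\<close>, is characterized
  by being given in each local parametrization by the area element \<open>\<bar>\<partial>\<^sub>1\<psi> \<times> \<partial>\<^sub>2\<psi>\<bar>\<close>; likewise for the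
  length measure of the boundary.  By the change of variables formula the requirements coming from
  different parametrizations are compatible, and countably many parametrizations cover \<open>S\<close>, so
  each of these measures exists and is unique for an embedded compact surface.
\<close>

definition area_measure :: "(real^3) set \<Rightarrow> (real^3) measure" where
  "area_measure S =
     (THE \<mu>. sets \<mu> = sets borel \<and> emeasure \<mu> (- S) = 0 \<and>
        (\<forall>W \<psi> B. local_param S W \<psi> \<longrightarrow> B \<in> sets borel \<longrightarrow> B \<subseteq> \<psi> ` (W \<inter> half_plane) \<longrightarrow>
           emeasure \<mu> B =
             (\<integral>\<^sup>+ y \<in> W \<inter> half_plane.
                indicator B (\<psi> y) *
                ennreal (norm (cross3 (partial_deriv \<psi> 1 y) (partial_deriv \<psi> 2 y))) \<partial>lborel)))"

definition boundary_length_measure :: "(real^3) set \<Rightarrow> (real^3) measure" where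
  "boundary_length_measure S =
     (THE \<mu>. sets \<mu> = sets borel \<and> emeasure \<mu> (- surface_boundary S) = 0 \<and>
        (\<forall>W \<psi> B. local_param S W \<psi> \<longrightarrow> B \<in> sets borel \<longrightarrow> B \<subseteq> \<psi> ` (W \<inter> {y. y $ 2 = 0}) \<longrightarrow>
           emeasure \<mu> B =
             (\<integral>\<^sup>+ t \<in> {t. vector [t, 0] \<in> W}.
                indicator B (\<psi> (vector [t, 0])) *
                ennreal (norm (partial_deriv \<psi> 1 (vector [t, 0]))) \<partial>lborel)))"


section \<open>Functions on a surface and the index\<close>

instantiation "fun" :: (type, real_vector) real_vector
begin

definition scaleR_fun :: "real \<Rightarrow> ('a \<Rightarrow> 'b) \<Rightarrow> 'a \<Rightarrow> 'b" where
  "scaleR_fun c u = (\<lambda>x. c *\<^sub>R u x)"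

instance
  by standard (simp_all add: scaleR_fun_def fun_eq_iff scaleR_add_right scaleR_add_left)

end

text \<open>
  Real functions on \<open>S\<close>, smooth up to the boundary, as a linear subspace of the functions on
  three-space: a function on \<open>S\<close> is identified with its extension by zero.  The extension by zero
  plays no role in smoothness, which asks for local smooth extensions \<open>F\<close> of the restriction to \<open>S\<close>.
\<close>

definition smooth_functions :: "(real^3) set \<Rightarrow> (real^3 \<Rightarrow> real) set" where
  "smooth_functions S =
     {u. (\<forall>x. x \<notin> S \<longrightarrow> u x = 0) \<and>
         (\<forall>p\<in>S. \<exists>U F. open U \<and> p \<in> U \<and> smooth_on U F \<and> (\<forall>x\<in>U \<inter> S. F x = u x))}"

text \<open>
  The intrinsic gradient is the tangent vector representing the derivative of \<open>u\<close> along \<open>S\<close>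
  (derivative within \<open>S\<close>; it is determined only in tangential directions).
\<close>

definition surface_gradient :: "(real^3) set \<Rightarrow> (real^3 \<Rightarrow> real) \<Rightarrow> real^3 \<Rightarrow> real^3" where
  "surface_gradient S u p =
     (THE v. v \<in> tangent_plane S p \<and> (u has_derivative (\<lambda>w. v \<bullet> w)) (at p within S))"

definition index_form :: "(real^3) set \<Rightarrow> (real^3 \<Rightarrow> real) \<Rightarrow> real" where
  "index_form S u =
     (\<integral>p. (norm (surface_gradient S u p))\<^sup>2 - second_form_norm2 S p * (u p)\<^sup>2 \<partial>area_measure S)
     - (\<integral>p. (u p)\<^sup>2 \<partial>boundary_length_measure S)"

text \<open>
  Subspaces of a negative definite space are negative definite, so the supremum over
  finite-dimensional spaces is \<open>\<infinity>\<close> if an infinite-dimensional one exists.  (The library's \<open>dim\<close> is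
  zero for infinite-dimensional spaces.)
\<close>

definition surface_index :: "(real^3) set \<Rightarrow> enat" where
  "surface_index S =
     Sup {enat (dim V) | V. subspace V \<and> (\<exists>B. finite B \<and> V = span B) \<and>
            V \<subseteq> smooth_functions S \<and> (\<forall>u\<in>V. u \<noteq> 0 \<longrightarrow> index_form S u < 0)}"


section \<open>Free boundary minimal surfaces in the unit ball\<close>

definition free_boundary_minimal_surface :: "(real^3) set \<Rightarrow> bool" where
  "free_boundary_minimal_surface S \<longleftrightarrow>
     S \<noteq> {} \<and> compact S \<and> connected S \<and> embedded_surface S \<and>
     S \<subseteq> cball 0 1 \<and> surface_boundary S \<subseteq> sphere 0 1 \<and>
     minimal_surface S \<and> (\<forall>p\<in>surface_boundary S. exterior_conormal S p p)"

definition flat_disk_through_origin :: "(real^3) set \<Rightarrow> bool" where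
  "flat_disk_through_origin S \<longleftrightarrow> (\<exists>P. subspace P \<and> dim P = 2 \<and> S = P \<inter> cball 0 1)"

definition catenoid_T :: real where
  "catenoid_T = (THE T. 0 < T \<and> T * tanh T = 1)"

definition catenoid_a :: real where
  "catenoid_a = 1 / (catenoid_T * cosh catenoid_T)"

definition critical_catenoid :: "(real^3) set" where
  "critical_catenoid =
     {catenoid_a *\<^sub>R vector [cosh s * cos \<theta>, cosh s * sin \<theta>, s] | s \<theta>.
        s \<in> {- catenoid_T .. catenoid_T} \<and> \<theta> \<in> {0 ..< 2 * pi}}"

end

(*
The lower bound is tested on the restrictions u = c + <x, v> of affine functions. The first variation
formula for the fields g v, g affine, gives Q(u) = - int |A|^2 u^2 - c^2 length(boundary), which is
negative for u <> 0 unless u vanishes on a piece of the surface where A <> 0; such a piece would be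
planar, so failure forces A = 0 everywhere and the surface is a flat disk.

For the upper bounds it suffices to find one (disk) or four (catenoid) linear functionals on whose
common kernel Q is nonnegative. Separate u into its angular mean, its first Fourier modes p, q and a
remainder. On the disk the mean over the boundary is prescribed to vanish. On the catenoid, where Q
becomes the integral of u_s^2 + u_t^2 - 2 u^2 / cosh^2 s minus a boundary term, the mean is prescribed
to vanish on both boundary circles and p, q on the neck s = 0; the mean and the first modes are then
compared with the Jacobi fields 1 - s tanh s and s / cosh s + sinh s, and the remainder satisfies
the Wirtinger inequality with constant 4, which is absorbed by the Riccati function tanh.
*)

theory Submission imports Defs begin

section \<open>Calculus on the half plane\<close>

text \<open>The surface is known only through parametrizations that are not related to one another a
  priori, and boundary points are seen from one side only. Area, length, gradient and
  \<open>second_form_norm2\<close> are descriptions by \<open>THE\<close> over all of them, so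
  nothing can be computed before transition maps between relatively open pieces of the half plane
  are shown to be differentiable, to preserve the edge and to conjugate the shape operators up to
  sign.

  The two Jacobi fields have a geometric origin. \<open>1 - s * tanh s\<close> is the normal
  component of the position field, that is, of dilations; it vanishes at the ends exactly because
  \<open>T * tanh T = 1\<close>, which is why the mean is prescribed there. Multiplied by cos t or
  sin t, \<open>s / cosh s + sinh s\<close> is the normal component of a rotation about a horizontal
  axis. Rotations preserve the ball, so this field satisfies the natural boundary condition of Q;
  its only zero is at the neck, which is why the first modes are prescribed there.\<close>

lemma smooth_on_has_derivative:
  assumes "smooth_on W f" "y \<in> W"
  shows "(f has_derivative frechet_derivative f (at y)) (at y)"
proof -
  have "Ck_on (Suc 0) W f" using assms(1) unfolding smooth_on_def by blast
  then show ?thesis using assms(2) by (simp add: frechet_derivative_works)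
qed

lemma smooth_on_frechet_derivative:
  assumes "smooth_on W f"
  shows "smooth_on W (\<lambda>y. frechet_derivative f (at y) v)"
  unfolding smooth_on_def
proof
  fix k
  have "Ck_on (Suc k) W f" using assms(1) unfolding smooth_on_def by blast
  then show "Ck_on k W (\<lambda>y. frechet_derivative f (at y) v)" by simp
qed

lemma smooth_on_partial_deriv:
  "smooth_on W f \<Longrightarrow> smooth_on W (partial_deriv f i)"
  using smooth_on_frechet_derivative[of W f "axis i 1"] by (simp add: partial_deriv_def[abs_def])

lemma smooth_on_imp_continuous_on: "smooth_on W f \<Longrightarrow> continuous_on W f"
  unfolding smooth_on_def using Ck_on.simps(1) by blast

lemma vec2_expand: "(v::real^2) = v $ 1 *\<^sub>R axis 1 1 + v $ 2 *\<^sub>R axis 2 1"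
  by (simp add: vec_eq_iff forall_2 axis_def)

lemma linear_real2_expand:
  assumes "linear (f :: real^2 \<Rightarrow> 'b::real_vector)"
  shows "f v = v $ 1 *\<^sub>R f (axis 1 1) + v $ 2 *\<^sub>R f (axis 2 1)"
  by (subst vec2_expand[of v]) (simp add: linear_add[OF assms] linear_scale[OF assms])

lemma frechet_eq_partials:
  assumes "f differentiable (at y)"
  shows "frechet_derivative f (at y) v = v $ 1 *\<^sub>R partial_deriv f 1 y + v $ 2 *\<^sub>R partial_deriv f 2 y"
  unfolding partial_deriv_def
  by (rule linear_real2_expand) (rule linear_frechet_derivative[OF assms])

lemma has_derivative_partials:
  assumes "smooth_on W f" "y \<in> W"
  shows "(f has_derivative (\<lambda>v. v $ 1 *\<^sub>R partial_deriv f 1 y + v $ 2 *\<^sub>R partial_deriv f 2 y)) (at y)"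
proof -
  have d: "(f has_derivative frechet_derivative f (at y)) (at y)"
    by (rule smooth_on_has_derivative[OF assms])
  then have "f differentiable (at y)" by (auto simp: differentiable_def)
  then show ?thesis using d frechet_eq_partials[of f y] by (metis (no_types, lifting) ext)
qed

lemma partial_deriv_eqI:
  "(f has_derivative f') (at y) \<Longrightarrow> partial_deriv f i y = f' (axis i 1)"
  unfolding partial_deriv_def using frechet_derivative_at by metis

section \<open>Symmetry of mixed partial derivatives\<close>

lemma has_derivative_real_line:
  fixes f :: "real^2 \<Rightarrow> real"
  assumes "smooth_on W f" "a + t *\<^sub>R axis i 1 \<in> W"
  shows "((\<lambda>s. f (a + s *\<^sub>R axis i 1)) has_real_derivative partial_deriv f i (a + t *\<^sub>R axis i 1)) (at t)"
proof -
  have d: "(f has_derivative frechet_derivative f (at (a + t *\<^sub>R axis i 1))) (at (a + t *\<^sub>R axis i 1))"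
    by (rule smooth_on_has_derivative[OF assms])
  have l: "linear (frechet_derivative f (at (a + t *\<^sub>R axis i 1)))"
    using d has_derivative_linear by blast
  have "((\<lambda>s. a + s *\<^sub>R axis i 1) has_derivative (\<lambda>s. s *\<^sub>R axis i 1)) (at t)"
    by (auto intro!: derivative_eq_intros)
  from has_derivative_compose[OF this d]
  show ?thesis unfolding has_field_derivative_def partial_deriv_def
    by (simp add: linear_scale[OF l] mult_commute_abs)
qed

text \<open>The second difference of f over a square of side h is symmetric in the two directions,
  while the mean value theorem, applied once in each direction, turns it into a mixed partial
  derivative. The diagonal of the square is shorter than \<open>2 * h\<close>, hence the radius of
  the ball required inside W.\<close>

lemma symmetric_partials_real_aux:
  fixes f :: "real^2 \<Rightarrow> real"
  assumes sm: "smooth_on W f" and b: "ball y (2*h) \<subseteq> W" and h: "0 < h" and ij: "i \<noteq> j"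
  obtains z where "dist z y < 2 * h"
    "f (y + h *\<^sub>R axis i 1 + h *\<^sub>R axis j 1) - f (y + h *\<^sub>R axis i 1) - f (y + h *\<^sub>R axis j 1) + f y
       = h * (h * partial_deriv (partial_deriv f i) j z)"
proof -
  have ax: "axis i 1 \<bullet> (axis j 1 :: real^2) = 0" using ij by (simp add: inner_axis_axis)
  have sq: "norm (s *\<^sub>R axis i 1 + t *\<^sub>R axis j 1 :: real^2) < 2 * h" if "\<bar>s\<bar> \<le> h" "\<bar>t\<bar> \<le> h" for s t
  proof -
    have "(norm (s *\<^sub>R axis i 1 + t *\<^sub>R axis j 1 :: real^2))\<^sup>2 = s\<^sup>2 + t\<^sup>2"
      unfolding power2_norm_eq_inner
      using ij by (simp add: inner_add_left inner_add_right inner_axis_axis power2_eq_square)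
    also have "\<dots> \<le> h\<^sup>2 + h\<^sup>2" using that h by (intro add_mono) (auto simp: abs_le_square_iff[symmetric])
    also have "\<dots> < (2*h)\<^sup>2" using h by (simp add: power2_eq_square)
    finally show ?thesis using h by (meson power2_less_imp_less less_eq_real_def mult_pos_pos zero_less_numeral)
  qed
  have inW: "y + s *\<^sub>R axis i 1 + t *\<^sub>R axis j 1 \<in> W" if "\<bar>s\<bar> \<le> h" "\<bar>t\<bar> \<le> h" for s t
  proof (rule subsetD[OF b])
    have "dist y (y + s *\<^sub>R axis i 1 + t *\<^sub>R axis j 1) = norm (s *\<^sub>R axis i 1 + t *\<^sub>R axis j 1 :: real^2)"
      by (metis add.assoc add_diff_cancel_left' dist_commute dist_norm)
    then show "y + s *\<^sub>R axis i 1 + t *\<^sub>R axis j 1 \<in> ball y (2*h)" using sq[OF that] by simp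
  qed
  \<comment> \<open>The increment of f across the square in direction j, as a function of the
    position s in direction i; the second difference is the increment of g.\<close>
  define g where "g s = f (y + h *\<^sub>R axis j 1 + s *\<^sub>R axis i 1) - f (y + s *\<^sub>R axis i 1)" for s
  have dg: "(g has_real_derivative (partial_deriv f i (y + h *\<^sub>R axis j 1 + s *\<^sub>R axis i 1)
      - partial_deriv f i (y + s *\<^sub>R axis i 1))) (at s)" if "0 \<le> s" "s \<le> h" for s
    unfolding g_def
    by (intro DERIV_diff has_derivative_real_line[OF sm])
      (use inW[of s h] inW[of s 0] that h in \<open>auto simp: algebra_simps\<close>)
  obtain s where s: "0 < s" "s < h" "g h - g 0 = (h - 0) * (partial_deriv f i (y + h *\<^sub>R axis j 1 + s *\<^sub>R axis i 1)
      - partial_deriv f i (y + s *\<^sub>R axis i 1))"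
    using MVT2[OF h, of g "\<lambda>s. partial_deriv f i (y + h *\<^sub>R axis j 1 + s *\<^sub>R axis i 1)
      - partial_deriv f i (y + s *\<^sub>R axis i 1)"] dg by auto
  define k where "k t = partial_deriv f i (y + s *\<^sub>R axis i 1 + t *\<^sub>R axis j 1)" for t
  have dk: "(k has_real_derivative (partial_deriv (partial_deriv f i) j (y + s *\<^sub>R axis i 1 + t *\<^sub>R axis j 1))) (at t)"
    if "0 \<le> t" "t \<le> h" for t
    unfolding k_def
    by (intro has_derivative_real_line[OF smooth_on_partial_deriv[OF sm]] inW)
      (use s that in auto)
  obtain t where t: "0 < t" "t < h" "k h - k 0 = (h - 0) * partial_deriv (partial_deriv f i) j (y + s *\<^sub>R axis i 1 + t *\<^sub>R axis j 1)"
    using MVT2[OF h, of k "\<lambda>t. partial_deriv (partial_deriv f i) j (y + s *\<^sub>R axis i 1 + t *\<^sub>R axis j 1)"] dk by auto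
  show ?thesis
  proof (rule that)
    show "dist (y + s *\<^sub>R axis i 1 + t *\<^sub>R axis j 1) y < 2 * h"
      using sq[of s t] s t by (simp add: dist_norm add.assoc)
    have "g h - g 0 = h * (k h - k 0)" using s(3) by (simp add: k_def add.commute add.left_commute)
    then have "g h - g 0 = h * (h * partial_deriv (partial_deriv f i) j (y + s *\<^sub>R axis i 1 + t *\<^sub>R axis j 1))"
      using t(3) by simp
    then show "f (y + h *\<^sub>R axis i 1 + h *\<^sub>R axis j 1) - f (y + h *\<^sub>R axis i 1) - f (y + h *\<^sub>R axis j 1) + f y
       = h * (h * partial_deriv (partial_deriv f i) j (y + s *\<^sub>R axis i 1 + t *\<^sub>R axis j 1))"
      by (simp add: g_def add.commute add.left_commute)
  qed
qed

text \<open>Both orders of differentiation represent one and the same second difference, at points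
  \<open>z1\<close> and \<open>z2\<close> close to y. If the two derivatives differed at y,
  continuity would keep these two values apart for small h.\<close>

lemma symmetric_partials_real:
  fixes f :: "real^2 \<Rightarrow> real"
  assumes W: "open W" and sm: "smooth_on W f" and y: "y \<in> W"
  shows "partial_deriv (partial_deriv f i) j y = partial_deriv (partial_deriv f j) i y"
proof (cases "i = j")
  case False
  let ?A = "partial_deriv (partial_deriv f i) j" and ?B = "partial_deriv (partial_deriv f j) i"
  have cA: "isCont ?A y" and cB: "isCont ?B y"
    using smooth_on_imp_continuous_on[OF smooth_on_partial_deriv[OF smooth_on_partial_deriv[OF sm]]]
      W y continuous_on_eq_continuous_at by blast+
  show ?thesis
  proof (rule ccontr)
    assume "?A y \<noteq> ?B y"
    then have e: "0 < \<bar>?A y - ?B y\<bar> / 2" (is "0 < ?e") by simp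
    obtain d1 where d1: "d1 > 0" "\<And>z. dist z y < d1 \<Longrightarrow> dist (?A z) (?A y) < ?e"
      using cA e unfolding continuous_at_eps_delta by blast
    obtain d2 where d2: "d2 > 0" "\<And>z. dist z y < d2 \<Longrightarrow> dist (?B z) (?B y) < ?e"
      using cB e unfolding continuous_at_eps_delta by blast
    obtain d3 where d3: "d3 > 0" "ball y d3 \<subseteq> W" using W y openE by blast
    define h where "h = min d1 (min d2 d3) / 2"
    have h: "h > 0" "2*h \<le> d1" "2*h \<le> d2" "2*h \<le> d3" using d1 d2 d3 by (auto simp: h_def)
    have b: "ball y (2*h) \<subseteq> W" using d3 h by auto
    obtain z1 where z1: "dist z1 y < 2 * h"
      "f (y + h *\<^sub>R axis i 1 + h *\<^sub>R axis j 1) - f (y + h *\<^sub>R axis i 1) - f (y + h *\<^sub>R axis j 1) + f y = h * (h * ?A z1)"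
      using symmetric_partials_real_aux[OF sm b h(1) False] by blast
    obtain z2 where z2: "dist z2 y < 2 * h"
      "f (y + h *\<^sub>R axis j 1 + h *\<^sub>R axis i 1) - f (y + h *\<^sub>R axis j 1) - f (y + h *\<^sub>R axis i 1) + f y = h * (h * ?B z2)"
      using symmetric_partials_real_aux[OF sm b h(1)] False by metis
    have "h * (h * ?A z1) = h * (h * ?B z2)" using z1(2) z2(2) by (simp add: algebra_simps)
    then have eq: "?A z1 = ?B z2" using h by simp
    have "dist (?A z1) (?A y) < ?e" "dist (?B z2) (?B y) < ?e" using d1 d2 h z1 z2 by auto
    then show False using eq unfolding dist_real_def by (smt (verit) field_sum_of_halves)
  qed
qed simp

lemma frechet_derivative_cong_open:
  assumes "open W" "y \<in> W" "\<And>z. z \<in> W \<Longrightarrow> f z = g z"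
  shows "frechet_derivative f (at y) = frechet_derivative g (at y)"
    "f differentiable (at y) \<longleftrightarrow> g differentiable (at y)"
proof -
  have "(f has_derivative D) (at y) \<longleftrightarrow> (g has_derivative D) (at y)" for D
    using has_derivative_transform_within_open[of f D y UNIV W g]
      has_derivative_transform_within_open[of g D y UNIV W f] assms by metis
  then show "frechet_derivative f (at y) = frechet_derivative g (at y)"
    "f differentiable (at y) \<longleftrightarrow> g differentiable (at y)"
    unfolding frechet_derivative_def differentiable_def by simp_all
qed

text \<open>The recursion of \<open>Ck_on\<close> mentions derivatives only at points of W, so a
  formula for the derivative that is valid on W alone may replace it. This is how inner products,
  sums and products pass smoothness down one order.\<close>

lemma Ck_on_cong:
  assumes "open W" "\<And>y. y \<in> W \<Longrightarrow> g y = h y"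
  shows "Ck_on k W g \<longleftrightarrow> Ck_on k W h"
  using assms(2)
proof (induction k arbitrary: g h)
  case 0
  then show ?case using continuous_on_cong[of W W g h] by simp
next
  case (Suc k)
  have eq: "frechet_derivative g (at y) = frechet_derivative h (at y)"
      "g differentiable (at y) \<longleftrightarrow> h differentiable (at y)" if "y \<in> W" for y
    using frechet_derivative_cong_open[OF assms(1) that, of g h] Suc.prems by blast+
  have "Ck_on k W (\<lambda>x. frechet_derivative g (at x) v) = Ck_on k W (\<lambda>x. frechet_derivative h (at x) v)" for v
    by (rule Suc.IH) (simp add: eq)
  moreover have "(\<forall>x\<in>W. g differentiable at x) = (\<forall>x\<in>W. h differentiable at x)"
    using eq(2) by blast
  ultimately show ?case by simp
qed

lemma Ck_on_inner:
  assumes "open W" "Ck_on k W f"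
  shows "Ck_on k W (\<lambda>y. f y \<bullet> a)"
  using assms(2)
proof (induction k arbitrary: f)
  case 0
  then have "continuous_on W f" by simp
  then have "continuous_on W (\<lambda>y. f y \<bullet> a)" by (rule continuous_on_inner) (rule continuous_on_const)
  then show ?case by simp
next
  case (Suc k)
  have d: "((\<lambda>y. f y \<bullet> a) has_derivative (\<lambda>v. frechet_derivative f (at y) v \<bullet> a)) (at y)" if "y \<in> W" for y
    using Suc.prems that by (auto intro!: has_derivative_inner_left simp: frechet_derivative_works[symmetric])
  have eq: "frechet_derivative (\<lambda>y. f y \<bullet> a) (at y) v = frechet_derivative f (at y) v \<bullet> a" if "y \<in> W" for y v
    by (rule fun_cong[OF frechet_derivative_at[OF d[OF that], symmetric]])
  have "Ck_on k W (\<lambda>x. frechet_derivative f (at x) v \<bullet> a)" for v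
    using Suc by simp
  then have "Ck_on k W (\<lambda>x. frechet_derivative (\<lambda>y. f y \<bullet> a) (at x) v)" for v
    using Ck_on_cong[OF assms(1), of "\<lambda>x. frechet_derivative (\<lambda>y. f y \<bullet> a) (at x) v"
        "\<lambda>x. frechet_derivative f (at x) v \<bullet> a", OF eq] by blast
  then show ?case using d by (auto simp: differentiable_def)
qed

lemma smooth_on_inner: "open W \<Longrightarrow> smooth_on W f \<Longrightarrow> smooth_on W (\<lambda>y. f y \<bullet> a)"
  unfolding smooth_on_def using Ck_on_inner by blast

lemma partial_deriv_inner:
  assumes "smooth_on W f" "y \<in> W"
  shows "partial_deriv (\<lambda>y. f y \<bullet> a) i y = partial_deriv f i y \<bullet> a"
proof -
  have "((\<lambda>y. f y \<bullet> a) has_derivative (\<lambda>v. frechet_derivative f (at y) v \<bullet> a)) (at y)"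
    using smooth_on_has_derivative[OF assms] by (auto intro!: derivative_eq_intros)
  from partial_deriv_eqI[OF this] show ?thesis by (simp add: partial_deriv_def)
qed

lemma partial_deriv_cong:
  assumes "open W" "y \<in> W" "\<And>z. z \<in> W \<Longrightarrow> f z = g z"
  shows "partial_deriv f i y = partial_deriv g i y"
  unfolding partial_deriv_def using frechet_derivative_cong_open(1)[OF assms] by simp

lemma symmetric_partials:
  fixes f :: "real^2 \<Rightarrow> 'b::euclidean_space"
  assumes W: "open W" and sm: "smooth_on W f" and y: "y \<in> W"
  shows "partial_deriv (partial_deriv f i) j y = partial_deriv (partial_deriv f j) i y"
proof (rule euclidean_eqI)
  fix b :: 'b
  have *: "partial_deriv (partial_deriv f i) j y \<bullet> b = partial_deriv (partial_deriv (\<lambda>y. f y \<bullet> b) i) j y" for i j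
  proof -
    have "partial_deriv (partial_deriv f i) j y \<bullet> b = partial_deriv (\<lambda>y. partial_deriv f i y \<bullet> b) j y"
      by (rule partial_deriv_inner[symmetric, OF smooth_on_partial_deriv[OF sm] y])
    also have "\<dots> = partial_deriv (partial_deriv (\<lambda>y. f y \<bullet> b) i) j y"
      by (rule partial_deriv_cong[OF W y]) (rule partial_deriv_inner[symmetric, OF sm])
    finally show ?thesis .
  qed
  show "partial_deriv (partial_deriv f i) j y \<bullet> b = partial_deriv (partial_deriv f j) i y \<bullet> b"
    unfolding * by (rule symmetric_partials_real[OF W smooth_on_inner[OF W sm] y])
qed

section \<open>Charts\<close>

locale surface_chart =
  fixes S :: "(real^3) set" and W :: "(real^2) set" and \<psi> :: "real^2 \<Rightarrow> real^3"
  assumes param: "local_param S W \<psi>"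
begin

abbreviation "HD \<equiv> W \<inter> half_plane"
abbreviation "d\<psi> y \<equiv> frechet_derivative \<psi> (at y)"
abbreviation "E \<equiv> partial_deriv \<psi>"
definition "inv_chart = inv_into HD \<psi>"

lemma open_W: "open W" and smooth: "smooth_on W \<psi>"
  and inj_d: "y \<in> W \<Longrightarrow> inj (d\<psi> y)"
  and openin_image: "openin (top_of_set S) (\<psi> ` HD)"
  using param by (auto simp: local_param_def)

lemma inj_on_chart: "inj_on \<psi> HD" and continuous_inv: "continuous_on (\<psi> ` HD) inv_chart"
  and continuous_chart: "continuous_on HD \<psi>"
proof -
  obtain g where g: "homeomorphism HD (\<psi> ` HD) \<psi> g"
    using param by (auto simp: local_param_def)
  show i: "inj_on \<psi> HD" using g unfolding homeomorphism_def by (metis inj_onI)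
  have eq: "inv_chart x = g x" if "x \<in> \<psi> ` HD" for x
    using that g i unfolding inv_chart_def homeomorphism_def by (metis imageE inv_into_f_f)
  have "continuous_on (\<psi> ` HD) g" using g by (simp add: homeomorphism_def)
  then show "continuous_on (\<psi> ` HD) inv_chart"
    by (simp add: continuous_on_cong[OF refl eq])
  show "continuous_on HD \<psi>" using g by (simp add: homeomorphism_def)
qed

lemma inv_chart[simp]: "y \<in> HD \<Longrightarrow> inv_chart (\<psi> y) = y"
  unfolding inv_chart_def using inj_on_chart by simp

lemma inv_chart_in: "x \<in> \<psi> ` HD \<Longrightarrow> inv_chart x \<in> HD \<and> \<psi> (inv_chart x) = x"
  by auto

lemma chart_in: "y \<in> HD \<Longrightarrow> \<psi> y \<in> S"
  using openin_image openin_imp_subset by fastforce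

lemma has_derivative_chart: "y \<in> W \<Longrightarrow> (\<psi> has_derivative d\<psi> y) (at y)"
  by (rule smooth_on_has_derivative[OF smooth])

lemma linear_d: "y \<in> W \<Longrightarrow> linear (d\<psi> y)"
  using has_derivative_chart has_derivative_linear by blast

lemma d_eq: "y \<in> W \<Longrightarrow> d\<psi> y v = v $ 1 *\<^sub>R E 1 y + v $ 2 *\<^sub>R E 2 y"
  by (rule frechet_eq_partials) (use has_derivative_chart in \<open>auto simp: differentiable_def\<close>)

text \<open>An injective derivative is bounded below by a multiple B of the norm, and close to y the
  error of the linear approximation uses up at most half of it. Distances in the parameter plane are
  thereby controlled by distances on the surface.\<close>

lemma inverse_lipschitz:
  assumes "y \<in> W"
  obtains c d where "c > 0" "d > 0" "\<And>z. norm (z - y) < d \<Longrightarrow> c * norm (z - y) \<le> norm (\<psi> z - \<psi> y)"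
proof -
  obtain B where B: "B > 0" "\<And>v. B * norm v \<le> norm (d\<psi> y v)"
    using linear_inj_bounded_below_pos[OF linear_d inj_d] assms by blast
  obtain d where d: "d > 0" "\<And>z. norm (z - y) < d \<Longrightarrow> norm (\<psi> z - \<psi> y - d\<psi> y (z - y)) \<le> B/2 * norm (z - y)"
    using has_derivative_chart[OF assms] B(1) unfolding has_derivative_at_alt by (meson half_gt_zero)
  show ?thesis
  proof (rule that[of "B/2" d])
    fix z assume z: "norm (z - y) < d"
    have "norm (d\<psi> y (z - y)) \<le> norm (\<psi> z - \<psi> y) + norm (\<psi> z - \<psi> y - d\<psi> y (z - y))"
      by (metis norm_minus_commute norm_triangle_sub)
    then show "B/2 * norm (z - y) \<le> norm (\<psi> z - \<psi> y)"
      using B(2)[of "z - y"] d(2)[OF z] by linarith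
  qed (use B d in auto)
qed

text \<open>Openness of the image in S keeps nearby points inside the chart, and continuity of the
  inverse keeps their parameters close to y.\<close>

lemma near_image:
  assumes y: "y \<in> HD" and e: "e > 0"
  obtains d where "d > 0" "\<And>x. x \<in> S \<Longrightarrow> dist x (\<psi> y) < d \<Longrightarrow> x \<in> \<psi> ` HD \<and> dist (inv_chart x) y < e"
proof -
  have p: "\<psi> y \<in> \<psi> ` HD" using y by blast
  obtain d1 where d1: "d1 > 0" "\<And>x. x \<in> S \<Longrightarrow> dist x (\<psi> y) < d1 \<Longrightarrow> x \<in> \<psi> ` HD"
    using openin_image p unfolding openin_euclidean_subtopology_iff by blast
  obtain d2 where d2: "d2 > 0" "\<And>x. x \<in> \<psi> ` HD \<Longrightarrow> dist x (\<psi> y) < d2 \<Longrightarrow> dist (inv_chart x) (inv_chart (\<psi> y)) < e"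
    using continuous_inv p e unfolding continuous_on_iff by blast
  show ?thesis
    by (rule that[of "min d1 d2"]) (use d1 d2 y in auto)
qed

lemma near_image_simple:
  assumes y: "y \<in> HD"
  obtains d where "d > 0" "\<And>x. x \<in> S \<Longrightarrow> dist x (\<psi> y) < d \<Longrightarrow> x \<in> \<psi> ` HD"
proof (rule near_image[OF y zero_less_one])
  fix d assume "d > 0" and d: "\<And>x. x \<in> S \<Longrightarrow> dist x (\<psi> y) < d \<Longrightarrow> x \<in> \<psi> ` HD \<and> dist (inv_chart x) y < 1"
  show ?thesis by (rule that[OF \<open>d > 0\<close>]) (rule d[THEN conjunct1])
qed

text \<open>The lower bound of \<open>inverse_lipschitz\<close> converts an error that is small
  relative to the parameter distance into one that is small relative to the distance on S.
  Differentiability in a single chart therefore suffices, without an inverse function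
  theorem.\<close>

lemma has_derivative_within_surface:
  fixes f :: "real^3 \<Rightarrow> 'b::real_normed_vector"
  assumes y: "y \<in> HD" and L: "bounded_linear L"
    and f: "((\<lambda>z. f (\<psi> z)) has_derivative (\<lambda>v. L (d\<psi> y v))) (at y within HD)"
  shows "(f has_derivative L) (at (\<psi> y) within S)"
  unfolding has_derivative_within_alt
proof (intro conjI allI impI)
  show "bounded_linear L" by fact
  fix e :: real assume e: "e > 0"
  have yW: "y \<in> W" using y by simp
  obtain c d0 where c: "c > 0" "d0 > 0" "\<And>z. norm (z - y) < d0 \<Longrightarrow> c * norm (z - y) \<le> norm (\<psi> z - \<psi> y)"
    using inverse_lipschitz[OF yW] by blast
  obtain K where K: "K > 0" "\<And>v. norm (L v) \<le> K * norm v"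
    using bounded_linear.pos_bounded[OF L] by (metis mult.commute)
  \<comment> \<open>With these choices the error of f in the chart and the error of \<psi>,
    magnified by the bound K of L, each contribute half of
    \<open>e * c * norm (z - y)\<close>.\<close>
  define e1 where "e1 = e * c / 2"
  define e2 where "e2 = e * c / (2 * K)"
  have e12: "e1 > 0" "e2 > 0" using e c K by (auto simp: e1_def e2_def)
  obtain d1 where d1: "d1 > 0" "\<And>z. z \<in> HD \<Longrightarrow> norm (z - y) < d1 \<Longrightarrow>
      norm (f (\<psi> z) - f (\<psi> y) - L (d\<psi> y (z - y))) \<le> e1 * norm (z - y)"
    using f e12(1) unfolding has_derivative_within_alt by meson
  obtain d2 where d2: "d2 > 0" "\<And>z. norm (z - y) < d2 \<Longrightarrow>
      norm (\<psi> z - \<psi> y - d\<psi> y (z - y)) \<le> e2 * norm (z - y)"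
    using has_derivative_chart[OF yW] e12(2) unfolding has_derivative_at_alt by meson
  obtain d where d: "d > 0" "\<And>x. x \<in> S \<Longrightarrow> dist x (\<psi> y) < d \<Longrightarrow> x \<in> \<psi> ` HD \<and> dist (inv_chart x) y < min d0 (min d1 d2)"
    using near_image[OF y, of "min d0 (min d1 d2)"] c d1 d2 by auto
  show "\<exists>d>0. \<forall>x\<in>S. norm (x - \<psi> y) < d \<longrightarrow> norm (f x - f (\<psi> y) - L (x - \<psi> y)) \<le> e * norm (x - \<psi> y)"
  proof (intro exI conjI ballI impI)
    show "d > 0" by fact
    fix x assume x: "x \<in> S" "norm (x - \<psi> y) < d"
    then have xi: "x \<in> \<psi> ` HD" and di: "dist (inv_chart x) y < min d0 (min d1 d2)"
      using d(2)[of x] by (auto simp: dist_norm)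
    define z where "z = inv_chart x"
    have z: "z \<in> HD" "\<psi> z = x" "norm (z - y) < d0" "norm (z - y) < d1" "norm (z - y) < d2"
      using inv_chart_in[OF xi] di by (auto simp: z_def dist_norm)
    have n0: "norm (z - y) \<le> norm (x - \<psi> y) / c"
      using c(3)[OF z(3)] c(1) z(2) by (simp add: field_simps)
    have lin: "L (\<psi> z - \<psi> y) = L (\<psi> z - \<psi> y - d\<psi> y (z - y)) + L (d\<psi> y (z - y))"
      using linear_add[OF bounded_linear.linear[OF L]] by (metis diff_add_cancel)
    have "norm (f x - f (\<psi> y) - L (x - \<psi> y)) =
        norm ((f (\<psi> z) - f (\<psi> y) - L (d\<psi> y (z - y))) - L (\<psi> z - \<psi> y - d\<psi> y (z - y)))"
      using lin z(2) by (simp add: algebra_simps)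
    also have "\<dots> \<le> e1 * norm (z - y) + K * (e2 * norm (z - y))"
    proof (rule order_trans[OF norm_triangle_ineq4 add_mono])
      show "norm (f (\<psi> z) - f (\<psi> y) - L (d\<psi> y (z - y))) \<le> e1 * norm (z - y)" by (rule d1(2)[OF z(1) z(4)])
      show "norm (L (\<psi> z - \<psi> y - d\<psi> y (z - y))) \<le> K * (e2 * norm (z - y))"
        by (rule order_trans[OF K(2)]) (use d2(2)[OF z(5)] K(1) in auto)
    qed
    also have "\<dots> = e * c * norm (z - y)" using K by (simp add: e1_def e2_def field_simps)
    also have "\<dots> \<le> e * c * (norm (x - \<psi> y) / c)"
      using n0 e c by (intro mult_left_mono) auto
    also have "\<dots> = e * norm (x - \<psi> y)" using c by simp
    finally show "norm (f x - f (\<psi> y) - L (x - \<psi> y)) \<le> e * norm (x - \<psi> y)" .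
  qed
qed

lemma has_derivative_compose_chart:
  assumes y: "y \<in> HD" and f: "(f has_derivative L) (at (\<psi> y) within S)"
  shows "((\<lambda>z. f (\<psi> z)) has_derivative (\<lambda>v. L (d\<psi> y v))) (at y within HD)"
proof (rule has_derivative_in_compose[where f = \<psi> and g = f and g' = L and f' = "d\<psi> y"])
  show "(\<psi> has_derivative d\<psi> y) (at y within HD)"
    using has_derivative_chart y has_derivative_at_withinI by blast
  show "(f has_derivative L) (at (\<psi> y) within \<psi> ` HD)"
    by (rule has_derivative_subset[OF f]) (use chart_in in blast)
qed

text \<open>At a boundary parameter only directions along the edge or into the half plane are
  available; at an interior parameter every direction is, for a time limited by the distance to the
  edge.\<close>

lemma dom_line:
  assumes y: "y \<in> HD" and v: "y $ 2 > 0 \<or> v $ 2 \<ge> 0"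
  obtains d where "d > 0" "\<And>t. 0 \<le> t \<Longrightarrow> t < d \<Longrightarrow> y + t *\<^sub>R v \<in> HD"
proof -
  have c: "continuous (at_right 0) (\<lambda>t. y + t *\<^sub>R v)" by (intro continuous_intros)
  have "open {t. y + t *\<^sub>R v \<in> W}"
  proof -
    have "continuous_on UNIV (\<lambda>t. y + t *\<^sub>R v)" by (intro continuous_intros)
    from open_vimage[OF open_W this] show ?thesis by (simp add: vimage_def)
  qed
  then obtain d1 where d1: "d1 > 0" "\<And>t. \<bar>t\<bar> < d1 \<Longrightarrow> y + t *\<^sub>R v \<in> W"
  proof -
    have "0 \<in> {t. y + t *\<^sub>R v \<in> W}" using y by simp
    then obtain e where "e > 0" "ball 0 e \<subseteq> {t. y + t *\<^sub>R v \<in> W}"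
      using \<open>open {t. y + t *\<^sub>R v \<in> W}\<close> openE by blast
    then show ?thesis using that[of e] by (auto simp: subset_iff)
  qed
  show ?thesis
  proof (cases "v $ 2 \<ge> 0")
    case True
    show ?thesis
      by (rule that[OF d1(1)]) (use d1 y True in \<open>auto simp: half_plane_def\<close>)
  next
    case False
    then have y2: "y $ 2 > 0" using v by simp
    show ?thesis
    proof (rule that[of "min d1 (y$2 / - v$2)"])
      show "min d1 (y$2 / - v$2) > 0" using d1 y2 False divide_pos_neg[of "y$2" "v$2"] by auto
      fix t :: real assume t: "0 \<le> t" "t < min d1 (y$2 / - v$2)"
      have "t < y$2 / - v$2" using t by simp
      then have "t * - v$2 \<le> y$2" using False pos_less_divide_eq[of "- v$2" t "y$2"] by simp
      then show "y + t *\<^sub>R v \<in> HD" using d1(2)[of t] t by (auto simp: half_plane_def)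
    qed
  qed
qed

text \<open>The basis vectors point into the half plane or along its edge, so difference quotients
  with positive increments in their directions determine the derivative even at boundary
  parameters.\<close>

lemma has_derivative_dom_unique:
  assumes y: "y \<in> HD" and f: "(f has_derivative A) (at y within HD)" "(f has_derivative B) (at y within HD)"
  shows "A = B"
proof (rule frechet_derivative_unique_within[OF f])
  fix i :: "real^2" and e :: real assume i: "i \<in> Basis" and e: "e > 0"
  have "i $ 2 \<ge> 0" using i by (auto simp: Basis_vec_def axis_def)
  then obtain d where d: "d > 0" "\<And>t. 0 \<le> t \<Longrightarrow> t < d \<Longrightarrow> y + t *\<^sub>R i \<in> HD"
    using dom_line[OF y] by blast
  show "\<exists>d. 0 < \<bar>d\<bar> \<and> \<bar>d\<bar> < e \<and> y + d *\<^sub>R i \<in> HD"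
    by (rule exI[of _ "min d e / 2"]) (use d e in auto)
qed

text \<open>Meant for the second coordinate of a transition map, which attains its least value 0
  where the image is a boundary parameter.\<close>

lemma derivative_nonneg_at_min:
  fixes f :: "real^2 \<Rightarrow> real"
  assumes y: "y \<in> HD" and f: "(f has_derivative A) (at y within HD)"
    and e: "e > 0" "\<And>z. z \<in> HD \<Longrightarrow> dist z y < e \<Longrightarrow> f z \<ge> f y"
    and v: "y $ 2 > 0 \<or> v $ 2 \<ge> 0"
  shows "A v \<ge> 0"
proof -
  obtain d where d: "d > 0" "\<And>t. 0 \<le> t \<Longrightarrow> t < d \<Longrightarrow> y + t *\<^sub>R v \<in> HD"
    using dom_line[OF y v] by blast
  have lA: "linear A" using f has_derivative_linear by blast
  have g: "((\<lambda>t. f (y + t *\<^sub>R v)) has_derivative (\<lambda>t. A (t *\<^sub>R v))) (at 0 within {0..d/2})"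
  proof (rule has_derivative_in_compose[where f = "\<lambda>t. y + t *\<^sub>R v" and g = f and g' = A and f' = "\<lambda>t. t *\<^sub>R v"])
    show "((\<lambda>t. y + t *\<^sub>R v) has_derivative (\<lambda>t. t *\<^sub>R v)) (at 0 within {0..d/2})"
      by (auto intro!: derivative_eq_intros)
    show "(f has_derivative A) (at (y + 0 *\<^sub>R v) within (\<lambda>t. y + t *\<^sub>R v) ` {0..d/2})"
      using has_derivative_subset[OF f, of "(\<lambda>t. y + t *\<^sub>R v) ` {0..d/2}"] d by fastforce
  qed
  have "((\<lambda>t. f (y + t *\<^sub>R v)) has_real_derivative A v) (at 0 within {0..d/2})"
    unfolding has_field_derivative_def
    by (rule has_derivative_eq_rhs[OF g]) (auto simp: linear_scale[OF lA])
  then have lim: "((\<lambda>t. (f (y + t *\<^sub>R v) - f y) / t) \<longlongrightarrow> A v) (at 0 within {0..d/2})"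
    by (simp add: has_field_derivative_iff)
  show ?thesis
  proof (rule tendsto_lowerbound[OF lim])
    show "at 0 within {0..d/2} \<noteq> bot"
      using d by (simp add: at_within_Icc_at_right)
    define e' where "e' = e / (norm v + 1)"
    have e': "e' > 0" using e by (simp add: e'_def add_nonneg_pos)
    show "\<forall>\<^sub>F t in at 0 within {0..d/2}. 0 \<le> (f (y + t *\<^sub>R v) - f y) / t"
      unfolding eventually_at
    proof (intro exI conjI ballI impI)
      show "e' > 0" by fact
      fix t assume t: "t \<in> {0..d/2}" "t \<noteq> 0 \<and> dist t 0 < e'"
      have "dist (y + t *\<^sub>R v) y = t * norm v" using t by (simp add: dist_norm)
      also have "\<dots> \<le> t * (norm v + 1)" using t by (simp add: mult_left_mono)
      also have "\<dots> < e' * (norm v + 1)" using t by (intro mult_strict_right_mono) (auto simp: add_nonneg_pos)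
      also have "\<dots> = e" using add_nonneg_pos[of "norm v" 1] by (simp add: e'_def)
      finally show "0 \<le> (f (y + t *\<^sub>R v) - f y) / t" using e(2) d(2) t by auto
    qed
  qed
qed

end

text \<open>M is the derivative of \<psi>1 followed by a left inverse L of the derivative of
  \<psi>2. The inverse chart of \<psi>2 is differentiable within S with derivative L, because in the
  chart \<psi>2 it is the identity. The last conclusion is the chain rule through the transition
  map, for an arbitrary function f of the second parameter.\<close>

lemma surface_chart_transition:
  assumes c1: "surface_chart S W1 \<psi>1" and c2: "surface_chart S W2 \<psi>2"
    and y1: "y1 \<in> W1 \<inter> half_plane" and y2: "y2 \<in> W2 \<inter> half_plane" and eq: "\<psi>1 y1 = \<psi>2 y2"
  obtains M :: "real^2^2" where
    "\<And>v. frechet_derivative \<psi>1 (at y1) v = frechet_derivative \<psi>2 (at y2) (M *v v)"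
    "((\<lambda>z. surface_chart.inv_chart W2 \<psi>2 (\<psi>1 z)) has_derivative (\<lambda>v. M *v v)) (at y1 within W1 \<inter> half_plane)"
    "\<And>f L. ((\<lambda>z. f z) has_derivative L) (at y2 within W2 \<inter> half_plane) \<Longrightarrow>
       ((\<lambda>z. f (surface_chart.inv_chart W2 \<psi>2 (\<psi>1 z))) has_derivative (\<lambda>v. L (M *v v))) (at y1 within W1 \<inter> half_plane)"
proof -
  interpret A: surface_chart S W1 \<psi>1 by fact
  interpret B: surface_chart S W2 \<psi>2 by fact
  have y2W: "y2 \<in> W2" using y2 by simp
  obtain L where L: "linear L" "L \<circ> B.d\<psi> y2 = id"
    using linear_injective_left_inverse[OF B.linear_d[OF y2W] B.inj_d[OF y2W]] by blast
  have Lid: "L (B.d\<psi> y2 v) = v" for v using L(2) by (metis comp_apply id_apply)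
  have bl: "bounded_linear L" using L(1) linear_conv_bounded_linear by blast
  have gen: "((\<lambda>z. f (B.inv_chart (\<psi>1 z))) has_derivative (\<lambda>v. D (L (A.d\<psi> y1 v)))) (at y1 within A.HD)"
    if f: "(f has_derivative D) (at y2 within B.HD)" for f :: "real^2 \<Rightarrow> 'z::real_normed_vector" and D
  proof -
    have "((\<lambda>x. f (B.inv_chart x)) has_derivative (\<lambda>w. D (L w))) (at (\<psi>2 y2) within S)"
    proof (rule B.has_derivative_within_surface[OF y2])
      show "bounded_linear (\<lambda>w. D (L w))"
        using bounded_linear_compose[OF has_derivative_bounded_linear[OF f] bl] .
      show "((\<lambda>z. f (B.inv_chart (\<psi>2 z))) has_derivative (\<lambda>v. D (L (B.d\<psi> y2 v)))) (at y2 within B.HD)"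
        unfolding Lid
        by (rule has_derivative_transform_within[OF f zero_less_one y2]) simp
    qed
    then show ?thesis using A.has_derivative_compose_chart[OF y1, of "\<lambda>x. f (B.inv_chart x)"] eq by simp
  qed
  define M where "M = matrix (\<lambda>v. L (A.d\<psi> y1 v))"
  have lin: "linear (\<lambda>v. L (A.d\<psi> y1 v))"
    using linear_compose[OF A.linear_d L(1)] y1 by (simp add: o_def)
  have M: "M *v v = L (A.d\<psi> y1 v)" for v
    unfolding M_def by (rule matrix_vector_mul(2)[OF lin, THEN fun_cong])
  have g1: "((\<lambda>z. B.inv_chart (\<psi>1 z)) has_derivative (\<lambda>v. M *v v)) (at y1 within A.HD)"
    unfolding M using gen[OF has_derivative_ident] .
  have g2: "((\<lambda>z. \<psi>2 (B.inv_chart (\<psi>1 z))) has_derivative (\<lambda>v. B.d\<psi> y2 (M *v v))) (at y1 within A.HD)"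
    unfolding M using gen[OF has_derivative_at_withinI[OF B.has_derivative_chart[OF y2W]]] .
  obtain d where d: "d > 0" "\<And>x. x \<in> S \<Longrightarrow> dist x (\<psi>2 y2) < d \<Longrightarrow> x \<in> \<psi>2 ` B.HD"
    using B.near_image_simple[OF y2] by metis
  obtain d' where d': "d' > 0" "\<And>z. z \<in> A.HD \<Longrightarrow> dist z y1 < d' \<Longrightarrow> dist (\<psi>1 z) (\<psi>1 y1) < d"
    using A.continuous_chart y1 d(1) unfolding continuous_on_iff by blast
  \<comment> \<open>Near y1 the map \<psi>1 coincides with \<psi>2 after the transition map, so
    uniqueness of the derivative on the half plane factors the derivative of \<psi>1 through
    M.\<close>
  have "(\<psi>1 has_derivative (\<lambda>v. B.d\<psi> y2 (M *v v))) (at y1 within A.HD)"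
  proof (rule has_derivative_transform_within[OF g2 d'(1) y1])
    fix z assume z: "z \<in> A.HD" "dist z y1 < d'"
    then have "\<psi>1 z \<in> \<psi>2 ` B.HD" using d(2) d'(2) A.chart_in eq by auto
    then show "\<psi>2 (B.inv_chart (\<psi>1 z)) = \<psi>1 z" using B.inv_chart_in by blast
  qed
  moreover have "(\<psi>1 has_derivative A.d\<psi> y1) (at y1 within A.HD)"
    using A.has_derivative_chart y1 has_derivative_at_withinI by blast
  ultimately have "A.d\<psi> y1 = (\<lambda>v. B.d\<psi> y2 (M *v v))"
    using A.has_derivative_dom_unique[OF y1] by blast
  then have 1: "A.d\<psi> y1 v = B.d\<psi> y2 (M *v v)" for v by metis
  show ?thesis by (rule that[OF 1 g1]) (simp only: M gen)
qed

section \<open>Unit normal and shape operator\<close>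

lemma bounded_bilinear_cross3: "bounded_bilinear cross3"
  using bilinear_cross bilinear_conv_bounded_bilinear by blast

lemma trace2: "trace (A :: real^2^2) = A $ 1 $ 1 + A $ 2 $ 2"
  by (simp add: trace_def sum_2)

lemma matrix_mult2: "((A :: real^2^2) ** (B :: real^2^2)) $ i $ j = A $ i $ 1 * B $ 1 $ j + A $ i $ 2 * B $ 2 $ j"
  by (simp add: matrix_matrix_mult_def sum_2)

lemma matrix_vector2: "((A :: real^2^2) *v v) $ i = A $ i $ 1 * v $ 1 + A $ i $ 2 * v $ 2"
  by (simp add: matrix_vector_mult_def sum_2)

text \<open>The component of m orthogonal to n is orthogonal to m as well, hence zero. The sign that
  relates the two vectors is kept as the number \<open>m \<bullet> n\<close>, so that it can later
  be followed continuously from point to point.\<close>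

lemma unit_normals_agree:
  fixes n m :: "'a::euclidean_space"
  assumes "norm n = 1" "norm m = 1" "\<And>v. v \<bullet> n = 0 \<Longrightarrow> v \<bullet> m = 0"
  shows "m = (m \<bullet> n) *\<^sub>R n" "(m \<bullet> n)\<^sup>2 = 1"
proof -
  have nn: "n \<bullet> n = 1" "m \<bullet> m = 1" using assms(1,2) by (simp_all add: norm_eq_1)
  have "(m - (m \<bullet> n) *\<^sub>R n) \<bullet> n = 0" using nn by (simp add: inner_diff_left)
  then have z: "(m - (m \<bullet> n) *\<^sub>R n) \<bullet> m = 0" by (rule assms(3))
  then show sq: "(m \<bullet> n)\<^sup>2 = 1" using nn by (simp add: inner_diff_left inner_diff_right inner_commute power2_eq_square)
  have "(m - (m \<bullet> n) *\<^sub>R n) \<bullet> (m - (m \<bullet> n) *\<^sub>R n) = 0"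
    using z \<open>(m - (m \<bullet> n) *\<^sub>R n) \<bullet> n = 0\<close> by (simp add: inner_diff_right)
  then show "m = (m \<bullet> n) *\<^sub>R n" by simp
qed

context surface_chart
begin

abbreviation "N \<equiv> param_normal \<psi>"
abbreviation "Sh \<equiv> shape_operator \<psi>"
definition "EE y = cross3 (E 1 y) (E 2 y)"
abbreviation "Ja y \<equiv> norm (EE y)"
definition "EE' i y = cross3 (partial_deriv (E 1) i y) (E 2 y) + cross3 (E 1 y) (partial_deriv (E 2) i y)"

lemma smooth_E: "smooth_on W (E i)"
  by (rule smooth_on_partial_deriv[OF smooth])

lemma continuous_E: "continuous_on W (E i)"
  by (rule smooth_on_imp_continuous_on[OF smooth_E])

lemma continuous_E2: "continuous_on W (partial_deriv (E i) j)"
  by (rule smooth_on_imp_continuous_on[OF smooth_on_partial_deriv[OF smooth_E]])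

lemma d_axis: "y \<in> W \<Longrightarrow> d\<psi> y (axis i 1) = E i y"
  by (simp add: partial_deriv_def)

text \<open>If the cross product vanished, Lagrange's identity for
  \<open>cross3 (E 1 y) (EE y)\<close> would be a linear relation between the partial derivatives in
  which \<open>E 2 y\<close> has the squared length of \<open>E 1 y\<close> as coefficient, against
  injectivity of the derivative.\<close>

lemma EE_nonzero:
  assumes y: "y \<in> W" shows "EE y \<noteq> 0"
proof
  assume z: "EE y = 0"
  have e1: "E 1 y \<noteq> 0"
  proof
    assume "E 1 y = 0"
    then have "d\<psi> y (axis 1 1) = d\<psi> y 0" using y d_axis linear_0[OF linear_d[OF y]] by simp
    then have "axis 1 1 = (0::real^2)" using inj_d[OF y] by (meson injD)
    then show False by (simp add: axis_eq_0_iff)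
  qed
  have "cross3 (E 1 y) (EE y) = 0" using z by simp
  then have "(E 1 y \<bullet> E 2 y) *\<^sub>R E 1 y - (E 1 y \<bullet> E 1 y) *\<^sub>R E 2 y = 0"
    by (simp add: EE_def Lagrange)
  then have "d\<psi> y (vector [E 1 y \<bullet> E 2 y, - (E 1 y \<bullet> E 1 y)]) = d\<psi> y 0"
    using y linear_0[OF linear_d[OF y]] by (simp add: d_eq)
  then have "vector [E 1 y \<bullet> E 2 y, - (E 1 y \<bullet> E 1 y)] = (0::real^2)" using inj_d[OF y] by (meson injD)
  then have "E 1 y \<bullet> E 1 y = 0" by (metis neg_equal_0_iff_equal vector_2(2) zero_index)
  then show False using e1 by simp
qed

lemma Ja_pos: "y \<in> W \<Longrightarrow> Ja y > 0"
  using EE_nonzero by simp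

lemma N_eq: "N y = inverse (Ja y) *\<^sub>R EE y"
  by (simp add: param_normal_def EE_def sgn_div_norm)

lemma EE_N: "y \<in> W \<Longrightarrow> EE y = Ja y *\<^sub>R N y"
  using EE_nonzero by (simp add: N_eq)

lemma norm_N: "y \<in> W \<Longrightarrow> norm (N y) = 1"
  using EE_nonzero by (simp add: N_eq)

lemma N_N: "y \<in> W \<Longrightarrow> N y \<bullet> N y = 1"
  using norm_N by (simp add: norm_eq_1)

lemma N_E: "N y \<bullet> E i y = 0" "E i y \<bullet> N y = 0"
proof -
  have "EE y \<bullet> E i y = 0" using exhaust_2[of i] by (auto simp: EE_def dot_cross_self)
  then show "N y \<bullet> E i y = 0" by (simp add: N_eq)
  then show "E i y \<bullet> N y = 0" by (simp add: inner_commute)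
qed

text \<open>By Lagrange's identity such a w has zero cross product with \<open>EE y\<close>, so it
  is parallel to the normal and at the same time orthogonal to it.\<close>

lemma eq_zero_if_orthogonal:
  assumes y: "y \<in> W" and w: "w \<bullet> N y = 0" "w \<bullet> E 1 y = 0" "w \<bullet> E 2 y = 0"
  shows "w = 0"
proof -
  have "cross3 w (EE y) = 0" unfolding EE_def Lagrange using w by simp
  then have "cross3 w (N y) = 0" by (simp add: N_eq cross_mult_right)
  then show ?thesis using norm_and_cross_eq_0[of w "N y"] w norm_N[OF y] by auto
qed

lemma range_d:
  assumes y: "y \<in> W" shows "range (d\<psi> y) = {v. v \<bullet> N y = 0}"
proof (rule subspace_dim_equal)
  show "subspace (range (d\<psi> y))" using linear_subspace_image[OF linear_d[OF y] subspace_UNIV] .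
  show "subspace {v. v \<bullet> N y = 0}" using subspace_hyperplane[of "N y"] by (simp add: inner_commute)
  show "range (d\<psi> y) \<subseteq> {v. v \<bullet> N y = 0}" using y by (auto simp: d_eq inner_add_left N_E)
  have "dim (range (d\<psi> y)) = dim (UNIV :: (real^2) set)"
    by (rule dim_image_eq) (use linear_d[OF y] inj_d[OF y] in \<open>auto simp: inj_on_def dest: injD\<close>)
  moreover have "dim {v. v \<bullet> N y = 0} = 2"
  proof -
    have "N y \<noteq> 0" using norm_N[OF y] by auto
    from dim_hyperplane[OF this] show ?thesis by (simp add: inner_commute)
  qed
  ultimately show "dim {v. v \<bullet> N y = 0} \<le> dim (range (d\<psi> y))" by simp
qed

lemma has_derivative_E: "y \<in> W \<Longrightarrow>
  (E i has_derivative (\<lambda>v. v $ 1 *\<^sub>R partial_deriv (E i) 1 y + v $ 2 *\<^sub>R partial_deriv (E i) 2 y)) (at y)"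
  by (rule has_derivative_partials[OF smooth_E])

lemma has_derivative_EE: 
  assumes y: "y \<in> W"
  shows "(EE has_derivative (\<lambda>v. v $ 1 *\<^sub>R EE' 1 y + v $ 2 *\<^sub>R EE' 2 y)) (at y)"
  unfolding EE_def[abs_def]
  by (rule has_derivative_eq_rhs[OF bounded_bilinear.FDERIV[OF bounded_bilinear_cross3
          has_derivative_E[OF y] has_derivative_E[OF y]]])
    (simp add: EE'_def fun_eq_iff cross_add_left cross_add_right cross_mult_left cross_mult_right algebra_simps)

text \<open>Only the part of the derivative of \<open>EE\<close> orthogonal to the normal survives
  the normalization, since the length changes at the rate of the component along the normal.\<close>

lemma has_derivative_N_aux:
  assumes y: "y \<in> W"
  shows "(N has_derivative (\<lambda>v. let c' = v $ 1 *\<^sub>R EE' 1 y + v $ 2 *\<^sub>R EE' 2 y in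
     inverse (Ja y) *\<^sub>R (c' - (c' \<bullet> N y) *\<^sub>R N y))) (at y)"
proof -
  let ?c = "\<lambda>v. v $ 1 *\<^sub>R EE' 1 y + v $ 2 *\<^sub>R EE' 2 y"
  have n: "((\<lambda>y. Ja y) has_derivative (\<lambda>v. ?c v \<bullet> sgn (EE y))) (at y)"
    by (rule has_derivative_compose[OF has_derivative_EE[OF y] Inner_Product.has_derivative_norm[OF EE_nonzero[OF y]]])
  have i: "((\<lambda>y. inverse (Ja y)) has_derivative (\<lambda>v. - (inverse (Ja y) * (?c v \<bullet> sgn (EE y)) * inverse (Ja y)))) (at y)"
    by (rule Deriv.has_derivative_inverse[OF _ n]) (use EE_nonzero[OF y] in simp)
  have s: "sgn (EE y) = N y" by (simp add: param_normal_def EE_def)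
  have "((\<lambda>y. inverse (Ja y) *\<^sub>R EE y) has_derivative (\<lambda>v. inverse (Ja y) *\<^sub>R ?c v +
      (- (inverse (Ja y) * (?c v \<bullet> sgn (EE y)) * inverse (Ja y))) *\<^sub>R EE y)) (at y)"
    by (rule has_derivative_scaleR[OF i has_derivative_EE[OF y]])
  then show ?thesis unfolding s N_eq[abs_def, symmetric]
    by (rule has_derivative_eq_rhs) (simp add: fun_eq_iff Let_def scaleR_diff_right N_eq algebra_simps)
qed

lemma partial_N: "y \<in> W \<Longrightarrow>
   partial_deriv N i y = inverse (Ja y) *\<^sub>R (EE' i y - (EE' i y \<bullet> N y) *\<^sub>R N y)"
  using partial_deriv_eqI[OF has_derivative_N_aux, of y i] exhaust_2[of i]
  by (auto simp: Let_def axis_def)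

lemma has_derivative_N:
  assumes y: "y \<in> W"
  shows "(N has_derivative (\<lambda>v. v $ 1 *\<^sub>R partial_deriv N 1 y + v $ 2 *\<^sub>R partial_deriv N 2 y)) (at y)"
proof -
  have "N differentiable (at y)" using has_derivative_N_aux[OF y] by (auto simp: differentiable_def)
  then have "(N has_derivative frechet_derivative N (at y)) (at y)" using frechet_derivative_works by blast
  then show ?thesis
    by (rule has_derivative_eq_rhs) (rule ext, rule frechet_eq_partials[OF \<open>N differentiable (at y)\<close>])
qed

lemma continuous_N: "continuous_on W N"
  using has_derivative_N has_derivative_continuous continuous_at_imp_continuous_on by blast

lemma continuous_EE: "continuous_on W EE"
  using has_derivative_EE has_derivative_continuous continuous_at_imp_continuous_on by blast

lemma continuous_Ja: "continuous_on W (\<lambda>y. Ja y)"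
  by (intro continuous_on_norm continuous_EE)

lemma continuous_partial_N: "continuous_on W (partial_deriv N i)"
proof -
  have "continuous_on W (EE' i)" unfolding EE'_def[abs_def]
    by (intro continuous_on_add continuous_on_cross continuous_E continuous_E2)
  then have "continuous_on W (\<lambda>y. inverse (Ja y) *\<^sub>R (EE' i y - (EE' i y \<bullet> N y) *\<^sub>R N y))"
    by (intro continuous_on_scaleR continuous_on_inverse continuous_Ja continuous_on_diff continuous_on_inner continuous_N)
      (use EE_nonzero in auto)
  then show ?thesis by (rule continuous_on_eq) (simp add: partial_N)
qed

lemma partial_N_N:
  assumes y: "y \<in> W" shows "partial_deriv N i y \<bullet> N y = 0"
  using N_N[OF y] by (simp add: partial_N[OF y] inner_diff_left)

text \<open>Obtained by differentiating the relation \<open>N y \<bullet> E j y = 0\<close>.\<close>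

lemma partial_N_E:
  assumes y: "y \<in> W" shows "partial_deriv N i y \<bullet> E j y = - (partial_deriv (E j) i y \<bullet> N y)"
proof -
  have "((\<lambda>y. N y \<bullet> E j y) has_derivative (\<lambda>v. N y \<bullet> (v $ 1 *\<^sub>R partial_deriv (E j) 1 y + v $ 2 *\<^sub>R partial_deriv (E j) 2 y)
     + (v $ 1 *\<^sub>R partial_deriv N 1 y + v $ 2 *\<^sub>R partial_deriv N 2 y) \<bullet> E j y)) (at y)"
    by (rule has_derivative_inner[OF has_derivative_N[OF y] has_derivative_E[OF y]])
  moreover have "((\<lambda>y. N y \<bullet> E j y) has_derivative (\<lambda>v. 0)) (at y)" by (simp add: N_E)
  ultimately have "(\<lambda>v::real^2. N y \<bullet> (v $ 1 *\<^sub>R partial_deriv (E j) 1 y + v $ 2 *\<^sub>R partial_deriv (E j) 2 y)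
     + (v $ 1 *\<^sub>R partial_deriv N 1 y + v $ 2 *\<^sub>R partial_deriv N 2 y) \<bullet> E j y) = (\<lambda>v. 0)"
    by (rule has_derivative_unique)
  from fun_cong[OF this, of "axis i 1"] show ?thesis
    using exhaust_2[of i] by (auto simp: axis_def inner_commute)
qed

lemma det_first_form: "det (first_fundamental_form \<psi> y) = (Ja y)\<^sup>2"
  unfolding EE_def norm_cross
  unfolding power2_norm_eq_inner
  by (simp add: det_2 first_fundamental_form_def power2_eq_square inner_commute)

lemma first_form_shape:
  assumes y: "y \<in> W" shows "first_fundamental_form \<psi> y ** Sh y = second_fundamental_form \<psi> y"
proof -
  have "det (first_fundamental_form \<psi> y) \<noteq> 0" using det_first_form EE_nonzero[OF y] by simp
  then have "invertible (first_fundamental_form \<psi> y)" by (simp add: invertible_det_nz)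
  then have "first_fundamental_form \<psi> y ** matrix_inv (first_fundamental_form \<psi> y) = mat 1"
    unfolding invertible_def matrix_inv_def by (rule someI2_ex) simp
  then show ?thesis by (simp add: shape_operator_def matrix_mul_assoc)
qed

lemma second_form_symmetric:
  assumes y: "y \<in> W"
  shows "second_fundamental_form \<psi> y $ i $ j = second_fundamental_form \<psi> y $ j $ i"
  using symmetric_partials[OF open_W smooth y, of i j] by (simp add: second_fundamental_form_def)

text \<open>Both sides are tangential and have the same products with \<open>E j y\<close>: on the
  left by \<open>partial_N_E\<close>, on the right because the first fundamental form times
  \<open>Sh\<close> is the second, whose symmetry exchanges the indices.\<close>

lemma weingarten:
  assumes y: "y \<in> W"
  shows "partial_deriv N i y = - (Sh y $ 1 $ i *\<^sub>R E 1 y + Sh y $ 2 $ i *\<^sub>R E 2 y)"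
proof -
  let ?w = "partial_deriv N i y + (Sh y $ 1 $ i *\<^sub>R E 1 y + Sh y $ 2 $ i *\<^sub>R E 2 y)"
  have "?w \<bullet> E j y = 0" for j
  proof -
    have "(Sh y $ 1 $ i *\<^sub>R E 1 y + Sh y $ 2 $ i *\<^sub>R E 2 y) \<bullet> E j y = (first_fundamental_form \<psi> y ** Sh y) $ j $ i"
      unfolding matrix_mult2 by (simp add: first_fundamental_form_def inner_add_right inner_commute)
    also have "\<dots> = second_fundamental_form \<psi> y $ i $ j"
      by (simp add: first_form_shape[OF y] second_form_symmetric[OF y])
    also have "\<dots> = - (partial_deriv N i y \<bullet> E j y)"
      by (simp add: partial_N_E[OF y] second_fundamental_form_def)
    finally show ?thesis by (simp add: inner_add_left)
  qed
  moreover have "?w \<bullet> N y = 0" using partial_N_N[OF y] N_E by (simp add: inner_add_left)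
  ultimately have "?w = 0" using eq_zero_if_orthogonal[OF y] by blast
  then show ?thesis by (rule eq_neg_iff_add_eq_0[THEN iffD2])
qed

lemma has_derivative_N_shape:
  assumes y: "y \<in> W"
  shows "(N has_derivative (\<lambda>v. - d\<psi> y (Sh y *v v))) (at y)"
  by (rule has_derivative_eq_rhs[OF has_derivative_N[OF y]])
    (simp add: fun_eq_iff weingarten[OF y] d_eq[OF y] matrix_vector2 algebra_simps)

text \<open>The shape operator is self-adjoint for the first fundamental form, so its square has
  nonnegative trace. With trace zero this becomes an identity between three matrix entries.\<close>

lemma shape_trace_square:
  assumes y: "y \<in> W" and tr: "trace (Sh y) = 0"
  shows "trace (Sh y ** Sh y) \<ge> 0" "trace (Sh y ** Sh y) = 0 \<Longrightarrow> Sh y = 0"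
proof -
  let ?g = "first_fundamental_form \<psi> y" and ?a = "Sh y $ 1 $ 1" and ?b = "Sh y $ 1 $ 2" and ?c = "Sh y $ 2 $ 1"
  define e f g where "e = ?g $ 1 $ 1" and "f = ?g $ 1 $ 2" and "g = ?g $ 2 $ 2"
  have sym: "?g $ 2 $ 1 = f" by (simp add: f_def first_fundamental_form_def inner_commute)
  have d: "Sh y $ 2 $ 2 = - ?a" using tr by (simp add: trace2 add_eq_0_iff)
  have "(?g ** Sh y) $ 1 $ 2 = (?g ** Sh y) $ 2 $ 1"
    unfolding first_form_shape[OF y] by (rule second_form_symmetric[OF y])
  then have eb: "e * ?b = 2 * f * ?a + g * ?c"
    unfolding matrix_mult2 d sym by (simp add: e_def f_def g_def)
  have det: "e * g - f\<^sup>2 > 0"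
    using det_first_form[of y] EE_nonzero[OF y] unfolding det_2 sym by (simp add: e_def f_def g_def power2_eq_square)
  have "e \<ge> 0" by (simp add: e_def first_fundamental_form_def)
  moreover have "e \<noteq> 0" using det by auto
  ultimately have e: "e > 0" by simp
  have tr2: "trace (Sh y ** Sh y) = 2 * (?a\<^sup>2 + ?b * ?c)"
    unfolding trace2 matrix_mult2 d by (simp add: power2_eq_square)
  \<comment> \<open>\<open>eb\<close> expresses self-adjointness. It eliminates the entry b and
    leaves a sum of squares, the second one weighted by the determinant of the first fundamental
    form.\<close>
  have key: "e\<^sup>2 * (?a\<^sup>2 + ?b * ?c) = (e * ?a + f * ?c)\<^sup>2 + (e * g - f\<^sup>2) * ?c\<^sup>2"
  proof -
    have "e\<^sup>2 * (?a\<^sup>2 + ?b * ?c) = e\<^sup>2 * ?a\<^sup>2 + e * (e * ?b) * ?c" by (simp add: power2_eq_square algebra_simps)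
    then show ?thesis unfolding eb by (simp add: power2_eq_square algebra_simps)
  qed
  have "0 \<le> e\<^sup>2 * (?a\<^sup>2 + ?b * ?c)" unfolding key using det by simp
  then show "trace (Sh y ** Sh y) \<ge> 0" unfolding tr2 using e by (simp add: zero_le_mult_iff)
  assume "trace (Sh y ** Sh y) = 0"
  then have "?a\<^sup>2 + ?b * ?c = 0" using tr2 by simp
  then have z: "(e * ?a + f * ?c)\<^sup>2 + (e * g - f\<^sup>2) * ?c\<^sup>2 = 0" using key by simp
  have c2: "(e * g - f\<^sup>2) * ?c\<^sup>2 \<ge> 0" using det by simp
  then have "(e * g - f\<^sup>2) * ?c\<^sup>2 = 0" "(e * ?a + f * ?c)\<^sup>2 = 0"
    using z zero_le_power2[of "e * ?a + f * ?c"] by linarith+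
  then have c0: "?c = 0" and a0: "?a = 0" using det e by auto
  then have "?b = 0" using eb e by simp
  then show "Sh y = 0" using c0 a0 d by (simp add: vec_eq_iff forall_2)
qed

lemma minimal_trace: "minimal_surface S \<Longrightarrow> y \<in> HD \<Longrightarrow> trace (Sh y) = 0"
  using param unfolding minimal_surface_def by blast

end

section \<open>Independence of the chart: tangent plane and curvature\<close>

lemma range_d_transition:
  assumes c1: "surface_chart S W1 \<psi>1" and c2: "surface_chart S W2 \<psi>2"
    and y1: "y1 \<in> W1 \<inter> half_plane" and y2: "y2 \<in> W2 \<inter> half_plane" and eq: "\<psi>1 y1 = \<psi>2 y2"
  shows "range (frechet_derivative \<psi>1 (at y1)) = range (frechet_derivative \<psi>2 (at y2))"
proof
  show "range (frechet_derivative \<psi>1 (at y1)) \<subseteq> range (frechet_derivative \<psi>2 (at y2))"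
    using surface_chart_transition[OF c1 c2 y1 y2 eq] by (metis image_subsetI rangeI)
  show "range (frechet_derivative \<psi>2 (at y2)) \<subseteq> range (frechet_derivative \<psi>1 (at y1))"
    using surface_chart_transition[OF c2 c1 y2 y1 eq[symmetric]] by (metis image_subsetI rangeI)
qed

text \<open>The ranges of the derivatives agree for all parametrizations around a point, so their
  union in the definition of \<open>tangent_plane\<close> is a single plane.\<close>

lemma (in surface_chart) tangent_plane_chart:
  assumes y: "y \<in> HD" shows "tangent_plane S (\<psi> y) = {v. v \<bullet> N y = 0}"
proof -
  have "v \<in> range (d\<psi> y)" if "local_param S W' \<psi>'" "y' \<in> W' \<inter> half_plane" "\<psi>' y' = \<psi> y"
      "v \<in> range (frechet_derivative \<psi>' (at y'))" for v W' \<psi>' y'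
    using range_d_transition[of S W' \<psi>' W \<psi> y' y] that y surface_chart_axioms
    by (simp add: surface_chart_def)
  then have "tangent_plane S (\<psi> y) = range (d\<psi> y)"
    unfolding tangent_plane_def using param y by blast
  then show ?thesis using range_d y by simp
qed

text \<open>Along the transition map the first normal is \<sigma> times the second, with \<sigma> a
  locally constant sign. Differentiating this relation with \<open>has_derivative_N_shape\<close> on
  both sides shows that the shape operators are conjugate up to \<sigma>. The normals of two
  parametrizations may well be opposite, so the sign has to be carried along.\<close>

lemma shape_transition:
  assumes c1: "surface_chart S W1 \<psi>1" and c2: "surface_chart S W2 \<psi>2"
    and y1: "y1 \<in> W1 \<inter> half_plane" and y2: "y2 \<in> W2 \<inter> half_plane" and eq: "\<psi>1 y1 = \<psi>2 y2"
  obtains M :: "real^2^2" and \<sigma> where "invertible M" "\<sigma>\<^sup>2 = 1"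
    "M ** shape_operator \<psi>1 y1 = \<sigma> *\<^sub>R (shape_operator \<psi>2 y2 ** M)"
proof -
  interpret A: surface_chart S W1 \<psi>1 by fact
  interpret B: surface_chart S W2 \<psi>2 by fact
  obtain M where M: "\<And>v. A.d\<psi> y1 v = B.d\<psi> y2 (M *v v)"
    "((\<lambda>z. B.inv_chart (\<psi>1 z)) has_derivative (\<lambda>v. M *v v)) (at y1 within A.HD)"
    and comp: "\<And>(f::real^2\<Rightarrow>real^3) L. ((\<lambda>z. f z) has_derivative L) (at y2 within W2 \<inter> half_plane) \<Longrightarrow>
       ((\<lambda>z. f (B.inv_chart (\<psi>1 z))) has_derivative (\<lambda>v. L (M *v v))) (at y1 within A.HD)"
    using surface_chart_transition[OF assms] by metis
  have W: "y1 \<in> W1" "y2 \<in> W2" using y1 y2 by auto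
  define \<sigma> where "\<sigma> = A.N y1 \<bullet> B.N y2"
  define s where "s z = A.N z \<bullet> B.N (B.inv_chart (\<psi>1 z))" for z
  have iy: "B.inv_chart (\<psi>1 y1) = y2" using eq y2 by simp
  have dN2: "((\<lambda>z. B.N (B.inv_chart (\<psi>1 z))) has_derivative (\<lambda>v. - B.d\<psi> y2 (B.Sh y2 *v (M *v v)))) (at y1 within A.HD)"
    by (rule comp[of B.N "\<lambda>v. - B.d\<psi> y2 (B.Sh y2 *v v)"]) (use B.has_derivative_N_shape W has_derivative_at_withinI in blast)
  have dN1: "(A.N has_derivative (\<lambda>v. - A.d\<psi> y1 (A.Sh y1 *v v))) (at y1 within A.HD)"
    using A.has_derivative_N_shape W has_derivative_at_withinI by blast
  have cs: "continuous (at y1 within A.HD) s"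
    unfolding s_def using has_derivative_continuous[OF dN1] has_derivative_continuous[OF dN2]
    by (rule continuous_inner)
  obtain d where d: "d > 0" "\<And>x. x \<in> S \<Longrightarrow> dist x (\<psi>2 y2) < d \<Longrightarrow> x \<in> \<psi>2 ` B.HD"
    using B.near_image_simple[OF y2] by metis
  obtain d1 where d1: "d1 > 0" "\<And>z. z \<in> A.HD \<Longrightarrow> dist z y1 < d1 \<Longrightarrow> dist (\<psi>1 z) (\<psi>1 y1) < d"
    using A.continuous_chart y1 d(1) unfolding continuous_on_iff by blast
  obtain d2 where d2: "d2 > 0" "\<And>z. z \<in> A.HD \<Longrightarrow> dist z y1 < d2 \<Longrightarrow> dist (s z) (s y1) < 1"
    using cs unfolding continuous_within_eps_delta by (metis zero_less_one)
  have rel: "A.N z = s z *\<^sub>R B.N (B.inv_chart (\<psi>1 z))" "(s z)\<^sup>2 = 1" if z: "z \<in> A.HD" "dist z y1 < d1" for z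
  proof -
    have "\<psi>1 z \<in> \<psi>2 ` B.HD" using d(2)[of "\<psi>1 z"] d1(2)[OF z] A.chart_in[OF z(1)] eq by auto
    then have i: "B.inv_chart (\<psi>1 z) \<in> B.HD" "\<psi>2 (B.inv_chart (\<psi>1 z)) = \<psi>1 z" using B.inv_chart_in by auto
    have "{v. v \<bullet> A.N z = 0} = {v. v \<bullet> B.N (B.inv_chart (\<psi>1 z)) = 0}"
      using A.tangent_plane_chart[OF z(1)] B.tangent_plane_chart[OF i(1)] i(2) by simp
    then have or: "v \<bullet> B.N (B.inv_chart (\<psi>1 z)) = 0 \<Longrightarrow> v \<bullet> A.N z = 0" for v by blast
    show "A.N z = s z *\<^sub>R B.N (B.inv_chart (\<psi>1 z))" "(s z)\<^sup>2 = 1" unfolding s_def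
      by (rule unit_normals_agree[OF B.norm_N A.norm_N or]; use i z in simp)+
  qed
  have s1: "s y1 = \<sigma>" by (simp add: s_def \<sigma>_def iy)
  have sig: "\<sigma>\<^sup>2 = 1" using rel(2)[of y1] y1 d1 s1 by simp
  \<comment> \<open>A continuous function with values 1 and -1 is locally constant.\<close>
  have sc: "s z = \<sigma>" if z: "z \<in> A.HD" "dist z y1 < min d1 d2" for z
  proof -
    have "s z = 1 \<or> s z = -1" using rel(2)[of z] z by (simp add: power2_eq_1_iff)
    moreover have "\<sigma> = 1 \<or> \<sigma> = -1" using sig by (simp add: power2_eq_1_iff)
    moreover have "\<bar>s z - \<sigma>\<bar> < 1" using d2(2)[of z] z s1 by (simp add: dist_real_def)
    ultimately show ?thesis by auto
  qed
  have "((\<lambda>z. \<sigma> *\<^sub>R B.N (B.inv_chart (\<psi>1 z))) has_derivative (\<lambda>v. \<sigma> *\<^sub>R (- B.d\<psi> y2 (B.Sh y2 *v (M *v v))))) (at y1 within A.HD)"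
    by (rule has_derivative_scaleR_right[OF dN2])
  then have "(A.N has_derivative (\<lambda>v. \<sigma> *\<^sub>R (- B.d\<psi> y2 (B.Sh y2 *v (M *v v))))) (at y1 within A.HD)"
  proof (rule has_derivative_transform_within[OF _ _ y1])
    show "0 < min d1 d2" using d1 d2 by simp
    show "\<sigma> *\<^sub>R B.N (B.inv_chart (\<psi>1 z)) = A.N z" if "z \<in> A.HD" "dist z y1 < min d1 d2" for z
      using rel(1)[of z] sc[of z] that by simp
  qed
  from A.has_derivative_dom_unique[OF y1 dN1 this]
  have "- A.d\<psi> y1 (A.Sh y1 *v v) = \<sigma> *\<^sub>R (- B.d\<psi> y2 (B.Sh y2 *v (M *v v)))" for v by metis
  then have "B.d\<psi> y2 (M *v (A.Sh y1 *v v)) = B.d\<psi> y2 (\<sigma> *\<^sub>R (B.Sh y2 *v (M *v v)))" for v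
    unfolding M(1) linear_scale[OF B.linear_d[OF W(2)]] by simp
  then have "M *v (A.Sh y1 *v v) = \<sigma> *\<^sub>R (B.Sh y2 *v (M *v v))" for v
    using B.inj_d[OF W(2)] by (meson injD)
  then have "(M ** A.Sh y1) *v v = (\<sigma> *\<^sub>R (B.Sh y2 ** M)) *v v" for v
    by (simp add: matrix_vector_mul_assoc scaleR_matrix_vector_assoc)
  then have eqM: "M ** A.Sh y1 = \<sigma> *\<^sub>R (B.Sh y2 ** M)" by (simp add: matrix_eq)
  have "inj ((*v) M)"
  proof (rule injI)
    fix a b assume "M *v a = M *v b"
    then have "A.d\<psi> y1 a = A.d\<psi> y1 b" by (simp add: M(1))
    then show "a = b" using A.inj_d[OF W(1)] by (meson injD)
  qed
  then have "invertible M" using invertible_left_inverse matrix_left_invertible_injective by blast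
  then show ?thesis using that sig eqM by blast
qed

text \<open>Conjugation preserves traces; the sign \<sigma> disappears under the absolute value and
  in the square.\<close>

lemma shape_traces_invariant:
  assumes "surface_chart S W1 \<psi>1" "surface_chart S W2 \<psi>2"
    "y1 \<in> W1 \<inter> half_plane" "y2 \<in> W2 \<inter> half_plane" "\<psi>1 y1 = \<psi>2 y2"
  shows "\<bar>trace (shape_operator \<psi>1 y1)\<bar> = \<bar>trace (shape_operator \<psi>2 y2)\<bar>"
    "trace (shape_operator \<psi>1 y1 ** shape_operator \<psi>1 y1) = trace (shape_operator \<psi>2 y2 ** shape_operator \<psi>2 y2)"
proof -
  obtain M :: "real^2^2" and \<sigma> where M: "invertible M" and s: "\<sigma>\<^sup>2 = 1"
    and e: "M ** shape_operator \<psi>1 y1 = \<sigma> *\<^sub>R (shape_operator \<psi>2 y2 ** M)"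
    using shape_transition[OF assms] by metis
  let ?A = "shape_operator \<psi>1 y1" and ?B = "shape_operator \<psi>2 y2"
  obtain L where L: "L ** M = mat 1" "M ** L = mat 1" using M by (auto simp: invertible_def)
  have A: "?A = \<sigma> *\<^sub>R (L ** (?B ** M))"
    using arg_cong[OF e, of "\<lambda>X. L ** X"] L
    by (simp add: matrix_mul_assoc matrix_scalar_ac scalar_matrix_assoc[symmetric])
  have tr: "trace (L ** (X ** M)) = trace X" for X
    by (metis L(2) matrix_mul_assoc matrix_mul_rid trace_mul_sym)
  have tsc: "trace (c *\<^sub>R X) = c * trace X" for c and X :: "real^2^2" by (simp add: trace2 algebra_simps)
  have "trace ?A = \<sigma> * trace ?B" by (subst A) (simp add: tsc tr)
  moreover have "\<bar>\<sigma>\<bar> = 1" using s by (simp add: power2_eq_1_iff) linarith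
  ultimately show "\<bar>trace ?A\<bar> = \<bar>trace ?B\<bar>" by (simp add: abs_mult)
  have "?A ** ?A = (\<sigma> * \<sigma>) *\<^sub>R (L ** (?B ** M) ** (L ** (?B ** M)))"
    by (subst A, subst A) (simp add: matrix_scalar_ac scalar_matrix_assoc[symmetric])
  also have "L ** (?B ** M) ** (L ** (?B ** M)) = L ** (?B ** (M ** L) ** ?B ** M)"
    by (simp only: matrix_mul_assoc)
  also have "\<dots> = L ** ((?B ** ?B) ** M)" by (simp add: L)
  finally show "trace (?A ** ?A) = trace (?B ** ?B)"
    using s by (simp add: tr tsc power2_eq_square)
qed

lemma (in surface_chart) second_form_norm2_chart:
  assumes y: "y \<in> HD" shows "second_form_norm2 S (\<psi> y) = trace (Sh y ** Sh y)"
  unfolding second_form_norm2_def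
proof (rule the_equality)
  show "\<exists>W' \<psi>' y'. local_param S W' \<psi>' \<and> y' \<in> W' \<inter> half_plane \<and> \<psi>' y' = \<psi> y \<and>
        trace (Sh y ** Sh y) = trace (shape_operator \<psi>' y' ** shape_operator \<psi>' y')"
    using param y by blast
next
  fix a assume "\<exists>W' \<psi>' y'. local_param S W' \<psi>' \<and> y' \<in> W' \<inter> half_plane \<and> \<psi>' y' = \<psi> y \<and>
        a = trace (shape_operator \<psi>' y' ** shape_operator \<psi>' y')"
  then show "a = trace (Sh y ** Sh y)"
    using shape_traces_invariant(2)[OF _ surface_chart_axioms _ y] unfolding surface_chart_def by metis
qed

section \<open>Area and length measures\<close>

text \<open>The image under f of the measure with density J on D. Setting both functions to 0
  outside D makes them Borel on the whole space; where f takes this dummy value the density is 0, so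
  no mass is created at the origin.\<close>

definition pushed_density ::
  "'a::euclidean_space set \<Rightarrow> ('a \<Rightarrow> real) \<Rightarrow> ('a \<Rightarrow> 'b::euclidean_space) \<Rightarrow> 'b measure" where
  "pushed_density D J f =
     distr (density lborel (\<lambda>y. if y \<in> D then ennreal (J y) else 0)) borel (\<lambda>y. if y \<in> D then f y else 0)"

lemma measurable_if_continuous_on:
  fixes f :: "'a::euclidean_space \<Rightarrow> 'b::euclidean_space"
  assumes "D \<in> sets borel" "continuous_on D f"
  shows "(\<lambda>y. if y \<in> D then f y else 0) \<in> borel_measurable borel"
  by (rule borel_measurable_continuous_on_if[OF assms]) (rule continuous_on_const)

lemma sets_pushed_density: "sets (pushed_density D J f) = sets borel"
  by (simp add: pushed_density_def)

context
  fixes D :: "'a::euclidean_space set" and J :: "'a \<Rightarrow> real" and f :: "'a \<Rightarrow> 'b::euclidean_space"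
  assumes D: "D \<in> sets borel" and J: "continuous_on D J" and J0: "\<And>y. y \<in> D \<Longrightarrow> J y \<ge> 0"
    and f: "continuous_on D f"
begin

lemma borel_preimage_in:
  assumes "B \<in> sets borel" shows "{y \<in> D. f y \<in> B} \<in> sets borel"
proof -
  have "{y \<in> D. f y \<in> B} = D \<inter> ((\<lambda>y. if y \<in> D then f y else 0) -` B \<inter> space borel)" by auto
  then show ?thesis using D assms measurable_sets[OF measurable_if_continuous_on[OF D f]] by simp
qed

lemma measurable_density_in:
  assumes "B \<in> sets borel"
  shows "(\<lambda>y. if y \<in> D \<and> f y \<in> B then J y else 0) \<in> borel_measurable borel"
proof -
  have "continuous_on {y \<in> D. f y \<in> B} J" using J by (rule continuous_on_subset) auto
  from measurable_if_continuous_on[OF borel_preimage_in[OF assms] this] show ?thesis by simp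
qed

lemma measurable_density_ennreal: "(\<lambda>y. if y \<in> D then ennreal (J y) else 0) \<in> borel_measurable lborel"
proof -
  have "(\<lambda>y. ennreal (if y \<in> D then J y else 0)) \<in> borel_measurable lborel"
    using measurable_if_continuous_on[OF D J] by simp
  moreover have "(\<lambda>y. ennreal (if y \<in> D then J y else 0)) = (\<lambda>y. if y \<in> D then ennreal (J y) else 0)"
    by (simp add: fun_eq_iff)
  ultimately show ?thesis by simp
qed

lemma emeasure_pushed_density:
  assumes B: "B \<in> sets borel"
  shows "emeasure (pushed_density D J f) B = (\<integral>\<^sup>+y. ennreal (if y \<in> D \<and> f y \<in> B then J y else 0) \<partial>lborel)"
proof -
  let ?g = "\<lambda>y. if y \<in> D then f y else 0"
  have g: "?g \<in> borel_measurable borel" by (rule measurable_if_continuous_on[OF D f])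
  have "emeasure (pushed_density D J f) B = emeasure (density lborel (\<lambda>y. if y \<in> D then ennreal (J y) else 0)) (?g -` B)"
    unfolding pushed_density_def using emeasure_distr[of ?g "density lborel (\<lambda>y. if y \<in> D then ennreal (J y) else 0)" borel B] g B
    by simp
  also have "\<dots> = (\<integral>\<^sup>+y. (if y \<in> D then ennreal (J y) else 0) * indicator (?g -` B) y \<partial>lborel)"
    using measurable_sets[OF g B] by (intro emeasure_density[OF measurable_density_ennreal]) simp
  also have "\<dots> = (\<integral>\<^sup>+y. ennreal (if y \<in> D \<and> f y \<in> B then J y else 0) \<partial>lborel)"
    by (intro nn_integral_cong) (simp add: indicator_def)
  finally show ?thesis .
qed

lemma pushed_density_set_integral:
  assumes B: "B \<in> sets borel"
  shows "emeasure (pushed_density D J f) B = (\<integral>\<^sup>+y\<in>D. indicator B (f y) * ennreal (J y) \<partial>lborel)"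
  unfolding emeasure_pushed_density[OF B] by (intro nn_integral_cong) (auto simp: indicator_def)

lemma integral_pushed_density:
  fixes g :: "'b \<Rightarrow> real"
  assumes g: "g \<in> borel_measurable borel"
  shows "integral\<^sup>L (pushed_density D J f) g = (\<integral>y. (if y \<in> D then J y * g (f y) else 0) \<partial>lborel)"
    "integrable (pushed_density D J f) g \<longleftrightarrow> integrable lborel (\<lambda>y. if y \<in> D then J y * g (f y) else 0)"
proof -
  let ?g = "\<lambda>y. if y \<in> D then f y else 0" and ?J = "\<lambda>y. if y \<in> D then J y else 0"
  have m: "?g \<in> borel_measurable borel" "?J \<in> borel_measurable borel"
    by (rule measurable_if_continuous_on[OF D f], rule measurable_if_continuous_on[OF D J])
  have gm: "(\<lambda>y. g (?g y)) \<in> borel_measurable borel" using measurable_compose[OF m(1) g] .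
  have eq: "(\<lambda>y. if y \<in> D then ennreal (J y) else 0) = (\<lambda>y. ennreal (?J y))" by (simp add: fun_eq_iff)
  have nn: "AE y in lborel. 0 \<le> ?J y" using J0 by simp
  have c: "(\<lambda>y. ?J y *\<^sub>R g (?g y)) = (\<lambda>y. if y \<in> D then J y * g (f y) else 0)" by (simp add: fun_eq_iff)
  have "integral\<^sup>L (pushed_density D J f) g = integral\<^sup>L (density lborel (\<lambda>y. ennreal (?J y))) (\<lambda>y. g (?g y))"
    unfolding pushed_density_def eq by (rule integral_distr) (use m g in auto)
  also have "\<dots> = (\<integral>y. ?J y *\<^sub>R g (?g y) \<partial>lborel)"
    by (rule integral_density) (use m gm nn in auto)
  finally show "integral\<^sup>L (pushed_density D J f) g = (\<integral>y. (if y \<in> D then J y * g (f y) else 0) \<partial>lborel)" unfolding c .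
  have "integrable (pushed_density D J f) g = integrable (density lborel (\<lambda>y. ennreal (?J y))) (\<lambda>y. g (?g y))"
    unfolding pushed_density_def eq by (rule integrable_distr_eq) (use m g in auto)
  also have "\<dots> = integrable lborel (\<lambda>y. ?J y *\<^sub>R g (?g y))"
    by (rule integrable_density) (use m gm nn in auto)
  finally show "integrable (pushed_density D J f) g \<longleftrightarrow> integrable lborel (\<lambda>y. if y \<in> D then J y * g (f y) else 0)" unfolding c .
qed

end

text \<open>Change of variables compares finite values of gauge integrals only. If either side is
  finite, the other has the same value; otherwise both are infinite.\<close>

lemma nn_integral_eq_has_integral:
  fixes F1 :: "'a::euclidean_space \<Rightarrow> real" and F2 :: "'b::euclidean_space \<Rightarrow> real"
  assumes m: "F1 \<in> borel_measurable borel" "F2 \<in> borel_measurable borel"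
    and nn: "\<And>x. F1 x \<ge> 0" "\<And>x. F2 x \<ge> 0"
    and eq: "\<And>r. (F1 has_integral r) UNIV \<longleftrightarrow> (F2 has_integral r) UNIV"
  shows "(\<integral>\<^sup>+x. ennreal (F1 x) \<partial>lborel) = (\<integral>\<^sup>+x. ennreal (F2 x) \<partial>lborel)"
proof (cases "(\<integral>\<^sup>+x. ennreal (F1 x) \<partial>lborel) = \<infinity> \<and> (\<integral>\<^sup>+x. ennreal (F2 x) \<partial>lborel) = \<infinity>")
  case False
  have 1: ?thesis if fin: "(\<integral>\<^sup>+x. ennreal (F1 x) \<partial>lborel) \<noteq> \<infinity>"
  proof -
    obtain r where r: "(\<integral>\<^sup>+x. ennreal (F1 x) \<partial>lborel) = ennreal r" "r \<ge> 0"
      using fin by (cases "\<integral>\<^sup>+x. ennreal (F1 x) \<partial>lborel") auto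
    have "(F1 has_integral r) UNIV" by (rule nn_integral_has_integral[OF m(1) nn(1) r])
    then have "(F2 has_integral r) UNIV" using eq by simp
    from nn_integral_has_integral_lborel[OF m(2) nn(2) this] show ?thesis using r by simp
  qed
  have 2: ?thesis if fin: "(\<integral>\<^sup>+x. ennreal (F2 x) \<partial>lborel) \<noteq> \<infinity>"
  proof -
    obtain r where r: "(\<integral>\<^sup>+x. ennreal (F2 x) \<partial>lborel) = ennreal r" "r \<ge> 0"
      using fin by (cases "\<integral>\<^sup>+x. ennreal (F2 x) \<partial>lborel") auto
    have "(F2 has_integral r) UNIV" by (rule nn_integral_has_integral[OF m(2) nn(2) r])
    then have "(F1 has_integral r) UNIV" using eq by simp
    from nn_integral_has_integral_lborel[OF m(1) nn(1) this] show ?thesis using r by simp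
  qed
  show ?thesis using 1 2 False by blast
qed simp

lemma pushed_density_eqI:
  fixes D1 :: "'a::euclidean_space set" and D2 :: "'c::euclidean_space set"
    and f1 :: "'a \<Rightarrow> 'b::euclidean_space" and f2 :: "'c \<Rightarrow> 'b"
  assumes 1: "D1 \<in> sets borel" "continuous_on D1 J1" "\<And>y. y \<in> D1 \<Longrightarrow> J1 y \<ge> 0" "continuous_on D1 f1"
    and 2: "D2 \<in> sets borel" "continuous_on D2 J2" "\<And>y. y \<in> D2 \<Longrightarrow> J2 y \<ge> 0" "continuous_on D2 f2"
    and B: "B \<in> sets borel"
    and eq: "\<And>r. (J1 has_integral r) {y \<in> D1. f1 y \<in> B} \<longleftrightarrow> (J2 has_integral r) {y \<in> D2. f2 y \<in> B}"
  shows "emeasure (pushed_density D1 J1 f1) B = emeasure (pushed_density D2 J2 f2) B"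
proof -
  have "(\<integral>\<^sup>+y. ennreal (if y \<in> D1 \<and> f1 y \<in> B then J1 y else 0) \<partial>lborel) =
      (\<integral>\<^sup>+y. ennreal (if y \<in> D2 \<and> f2 y \<in> B then J2 y else 0) \<partial>lborel)"
  proof (rule nn_integral_eq_has_integral[OF measurable_density_in[OF 1 B] measurable_density_in[OF 2 B]])
    show "((\<lambda>y. if y \<in> D1 \<and> f1 y \<in> B then J1 y else 0) has_integral r) UNIV \<longleftrightarrow>
          ((\<lambda>y. if y \<in> D2 \<and> f2 y \<in> B then J2 y else 0) has_integral r) UNIV" for r
      using eq[of r] has_integral_restrict_UNIV[of "{y \<in> D1. f1 y \<in> B}" J1 r]
        has_integral_restrict_UNIV[of "{y \<in> D2. f2 y \<in> B}" J2 r] by simp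
  qed (use 1 2 in auto)
  then show ?thesis using emeasure_pushed_density[OF 1 B] emeasure_pushed_density[OF 2 B] by simp
qed

text \<open>The finite cover is cut into disjoint Borel pieces \<open>C k\<close>, and each piece is
  measured by its own member of the family. Consistency makes the sum agree with
  \<open>\<nu> i\<close> on \<open>X i\<close> for every index i, not only for the covering ones. A
  measure that is null outside A is determined by its values on the pieces, which gives
  uniqueness.\<close>

lemma glue_measures:
  fixes \<nu> :: "'i \<Rightarrow> 'a::topological_space measure" and X :: "'i \<Rightarrow> 'a set"
  assumes J: "finite J" "J \<subseteq> I" and A: "A = (\<Union>j\<in>J. X j)"
    and X: "\<And>i. i \<in> I \<Longrightarrow> X i \<in> sets borel" "\<And>i. i \<in> I \<Longrightarrow> X i \<subseteq> A"
    and s: "\<And>i. i \<in> I \<Longrightarrow> sets (\<nu> i) = sets borel"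
    and cons: "\<And>i j B. i \<in> I \<Longrightarrow> j \<in> I \<Longrightarrow> B \<in> sets borel \<Longrightarrow> B \<subseteq> X i \<inter> X j \<Longrightarrow> emeasure (\<nu> i) B = emeasure (\<nu> j) B"
  shows "\<exists>!\<mu>. sets \<mu> = sets borel \<and> emeasure \<mu> (- A) = 0 \<and>
    (\<forall>i\<in>I. \<forall>B. B \<in> sets borel \<longrightarrow> B \<subseteq> X i \<longrightarrow> emeasure \<mu> B = emeasure (\<nu> i) B)"
proof -
  obtain g where g: "bij_betw g {0..<card J} J" using ex_bij_betw_nat_finite[OF J(1)] by blast
  define n where "n = card J"
  have gJ: "g k \<in> J" if "k < n" for k using g that bij_betwE[OF g] by (auto simp: n_def)
  have gI: "g k \<in> I" if "k < n" for k using gJ[OF that] J by auto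
  define C where "C k = X (g k) - (\<Union>m<k. X (g m))" for k
  have Cb: "C k \<in> sets borel" if "k < n" for k
    unfolding C_def using X(1) gI that by (intro sets.Diff sets.finite_UN) auto
  have CX: "C k \<subseteq> X (g k)" for k by (auto simp: C_def)
  have Cd: "disjoint_family_on C {..<n}"
    unfolding disjoint_family_on_def
  proof (intro ballI impI)
    fix a b :: nat assume "a \<noteq> b"
    then consider "a < b" | "b < a" by linarith
    then show "C a \<inter> C b = {}" by cases (auto simp: C_def)
  qed
  have CA: "(\<Union>k<n. C k) = A"
  proof
    show "(\<Union>k<n. C k) \<subseteq> A" using CX A gJ by blast
    show "A \<subseteq> (\<Union>k<n. C k)"
    proof
      fix x assume "x \<in> A"
      then obtain j where "j \<in> J" "x \<in> X j" using A by blast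
      then obtain k where k: "k < n \<and> x \<in> X (g k)" using g unfolding bij_betw_def n_def by (metis atLeastLessThan_iff imageE)
      define l where "l = (LEAST k. k < n \<and> x \<in> X (g k))"
      have l: "l < n" "x \<in> X (g l)" using LeastI[of "\<lambda>k. k < n \<and> x \<in> X (g k)", OF k] by (auto simp: l_def)
      moreover have "x \<notin> X (g m)" if "m < l" for m
        using not_less_Least[of m "\<lambda>k. k < n \<and> x \<in> X (g k)"] that l by (auto simp: l_def[symmetric])
      ultimately show "x \<in> (\<Union>k<n. C k)" by (auto simp: C_def)
    qed
  qed
  have Ab: "A \<in> sets borel" unfolding CA[symmetric] using Cb by (intro sets.finite_UN) auto
  define F where "F B = (\<Sum>k<n. emeasure (\<nu> (g k)) (B \<inter> C k))" for B
  define \<mu> where "\<mu> = measure_of UNIV (sets borel) F"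
  have sig: "sigma_algebra UNIV (sets (borel :: 'a measure))"
    using sets.sigma_algebra_axioms[of "borel :: 'a measure"] by simp
  have F\<mu>: "emeasure \<mu> B = F B" if "B \<in> sets borel" for B
    unfolding \<mu>_def
  proof (rule emeasure_measure_of_sigma[OF sig _ _ that])
    show "positive (sets borel) F" by (simp add: positive_def F_def)
    show "countably_additive (sets borel) F"
      unfolding countably_additive_def
    proof (intro allI impI)
      fix B :: "nat \<Rightarrow> 'a set" assume B: "range B \<subseteq> sets borel" "disjoint_family B"
      have "(\<Sum>i. emeasure (\<nu> (g k)) (B i \<inter> C k)) = emeasure (\<nu> (g k)) ((\<Union>i. B i) \<inter> C k)" if k: "k < n" for k
      proof -
        have "(\<Sum>i. emeasure (\<nu> (g k)) (B i \<inter> C k)) = emeasure (\<nu> (g k)) (\<Union>i. B i \<inter> C k)"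
          by (rule suminf_emeasure) (use B Cb[OF k] s[OF gI[OF k]] in \<open>auto simp: disjoint_family_on_def\<close>)
        then show ?thesis by (simp add: Int_commute)
      qed
      then have "F (\<Union>i. B i) = (\<Sum>k<n. \<Sum>i. emeasure (\<nu> (g k)) (B i \<inter> C k))"
        unfolding F_def by simp
      also have "\<dots> = (\<Sum>i. F (B i))" unfolding F_def by (rule suminf_sum[symmetric]) simp
      finally show "(\<Sum>i. F (B i)) = F (\<Union>i. B i)" by simp
    qed
  qed
  have s\<mu>: "sets \<mu> = sets borel" unfolding \<mu>_def by (simp add: sigma_algebra.sets_measure_of_eq[OF sig])
  have split: "emeasure M B = (\<Sum>k<n. emeasure M (B \<inter> C k))"
    if "sets M = sets borel" "B \<in> sets borel" "B \<subseteq> A" for M B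
    by (rule sum_emeasure_cover) (use that Cb Cd CA in auto)
  show ?thesis
  proof (rule ex1I[of _ \<mu>], intro conjI ballI allI impI)
    show "sets \<mu> = sets borel" by (rule s\<mu>)
    have "(- A) \<inter> C k = {}" if "k < n" for k using CA that by blast
    then show "emeasure \<mu> (- A) = 0" using F\<mu>[of "- A"] Ab by (simp add: F_def)
    fix i B assume i: "i \<in> I" and B: "B \<in> sets borel" "B \<subseteq> X i"
    have "emeasure \<mu> B = (\<Sum>k<n. emeasure (\<nu> (g k)) (B \<inter> C k))" using F\<mu>[OF B(1)] by (simp add: F_def)
    also have "\<dots> = (\<Sum>k<n. emeasure (\<nu> i) (B \<inter> C k))"
    proof (rule sum.cong)
      fix k assume "k \<in> {..<n}"
      then have k: "k < n" by simp
      show "emeasure (\<nu> (g k)) (B \<inter> C k) = emeasure (\<nu> i) (B \<inter> C k)"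
        by (rule cons[OF gI[OF k] i]) (use B CX[of k] Cb[OF k] in auto)
    qed simp
    also have "\<dots> = emeasure (\<nu> i) B"
      by (rule split[symmetric]) (use s[OF i] B X(2)[OF i] in auto)
    finally show "emeasure \<mu> B = emeasure (\<nu> i) B" .
  next
    fix \<mu>' assume h: "sets \<mu>' = sets borel \<and> emeasure \<mu>' (- A) = 0 \<and>
      (\<forall>i\<in>I. \<forall>B. B \<in> sets borel \<longrightarrow> B \<subseteq> X i \<longrightarrow> emeasure \<mu>' B = emeasure (\<nu> i) B)"
    show "\<mu>' = \<mu>"
    proof (rule measure_eqI)
      show "sets \<mu>' = sets \<mu>" using h s\<mu> by simp
      fix B assume "B \<in> sets \<mu>'"
      then have B: "B \<in> sets borel" using h by simp
      have z: "emeasure \<mu>' (B - A) = 0"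
      proof -
        have "emeasure \<mu>' (B - A) \<le> emeasure \<mu>' (- A)" by (rule emeasure_mono) (use h Ab in auto)
        then show ?thesis using h by simp
      qed
      have "emeasure \<mu>' B = emeasure \<mu>' (B \<inter> A) + emeasure \<mu>' (B - A)"
        by (subst plus_emeasure) (use h B Ab in \<open>auto simp: Int_Diff_Un\<close>)
      also have "\<dots> = (\<Sum>k<n. emeasure \<mu>' (B \<inter> A \<inter> C k))" using z split[of \<mu>' "B \<inter> A"] h B Ab by simp
      also have "\<dots> = (\<Sum>k<n. emeasure (\<nu> (g k)) (B \<inter> C k))"
      proof (rule sum.cong)
        fix k assume "k \<in> {..<n}"
        then have k: "k < n" by simp
        have "B \<inter> A \<inter> C k = B \<inter> C k" using CA k by blast
        then show "emeasure \<mu>' (B \<inter> A \<inter> C k) = emeasure (\<nu> (g k)) (B \<inter> C k)"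
          using h gI[OF k] CX[of k] Cb[OF k] B by (simp add: le_infI2)
      qed simp
      also have "\<dots> = emeasure \<mu> B" using F\<mu>[OF B] by (simp add: F_def)
      finally show "emeasure \<mu>' B = emeasure \<mu> B" .
    qed
  qed
qed

section \<open>Invariance of area and length under change of chart\<close>

lemma has_integral_change_of_variables_nonneg:
  fixes J1 J2 :: "real^2 \<Rightarrow> real"
  assumes A: "A \<in> sets borel" and g: "\<And>y. y \<in> A \<Longrightarrow> (g has_derivative (\<lambda>v. M y *v v)) (at y within A)"
    and inj: "inj_on g A" and J: "\<And>y. y \<in> A \<Longrightarrow> J1 y = \<bar>det (M y)\<bar> * J2 (g y)"
    and nn: "\<And>y. y \<in> A \<Longrightarrow> J2 (g y) \<ge> 0"
  shows "(J1 has_integral r) A \<longleftrightarrow> (J2 has_integral r) (g ` A)"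
proof -
  have A': "A \<in> sets lebesgue" using A by auto
  \<comment> \<open>The theorem on change of variables is applied to absolutely integrable
    vector-valued functions. For nonnegative functions integrable and absolutely integrable mean the
    same, and \<open>vec\<close> reads a real function as a map into \<open>real^1\<close>.\<close>
  have conv: "(F has_integral r) S \<longleftrightarrow> (\<lambda>x. vec (F x) :: real^1) absolutely_integrable_on S \<and> integral S (\<lambda>x. vec (F x) :: real^1) = vec r"
    if "\<And>x. x \<in> S \<Longrightarrow> F x \<ge> 0" for F :: "real^2 \<Rightarrow> real" and S
    using absolutely_integrable_on_iff_nonneg[of S F] that
    by (simp add: absolutely_integrable_on_1_iff integral_on_1_eq has_integral_iff)
  have "(J1 has_integral r) A \<longleftrightarrow> ((\<lambda>y. \<bar>det (M y)\<bar> * J2 (g y)) has_integral r) A"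
    by (rule has_integral_cong) (rule J)
  also have "\<dots> \<longleftrightarrow> (\<lambda>x. vec (\<bar>det (M x)\<bar> * J2 (g x)) :: real^1) absolutely_integrable_on A
      \<and> integral A (\<lambda>x. vec (\<bar>det (M x)\<bar> * J2 (g x)) :: real^1) = vec r"
    by (rule conv) (use nn in simp)
  also have "\<dots> \<longleftrightarrow> (\<lambda>x. vec (J2 x) :: real^1) absolutely_integrable_on (g ` A)
      \<and> integral (g ` A) (\<lambda>x. vec (J2 x) :: real^1) = vec r"
  proof -
    have v: "(vec (a * b) :: real^1) = a *\<^sub>R vec b" for a b by (simp add: vec_eq_iff)
    have d: "det (matrix (\<lambda>v. M x *v v)) = det (M x)" for x by (simp add: matrix_of_matrix_vector_mul)
    show ?thesis
      unfolding v using has_absolute_integral_change_of_variables[OF A' g inj, of "\<lambda>x. vec (J2 x) :: real^1" "vec r"]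
      by (simp add: d)
  qed
  also have "\<dots> \<longleftrightarrow> (J2 has_integral r) (g ` A)"
    by (rule conv[symmetric]) (use nn in auto)
  finally show ?thesis .
qed

lemma transition_near:
  assumes c1: "surface_chart S W1 \<psi>1" and c2: "surface_chart S W2 \<psi>2"
    and y1: "y1 \<in> W1 \<inter> half_plane" and y2: "y2 \<in> W2 \<inter> half_plane" and eq: "\<psi>1 y1 = \<psi>2 y2"
  obtains d where "d > 0" "\<And>z. z \<in> W1 \<inter> half_plane \<Longrightarrow> dist z y1 < d \<Longrightarrow> \<psi>1 z \<in> \<psi>2 ` (W2 \<inter> half_plane)"
proof -
  interpret A: surface_chart S W1 \<psi>1 by fact
  interpret B: surface_chart S W2 \<psi>2 by fact
  obtain d where d: "d > 0" "\<And>x. x \<in> S \<Longrightarrow> dist x (\<psi>2 y2) < d \<Longrightarrow> x \<in> \<psi>2 ` B.HD"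
    using B.near_image_simple[OF y2] by metis
  obtain d1 where d1: "d1 > 0" "\<And>z. z \<in> A.HD \<Longrightarrow> dist z y1 < d1 \<Longrightarrow> dist (\<psi>1 z) (\<psi>1 y1) < d"
    using A.continuous_chart y1 d(1) unfolding continuous_on_iff by blast
  show ?thesis
  proof (rule that[OF d1(1)])
    fix z assume z: "z \<in> A.HD" "dist z y1 < d1"
    show "\<psi>1 z \<in> \<psi>2 ` B.HD" using d(2)[of "\<psi>1 z"] d1(2)[OF z] A.chart_in[OF z(1)] eq by auto
  qed
qed

lemma transition_exists:
  assumes c1: "surface_chart S W1 \<psi>1" and c2: "surface_chart S W2 \<psi>2"
    and y1: "y1 \<in> W1 \<inter> half_plane" and y2: "y2 \<in> W2 \<inter> half_plane" and eq: "\<psi>1 y1 = \<psi>2 y2"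
  shows "\<exists>M. (\<forall>v. frechet_derivative \<psi>1 (at y1) v = frechet_derivative \<psi>2 (at y2) (M *v v)) \<and>
    ((\<lambda>z. surface_chart.inv_chart W2 \<psi>2 (\<psi>1 z)) has_derivative (\<lambda>v. M *v v)) (at y1 within W1 \<inter> half_plane)"
  by (rule surface_chart_transition[OF assms]) blast

text \<open>If y2 lies on the edge, the second coordinate of the transition map is nonnegative near
  y1 and 0 at y1, so its derivative is nonnegative in every available direction. Both directions
  along the edge are available, which kills the entry \<open>M $ 2 $ 1\<close>; at an interior y1
  every direction would be, which would kill the whole row and contradict invertibility.\<close>

lemma boundary_transition:
  assumes c1: "surface_chart S W1 \<psi>1" and c2: "surface_chart S W2 \<psi>2"
    and y1: "y1 \<in> W1 \<inter> half_plane" and y2: "y2 \<in> W2 \<inter> half_plane" and eq: "\<psi>1 y1 = \<psi>2 y2"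
    and M1: "\<And>v. frechet_derivative \<psi>1 (at y1) v = frechet_derivative \<psi>2 (at y2) (M *v v)"
    and M2: "((\<lambda>z. surface_chart.inv_chart W2 \<psi>2 (\<psi>1 z)) has_derivative (\<lambda>v. M *v v)) (at y1 within W1 \<inter> half_plane)"
  shows "det M \<noteq> 0" "y2 $ 2 = 0 \<Longrightarrow> y1 $ 2 = 0" "y2 $ 2 = 0 \<Longrightarrow> M $ 2 $ 1 = 0" "y2 $ 2 = 0 \<Longrightarrow> M $ 2 $ 2 > 0"
proof -
  interpret A: surface_chart S W1 \<psi>1 by fact
  interpret B: surface_chart S W2 \<psi>2 by fact
  have "inj ((*v) M)"
  proof (rule injI)
    fix a b assume "M *v a = M *v b"
    then have "A.d\<psi> y1 a = A.d\<psi> y1 b" by (simp add: M1)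
    then show "a = b" using A.inj_d[of y1] y1 by (meson IntD1 injD)
  qed
  then have "invertible M" using invertible_left_inverse matrix_left_invertible_injective by blast
  then show det: "det M \<noteq> 0" by (simp add: invertible_det_nz)
  assume y20: "y2 $ 2 = 0"
  obtain d where d: "d > 0" "\<And>z. z \<in> A.HD \<Longrightarrow> dist z y1 < d \<Longrightarrow> \<psi>1 z \<in> \<psi>2 ` B.HD"
    using transition_near[OF c1 c2 y1 y2 eq] by metis
  have iy: "B.inv_chart (\<psi>1 y1) = y2" using eq y2 by simp
  have "((\<lambda>z. B.inv_chart (\<psi>1 z) \<bullet> axis 2 1) has_derivative (\<lambda>v. (M *v v) \<bullet> axis 2 1)) (at y1 within A.HD)"
    by (rule has_derivative_inner_left[OF M2])
  then have der: "((\<lambda>z. B.inv_chart (\<psi>1 z) $ 2) has_derivative (\<lambda>v. (M *v v) $ 2)) (at y1 within A.HD)"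
    by (simp add: inner_axis)
  have nn: "(M *v v) $ 2 \<ge> 0" if "y1 $ 2 > 0 \<or> v $ 2 \<ge> 0" for v
  proof (rule A.derivative_nonneg_at_min[OF y1 der d(1) _ that])
    fix z assume "z \<in> A.HD" "dist z y1 < d"
    from d(2)[OF this] show "B.inv_chart (\<psi>1 y1) $ 2 \<le> B.inv_chart (\<psi>1 z) $ 2"
      unfolding iy y20 using B.inv_chart_in[of "\<psi>1 z"] by (auto simp: half_plane_def)
  qed
  have e1: "M $ 2 $ 1 = 0"
    using nn[of "axis 1 1"] nn[of "- axis 1 1"] by (simp add: matrix_vector2 axis_def)
  have e2: "M $ 2 $ 2 \<ge> 0" using nn[of "axis 2 1"] by (simp add: matrix_vector2 axis_def)
  have e3: "M $ 2 $ 2 \<noteq> 0" using det e1 by (auto simp: det_2)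
  show "M $ 2 $ 1 = 0" "M $ 2 $ 2 > 0" using e1 e2 e3 by auto
  show "y1 $ 2 = 0"
  proof (rule ccontr)
    assume "y1 $ 2 \<noteq> 0"
    then have "y1 $ 2 > 0" using y1 by (simp add: half_plane_def)
    from nn[of "- axis 2 1"] this e2 e3 show False by (simp add: matrix_vector2 axis_def)
  qed
qed

abbreviation bpt :: "real \<Rightarrow> real^2" where "bpt t \<equiv> vector [t, 0]"

lemma bpt_eq: "bpt t = t *\<^sub>R axis 1 1"
  by (simp add: vec_eq_iff forall_2 axis_def)

lemma continuous_on_bpt: "continuous_on A bpt"
  unfolding bpt_eq by (intro continuous_intros)

lemma bpt_half_plane: "bpt t \<in> half_plane"
  by (simp add: half_plane_def)

lemma bpt_of: "y $ 2 = 0 \<Longrightarrow> bpt (y $ 1) = y"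
  by (simp add: vec_eq_iff forall_2)

lemma half_plane_borel: "half_plane \<in> sets borel" and closed_half_plane: "closed half_plane"
proof -
  show "closed half_plane" unfolding half_plane_def
    by (intro closed_Collect_le continuous_intros)
  then show "half_plane \<in> sets borel" by simp
qed

context surface_chart
begin

abbreviation "BD \<equiv> {t. bpt t \<in> W}"
abbreviation "area_chart \<equiv> pushed_density HD (\<lambda>y. Ja y) \<psi>"
abbreviation "length_chart \<equiv> pushed_density BD (\<lambda>t. norm (E 1 (bpt t))) (\<lambda>t. \<psi> (bpt t))"

lemma HD_borel: "HD \<in> sets borel"
  using open_W half_plane_borel by auto

lemma open_BD: "open BD"
  using open_vimage[OF open_W continuous_on_bpt] by (simp add: vimage_def)

lemma BD_borel: "BD \<in> sets borel"
  using open_BD by simp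

lemma boundary_image: "\<psi> ` (W \<inter> {y. y $ 2 = 0}) = (\<lambda>t. \<psi> (bpt t)) ` BD"
proof
  show "\<psi> ` (W \<inter> {y. y $ 2 = 0}) \<subseteq> (\<lambda>t. \<psi> (bpt t)) ` BD"
  proof
    fix x assume "x \<in> \<psi> ` (W \<inter> {y. y $ 2 = 0})"
    then obtain y where "y \<in> W" "y $ 2 = 0" "x = \<psi> y" by blast
    then show "x \<in> (\<lambda>t. \<psi> (bpt t)) ` BD" using bpt_of[of y] by (intro image_eqI[of _ _ "y $ 1"]) auto
  qed
qed auto

lemma area_chart_facts: "HD \<in> sets borel" "continuous_on HD (\<lambda>y. Ja y)" "\<And>y. y \<in> HD \<Longrightarrow> Ja y \<ge> 0" "continuous_on HD \<psi>"
  using HD_borel continuous_on_subset[OF continuous_Ja] continuous_chart by auto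

lemma length_chart_facts: "BD \<in> sets borel" "continuous_on BD (\<lambda>t. norm (E 1 (bpt t)))"
  "\<And>t. t \<in> BD \<Longrightarrow> norm (E 1 (bpt t)) \<ge> 0" "continuous_on BD (\<lambda>t. \<psi> (bpt t))"
proof -
  show "continuous_on BD (\<lambda>t. norm (E 1 (bpt t)))"
    by (intro continuous_on_norm continuous_on_compose2[OF continuous_E continuous_on_bpt]) auto
  show "continuous_on BD (\<lambda>t. \<psi> (bpt t))"
    by (rule continuous_on_compose2[OF smooth_on_imp_continuous_on[OF smooth] continuous_on_bpt]) auto
qed (use BD_borel in auto)

lemma E1_nonzero: "y \<in> W \<Longrightarrow> E 1 y \<noteq> 0"
  using EE_nonzero unfolding EE_def by force

lemma image_borel:
  assumes "closed S" shows "\<psi> ` HD \<in> sets borel"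
proof -
  obtain T where "open T" "\<psi> ` HD = S \<inter> T" using openin_image openin_open by blast
  then show ?thesis using assms by auto
qed

text \<open>Inside the Borel set covered by the chart, the boundary points form the relatively
  closed zero set of the second coordinate of the inverse chart.\<close>

lemma boundary_image_borel:
  assumes "closed S" shows "(\<lambda>t. \<psi> (bpt t)) ` BD \<in> sets borel"
proof -
  have "continuous_on (\<psi> ` HD) (\<lambda>x. inv_chart x $ 2)" using continuous_inv by (intro continuous_intros)
  from continuous_closedin_preimage[OF this closed_singleton[of 0]]
  have cl: "closedin (top_of_set (\<psi> ` HD)) (\<psi> ` HD \<inter> (\<lambda>x. inv_chart x $ 2) -` {0})" .
  have eq: "\<psi> ` HD \<inter> (\<lambda>x. inv_chart x $ 2) -` {0} = (\<lambda>t. \<psi> (bpt t)) ` BD" (is "?l = ?r")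
  proof
    show "?l \<subseteq> ?r"
    proof
      fix x assume "x \<in> ?l"
      then have "inv_chart x \<in> HD" "\<psi> (inv_chart x) = x" "inv_chart x $ 2 = 0" using inv_chart_in by auto
      then show "x \<in> ?r" using bpt_of[of "inv_chart x"] by (intro image_eqI[of _ _ "inv_chart x $ 1"]) auto
    qed
    show "?r \<subseteq> ?l" using bpt_half_plane by auto
  qed
  obtain T where "closed T" "?r = \<psi> ` HD \<inter> T" using cl unfolding eq closedin_closed by blast
  then show ?thesis using image_borel[OF assms] by auto
qed

end

text \<open>The transition map carries the parameters of B in one chart bijectively to those in the
  other. When the partial derivatives of \<psi>1 are expressed by those of \<psi>2 through M, their
  cross product picks up the factor \<open>det (M y)\<close>, which is exactly the Jacobian in the
  change of variables.\<close>

lemma area_charts_consistent: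
  assumes c1: "surface_chart S W1 \<psi>1" and c2: "surface_chart S W2 \<psi>2"
    and B: "B \<in> sets borel" "B \<subseteq> \<psi>1 ` (W1 \<inter> half_plane)" "B \<subseteq> \<psi>2 ` (W2 \<inter> half_plane)"
  shows "emeasure (pushed_density (W1 \<inter> half_plane) (\<lambda>y. norm (surface_chart.EE \<psi>1 y)) \<psi>1) B =
    emeasure (pushed_density (W2 \<inter> half_plane) (\<lambda>y. norm (surface_chart.EE \<psi>2 y)) \<psi>2) B"
proof -
  interpret A: surface_chart S W1 \<psi>1 by fact
  interpret B: surface_chart S W2 \<psi>2 by fact
  let ?A1 = "{y \<in> A.HD. \<psi>1 y \<in> B}" and ?A2 = "{y \<in> B.HD. \<psi>2 y \<in> B}"
  let ?g = "\<lambda>y. B.inv_chart (\<psi>1 y)"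
  have g2: "?g y \<in> B.HD" "\<psi>2 (?g y) = \<psi>1 y" if "y \<in> ?A1" for y
    using that B(3) B.inv_chart_in[of "\<psi>1 y"] by auto
  have ex: "\<exists>M. (\<forall>v. A.d\<psi> y v = B.d\<psi> (?g y) (M *v v)) \<and> (?g has_derivative (\<lambda>v. M *v v)) (at y within A.HD)"
    if y: "y \<in> ?A1" for y
    by (rule transition_exists[OF c1 c2 _ g2(1)[OF y] g2(2)[OF y, symmetric]]) (use y in simp)
  define M where "M y = (SOME M. (\<forall>v. A.d\<psi> y v = B.d\<psi> (?g y) (M *v v)) \<and> (?g has_derivative (\<lambda>v. M *v v)) (at y within A.HD))" for y
  have M: "A.d\<psi> y v = B.d\<psi> (?g y) (M y *v v)" "(?g has_derivative (\<lambda>v. M y *v v)) (at y within A.HD)"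
    if y: "y \<in> ?A1" for y v
    using someI_ex[OF ex[OF y]] unfolding M_def by blast+
  have im: "?g ` ?A1 = ?A2"
  proof
    show "?g ` ?A1 \<subseteq> ?A2" using g2 by auto
    show "?A2 \<subseteq> ?g ` ?A1"
    proof
      fix z assume z: "z \<in> ?A2"
      then obtain y where y: "y \<in> A.HD" "\<psi>1 y = \<psi>2 z" using B(2) by force
      then have "y \<in> ?A1" "?g y = z" using z by auto
      then show "z \<in> ?g ` ?A1" by blast
    qed
  qed
  have inj: "inj_on ?g ?A1"
  proof (rule inj_onI)
    fix a b assume ab: "a \<in> ?A1" "b \<in> ?A1" "?g a = ?g b"
    have "\<psi>1 a = \<psi>1 b" by (rule trans[OF g2(2)[OF ab(1), symmetric]]) (simp only: ab(3) g2(2)[OF ab(2)])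
    then show "a = b" by (rule inj_onD[OF A.inj_on_chart]) (use ab in simp_all)
  qed
  have J: "A.Ja y = \<bar>det (M y)\<bar> * B.Ja (?g y)" if y: "y \<in> ?A1" for y
  proof -
    have W: "y \<in> W1" "?g y \<in> W2" using y g2[OF y] by auto
    have "A.E i y = M y $ 1 $ i *\<^sub>R B.E 1 (?g y) + M y $ 2 $ i *\<^sub>R B.E 2 (?g y)" for i
      using M(1)[OF y, of "axis i 1"] exhaust_2[of i]
      by (auto simp: A.d_axis[OF W(1)] B.d_eq[OF W(2)] matrix_vector_mult_basis column_def)
    then have "A.EE y = det (M y) *\<^sub>R B.EE (?g y)"
      unfolding A.EE_def B.EE_def
      by (simp add: det_2 cross_add_left cross_add_right cross_mult_left cross_mult_right
          cross_skew[of "B.E 2 (?g y)" "B.E 1 (?g y)"] algebra_simps)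
    then show ?thesis by simp
  qed
  show ?thesis
  proof (rule pushed_density_eqI[OF A.area_chart_facts B.area_chart_facts B(1)])
    show "((\<lambda>y. A.Ja y) has_integral r) ?A1 \<longleftrightarrow> ((\<lambda>y. B.Ja y) has_integral r) ?A2" for r
      unfolding im[symmetric]
    proof (rule has_integral_change_of_variables_nonneg[where M = M])
      show "?A1 \<in> sets borel" using borel_preimage_in[OF A.area_chart_facts B(1)] .
      show "(?g has_derivative (\<lambda>v. M y *v v)) (at y within ?A1)" if "y \<in> ?A1" for y
        by (rule has_derivative_subset[OF M(2)[OF that]]) auto
    qed (use inj J in auto)
  qed
qed

text \<open>At boundary parameters the entry \<open>M t $ 2 $ 1\<close> vanishes, so the transition
  map restricted to the edge has derivative \<open>M t $ 1 $ 1\<close>, and the tangent vectors of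
  the boundary curve differ by the same factor. What remains is a one-dimensional change of
  variables.\<close>

lemma length_charts_consistent:
  assumes c1: "surface_chart S W1 \<psi>1" and c2: "surface_chart S W2 \<psi>2"
    and B: "B \<in> sets borel" "B \<subseteq> (\<lambda>t. \<psi>1 (bpt t)) ` {t. bpt t \<in> W1}" "B \<subseteq> (\<lambda>t. \<psi>2 (bpt t)) ` {t. bpt t \<in> W2}"
  shows "emeasure (pushed_density {t. bpt t \<in> W1} (\<lambda>t. norm (partial_deriv \<psi>1 1 (bpt t))) (\<lambda>t. \<psi>1 (bpt t))) B =
    emeasure (pushed_density {t. bpt t \<in> W2} (\<lambda>t. norm (partial_deriv \<psi>2 1 (bpt t))) (\<lambda>t. \<psi>2 (bpt t))) B"
proof -
  interpret A: surface_chart S W1 \<psi>1 by fact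
  interpret B: surface_chart S W2 \<psi>2 by fact
  let ?A1 = "{t \<in> A.BD. \<psi>1 (bpt t) \<in> B}" and ?A2 = "{t \<in> B.BD. \<psi>2 (bpt t) \<in> B}"
  let ?h = "\<lambda>y. B.inv_chart (\<psi>1 y)"
  let ?g = "\<lambda>t. ?h (bpt t) $ 1"
  have Hd: "bpt t \<in> A.HD" if "t \<in> A.BD" for t using that bpt_half_plane by simp
  have Hd2: "bpt t \<in> B.HD" if "t \<in> B.BD" for t using that bpt_half_plane by simp
  have g2: "?h (bpt t) = bpt (?g t)" "?g t \<in> B.BD" "\<psi>2 (bpt (?g t)) = \<psi>1 (bpt t)" if t: "t \<in> ?A1" for t
  proof -
    obtain s where s: "s \<in> B.BD" "\<psi>1 (bpt t) = \<psi>2 (bpt s)" using t B(3) by auto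
    then have "?h (bpt t) = bpt s" using Hd2 by simp
    then show "?h (bpt t) = bpt (?g t)" "?g t \<in> B.BD" "\<psi>2 (bpt (?g t)) = \<psi>1 (bpt t)" using s by auto
  qed
  have ex: "\<exists>M. (\<forall>v. A.d\<psi> (bpt t) v = B.d\<psi> (bpt (?g t)) (M *v v)) \<and> (?h has_derivative (\<lambda>v. M *v v)) (at (bpt t) within A.HD)"
    if t: "t \<in> ?A1" for t
    by (rule transition_exists[OF c1 c2 Hd Hd2[OF g2(2)[OF t]] g2(3)[OF t, symmetric]]) (use t in simp)
  define M where "M t = (SOME M. (\<forall>v. A.d\<psi> (bpt t) v = B.d\<psi> (bpt (?g t)) (M *v v)) \<and> (?h has_derivative (\<lambda>v. M *v v)) (at (bpt t) within A.HD))" for t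
  have M: "A.d\<psi> (bpt t) v = B.d\<psi> (bpt (?g t)) (M t *v v)" "(?h has_derivative (\<lambda>v. M t *v v)) (at (bpt t) within A.HD)"
    if t: "t \<in> ?A1" for t v
    using someI_ex[OF ex[OF t]] unfolding M_def by blast+
  have M21: "M t $ 2 $ 1 = 0" if t: "t \<in> ?A1" for t
    by (rule boundary_transition(3)[OF c1 c2 Hd Hd2[OF g2(2)[OF t]] g2(3)[OF t, symmetric] M[OF t]])
      (use t in auto)
  have der: "(?g has_field_derivative M t $ 1 $ 1) (at t within A.BD)" if t: "t \<in> ?A1" for t
  proof -
    have "(bpt has_derivative (\<lambda>s. s *\<^sub>R axis 1 1)) (at t within A.BD)"
      unfolding bpt_eq by (auto intro!: derivative_eq_intros)
    moreover have "(?h has_derivative (\<lambda>v. M t *v v)) (at (bpt t) within bpt ` A.BD)"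
      by (rule has_derivative_subset[OF M(2)[OF t]]) (use Hd in auto)
    ultimately have "((\<lambda>t. ?h (bpt t)) has_derivative (\<lambda>s. M t *v (s *\<^sub>R axis 1 1))) (at t within A.BD)"
      by (rule has_derivative_in_compose)
    from has_derivative_inner_left[OF this, of "axis 1 1"]
    have "(?g has_derivative (\<lambda>s. (M t *v (s *\<^sub>R axis 1 1)) $ 1)) (at t within A.BD)"
      by (simp add: inner_axis)
    then show ?thesis unfolding has_field_derivative_def
      by (rule has_derivative_eq_rhs) (simp add: fun_eq_iff matrix_vector2 axis_def)
  qed
  have im: "?g ` ?A1 = ?A2"
  proof
    show "?g ` ?A1 \<subseteq> ?A2" using g2 by auto
    show "?A2 \<subseteq> ?g ` ?A1"
    proof
      fix z assume z: "z \<in> ?A2"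
      then obtain t where t: "t \<in> A.BD" "\<psi>1 (bpt t) = \<psi>2 (bpt z)" using B(2) by force
      then have "t \<in> ?A1" "?g t = z" using z Hd2[of z] by auto
      then show "z \<in> ?g ` ?A1" by blast
    qed
  qed
  have inj: "inj_on ?g ?A1"
  proof (rule inj_onI)
    fix a b assume ab: "a \<in> ?A1" "b \<in> ?A1" "?g a = ?g b"
    have "\<psi>1 (bpt a) = \<psi>1 (bpt b)" by (rule trans[OF g2(3)[OF ab(1), symmetric]]) (simp only: ab(3) g2(3)[OF ab(2)])
    then have "bpt a = bpt b" by (rule inj_onD[OF A.inj_on_chart]) (use Hd ab in simp_all)
    then show "a = b" by (metis vector_2(1))
  qed
  have J: "norm (A.E 1 (bpt t)) = \<bar>M t $ 1 $ 1\<bar> * norm (B.E 1 (bpt (?g t)))" if t: "t \<in> ?A1" for t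
  proof -
    have W: "bpt t \<in> W1" "bpt (?g t) \<in> W2" using t g2[OF t] by auto
    have "A.E 1 (bpt t) = M t $ 1 $ 1 *\<^sub>R B.E 1 (bpt (?g t))"
      using M(1)[OF t, of "axis 1 1"] M21[OF t]
      by (simp add: A.d_axis[OF W(1)] B.d_eq[OF W(2)] matrix_vector_mult_basis column_def)
    then show ?thesis by simp
  qed
  show ?thesis
  proof (rule pushed_density_eqI[OF A.length_chart_facts B.length_chart_facts B(1)])
    fix r
    let ?J1 = "\<lambda>t. norm (A.E 1 (bpt t))" and ?J2 = "\<lambda>t. norm (B.E 1 (bpt t))"
    have A1b: "?A1 \<in> sets borel" using borel_preimage_in[OF A.length_chart_facts B(1)] .
    have conv: "(F has_integral r) T \<longleftrightarrow> F absolutely_integrable_on T \<and> integral T F = r"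
      if "\<And>x. x \<in> T \<Longrightarrow> F x \<ge> 0" for F :: "real \<Rightarrow> real" and T
      using absolutely_integrable_on_iff_nonneg[of T F] that by (simp add: has_integral_iff)
    have "(?J1 has_integral r) ?A1 \<longleftrightarrow> ((\<lambda>t. \<bar>M t $ 1 $ 1\<bar> * ?J2 (?g t)) has_integral r) ?A1"
      by (rule has_integral_cong) (rule J)
    also have "\<dots> \<longleftrightarrow> (\<lambda>t. \<bar>M t $ 1 $ 1\<bar> * ?J2 (?g t)) absolutely_integrable_on ?A1 \<and> integral ?A1 (\<lambda>t. \<bar>M t $ 1 $ 1\<bar> * ?J2 (?g t)) = r"
      by (rule conv) simp
    also have "\<dots> \<longleftrightarrow> ?J2 absolutely_integrable_on (?g ` ?A1) \<and> integral (?g ` ?A1) ?J2 = r"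
    proof (rule has_absolute_integral_change_of_variables_1')
      show "?A1 \<in> sets lebesgue" using A1b by auto
      show "(?g has_field_derivative M t $ 1 $ 1) (at t within ?A1)" if "t \<in> ?A1" for t
        by (rule has_field_derivative_subset[OF der[OF that]]) auto
    qed (rule inj)
    also have "\<dots> \<longleftrightarrow> (?J2 has_integral r) ?A2" unfolding im by (rule conv[symmetric]) simp
    finally show "(?J1 has_integral r) ?A1 \<longleftrightarrow> (?J2 has_integral r) ?A2" .
  qed
qed

text \<open>A boundary parameter in one chart is one in every chart, by
  \<open>boundary_transition\<close>. The boundary can therefore be read off in any atlas.\<close>

lemma surface_boundary_chart_iff:
  assumes c: "surface_chart S W \<psi>" and y: "y \<in> W \<inter> half_plane"
  shows "\<psi> y \<in> surface_boundary S \<longleftrightarrow> y $ 2 = 0"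
proof
  assume "y $ 2 = 0" then show "\<psi> y \<in> surface_boundary S"
    using c y unfolding surface_boundary_def surface_chart_def by blast
next
  assume "\<psi> y \<in> surface_boundary S"
  then obtain W' \<psi>' y' where h: "local_param S W' \<psi>'" "y' \<in> W'" "y' $ 2 = 0" "\<psi> y = \<psi>' y'"
    unfolding surface_boundary_def by blast
  then have c': "surface_chart S W' \<psi>'" and y': "y' \<in> W' \<inter> half_plane" by (auto simp: surface_chart_def half_plane_def)
  obtain M where "\<And>v. frechet_derivative \<psi> (at y) v = frechet_derivative \<psi>' (at y') (M *v v)"
    "((\<lambda>z. surface_chart.inv_chart W' \<psi>' (\<psi> z)) has_derivative (\<lambda>v. M *v v)) (at y within W \<inter> half_plane)"
    using transition_exists[OF c c' y y' h(4)] by blast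
  from boundary_transition(2)[OF c c' y y' h(4) this h(3)] show "y $ 2 = 0" .
qed

lemma local_param_restrict:
  assumes p: "local_param S W \<psi>" and W': "open W'" "W' \<subseteq> W"
  shows "local_param S W' \<psi>"
proof -
  interpret surface_chart S W \<psi> using p by (simp add: surface_chart_def)
  have sub: "W' \<inter> half_plane \<subseteq> HD" using W' by auto
  have sm: "smooth_on W' \<psi>"
  proof -
    have "Ck_on k W f \<Longrightarrow> Ck_on k W' f" for k and f :: "real^2 \<Rightarrow> real^3"
      by (induction k arbitrary: f) (use W'(2) in \<open>auto intro: continuous_on_subset\<close>)
    then show ?thesis using smooth unfolding smooth_on_def by blast
  qed
  have eq: "\<psi> ` (W' \<inter> half_plane) = \<psi> ` HD \<inter> inv_chart -` W'"
    using sub by auto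
  have "openin (top_of_set (\<psi> ` HD)) (\<psi> ` (W' \<inter> half_plane))"
    unfolding eq by (rule continuous_openin_preimage_gen[OF continuous_inv W'(1)])
  then have op: "openin (top_of_set S) (\<psi> ` (W' \<inter> half_plane))"
    using openin_image openin_trans by blast
  have "homeomorphism (W' \<inter> half_plane) (\<psi> ` (W' \<inter> half_plane)) \<psi> inv_chart"
    by (rule homeomorphismI)
      (use continuous_on_subset[OF continuous_chart sub] continuous_on_subset[OF continuous_inv image_mono[OF sub]] sub in auto)
  then show ?thesis unfolding local_param_def using W' sm op inj_d by blast
qed

lemma pushed_density_finite:
  fixes D :: "'a::euclidean_space set" and f :: "'a \<Rightarrow> 'b::euclidean_space"
  assumes D: "D \<in> sets borel" "continuous_on D J" "\<And>y. y \<in> D \<Longrightarrow> J y \<ge> 0" "continuous_on D f"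
    and b: "bounded D" "\<And>y. y \<in> D \<Longrightarrow> J y \<le> K"
  shows "emeasure (pushed_density D J f) UNIV < \<infinity>"
proof -
  have "emeasure (pushed_density D J f) UNIV \<le> (\<integral>\<^sup>+y. ennreal K * indicator D y \<partial>lborel)"
    unfolding emeasure_pushed_density[OF D, of UNIV, simplified]
    by (intro nn_integral_mono) (use b(2) in \<open>auto simp: indicator_def intro: ennreal_leI\<close>)
  also have "\<dots> = ennreal K * emeasure lborel D" using D(1) by (subst nn_integral_cmult_indicator) auto
  also have "\<dots> < \<infinity>" using emeasure_bounded_finite[OF b(1)] by (simp add: ennreal_mult_less_top)
  finally show ?thesis .
qed

context surface_chart
begin

text \<open>On a closed ball inside W the area and length elements are bounded by compactness, so
  the smaller chart carries finite measures.\<close>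

lemma small_chart:
  assumes "y \<in> W" obtains r where "r > 0" "ball y r \<subseteq> W"
    "emeasure (pushed_density (ball y r \<inter> half_plane) (\<lambda>y. Ja y) \<psi>) UNIV < \<infinity>"
    "emeasure (pushed_density {t. bpt t \<in> ball y r} (\<lambda>t. norm (E 1 (bpt t))) (\<lambda>t. \<psi> (bpt t))) UNIV < \<infinity>"
proof -
  obtain r where r: "r > 0" "cball y r \<subseteq> W" using open_W assms open_contains_cball by blast
  have sub: "ball y r \<subseteq> W" using r by force
  have cp: "local_param S (ball y r) \<psi>" by (rule local_param_restrict[OF param]) (use sub in auto)
  interpret B: surface_chart S "ball y r" \<psi> using cp by (simp add: surface_chart_def)
  have "compact ((\<lambda>z. Ja z) ` cball y r)" "compact ((\<lambda>y. norm (E 1 y)) ` cball y r)"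
    by (intro compact_continuous_image continuous_on_norm continuous_on_subset[OF continuous_EE r(2)]
        continuous_on_subset[OF continuous_E r(2)] compact_cball)+
  then obtain K1 K2 where "\<forall>x\<in>(\<lambda>z. Ja z) ` cball y r. norm x \<le> K1" "\<forall>x\<in>(\<lambda>y. norm (E 1 y)) ` cball y r. norm x \<le> K2"
    unfolding compact_eq_bounded_closed bounded_iff by meson
  then have K1: "\<And>z. z \<in> cball y r \<Longrightarrow> Ja z \<le> K1" and K2: "\<And>z. z \<in> cball y r \<Longrightarrow> norm (E 1 z) \<le> K2"
    by auto
  show ?thesis
  proof (rule that[OF r(1) sub])
    show "emeasure B.area_chart UNIV < \<infinity>"
      by (rule pushed_density_finite[OF B.area_chart_facts, where K = K1])
        (use K1 in \<open>auto intro: bounded_subset[OF bounded_ball]\<close>)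
    have "B.BD \<subseteq> cball (y $ 1) r"
    proof
      fix t assume "t \<in> B.BD"
      then have "norm (y - bpt t) < r" by (simp add: dist_norm)
      moreover have "\<bar>(y - bpt t) $ 1\<bar> \<le> norm (y - bpt t)" by (rule component_le_norm_cart)
      ultimately show "t \<in> cball (y $ 1) r" by (simp add: dist_real_def)
    qed
    then show "emeasure B.length_chart UNIV < \<infinity>"
      by (intro pushed_density_finite[OF B.length_chart_facts, where K = K2])
        (use K2 in \<open>auto intro: bounded_subset[OF bounded_cball]\<close>)
  qed
qed

lemma interior_point_near:
  assumes "y \<in> HD" "e > 0" obtains z where "z \<in> HD" "z $ 2 > 0" "dist z y < e"
proof -
  obtain d where d: "d > 0" "\<And>t. 0 \<le> t \<Longrightarrow> t < d \<Longrightarrow> y + t *\<^sub>R axis 2 1 \<in> HD"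
    by (rule dom_line[OF assms(1), of "axis 2 1"]) auto
  let ?t = "min d e / 2"
  have n: "norm (axis 2 1 :: real^2) = 1" by (simp add: norm_eq_1 inner_axis_axis)
  show ?thesis
    by (rule that[of "y + ?t *\<^sub>R axis 2 1"])
      (use d assms in \<open>auto simp: half_plane_def dist_norm add_nonneg_pos n\<close>)
qed

text \<open>Moving from y into the open half plane gives an open set of parameters even when y lies
  on the edge. Open sets can be differentiated on and have positive Lebesgue measure.\<close>

lemma HD_positive_on_open:
  fixes F :: "real^2 \<Rightarrow> real"
  assumes y: "y \<in> HD" and c: "continuous_on HD F" and F: "F y > 0"
  obtains U where "open U" "U \<noteq> {}" "U \<subseteq> HD" "\<And>z. z \<in> U \<Longrightarrow> F z > 0"
proof -
  obtain e where e: "e > 0" "\<And>z. z \<in> HD \<Longrightarrow> dist z y < e \<Longrightarrow> dist (F z) (F y) < F y"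
    using c y F unfolding continuous_on_iff by blast
  obtain z where z: "z \<in> HD" "z $ 2 > 0" "dist z y < e" using interior_point_near[OF y e(1)] by metis
  let ?U = "W \<inter> {z. z $ 2 > 0} \<inter> ball y e"
  show ?thesis
  proof (rule that[of ?U])
    have "open {z::real^2. z $ 2 > 0}" by (intro open_Collect_less continuous_intros)
    then show "open ?U" using open_W by auto
    show "?U \<noteq> {}" using z by (auto simp: dist_commute)
    show "?U \<subseteq> HD" by (auto simp: half_plane_def)
    fix w assume w: "w \<in> ?U"
    then have "dist (F w) (F y) < F y" by (intro e(2)) (auto simp: half_plane_def dist_commute)
    then show "F w > 0" by (simp add: dist_real_def)
  qed
qed

section \<open>Gradients of functions on the surface\<close>

lemma surface_gradient_eqI:
  assumes y: "y \<in> HD" and v: "v \<bullet> N y = 0"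
    and d: "((\<lambda>z. u (\<psi> z)) has_derivative (\<lambda>h. v \<bullet> d\<psi> y h)) (at y within HD)"
  shows "surface_gradient S u (\<psi> y) = v"
  unfolding surface_gradient_def
proof (rule the_equality)
  have yW: "y \<in> W" using y by simp
  have "(u has_derivative (\<lambda>w. v \<bullet> w)) (at (\<psi> y) within S)"
    by (rule has_derivative_within_surface[OF y _ d]) (rule bounded_linear_inner_right)
  then show "v \<in> tangent_plane S (\<psi> y) \<and> (u has_derivative (\<bullet>) v) (at (\<psi> y) within S)"
    using v tangent_plane_chart[OF y] by simp
  fix v' assume h: "v' \<in> tangent_plane S (\<psi> y) \<and> (u has_derivative (\<bullet>) v') (at (\<psi> y) within S)"
  then have t: "v' \<bullet> N y = 0" using tangent_plane_chart[OF y] by simp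
  have "((\<lambda>z. u (\<psi> z)) has_derivative (\<lambda>h. v' \<bullet> d\<psi> y h)) (at y within HD)"
    by (rule has_derivative_compose_chart[OF y]) (use h in simp)
  from has_derivative_dom_unique[OF y this d] have e: "v' \<bullet> d\<psi> y h = v \<bullet> d\<psi> y h" for h by metis
  have "(v' - v) \<bullet> E i y = 0" for i using e[of "axis i 1"] by (simp add: d_axis[OF yW] inner_diff_left)
  then have "v' - v = 0" using eq_zero_if_orthogonal[OF yW, of "v' - v"] t v by (simp add: inner_diff_left)
  then show "v' = v" by simp
qed

definition tan_proj :: "real^2 \<Rightarrow> real^3 \<Rightarrow> real^3" where
  "tan_proj y w = w - (w \<bullet> N y) *\<^sub>R N y"

lemma tan_proj_N: "y \<in> W \<Longrightarrow> tan_proj y w \<bullet> N y = 0"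
  by (simp add: tan_proj_def inner_diff_left N_N)

lemma tan_proj_d: "y \<in> W \<Longrightarrow> tan_proj y w \<bullet> d\<psi> y h = w \<bullet> d\<psi> y h"
  by (simp add: tan_proj_def inner_diff_left d_eq inner_add_right N_E)

lemma tan_proj_inner: "y \<in> W \<Longrightarrow> tan_proj y w \<bullet> tan_proj y v = w \<bullet> v - (w \<bullet> N y) * (v \<bullet> N y)"
  using N_N[of y] by (simp add: tan_proj_def inner_diff_left inner_diff_right inner_commute algebra_simps)

text \<open>Pairing with tangent vectors does not see the normal component of the ambient gradient
  w, so its tangential projection represents the derivative along S.\<close>

lemma surface_gradient_ambient:
  assumes y: "y \<in> HD" and U: "open U" "\<psi> y \<in> U" and F: "(F has_derivative (\<lambda>h. w \<bullet> h)) (at (\<psi> y))"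
    and eq: "\<And>x. x \<in> U \<inter> S \<Longrightarrow> F x = u x"
  shows "surface_gradient S u (\<psi> y) = tan_proj y w"
    "((\<lambda>z. u (\<psi> z)) has_derivative (\<lambda>h. w \<bullet> d\<psi> y h)) (at y within HD)"
proof -
  have yW: "y \<in> W" using y by simp
  obtain e where e: "e > 0" "ball (\<psi> y) e \<subseteq> U" using U openE by blast
  obtain d where d: "d > 0" "\<And>z. z \<in> HD \<Longrightarrow> dist z y < d \<Longrightarrow> dist (\<psi> z) (\<psi> y) < e"
    using continuous_chart y e(1) unfolding continuous_on_iff by blast
  have "((\<lambda>z. F (\<psi> z)) has_derivative (\<lambda>h. w \<bullet> d\<psi> y h)) (at y within HD)"
    by (rule has_derivative_at_withinI[OF has_derivative_compose[OF has_derivative_chart[OF yW] F]])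
  then show 1: "((\<lambda>z. u (\<psi> z)) has_derivative (\<lambda>h. w \<bullet> d\<psi> y h)) (at y within HD)"
  proof (rule has_derivative_transform_within[OF _ d(1) y])
    fix z assume "z \<in> HD" "dist z y < d"
    then show "F (\<psi> z) = u (\<psi> z)" using d(2)[of z] e(2) chart_in[of z] by (intro eq) (auto simp: dist_commute)
  qed
  show "surface_gradient S u (\<psi> y) = tan_proj y w"
    by (rule surface_gradient_eqI[OF y tan_proj_N[OF yW]]) (use 1 tan_proj_d[OF yW] in simp)
qed

end

lemma smooth_on_gradient:
  fixes F :: "real^3 \<Rightarrow> real"
  assumes "smooth_on U F"
  obtains w where "continuous_on U w" "\<And>x. x \<in> U \<Longrightarrow> (F has_derivative (\<lambda>h. w x \<bullet> h)) (at x)"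
proof (rule that)
  let ?w = "\<lambda>x. \<Sum>b\<in>Basis. frechet_derivative F (at x) b *\<^sub>R b"
  show "continuous_on U ?w"
    by (intro continuous_on_sum continuous_on_scaleR continuous_on_const
        smooth_on_imp_continuous_on[OF smooth_on_frechet_derivative[OF assms]])
  fix x assume x: "x \<in> U"
  have d: "(F has_derivative frechet_derivative F (at x)) (at x)" by (rule smooth_on_has_derivative[OF assms x])
  have l: "linear (frechet_derivative F (at x))" using d has_derivative_linear by blast
  have "frechet_derivative F (at x) h = ?w x \<bullet> h" for h
  proof -
    have "frechet_derivative F (at x) h = (\<Sum>b\<in>Basis. (h \<bullet> b) *\<^sub>R frechet_derivative F (at x) b)"
      by (subst (1) euclidean_representation[of h, symmetric]) (simp only: linear_sum[OF l] linear_scale[OF l])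
    also have "\<dots> = ?w x \<bullet> h" by (simp add: inner_sum_right inner_commute mult.commute)
    finally show ?thesis .
  qed
  then show "(F has_derivative (\<lambda>h. ?w x \<bullet> h)) (at x)" using d by (metis (no_types, lifting) ext)
qed

text \<open>Around each point a local smooth extension computes the gradient as a projection.
  Continuity is checked point by point, because the extension changes from one point to
  another.\<close>

lemma (in surface_chart) smooth_function_chart:
  assumes u: "u \<in> smooth_functions S"
  shows "continuous_on HD (\<lambda>y. surface_gradient S u (\<psi> y))"
    "continuous_on HD (\<lambda>y. u (\<psi> y))"
    "\<And>y. y \<in> HD \<Longrightarrow> surface_gradient S u (\<psi> y) \<bullet> N y = 0"
    "\<And>y. y \<in> HD \<Longrightarrow> ((\<lambda>z. u (\<psi> z)) has_derivative (\<lambda>h. surface_gradient S u (\<psi> y) \<bullet> d\<psi> y h)) (at y within HD)"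
proof -
  have loc: "\<exists>U F w. open U \<and> \<psi> y \<in> U \<and> (\<forall>x\<in>U. (F has_derivative (\<lambda>h. w x \<bullet> h)) (at x)) \<and> continuous_on U w \<and>
     (\<forall>x\<in>U \<inter> S. F x = u x)" if y: "y \<in> HD" for y
  proof -
    obtain U F where "open U" "\<psi> y \<in> U" "smooth_on U F" "\<forall>x\<in>U \<inter> S. F x = u x"
      using u chart_in[OF y] unfolding smooth_functions_def by blast
    then show ?thesis using smooth_on_gradient[of U F] by metis
  qed
  show 3: "surface_gradient S u (\<psi> y) \<bullet> N y = 0"
    and 4: "((\<lambda>z. u (\<psi> z)) has_derivative (\<lambda>h. surface_gradient S u (\<psi> y) \<bullet> d\<psi> y h)) (at y within HD)"
    if y: "y \<in> HD" for y
  proof -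
    have yW: "y \<in> W" using y by simp
    obtain U F w where "open U" "\<psi> y \<in> U" "\<forall>x\<in>U. (F has_derivative (\<lambda>h. w x \<bullet> h)) (at x)" "\<forall>x\<in>U \<inter> S. F x = u x"
      using loc[OF y] by blast
    then have g: "surface_gradient S u (\<psi> y) = tan_proj y (w (\<psi> y))"
      "((\<lambda>z. u (\<psi> z)) has_derivative (\<lambda>h. w (\<psi> y) \<bullet> d\<psi> y h)) (at y within HD)"
      using surface_gradient_ambient[OF y, of U F "w (\<psi> y)" u] by auto
    show "surface_gradient S u (\<psi> y) \<bullet> N y = 0" using g tan_proj_N[OF yW] by simp
    show "((\<lambda>z. u (\<psi> z)) has_derivative (\<lambda>h. surface_gradient S u (\<psi> y) \<bullet> d\<psi> y h)) (at y within HD)"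
      using g tan_proj_d[OF yW] by simp
  qed
  show "continuous_on HD (\<lambda>y. u (\<psi> y))"
    using 4 has_derivative_continuous continuous_on_eq_continuous_within by blast
  show "continuous_on HD (\<lambda>y. surface_gradient S u (\<psi> y))"
    unfolding continuous_on_eq_continuous_within
  proof
    fix y assume y: "y \<in> HD"
    obtain U F w where U: "open U" "\<psi> y \<in> U" "\<forall>x\<in>U. (F has_derivative (\<lambda>h. w x \<bullet> h)) (at x)" "continuous_on U w" "\<forall>x\<in>U \<inter> S. F x = u x"
      using loc[OF y] by blast
    obtain e where e: "e > 0" "ball (\<psi> y) e \<subseteq> U" using U openE by blast
    obtain d where d: "d > 0" "\<And>z. z \<in> HD \<Longrightarrow> dist z y < d \<Longrightarrow> dist (\<psi> z) (\<psi> y) < e"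
      using continuous_chart y e(1) unfolding continuous_on_iff by blast
    have c\<psi>: "continuous (at y within HD) \<psi>" using continuous_chart y continuous_on_eq_continuous_within by blast
    have cw: "continuous (at (\<psi> y)) w" using U continuous_on_eq_continuous_at by blast
    have cN: "continuous (at y within HD) N"
      using continuous_on_subset[OF continuous_N, of HD] y continuous_on_eq_continuous_within by blast
    have "continuous (at y within HD) (\<lambda>z. w (\<psi> z))"
      using continuous_within_compose3[OF cw c\<psi>] .
    then have "continuous (at y within HD) (\<lambda>z. tan_proj z (w (\<psi> z)))"
      unfolding tan_proj_def using cN by (intro continuous_intros)
    then show "continuous (at y within HD) (\<lambda>y. surface_gradient S u (\<psi> y))"
    proof (rule continuous_transform_within[OF _ d(1) y])
      fix z assume z: "z \<in> HD" "dist z y < d"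
      then have "\<psi> z \<in> U" using d(2)[of z] e(2) by (auto simp: dist_commute)
      then show "tan_proj z (w (\<psi> z)) = surface_gradient S u (\<psi> z)"
        using surface_gradient_ambient(1)[OF z(1) U(1), of F "w (\<psi> z)" u] U by auto
    qed
  qed
qed

section \<open>Integration on a compact surface\<close>

text \<open>Chart images are relatively open and inverse charts are continuous, so continuity may be
  tested in the parameters.\<close>

lemma continuous_on_surfaceI:
  fixes F :: "real^3 \<Rightarrow> 'b::real_normed_vector"
  assumes e: "embedded_surface S"
    and c: "\<And>W \<psi>. local_param S W \<psi> \<Longrightarrow> continuous_on (W \<inter> half_plane) (\<lambda>y. F (\<psi> y))"
  shows "continuous_on S F"
  unfolding continuous_on_eq_continuous_within
proof
  fix p assume "p \<in> S"
  then obtain W \<psi> where p: "local_param S W \<psi>" "p \<in> \<psi> ` (W \<inter> half_plane)" using e unfolding embedded_surface_def by blast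
  interpret surface_chart S W \<psi> using p by (simp add: surface_chart_def)
  have "continuous_on (\<psi> ` HD) (\<lambda>x. F (\<psi> (inv_chart x)))"
    by (rule continuous_on_compose2[OF c[OF p(1)] continuous_inv]) (use inv_chart_in in auto)
  then have "continuous_on (\<psi> ` HD) F" by (rule continuous_on_eq) (use inv_chart_in in auto)
  then have c1: "continuous (at p within \<psi> ` HD) F" using p(2) continuous_on_eq_continuous_within by blast
  obtain T where T: "open T" "\<psi> ` HD = S \<inter> T" using openin_image openin_open by blast
  have "at p within \<psi> ` HD = at p within S"
    by (rule at_within_nhd[of p T]) (use T p(2) in auto)
  then show "continuous (at p within S) F" using c1 by simp
qed

locale compact_surface =
  fixes S :: "(real^3) set"
  assumes compact_S: "compact S" and embedded_S: "embedded_surface S"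
begin

lemma closed_S: "closed S"
  by (rule compact_imp_closed[OF compact_S])

lemma S_borel: "S \<in> sets borel"
  using closed_S by simp

text \<open>Compactness leaves finitely many small charts of finite measure. The total area and the
  boundary length are finite for this reason.\<close>

lemma finite_atlas:
  obtains \<A> where "finite \<A>" "S = (\<Union>(W, \<psi>)\<in>\<A>. \<psi> ` (W \<inter> half_plane))"
    "\<And>W \<psi>. (W, \<psi>) \<in> \<A> \<Longrightarrow> local_param S W \<psi> \<and>
      emeasure (pushed_density (W \<inter> half_plane) (\<lambda>y. norm (surface_chart.EE \<psi> y)) \<psi>) UNIV < \<infinity> \<and>
      emeasure (pushed_density {t. bpt t \<in> W} (\<lambda>t. norm (partial_deriv \<psi> 1 (bpt t))) (\<lambda>t. \<psi> (bpt t))) UNIV < \<infinity>"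
proof -
  define P where "P = {(W, \<psi>). local_param S W \<psi> \<and>
      emeasure (pushed_density (W \<inter> half_plane) (\<lambda>y. norm (surface_chart.EE \<psi> y)) \<psi>) UNIV < \<infinity> \<and>
      emeasure (pushed_density {t. bpt t \<in> W} (\<lambda>t. norm (partial_deriv \<psi> 1 (bpt t))) (\<lambda>t. \<psi> (bpt t))) UNIV < \<infinity>}"
  define im where "im c = snd c ` (fst c \<inter> half_plane)" for c :: "(real^2) set \<times> (real^2 \<Rightarrow> real^3)"
  have cov: "S \<subseteq> \<Union> (im ` P)"
  proof
    fix p assume "p \<in> S"
    then obtain W \<psi> y where p: "local_param S W \<psi>" "y \<in> W \<inter> half_plane" "p = \<psi> y" using embedded_S unfolding embedded_surface_def by blast
    interpret surface_chart S W \<psi> using p by (simp add: surface_chart_def)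
    obtain r where r: "r > 0" "ball y r \<subseteq> W"
      "emeasure (pushed_density (ball y r \<inter> half_plane) (\<lambda>y. Ja y) \<psi>) UNIV < \<infinity>"
      "emeasure (pushed_density {t. bpt t \<in> ball y r} (\<lambda>t. norm (E 1 (bpt t))) (\<lambda>t. \<psi> (bpt t))) UNIV < \<infinity>"
      using small_chart[of y] p by blast
    have "(ball y r, \<psi>) \<in> P" using r local_param_restrict[OF p(1) open_ball r(2)] by (simp add: P_def)
    moreover have "p \<in> im (ball y r, \<psi>)" using p r by (auto simp: im_def)
    ultimately show "p \<in> \<Union> (im ` P)" by blast
  qed
  have op: "\<forall>c\<in>im ` P. openin (top_of_set S) c" by (auto simp: P_def im_def local_param_def)
  obtain D where D: "D \<subseteq> im ` P" "finite D" "S \<subseteq> \<Union>D"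
    using compact_S[unfolded compact_eq_openin_cover] op cov by metis
  obtain A where A: "A \<subseteq> P" "finite A" "D = im ` A" using finite_subset_image[OF D(2,1)] by blast
  have sub: "im c \<subseteq> S" if "c \<in> A" for c using op A that openin_imp_subset by blast
  show ?thesis
  proof (rule that[OF A(2)])
    show "S = (\<Union>(W, \<psi>)\<in>A. \<psi> ` (W \<inter> half_plane))" using D(3) A(3) sub by (force simp: im_def)
    show "local_param S W \<psi> \<and>
      emeasure (pushed_density (W \<inter> half_plane) (\<lambda>y. norm (surface_chart.EE \<psi> y)) \<psi>) UNIV < \<infinity> \<and>
      emeasure (pushed_density {t. bpt t \<in> W} (\<lambda>t. norm (partial_deriv \<psi> 1 (bpt t))) (\<lambda>t. \<psi> (bpt t))) UNIV < \<infinity>"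
      if "(W, \<psi>) \<in> A" for W \<psi> using that A(1) by (auto simp: P_def)
  qed
qed

text \<open>Justifies the description by \<open>THE\<close> in \<open>area_measure\<close>: the
  measures of all parametrizations are glued, with a finite atlas as the covering subfamily.\<close>

lemma area_measure_unique:
  "\<exists>!\<mu>. sets \<mu> = sets borel \<and> emeasure \<mu> (- S) = 0 \<and>
        (\<forall>W \<psi> B. local_param S W \<psi> \<longrightarrow> B \<in> sets borel \<longrightarrow> B \<subseteq> \<psi> ` (W \<inter> half_plane) \<longrightarrow>
           emeasure \<mu> B =
             (\<integral>\<^sup>+ y \<in> W \<inter> half_plane.
                indicator B (\<psi> y) *
                ennreal (norm (cross3 (partial_deriv \<psi> 1 y) (partial_deriv \<psi> 2 y))) \<partial>lborel))"
proof -
  obtain \<A> where A: "finite \<A>" "S = (\<Union>(W, \<psi>)\<in>\<A>. \<psi> ` (W \<inter> half_plane))" "\<And>W \<psi>. (W, \<psi>) \<in> \<A> \<Longrightarrow> local_param S W \<psi>"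
    using finite_atlas by metis
  define I where "I = {c. local_param S (fst c) (snd c)}"
  define X where "X c = snd c ` (fst c \<inter> half_plane)" for c :: "(real^2) set \<times> (real^2 \<Rightarrow> real^3)"
  define \<nu> where "\<nu> c = pushed_density (fst c \<inter> half_plane) (\<lambda>y. norm (surface_chart.EE (snd c) y)) (snd c)" for c :: "(real^2) set \<times> (real^2 \<Rightarrow> real^3)"
  have "\<exists>!\<mu>. sets \<mu> = sets borel \<and> emeasure \<mu> (- S) = 0 \<and>
    (\<forall>c\<in>I. \<forall>B. B \<in> sets borel \<longrightarrow> B \<subseteq> X c \<longrightarrow> emeasure \<mu> B = emeasure (\<nu> c) B)"
  proof (rule glue_measures[OF A(1)])
    show "\<A> \<subseteq> I" using A(3) by (auto simp: I_def)
    show "S = (\<Union>c\<in>\<A>. X c)" by (subst A(2)) (auto simp: X_def)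
    fix c assume c: "c \<in> I"
    then interpret surface_chart S "fst c" "snd c" by (simp add: I_def surface_chart_def)
    show "X c \<in> sets borel" unfolding X_def by (rule image_borel[OF closed_S])
    show "X c \<subseteq> S" unfolding X_def using chart_in by auto
    show "sets (\<nu> c) = sets borel" by (simp add: \<nu>_def sets_pushed_density)
  next
    fix c c' B assume h: "c \<in> I" "c' \<in> I" "B \<in> sets borel" "B \<subseteq> X c \<inter> X c'"
    show "emeasure (\<nu> c) B = emeasure (\<nu> c') B"
      unfolding \<nu>_def by (rule area_charts_consistent[of S]) (use h in \<open>auto simp: I_def surface_chart_def X_def\<close>)
  qed
  moreover have "(\<forall>c\<in>I. \<forall>B. B \<in> sets borel \<longrightarrow> B \<subseteq> X c \<longrightarrow> emeasure \<mu> B = emeasure (\<nu> c) B) \<longleftrightarrow>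
     (\<forall>W \<psi> B. local_param S W \<psi> \<longrightarrow> B \<in> sets borel \<longrightarrow> B \<subseteq> \<psi> ` (W \<inter> half_plane) \<longrightarrow>
           emeasure \<mu> B = (\<integral>\<^sup>+ y \<in> W \<inter> half_plane. indicator B (\<psi> y) *
                ennreal (norm (cross3 (partial_deriv \<psi> 1 y) (partial_deriv \<psi> 2 y))) \<partial>lborel))" for \<mu>
  proof -
    have "emeasure (\<nu> (W, \<psi>)) B = (\<integral>\<^sup>+ y \<in> W \<inter> half_plane. indicator B (\<psi> y) *
                ennreal (norm (cross3 (partial_deriv \<psi> 1 y) (partial_deriv \<psi> 2 y))) \<partial>lborel)"
      if "local_param S W \<psi>" "B \<in> sets borel" for W \<psi> B
    proof -
      interpret surface_chart S W \<psi> using that by (simp add: surface_chart_def)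
      show ?thesis unfolding \<nu>_def using pushed_density_set_integral[OF area_chart_facts that(2)] by (simp add: EE_def)
    qed
    then show ?thesis by (simp add: I_def X_def)
  qed
  ultimately show ?thesis by simp
qed

text \<open>The two claims are proved together because gluing the length measures requires the
  boundary to be the union of the edges of a finite atlas.\<close>

lemma boundary_length_measure_unique:
  "\<exists>!\<mu>. sets \<mu> = sets borel \<and> emeasure \<mu> (- surface_boundary S) = 0 \<and>
        (\<forall>W \<psi> B. local_param S W \<psi> \<longrightarrow> B \<in> sets borel \<longrightarrow> B \<subseteq> \<psi> ` (W \<inter> {y. y $ 2 = 0}) \<longrightarrow>
           emeasure \<mu> B =
             (\<integral>\<^sup>+ t \<in> {t. vector [t, 0] \<in> W}.
                indicator B (\<psi> (vector [t, 0])) *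
                ennreal (norm (partial_deriv \<psi> 1 (vector [t, 0]))) \<partial>lborel))"
  and boundary_union: "finite \<A> \<Longrightarrow> S = (\<Union>(W, \<psi>)\<in>\<A>. \<psi> ` (W \<inter> half_plane)) \<Longrightarrow> (\<And>W \<psi>. (W, \<psi>) \<in> \<A> \<Longrightarrow> local_param S W \<psi>)
    \<Longrightarrow> surface_boundary S = (\<Union>(W, \<psi>)\<in>\<A>. (\<lambda>t. \<psi> (bpt t)) ` {t. bpt t \<in> W})"
proof -
  have sb: "surface_boundary S \<subseteq> S"
  proof
    fix p assume "p \<in> surface_boundary S"
    then obtain W \<psi> y where h: "local_param S W \<psi>" "y \<in> W" "y $ 2 = 0" "p = \<psi> y"
      unfolding surface_boundary_def by blast
    interpret surface_chart S W \<psi> using h by (simp add: surface_chart_def)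
    show "p \<in> S" using chart_in[of y] h by (simp add: half_plane_def)
  qed
  show bu: "surface_boundary S = (\<Union>(W, \<psi>)\<in>\<A>. (\<lambda>t. \<psi> (bpt t)) ` {t. bpt t \<in> W})"
    if A: "S = (\<Union>(W, \<psi>)\<in>\<A>. \<psi> ` (W \<inter> half_plane))" "\<And>W \<psi>. (W, \<psi>) \<in> \<A> \<Longrightarrow> local_param S W \<psi>" for \<A>
  proof
    show "surface_boundary S \<subseteq> (\<Union>(W, \<psi>)\<in>\<A>. (\<lambda>t. \<psi> (bpt t)) ` {t. bpt t \<in> W})"
    proof
      fix p assume p: "p \<in> surface_boundary S"
      then have "p \<in> S" using sb by auto
      then obtain W \<psi> y where h: "(W, \<psi>) \<in> \<A>" "y \<in> W \<inter> half_plane" "p = \<psi> y" by (subst (asm) A(1)) auto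
      then have "y $ 2 = 0" using surface_boundary_chart_iff[of S W \<psi> y] p A(2) by (simp add: surface_chart_def)
      then have "p = \<psi> (bpt (y $ 1))" "bpt (y $ 1) \<in> W" using h bpt_of[of y] by auto
      then show "p \<in> (\<Union>(W, \<psi>)\<in>\<A>. (\<lambda>t. \<psi> (bpt t)) ` {t. bpt t \<in> W})" using h by blast
    qed
    show "(\<Union>(W, \<psi>)\<in>\<A>. (\<lambda>t. \<psi> (bpt t)) ` {t. bpt t \<in> W}) \<subseteq> surface_boundary S"
      using A(2) unfolding surface_boundary_def by force
  qed
  obtain \<A> where A: "finite \<A>" "S = (\<Union>(W, \<psi>)\<in>\<A>. \<psi> ` (W \<inter> half_plane))" "\<And>W \<psi>. (W, \<psi>) \<in> \<A> \<Longrightarrow> local_param S W \<psi>"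
    using finite_atlas by metis
  define I where "I = {c. local_param S (fst c) (snd c)}"
  define X where "X c = (\<lambda>t. snd c (bpt t)) ` {t. bpt t \<in> fst c}" for c :: "(real^2) set \<times> (real^2 \<Rightarrow> real^3)"
  define \<nu> where "\<nu> c = pushed_density {t. bpt t \<in> fst c} (\<lambda>t. norm (partial_deriv (snd c) 1 (bpt t))) (\<lambda>t. snd c (bpt t))" for c :: "(real^2) set \<times> (real^2 \<Rightarrow> real^3)"
  have "\<exists>!\<mu>. sets \<mu> = sets borel \<and> emeasure \<mu> (- surface_boundary S) = 0 \<and>
    (\<forall>c\<in>I. \<forall>B. B \<in> sets borel \<longrightarrow> B \<subseteq> X c \<longrightarrow> emeasure \<mu> B = emeasure (\<nu> c) B)"
  proof (rule glue_measures[OF A(1)])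
    show "\<A> \<subseteq> I" using A(3) by (auto simp: I_def)
    show "surface_boundary S = (\<Union>c\<in>\<A>. X c)" by (subst bu[OF A(2,3)]) (auto simp: X_def)
    fix c assume c: "c \<in> I"
    then interpret surface_chart S "fst c" "snd c" by (simp add: I_def surface_chart_def)
    show "X c \<in> sets borel" unfolding X_def by (rule boundary_image_borel[OF closed_S])
    show "X c \<subseteq> surface_boundary S" unfolding X_def surface_boundary_def using param by force
    show "sets (\<nu> c) = sets borel" by (simp add: \<nu>_def sets_pushed_density)
  next
    fix c c' B assume h: "c \<in> I" "c' \<in> I" "B \<in> sets borel" "B \<subseteq> X c \<inter> X c'"
    show "emeasure (\<nu> c) B = emeasure (\<nu> c') B"
      unfolding \<nu>_def by (rule length_charts_consistent[of S]) (use h in \<open>auto simp: I_def surface_chart_def X_def\<close>)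
  qed
  moreover have "(\<forall>c\<in>I. \<forall>B. B \<in> sets borel \<longrightarrow> B \<subseteq> X c \<longrightarrow> emeasure \<mu> B = emeasure (\<nu> c) B) \<longleftrightarrow>
     (\<forall>W \<psi> B. local_param S W \<psi> \<longrightarrow> B \<in> sets borel \<longrightarrow> B \<subseteq> \<psi> ` (W \<inter> {y. y $ 2 = 0}) \<longrightarrow>
           emeasure \<mu> B = (\<integral>\<^sup>+ t \<in> {t. vector [t, 0] \<in> W}. indicator B (\<psi> (vector [t, 0])) *
                ennreal (norm (partial_deriv \<psi> 1 (vector [t, 0]))) \<partial>lborel))" for \<mu>
  proof -
    have "emeasure (\<nu> (W, \<psi>)) B = (\<integral>\<^sup>+ t \<in> {t. vector [t, 0] \<in> W}. indicator B (\<psi> (vector [t, 0])) *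
                ennreal (norm (partial_deriv \<psi> 1 (vector [t, 0]))) \<partial>lborel)"
       and "\<psi> ` (W \<inter> {y. y $ 2 = 0}) = X (W, \<psi>)"
      if "local_param S W \<psi>" "B \<in> sets borel" for W \<psi> B
    proof -
      interpret surface_chart S W \<psi> using that by (simp add: surface_chart_def)
      show "emeasure (\<nu> (W, \<psi>)) B = (\<integral>\<^sup>+ t \<in> {t. vector [t, 0] \<in> W}. indicator B (\<psi> (vector [t, 0])) *
                ennreal (norm (partial_deriv \<psi> 1 (vector [t, 0]))) \<partial>lborel)"
        unfolding \<nu>_def using pushed_density_set_integral[OF length_chart_facts that(2)] by simp
      show "\<psi> ` (W \<inter> {y. y $ 2 = 0}) = X (W, \<psi>)" by (simp add: X_def boundary_image)
    qed
    then show ?thesis unfolding I_def by (simp cong: conj_cong imp_cong)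
  qed
  ultimately show "\<exists>!\<mu>. sets \<mu> = sets borel \<and> emeasure \<mu> (- surface_boundary S) = 0 \<and>
        (\<forall>W \<psi> B. local_param S W \<psi> \<longrightarrow> B \<in> sets borel \<longrightarrow> B \<subseteq> \<psi> ` (W \<inter> {y. y $ 2 = 0}) \<longrightarrow>
           emeasure \<mu> B =
             (\<integral>\<^sup>+ t \<in> {t. vector [t, 0] \<in> W}.
                indicator B (\<psi> (vector [t, 0])) *
                ennreal (norm (partial_deriv \<psi> 1 (vector [t, 0]))) \<partial>lborel))" by simp
qed

end

text \<open>The two measures are known to agree only on Borel subsets of X, so both integrals are
  moved to \<open>restrict_space\<close>; this changes nothing, as g vanishes almost everywhere
  outside X.\<close>

lemma integral_eq_pushed_density:
  fixes D :: "'a::euclidean_space set" and f :: "'a \<Rightarrow> 'b::euclidean_space" and g :: "'b \<Rightarrow> real"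
  assumes D: "D \<in> sets borel" "continuous_on D J" "\<And>y. y \<in> D \<Longrightarrow> J y \<ge> 0" "continuous_on D f"
    and M: "sets M = sets borel" and X: "X \<in> sets borel" "f ` D \<subseteq> X"
    and eq: "\<And>B. B \<in> sets borel \<Longrightarrow> B \<subseteq> X \<Longrightarrow> emeasure M B = emeasure (pushed_density D J f) B"
    and g: "g \<in> borel_measurable borel" "AE x in M. x \<notin> X \<longrightarrow> g x = 0"
  shows "integral\<^sup>L M g = (\<integral>y. (if y \<in> D then J y * g (f y) else 0) \<partial>lborel)"
proof -
  let ?P = "pushed_density D J f"
  have sp: "space M = UNIV" using sets_eq_imp_space_eq[OF M] by simp
  have mg: "g \<in> borel_measurable M" using g(1) M measurable_cong_sets by blast
  have rs: "restrict_space M X = restrict_space ?P X"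
  proof (rule measure_eqI)
    show "sets (restrict_space M X) = sets (restrict_space ?P X)"
      by (simp add: sets_restrict_space M sets_pushed_density)
    fix B assume "B \<in> sets (restrict_space M X)"
    then have B: "B \<in> sets borel" "B \<subseteq> X" using X(1) by (auto simp: sets_restrict_space M)
    have "emeasure (restrict_space M X) B = emeasure M B"
      by (rule emeasure_restrict_space) (use X B M sp in auto)
    also have "\<dots> = emeasure ?P B" by (rule eq[OF B])
    also have "\<dots> = emeasure (restrict_space ?P X) B"
      by (rule emeasure_restrict_space[symmetric]) (use X B in \<open>auto simp: sets_pushed_density pushed_density_def\<close>)
    finally show "emeasure (restrict_space M X) B = emeasure (restrict_space ?P X) B" .
  qed
  have mi: "(\<lambda>x. indicator X x *\<^sub>R g x) \<in> borel_measurable borel" using X(1) g(1) by auto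
  have "integral\<^sup>L M g = integral\<^sup>L M (\<lambda>x. indicator X x *\<^sub>R g x)"
  proof (rule integral_cong_AE[OF mg])
    show "(\<lambda>x. indicator X x *\<^sub>R g x) \<in> borel_measurable M" using mi M measurable_cong_sets by blast
    show "AE x in M. g x = indicator X x *\<^sub>R g x" using g(2) by eventually_elim (auto simp: indicator_def)
  qed
  also have "\<dots> = integral\<^sup>L (restrict_space M X) g"
    by (rule integral_restrict_space[symmetric]) (use X M sp in auto)
  also have "\<dots> = integral\<^sup>L ?P (\<lambda>x. indicator X x *\<^sub>R g x)"
    unfolding rs by (rule integral_restrict_space) (use X in \<open>auto simp: sets_pushed_density pushed_density_def\<close>)
  also have "\<dots> = (\<integral>y. (if y \<in> D then J y * (indicator X (f y) *\<^sub>R g (f y)) else 0) \<partial>lborel)"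
    by (rule integral_pushed_density(1)[OF D mi])
  also have "\<dots> = (\<integral>y. (if y \<in> D then J y * g (f y) else 0) \<partial>lborel)"
    by (rule Bochner_Integration.integral_cong) (use X(2) in \<open>auto simp: indicator_def\<close>)
  finally show ?thesis .
qed

context compact_surface
begin

abbreviation "area \<equiv> area_measure S"
abbreviation "len \<equiv> boundary_length_measure S"

lemma sets_area[simp, measurable_cong]: "sets area = sets borel"
  and area_compl: "emeasure area (- S) = 0"
  using theI'[OF area_measure_unique] unfolding area_measure_def[symmetric] by auto

lemma sets_len[simp, measurable_cong]: "sets len = sets borel"
  and len_compl': "emeasure len (- surface_boundary S) = 0"
  using theI'[OF boundary_length_measure_unique] unfolding boundary_length_measure_def[symmetric] by auto

lemma space_area[simp]: "space area = UNIV" and space_len[simp]: "space len = UNIV"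
  using sets_eq_imp_space_eq[OF sets_area] sets_eq_imp_space_eq[OF sets_len] by simp_all

lemma area_chart_eq:
  assumes p: "local_param S W \<psi>" and B: "B \<in> sets borel" "B \<subseteq> \<psi> ` (W \<inter> half_plane)"
  shows "emeasure area B = emeasure (pushed_density (W \<inter> half_plane) (\<lambda>y. norm (surface_chart.EE \<psi> y)) \<psi>) B"
proof -
  interpret surface_chart S W \<psi> using p by (simp add: surface_chart_def)
  show ?thesis
    using theI'[OF area_measure_unique] B p pushed_density_set_integral[OF area_chart_facts B(1)]
    unfolding area_measure_def[symmetric] by (simp add: EE_def)
qed

lemma len_chart_eq:
  assumes p: "local_param S W \<psi>" and B: "B \<in> sets borel" "B \<subseteq> (\<lambda>t. \<psi> (bpt t)) ` {t. bpt t \<in> W}"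
  shows "emeasure len B = emeasure (pushed_density {t. bpt t \<in> W} (\<lambda>t. norm (partial_deriv \<psi> 1 (bpt t))) (\<lambda>t. \<psi> (bpt t))) B"
proof -
  interpret surface_chart S W \<psi> using p by (simp add: surface_chart_def)
  show ?thesis
    using theI'[OF boundary_length_measure_unique] B p pushed_density_set_integral[OF length_chart_facts B(1)]
    unfolding boundary_length_measure_def[symmetric] boundary_image[symmetric] by simp
qed

lemma boundary_subset: "surface_boundary S \<subseteq> S"
proof
  fix p assume "p \<in> surface_boundary S"
  then obtain W \<psi> y where h: "local_param S W \<psi>" "y \<in> W" "y $ 2 = 0" "p = \<psi> y"
    unfolding surface_boundary_def by blast
  interpret surface_chart S W \<psi> using h by (simp add: surface_chart_def)
  show "p \<in> S" using chart_in[of y] h by (simp add: half_plane_def)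
qed

lemma finite_area: "emeasure area UNIV < \<infinity>" and finite_len: "emeasure len UNIV < \<infinity>"
  and boundary_borel: "surface_boundary S \<in> sets borel"
proof -
  obtain \<A> where A: "finite \<A>" "S = (\<Union>(W, \<psi>)\<in>\<A>. \<psi> ` (W \<inter> half_plane))"
    "\<And>W \<psi>. (W, \<psi>) \<in> \<A> \<Longrightarrow> local_param S W \<psi> \<and>
      emeasure (pushed_density (W \<inter> half_plane) (\<lambda>y. norm (surface_chart.EE \<psi> y)) \<psi>) UNIV < \<infinity> \<and>
      emeasure (pushed_density {t. bpt t \<in> W} (\<lambda>t. norm (partial_deriv \<psi> 1 (bpt t))) (\<lambda>t. \<psi> (bpt t))) UNIV < \<infinity>"
    using finite_atlas by metis
  have bu: "surface_boundary S = (\<Union>(W, \<psi>)\<in>\<A>. (\<lambda>t. \<psi> (bpt t)) ` {t. bpt t \<in> W})"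
    by (rule boundary_union[OF A(1,2)]) (use A(3) in blast)
  have c: "snd c ` (fst c \<inter> half_plane) \<in> sets borel" "(\<lambda>t. snd c (bpt t)) ` {t. bpt t \<in> fst c} \<in> sets borel"
     "emeasure area (snd c ` (fst c \<inter> half_plane)) < \<infinity>" "emeasure len ((\<lambda>t. snd c (bpt t)) ` {t. bpt t \<in> fst c}) < \<infinity>"
    if "c \<in> \<A>" for c
  proof -
    have p: "local_param S (fst c) (snd c)" using A(3)[of "fst c" "snd c"] that by simp
    then interpret surface_chart S "fst c" "snd c" by (simp add: surface_chart_def)
    show 1: "snd c ` (fst c \<inter> half_plane) \<in> sets borel" by (rule image_borel[OF closed_S])
    show 2: "(\<lambda>t. snd c (bpt t)) ` {t. bpt t \<in> fst c} \<in> sets borel" by (rule boundary_image_borel[OF closed_S])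
    have "emeasure area (snd c ` HD) \<le> emeasure area_chart UNIV"
      unfolding area_chart_eq[OF p 1 subset_refl] by (rule emeasure_mono) (auto simp: sets_pushed_density)
    then show "emeasure area (snd c ` HD) < \<infinity>" using A(3)[of "fst c" "snd c"] that by (auto intro: le_less_trans)
    have "emeasure len ((\<lambda>t. snd c (bpt t)) ` {t. bpt t \<in> fst c}) \<le> emeasure length_chart UNIV"
      unfolding len_chart_eq[OF p 2 subset_refl] by (rule emeasure_mono) (auto simp: sets_pushed_density)
    then show "emeasure len ((\<lambda>t. snd c (bpt t)) ` {t. bpt t \<in> fst c}) < \<infinity>"
      using A(3)[of "fst c" "snd c"] that by (auto intro: le_less_trans)
  qed
  have S': "S = (\<Union>c\<in>\<A>. snd c ` (fst c \<inter> half_plane))" by (subst A(2)) auto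
  have B': "surface_boundary S = (\<Union>c\<in>\<A>. (\<lambda>t. snd c (bpt t)) ` {t. bpt t \<in> fst c})" by (subst bu) auto
  show bb: "surface_boundary S \<in> sets borel" unfolding B' by (intro sets.finite_UN A(1)) (use c in auto)
  have "emeasure area S \<le> (\<Sum>c\<in>\<A>. emeasure area (snd c ` (fst c \<inter> half_plane)))"
    by (subst S') (rule emeasure_subadditive_finite[OF A(1)], use c in auto)
  also have "\<dots> < \<infinity>" using c by (simp add: A(1))
  finally have "emeasure area S < \<infinity>" .
  moreover have "emeasure area UNIV \<le> emeasure area S + emeasure area (- S)"
    using emeasure_subadditive[of S area "- S"] S_borel by (simp add: Compl_partition)
  ultimately show "emeasure area UNIV < \<infinity>" using area_compl by simp
  have "emeasure len (surface_boundary S) \<le> (\<Sum>c\<in>\<A>. emeasure len ((\<lambda>t. snd c (bpt t)) ` {t. bpt t \<in> fst c}))"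
    by (subst B') (rule emeasure_subadditive_finite[OF A(1)], use c in auto)
  also have "\<dots> < \<infinity>" using c by (simp add: A(1))
  finally have "emeasure len (surface_boundary S) < \<infinity>" .
  moreover have "emeasure len UNIV \<le> emeasure len (surface_boundary S) + emeasure len (- surface_boundary S)"
    using emeasure_subadditive[of "surface_boundary S" len "- surface_boundary S"] bb by (simp add: Compl_partition)
  ultimately show "emeasure len UNIV < \<infinity>" using len_compl' by simp
qed

sublocale area: finite_measure area
  by (rule finite_measureI) (use finite_area in simp)

sublocale len: finite_measure len
  by (rule finite_measureI) (use finite_len in simp)

lemma AE_area: "AE x in area. x \<in> S"
  by (rule AE_I[of _ _ "- S"]) (use area_compl S_borel in auto)

lemma AE_len: "AE x in len. x \<in> surface_boundary S"
  by (rule AE_I[of _ _ "- surface_boundary S"]) (use len_compl' boundary_borel in auto)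

lemma AE_len': "AE x in len. x \<in> S"
  using AE_len by eventually_elim (use boundary_subset in auto)

text \<open>Both measures are carried by S. Extending by 0 turns a function that is continuous on
  the compact set S into a bounded Borel function on three-space, whatever values F takes
  elsewhere.\<close>

definition "zext F x = (if x \<in> S then F x else (0::real))"
abbreviation "aint F \<equiv> integral\<^sup>L area (zext F)"
abbreviation "lint F \<equiv> integral\<^sup>L len (zext F)"

lemma zext_measurable: "continuous_on S F \<Longrightarrow> zext F \<in> borel_measurable borel"
  unfolding zext_def[abs_def] by (rule measurable_if_continuous_on[OF S_borel])

lemma zext_integrable:
  assumes F: "continuous_on S F"
  shows "integrable area (zext F)" "integrable len (zext F)"
proof -
  have "compact (F ` S)" by (rule compact_continuous_image[OF F compact_S])
  then obtain K where K: "\<And>x. x \<in> S \<Longrightarrow> norm (F x) \<le> K"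
    unfolding compact_eq_bounded_closed bounded_iff by auto
  have b: "norm (zext F x) \<le> max K 0" for x using K[of x] by (auto simp: zext_def)
  show "integrable area (zext F)"
    by (rule area.integrable_const_bound[of _ "max K 0"]) (use b zext_measurable[OF F] in auto)
  show "integrable len (zext F)"
    by (rule len.integrable_const_bound[of _ "max K 0"]) (use b zext_measurable[OF F] in auto)
qed

text \<open>The constant c admits integrands whose value off S is a fixed but unspecified number, as
  happens with descriptions by \<open>THE\<close>.\<close>

lemma aint_eqI:
  assumes F: "continuous_on S F" and g: "\<And>x. x \<in> S \<Longrightarrow> g x = F x" "\<And>x. x \<notin> S \<Longrightarrow> g x = c"
  shows "integral\<^sup>L area g = aint F" "integral\<^sup>L len g = lint F"
proof -
  have "(\<lambda>x. if x \<in> S then F x else c) \<in> borel_measurable borel"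
    by (rule borel_measurable_continuous_on_if[OF S_borel F]) (rule continuous_on_const)
  moreover have "g = (\<lambda>x. if x \<in> S then F x else c)" using g by auto
  ultimately have m: "g \<in> borel_measurable borel" by simp
  show "integral\<^sup>L area g = aint F"
  proof (rule integral_cong_AE)
    show "AE x in area. g x = zext F x" using AE_area by eventually_elim (simp add: g zext_def)
  qed (use m zext_measurable[OF F] in auto)
  show "integral\<^sup>L len g = lint F"
  proof (rule integral_cong_AE)
    show "AE x in len. g x = zext F x" using AE_len' by eventually_elim (simp add: g zext_def)
  qed (use m zext_measurable[OF F] in auto)
qed

lemma int_add:
  assumes "continuous_on S F" "continuous_on S G"
  shows "aint (\<lambda>x. F x + G x) = aint F + aint G" "lint (\<lambda>x. F x + G x) = lint F + lint G"
proof -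
  have e: "zext (\<lambda>x. F x + G x) = (\<lambda>x. zext F x + zext G x)" by (auto simp: zext_def)
  show "aint (\<lambda>x. F x + G x) = aint F + aint G" "lint (\<lambda>x. F x + G x) = lint F + lint G"
    unfolding e by (rule Bochner_Integration.integral_add; rule zext_integrable; rule assms)+
qed

lemma int_diff:
  assumes "continuous_on S F" "continuous_on S G"
  shows "aint (\<lambda>x. F x - G x) = aint F - aint G" "lint (\<lambda>x. F x - G x) = lint F - lint G"
proof -
  have e: "zext (\<lambda>x. F x - G x) = (\<lambda>x. zext F x - zext G x)" by (auto simp: zext_def)
  show "aint (\<lambda>x. F x - G x) = aint F - aint G" "lint (\<lambda>x. F x - G x) = lint F - lint G"
    unfolding e by (rule Bochner_Integration.integral_diff; rule zext_integrable; rule assms)+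
qed

lemma int_scale: "aint (\<lambda>x. c * F x) = c * aint F" "lint (\<lambda>x. c * F x) = c * lint F"
proof -
  have e: "zext (\<lambda>x. c * F x) = (\<lambda>x. c * zext F x)" by (auto simp: zext_def)
  show "aint (\<lambda>x. c * F x) = c * aint F" "lint (\<lambda>x. c * F x) = c * lint F"
    unfolding e by simp_all
qed

lemma int_sum:
  assumes "\<And>i. i \<in> I \<Longrightarrow> continuous_on S (F i)"
  shows "aint (\<lambda>x. \<Sum>i\<in>I. F i x) = (\<Sum>i\<in>I. aint (F i))" "lint (\<lambda>x. \<Sum>i\<in>I. F i x) = (\<Sum>i\<in>I. lint (F i))"
proof -
  have e: "zext (\<lambda>x. \<Sum>i\<in>I. F i x) = (\<lambda>x. \<Sum>i\<in>I. zext (F i) x)" by (auto simp: zext_def)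
  show "aint (\<lambda>x. \<Sum>i\<in>I. F i x) = (\<Sum>i\<in>I. aint (F i))" "lint (\<lambda>x. \<Sum>i\<in>I. F i x) = (\<Sum>i\<in>I. lint (F i))"
    unfolding e by (rule Bochner_Integration.integral_sum; rule zext_integrable; erule assms)+
qed

lemma int_cong: "(\<And>x. x \<in> S \<Longrightarrow> F x = G x) \<Longrightarrow> aint F = aint G"
  "(\<And>x. x \<in> S \<Longrightarrow> F x = G x) \<Longrightarrow> lint F = lint G"
proof -
  assume "\<And>x. x \<in> S \<Longrightarrow> F x = G x"
  then have "zext F = zext G" by (auto simp: zext_def)
  then show "aint F = aint G" "lint F = lint G" by simp_all
qed

lemma lint_cong_boundary:
  assumes "continuous_on S F" "continuous_on S G" "\<And>x. x \<in> surface_boundary S \<Longrightarrow> F x = G x"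
  shows "lint F = lint G"
proof (rule integral_cong_AE)
  show "AE x in len. zext F x = zext G x"
    using AE_len by eventually_elim (use assms(3) in \<open>auto simp: zext_def\<close>)
qed (use zext_measurable assms in auto)

lemma int_nonneg: "(\<And>x. x \<in> S \<Longrightarrow> F x \<ge> 0) \<Longrightarrow> aint F \<ge> 0"
  "(\<And>x. x \<in> S \<Longrightarrow> F x \<ge> 0) \<Longrightarrow> lint F \<ge> 0"
  by (auto intro!: Bochner_Integration.integral_nonneg simp: zext_def)

text \<open>Otherwise F would vanish almost everywhere. In a chart around p this would make the area
  element 0 almost everywhere on a nonempty open set of parameters, whereas it is positive
  throughout.\<close>

lemma aint_pos:
  assumes F: "continuous_on S F" and nn: "\<And>x. x \<in> S \<Longrightarrow> F x \<ge> 0" and p: "p \<in> S" "F p > 0"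
  shows "aint F > 0"
proof (rule ccontr)
  assume "\<not> aint F > 0"
  then have "aint F = 0" using int_nonneg(1)[of F] nn by force
  moreover have "AE x in area. 0 \<le> zext F x" using nn by (simp add: zext_def)
  ultimately have z: "AE x in area. zext F x = 0"
    using integral_nonneg_eq_0_iff_AE[OF zext_integrable(1)[OF F]] by simp
  obtain W \<psi> y where c: "local_param S W \<psi>" "y \<in> W \<inter> half_plane" "p = \<psi> y"
    using p(1) embedded_S unfolding embedded_surface_def by blast
  interpret surface_chart S W \<psi> using c by (simp add: surface_chart_def)
  have cF: "continuous_on HD (\<lambda>z. F (\<psi> z))"
    by (rule continuous_on_compose2[OF F continuous_chart]) (use chart_in in auto)
  obtain U where U: "open U" "U \<noteq> {}" "U \<subseteq> HD" "\<And>z. z \<in> U \<Longrightarrow> F (\<psi> z) > 0"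
    using HD_positive_on_open[OF c(2) cF] p(2) c(3) by metis
  define B where "B = {x \<in> \<psi> ` HD. zext F x \<noteq> 0}"
  have Bb: "B \<in> sets borel"
  proof -
    have "B = \<psi> ` HD \<inter> (zext F -` (- {0}) \<inter> space borel)" by (auto simp: B_def)
    then show ?thesis using measurable_sets[OF zext_measurable[OF F], of "- {0}"] image_borel[OF closed_S] by simp
  qed
  have "AE x in area. x \<notin> B" using z by eventually_elim (auto simp: B_def)
  then have "emeasure area B = 0"
    using AE_iff_measurable[of B area "\<lambda>x. x \<notin> B"] Bb by simp
  then have "(\<integral>\<^sup>+z. ennreal (if z \<in> HD \<and> \<psi> z \<in> B then Ja z else 0) \<partial>lborel) = 0"
    using area_chart_eq[OF c(1) Bb] emeasure_pushed_density[OF area_chart_facts Bb] by (simp add: B_def)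
  then have ae: "AE z in lborel. ennreal (if z \<in> HD \<and> \<psi> z \<in> B then Ja z else 0) = 0"
    using measurable_density_in[OF area_chart_facts Bb] by (subst (asm) nn_integral_0_iff_AE) auto
  have "AE z in lborel. z \<notin> U"
    using ae
  proof eventually_elim
    case (elim z)
    show ?case
    proof
      assume zU: "z \<in> U"
      then have "z \<in> HD" "F (\<psi> z) > 0" using U by auto
      then have "\<psi> z \<in> B" using chart_in[of z] by (auto simp: B_def zext_def)
      then have "Ja z \<le> 0" using elim \<open>z \<in> HD\<close> by (simp add: ennreal_eq_0_iff)
      then show False using Ja_pos[of z] \<open>z \<in> HD\<close> by simp
    qed
  qed
  then have "emeasure lborel U = 0" using AE_iff_measurable[of U lborel "\<lambda>x. x \<notin> U"] U(1) by simp
  then have "negligible U" using U(1) by (simp add: negligible_iff_null_sets null_sets_completionI null_setsI)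
  then show False using open_not_negligible U by blast
qed

lemma chart_borel: "local_param S W \<psi> \<Longrightarrow> \<psi> ` (W \<inter> half_plane) \<in> sets borel"
  "local_param S W \<psi> \<Longrightarrow> (\<lambda>t. \<psi> (bpt t)) ` {t. bpt t \<in> W} \<in> sets borel"
  using surface_chart.image_borel surface_chart.boundary_image_borel closed_S by (auto simp: surface_chart_def)

lemma aint_chart:
  assumes c: "local_param S W \<psi>" and F: "continuous_on S F"
    and z: "AE x in area. x \<in> S - \<psi> ` (W \<inter> half_plane) \<longrightarrow> F x = 0"
  shows "aint F = (\<integral>y. (if y \<in> W \<inter> half_plane then norm (surface_chart.EE \<psi> y) * F (\<psi> y) else 0) \<partial>lborel)"
proof -
  interpret surface_chart S W \<psi> using c by (simp add: surface_chart_def)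
  have "aint F = (\<integral>y. (if y \<in> HD then Ja y * zext F (\<psi> y) else 0) \<partial>lborel)"
  proof (rule integral_eq_pushed_density[OF area_chart_facts sets_area chart_borel(1)[OF c] subset_refl _ zext_measurable[OF F]])
    show "AE x in area. x \<notin> \<psi> ` HD \<longrightarrow> zext F x = 0" using z by eventually_elim (auto simp: zext_def)
  qed (auto intro: area_chart_eq[OF c])
  also have "\<dots> = (\<integral>y. (if y \<in> HD then Ja y * F (\<psi> y) else 0) \<partial>lborel)"
    by (rule Bochner_Integration.integral_cong) (use chart_in in \<open>auto simp: zext_def\<close>)
  finally show ?thesis .
qed

lemma lint_chart:
  assumes c: "local_param S W \<psi>" and F: "continuous_on S F"
    and z: "AE x in len. x \<in> surface_boundary S - (\<lambda>t. \<psi> (bpt t)) ` {t. bpt t \<in> W} \<longrightarrow> F x = 0"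
  shows "lint F = (\<integral>t. (if bpt t \<in> W then norm (partial_deriv \<psi> 1 (bpt t)) * F (\<psi> (bpt t)) else 0) \<partial>lborel)"
proof -
  interpret surface_chart S W \<psi> using c by (simp add: surface_chart_def)
  have "lint F = (\<integral>t. (if t \<in> BD then norm (E 1 (bpt t)) * zext F (\<psi> (bpt t)) else 0) \<partial>lborel)"
  proof (rule integral_eq_pushed_density[OF length_chart_facts sets_len chart_borel(2)[OF c] subset_refl _ zext_measurable[OF F]])
    show "AE x in len. x \<notin> (\<lambda>t. \<psi> (bpt t)) ` BD \<longrightarrow> zext F x = 0"
      using z AE_len by eventually_elim (auto simp: zext_def)
  qed (auto intro: len_chart_eq[OF c])
  also have "\<dots> = (\<integral>t. (if bpt t \<in> W then norm (E 1 (bpt t)) * F (\<psi> (bpt t)) else 0) \<partial>lborel)"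
    by (rule Bochner_Integration.integral_cong) (use chart_in bpt_half_plane in \<open>auto simp: zext_def\<close>)
  finally show ?thesis .
qed

end

section \<open>Divergence theorem on the half plane\<close>

lemma vector2_eq: "(vector [a, b] :: real^2) = a *\<^sub>R axis 1 1 + b *\<^sub>R axis 2 1"
  by (simp add: vec_eq_iff forall_2 axis_def)

lemma continuous_on_vector2: "continuous_on A (\<lambda>p::real\<times>real. vector [fst p, snd p] :: real^2)"
  unfolding vector2_eq by (intro continuous_intros)

text \<open>Lebesgue measure is determined by its values on boxes. The identification with the
  product measure gives iterated integrals in the two coordinates.\<close>

lemma lborel_real2: "lborel = distr (lborel \<Otimes>\<^sub>M lborel) borel (\<lambda>p. vector [fst p, snd p] :: real^2)"
proof (rule lborel_eqI)
  have m: "(\<lambda>p::real\<times>real. vector [fst p, snd p] :: real^2) \<in> borel_measurable (lborel \<Otimes>\<^sub>M lborel)"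
    using borel_measurable_continuous_onI[OF continuous_on_vector2] by (simp add: lborel_prod)
  have B: "(Basis :: (real^2) set) = {axis 1 1, axis 2 1}"
    by (auto simp: Basis_vec_def UNIV_2)
  have ne: "axis 1 1 \<noteq> (axis 2 1 :: real^2)" by (simp add: axis_eq_axis)
  fix l u :: "real^2" assume lu: "\<And>b. b \<in> Basis \<Longrightarrow> l \<bullet> b \<le> u \<bullet> b"
  then have lu': "l $ 1 \<le> u $ 1" "l $ 2 \<le> u $ 2" using lu[of "axis 1 1"] lu[of "axis 2 1"] by (simp_all add: B inner_axis)
  have "(\<lambda>p. vector [fst p, snd p] :: real^2) -` box l u = {l $ 1<..<u $ 1} \<times> {l $ 2<..<u $ 2}"
    by (auto simp: mem_box B inner_axis)
  then have "emeasure (distr (lborel \<Otimes>\<^sub>M lborel) borel (\<lambda>p. vector [fst p, snd p] :: real^2)) (box l u)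
     = emeasure (lborel \<Otimes>\<^sub>M lborel) ({l $ 1<..<u $ 1} \<times> {l $ 2<..<u $ 2})"
    using m by (subst emeasure_distr) (auto simp: space_pair_measure)
  also have "\<dots> = ennreal ((u $ 1 - l $ 1) * (u $ 2 - l $ 2))"
    using lu' by (subst lborel.emeasure_pair_measure_Times) (auto simp: ennreal_mult'')
  also have "\<dots> = ennreal (\<Prod>b\<in>Basis. (u - l) \<bullet> b)"
    unfolding B using ne by (simp add: inner_axis)
  finally show "emeasure (distr (lborel \<Otimes>\<^sub>M lborel) borel (\<lambda>p. vector [fst p, snd p] :: real^2)) (box l u) =
     ennreal (\<Prod>b\<in>Basis. (u - l) \<bullet> b)" .
qed simp

lemma Fubini_real2:
  fixes F :: "real^2 \<Rightarrow> real"
  assumes F: "integrable lborel F"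
  shows "integral\<^sup>L lborel F = (\<integral>a. (\<integral>b. F (vector [a, b]) \<partial>lborel) \<partial>lborel)"
    "integral\<^sup>L lborel F = (\<integral>b. (\<integral>a. F (vector [a, b]) \<partial>lborel) \<partial>lborel)"
proof -
  let ?v = "\<lambda>p::real\<times>real. vector [fst p, snd p] :: real^2"
  have m: "?v \<in> borel_measurable (lborel \<Otimes>\<^sub>M lborel)"
    using borel_measurable_continuous_onI[OF continuous_on_vector2] by (simp add: lborel_prod)
  have mF: "F \<in> borel_measurable borel" using F by (simp add: integrable_iff_bounded)
  have i: "integrable (lborel \<Otimes>\<^sub>M lborel) (\<lambda>p. F (?v p))"
    using F integrable_distr_eq[OF m mF] by (metis lborel_real2)
  have e: "integral\<^sup>L lborel F = integral\<^sup>L (lborel \<Otimes>\<^sub>M lborel) (\<lambda>p. F (?v p))"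
    using integral_distr[OF m mF] by (metis lborel_real2)
  show "integral\<^sup>L lborel F = (\<integral>a. (\<integral>b. F (vector [a, b]) \<partial>lborel) \<partial>lborel)"
    unfolding e using lborel_pair.integral_fst'[OF i] by simp
  have i': "integrable (lborel \<Otimes>\<^sub>M lborel) (case_prod (\<lambda>a b. F (vector [a, b])))"
    using i by (simp add: case_prod_beta')
  show "integral\<^sup>L lborel F = (\<integral>b. (\<integral>a. F (vector [a, b]) \<partial>lborel) \<partial>lborel)"
    unfolding e using lborel_pair.integral_snd[OF i'] by (simp add: case_prod_beta')
qed

text \<open>Fubini's theorem and the fundamental theorem of calculus on lines. On horizontal lines
  the derivative of K1 integrates to 0 because of the support; vertical lines start at the edge,
  where the value of K2 remains with a minus sign.\<close>

lemma half_plane_divergence: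
  fixes K1 K2 :: "real^2 \<Rightarrow> real"
  assumes d1: "\<And>y. y \<in> half_plane \<Longrightarrow> (K1 has_derivative D1 y) (at y within half_plane)"
    and d2: "\<And>y. y \<in> half_plane \<Longrightarrow> (K2 has_derivative D2 y) (at y within half_plane)"
    and c1: "continuous_on half_plane (\<lambda>y. D1 y (axis 1 1))" and c2: "continuous_on half_plane (\<lambda>y. D2 y (axis 2 1))"
    and R: "R > 0" and supp: "\<And>y. y \<in> half_plane \<Longrightarrow> R \<le> norm y \<Longrightarrow>
       K1 y = 0 \<and> K2 y = 0 \<and> D1 y (axis 1 1) = 0 \<and> D2 y (axis 2 1) = 0"
  shows "(\<integral>y. (if y \<in> half_plane then D1 y (axis 1 1) + D2 y (axis 2 1) else 0) \<partial>lborel) = - (\<integral>t. K2 (bpt t) \<partial>lborel)"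
proof -
  have int: "integrable lborel (\<lambda>y. if y \<in> half_plane then F y else 0)"
    if F: "continuous_on half_plane F" "\<And>y. y \<in> half_plane \<Longrightarrow> R \<le> norm y \<Longrightarrow> F y = 0" for F :: "real^2 \<Rightarrow> real"
  proof -
    have "compact (half_plane \<inter> cball 0 R)" using closed_half_plane by (simp add: closed_Int_compact)
    then have "integrable lborel (\<lambda>y. indicator (half_plane \<inter> cball 0 R) y *\<^sub>R F y)"
      by (rule borel_integrable_compact) (use F(1) continuous_on_subset in blast)
    moreover have "(\<lambda>y. indicator (half_plane \<inter> cball 0 R) y *\<^sub>R F y) = (\<lambda>y. if y \<in> half_plane then F y else 0)"
      using F(2) by (auto simp: fun_eq_iff indicator_def)
    ultimately show ?thesis by simp
  qed
  let ?f1 = "\<lambda>y. if y \<in> half_plane then D1 y (axis 1 1) else 0"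
  let ?f2 = "\<lambda>y. if y \<in> half_plane then D2 y (axis 2 1) else 0"
  have i1: "integrable lborel ?f1" and i2: "integrable lborel ?f2"
    using int[OF c1] int[OF c2] supp by auto
  have l1: "linear (D1 y)" "linear (D2 y)" if "y \<in> half_plane" for y
    using d1[OF that] d2[OF that] has_derivative_linear by auto
  have nr: "\<bar>a\<bar> \<le> norm (vector [a, b] :: real^2)" "\<bar>b\<bar> \<le> norm (vector [a, b] :: real^2)" for a b
    using component_le_norm_cart[of "vector [a, b] :: real^2" 1] component_le_norm_cart[of "vector [a, b] :: real^2" 2] by auto
  have H: "vector [a, b] \<in> half_plane \<longleftrightarrow> b \<ge> 0" for a b by (simp add: half_plane_def)
  have "(\<integral>a. ?f1 (vector [a, b]) \<partial>lborel) = 0" for b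
  proof (cases "b \<ge> 0")
    case True
    have "(\<integral>a. ?f1 (vector [a, b]) \<partial>lborel) = (\<integral>a. indicator {-R..R} a *\<^sub>R D1 (vector [a, b]) (axis 1 1) \<partial>lborel)"
    proof (rule Bochner_Integration.integral_cong[OF refl])
      fix a show "?f1 (vector [a, b]) = indicator {-R..R} a *\<^sub>R D1 (vector [a, b]) (axis 1 1)"
      proof (cases "a \<in> {-R..R}")
        case False
        then have "R \<le> \<bar>a\<bar>" by (auto simp: abs_if)
        then have "R \<le> norm (vector [a, b] :: real^2)" using nr(1)[of a b] by linarith
        then show ?thesis using True supp[of "vector [a, b]"] False by (simp add: H)
      qed (use True in \<open>simp add: H\<close>)
    qed
    also have "\<dots> = K1 (vector [R, b]) - K1 (vector [-R, b])"
    proof (rule integral_FTC_Icc)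
      show "- R \<le> R" using R by simp
      fix a assume a: "- R \<le> a" "a \<le> R"
      have "((\<lambda>a. vector [a, b] :: real^2) has_derivative (\<lambda>h. h *\<^sub>R axis 1 1)) (at a within {-R..R})"
        unfolding vector2_eq by (auto intro!: derivative_eq_intros)
      moreover have "(K1 has_derivative D1 (vector [a, b])) (at (vector [a, b]) within (\<lambda>a. vector [a, b]) ` {-R..R})"
        by (rule has_derivative_subset[OF d1]) (use True H in auto)
      ultimately have "((\<lambda>a. K1 (vector [a, b])) has_derivative (\<lambda>h. D1 (vector [a, b]) (h *\<^sub>R axis 1 1))) (at a within {-R..R})"
        by (rule has_derivative_in_compose)
      then show "((\<lambda>a. K1 (vector [a, b])) has_vector_derivative D1 (vector [a, b]) (axis 1 1)) (at a within {-R..R})"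
        unfolding has_vector_derivative_def by (rule has_derivative_eq_rhs) (use l1(1) True H in \<open>simp add: linear_scale fun_eq_iff\<close>)
    next
      have "continuous_on {-R..R} (\<lambda>a. vector [a, b] :: real^2)" unfolding vector2_eq by (intro continuous_intros)
      then show "continuous_on {-R..R} (\<lambda>a. D1 (vector [a, b]) (axis 1 1))"
        by (rule continuous_on_compose2[OF c1]) (use True H in auto)
    qed
    also have "\<dots> = 0" using supp[of "vector [R, b]"] supp[of "vector [-R, b]"] nr(1)[of R b] nr(1)[of "-R" b] R True by (simp add: H)
    finally show ?thesis .
  qed (simp add: H)
  then have I1: "integral\<^sup>L lborel ?f1 = 0" using Fubini_real2(2)[OF i1] by simp
  have "(\<integral>b. ?f2 (vector [a, b]) \<partial>lborel) = - K2 (bpt a)" for a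
  proof -
    have "(\<integral>b. ?f2 (vector [a, b]) \<partial>lborel) = (\<integral>b. indicator {0..R} b *\<^sub>R D2 (vector [a, b]) (axis 2 1) \<partial>lborel)"
    proof (rule Bochner_Integration.integral_cong[OF refl])
      fix b show "?f2 (vector [a, b]) = indicator {0..R} b *\<^sub>R D2 (vector [a, b]) (axis 2 1)"
      proof (cases "b \<in> {0..R}")
        case False
        then consider "b < 0" | "R < b" by fastforce
        then show ?thesis
        proof cases
          case 2
          then have "R \<le> norm (vector [a, b] :: real^2)" using nr(2)[of b a] by linarith
          then show ?thesis using supp[of "vector [a, b]"] 2 R by (simp add: H)
        qed (simp add: H)
      qed (simp add: H)
    qed
    also have "\<dots> = K2 (vector [a, R]) - K2 (vector [a, 0])"
    proof (rule integral_FTC_Icc)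
      show "0 \<le> R" using R by simp
      fix b assume b: "0 \<le> b" "b \<le> R"
      have "((\<lambda>b. vector [a, b] :: real^2) has_derivative (\<lambda>h. h *\<^sub>R axis 2 1)) (at b within {0..R})"
        unfolding vector2_eq by (auto intro!: derivative_eq_intros)
      moreover have "(K2 has_derivative D2 (vector [a, b])) (at (vector [a, b]) within (\<lambda>b. vector [a, b]) ` {0..R})"
        by (rule has_derivative_subset[OF d2]) (use b H in auto)
      ultimately have "((\<lambda>b. K2 (vector [a, b])) has_derivative (\<lambda>h. D2 (vector [a, b]) (h *\<^sub>R axis 2 1))) (at b within {0..R})"
        by (rule has_derivative_in_compose)
      then show "((\<lambda>b. K2 (vector [a, b])) has_vector_derivative D2 (vector [a, b]) (axis 2 1)) (at b within {0..R})"
        unfolding has_vector_derivative_def by (rule has_derivative_eq_rhs) (use l1(2) b H in \<open>simp add: linear_scale fun_eq_iff\<close>)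
    next
      have "continuous_on {0..R} (\<lambda>b. vector [a, b] :: real^2)" unfolding vector2_eq by (intro continuous_intros)
      then show "continuous_on {0..R} (\<lambda>b. D2 (vector [a, b]) (axis 2 1))"
        by (rule continuous_on_compose2[OF c2]) (use H in auto)
    qed
    also have "\<dots> = - K2 (bpt a)" using supp[of "vector [a, R]"] nr(2)[of R a] R by (simp add: H)
    finally show ?thesis .
  qed
  then have I2: "integral\<^sup>L lborel ?f2 = - (\<integral>t. K2 (bpt t) \<partial>lborel)" using Fubini_real2(1)[OF i2] by simp
  have "(\<lambda>y. if y \<in> half_plane then D1 y (axis 1 1) + D2 y (axis 2 1) else 0) = (\<lambda>y. ?f1 y + ?f2 y)" by auto
  then show ?thesis using Bochner_Integration.integral_add[OF i1 i2] I1 I2 by simp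
qed

lemma at_within_half_plane:
  assumes "open W" "y \<in> W" shows "at y within (W \<inter> half_plane) = at y within half_plane"
  by (rule at_within_nhd[OF assms(2,1)]) auto

text \<open>Fields supported in a compact subset C of W extend by zero to the whole half plane. The
  complement of C is open, so the extension is differentiable also at the points outside W.\<close>

lemma half_plane_divergence_local:
  fixes K1 K2 :: "real^2 \<Rightarrow> real"
  assumes W: "open W" and C: "compact C" "C \<subseteq> W"
    and d1: "\<And>y. y \<in> W \<inter> half_plane \<Longrightarrow> (K1 has_derivative D1 y) (at y within W \<inter> half_plane)"
    and d2: "\<And>y. y \<in> W \<inter> half_plane \<Longrightarrow> (K2 has_derivative D2 y) (at y within W \<inter> half_plane)"
    and c1: "continuous_on (W \<inter> half_plane) (\<lambda>y. D1 y (axis 1 1))" and c2: "continuous_on (W \<inter> half_plane) (\<lambda>y. D2 y (axis 2 1))"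
    and supp: "\<And>y. y \<in> W \<inter> half_plane \<Longrightarrow> y \<notin> C \<Longrightarrow>
       K1 y = 0 \<and> K2 y = 0 \<and> D1 y (axis 1 1) = 0 \<and> D2 y (axis 2 1) = 0"
  shows "(\<integral>y. (if y \<in> W \<inter> half_plane then D1 y (axis 1 1) + D2 y (axis 2 1) else 0) \<partial>lborel) = - (\<integral>t. (if bpt t \<in> W then K2 (bpt t) else 0) \<partial>lborel)"
proof -
  let ?K1 = "\<lambda>y. if y \<in> W then K1 y else 0" and ?K2 = "\<lambda>y. if y \<in> W then K2 y else 0"
  let ?D1 = "\<lambda>y. if y \<in> W then D1 y else (\<lambda>h. 0)" and ?D2 = "\<lambda>y. if y \<in> W then D2 y else (\<lambda>h. 0)"
  obtain R where R: "R > 0" "\<And>y. y \<in> C \<Longrightarrow> norm y < R"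
    using compact_imp_bounded[OF C(1)] unfolding bounded_pos by (metis gt_ex less_le_trans less_trans not_le)
  have oC: "open (- C)" using C compact_imp_closed by auto
  have der: "((\<lambda>y. if y \<in> W then K y else 0) has_derivative (if y \<in> W then D y else (\<lambda>h. 0))) (at y within half_plane)"
    if y: "y \<in> half_plane" and d: "\<And>y. y \<in> W \<inter> half_plane \<Longrightarrow> (K has_derivative D y) (at y within W \<inter> half_plane)"
      and z: "\<And>y. y \<in> W \<inter> half_plane \<Longrightarrow> y \<notin> C \<Longrightarrow> K y = 0"
    for y and K :: "real^2 \<Rightarrow> real" and D
  proof (cases "y \<in> W")
    case True
    have "(K has_derivative D y) (at y within half_plane)" using d[of y] y True at_within_half_plane[OF W True] by simp
    then have "((\<lambda>y. if y \<in> W then K y else 0) has_derivative D y) (at y within half_plane)"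
      by (rule has_derivative_transform_within_open[OF _ W True]) simp
    then show ?thesis using True by simp
  next
    case False
    obtain e where e: "e > 0" "ball y e \<subseteq> - C" using openE[OF oC, of y] False C by blast
    have "((\<lambda>y. 0 :: real) has_derivative (\<lambda>h. 0)) (at y within half_plane)" by simp
    then have "((\<lambda>y. if y \<in> W then K y else 0) has_derivative (\<lambda>h. 0)) (at y within half_plane)"
      by (rule has_derivative_transform_within[OF _ e(1) y]) (use z e in \<open>auto simp: dist_commute subset_iff\<close>)
    then show ?thesis using False by simp
  qed
  have cont: "continuous_on half_plane (\<lambda>y. (if y \<in> W then D y else (\<lambda>h. 0)) e)"
    if c: "continuous_on (W \<inter> half_plane) (\<lambda>y. D y e)" and z: "\<And>y. y \<in> W \<inter> half_plane \<Longrightarrow> y \<notin> C \<Longrightarrow> D y e = 0"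
    for D :: "real^2 \<Rightarrow> real^2 \<Rightarrow> real" and e
    unfolding continuous_on_eq_continuous_within
  proof
    fix y :: "real^2" assume y: "y \<in> half_plane"
    show "continuous (at y within half_plane) (\<lambda>y. (if y \<in> W then D y else (\<lambda>h. 0)) e)"
    proof (cases "y \<in> W")
      case True
      then have cD: "continuous (at y within half_plane) (\<lambda>y. D y e)"
        using c y at_within_half_plane[OF W True] unfolding continuous_on_eq_continuous_within by (metis IntI)
      obtain r where r: "r > 0" "ball y r \<subseteq> W" using W True openE by blast
      show ?thesis
        by (rule continuous_transform_within[OF cD r(1) y]) (use r in \<open>auto simp: dist_commute subset_iff\<close>)
    next
      case False
      obtain r where r: "r > 0" "ball y r \<subseteq> - C" using openE[OF oC, of y] False C by blast
      have "continuous (at y within half_plane) (\<lambda>y. 0 :: real)" by simp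
      then show ?thesis
        by (rule continuous_transform_within[OF _ r(1) y]) (use r z in \<open>auto simp: dist_commute subset_iff\<close>)
    qed
  qed
  have "(\<integral>y. (if y \<in> half_plane then ?D1 y (axis 1 1) + ?D2 y (axis 2 1) else 0) \<partial>lborel) = - (\<integral>t. ?K2 (bpt t) \<partial>lborel)"
  proof (rule half_plane_divergence[OF _ _ _ _ R(1)])
    show "(?K1 has_derivative ?D1 y) (at y within half_plane)" "(?K2 has_derivative ?D2 y) (at y within half_plane)"
      if "y \<in> half_plane" for y
      by (rule der[OF that d1], assumption, use supp in blast) (rule der[OF that d2], assumption, use supp in blast)
    show "continuous_on half_plane (\<lambda>y. ?D1 y (axis 1 1))" "continuous_on half_plane (\<lambda>y. ?D2 y (axis 2 1))"
      by (rule cont[of D1 "axis 1 1", OF c1], use supp in blast)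
        (rule cont[of D2 "axis 2 1", OF c2], use supp in blast)
    show "?K1 y = 0 \<and> ?K2 y = 0 \<and> ?D1 y (axis 1 1) = 0 \<and> ?D2 y (axis 2 1) = 0"
      if "y \<in> half_plane" "R \<le> norm y" for y
      using supp[of y] R(2)[of y] that by auto
  qed
  moreover have "(\<lambda>y. if y \<in> half_plane then ?D1 y (axis 1 1) + ?D2 y (axis 2 1) else 0) =
      (\<lambda>y. if y \<in> W \<inter> half_plane then D1 y (axis 1 1) + D2 y (axis 2 1) else 0)" by auto
  ultimately show ?thesis by simp
qed

section \<open>First variation formula\<close>

context surface_chart
begin

text \<open>\<open>cross3 (E 2 y) (N y)\<close> and \<open>cross3 (N y) (E 1 y)\<close> are the
  components of the conormal field of the chart, and their divergence is, up to the area element,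
  the Laplacian of the position vector. Mixed second derivatives cancel by symmetry, and
  Weingarten's formula leaves the trace of the shape operator times \<open>EE y\<close>.\<close>

lemma divergence_free:
  assumes y: "y \<in> W" and tr: "trace (Sh y) = 0"
  shows "cross3 (partial_deriv (E 2) 1 y) (N y) + cross3 (E 2 y) (partial_deriv N 1 y)
    + (cross3 (partial_deriv N 2 y) (E 1 y) + cross3 (N y) (partial_deriv (E 1) 2 y)) = 0"
proof -
  have s: "partial_deriv (E 1) 2 y = partial_deriv (E 2) 1 y" by (rule symmetric_partials[OF open_W smooth y])
  have t: "Sh y $ 2 $ 2 = - Sh y $ 1 $ 1" using tr by (simp add: trace2 add_eq_0_iff)
  show ?thesis
    unfolding s weingarten[OF y] t cross_skew[of "partial_deriv (E 2) 1 y" "N y"]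
    by (simp add: cross_add_left cross_add_right cross_mult_left cross_mult_right
        cross_skew[of "E 2 y" "E 1 y"] Cross3.left_diff_distrib Cross3.right_diff_distrib)
qed

text \<open>Lagrange's identity is used twice: the combination is the cross product of the normal
  with \<open>cross3 w (EE y)\<close>, and the double cross product with a unit normal is the
  tangential projection.\<close>

lemma tan_proj_cross:
  assumes y: "y \<in> W"
  shows "(w \<bullet> E 1 y) *\<^sub>R cross3 (E 2 y) (N y) + (w \<bullet> E 2 y) *\<^sub>R cross3 (N y) (E 1 y) = Ja y *\<^sub>R tan_proj y w"
proof -
  have "(w \<bullet> E 1 y) *\<^sub>R cross3 (E 2 y) (N y) + (w \<bullet> E 2 y) *\<^sub>R cross3 (N y) (E 1 y) =
      cross3 (N y) ((w \<bullet> E 2 y) *\<^sub>R E 1 y - (w \<bullet> E 1 y) *\<^sub>R E 2 y)"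
    by (simp add: cross_mult_right Cross3.right_diff_distrib cross_skew[of "E 2 y" "N y"])
  also have "\<dots> = cross3 (N y) (cross3 w (EE y))" by (simp add: EE_def Lagrange)
  also have "\<dots> = Ja y *\<^sub>R cross3 (N y) (cross3 w (N y))" using EE_N[OF y] by (metis cross_mult_right)
  also have "\<dots> = Ja y *\<^sub>R tan_proj y w" unfolding Lagrange tan_proj_def by (simp add: N_N[OF y] inner_commute)
  finally show ?thesis .
qed

text \<open>The cross product and the exterior conormal are both tangential and orthogonal to the
  edge, so only length and sign are in question. The conormal is given in some other
  parametrization; the shape of the transition matrix at the edge preserves the sign of the second
  component.\<close>

lemma conormal_eq:
  assumes y: "y \<in> HD" "y $ 2 = 0" and con: "exterior_conormal S (\<psi> y) \<nu>"
  shows "cross3 (E 1 y) (N y) = norm (E 1 y) *\<^sub>R \<nu>"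
proof -
  have yW: "y \<in> W" using y by simp
  obtain W' \<psi>' y' w where h: "local_param S W' \<psi>'" "y' \<in> W'" "y' $ 2 = 0" "\<psi>' y' = \<psi> y"
     "norm \<nu> = 1" "\<nu> \<bullet> partial_deriv \<psi>' 1 y' = 0" "w $ 2 < 0" "\<nu> = frechet_derivative \<psi>' (at y') w"
    using con unfolding exterior_conormal_def by blast
  have c': "surface_chart S W' \<psi>'" using h(1) by (simp add: surface_chart_def)
  have y': "y' \<in> W' \<inter> half_plane" using h by (simp add: half_plane_def)
  obtain M where M: "\<And>v. frechet_derivative \<psi>' (at y') v = d\<psi> y (M *v v)"
    "((\<lambda>z. inv_chart (\<psi>' z)) has_derivative (\<lambda>v. M *v v)) (at y' within W' \<inter> half_plane)"
    using transition_exists[OF c' surface_chart_axioms y' y(1) h(4)] by blast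
  note bt = boundary_transition[OF c' surface_chart_axioms y' y(1) h(4) M]
  have M0: "det M \<noteq> 0" "M $ 2 $ 1 = 0" "M $ 2 $ 2 > 0" using bt y(2) by auto
  then have M11: "M $ 1 $ 1 \<noteq> 0" by (auto simp: det_2)
  have "partial_deriv \<psi>' 1 y' = M $ 1 $ 1 *\<^sub>R E 1 y"
    using M(1)[of "axis 1 1"] M0 by (simp add: partial_deriv_def[of \<psi>'] d_eq[OF yW] matrix_vector_mult_basis column_def)
  then have n1: "\<nu> \<bullet> E 1 y = 0" using h(6) M11 by simp
  define a b where "a = (M *v w) $ 1" and "b = (M *v w) $ 2"
  have \<nu>: "\<nu> = a *\<^sub>R E 1 y + b *\<^sub>R E 2 y" using h(8) M(1)[of w] by (simp add: d_eq[OF yW] a_def b_def)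
  have b: "b < 0" using M0 h(7) by (simp add: b_def matrix_vector2 mult_pos_neg)
  have nN: "\<nu> \<bullet> N y = 0" unfolding \<nu> by (simp add: inner_add_left N_E)
  let ?c = "cross3 (E 1 y) (N y)"
  \<comment> \<open>The inward vector \<open>E 2 y\<close> has a negative product with
    \<open>?c\<close>, and the conormal has the negative coefficient b along \<open>E 2 y\<close>;
    hence both point to the same side of the boundary.\<close>
  have cE2: "?c \<bullet> E 2 y = - Ja y"
  proof -
    have "?c \<bullet> E 2 y = - (EE y \<bullet> N y)"
      unfolding EE_def by (simp add: cross3_simps)
    then show ?thesis using EE_N[OF yW] N_N[OF yW] by (metis inner_scaleR_left mult.right_neutral)
  qed
  have c\<nu>: "?c \<bullet> \<nu> = - b * Ja y"
    unfolding \<nu> inner_add_right using cE2 by (simp add: dot_cross_self)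
  define z where "z = ?c - (?c \<bullet> \<nu>) *\<^sub>R \<nu>"
  have z1: "z \<bullet> N y = 0" "z \<bullet> E 1 y = 0" by (simp_all add: z_def inner_diff_left nN n1 dot_cross_self)
  have nn: "\<nu> \<bullet> \<nu> = 1" using h(5) by (simp add: norm_eq_1)
  have "z \<bullet> \<nu> = 0" by (simp add: z_def inner_diff_left nn)
  then have "z \<bullet> E 2 y = 0" using z1 b unfolding \<nu> inner_add_right by simp
  then have "z = 0" using eq_zero_if_orthogonal[OF yW] z1 by blast
  then have cz: "?c = (?c \<bullet> \<nu>) *\<^sub>R \<nu>" by (simp add: z_def)
  have pos: "?c \<bullet> \<nu> > 0" unfolding c\<nu> using b Ja_pos[OF yW] by (simp add: mult_neg_pos)
  have "norm ?c = norm (E 1 y)"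
  proof -
    have "(norm ?c)\<^sup>2 = (norm (E 1 y))\<^sup>2" unfolding norm_cross using norm_N[OF yW] N_E by simp
    then show ?thesis by simp
  qed
  moreover have "norm ?c = ?c \<bullet> \<nu>" using cz pos h(5) by (metis abs_of_pos mult.right_neutral norm_scaleR)
  ultimately show ?thesis using cz by simp
qed

text \<open>The divergence theorem for g times the conormal field, tested against v. Minimality
  removes the divergence of the field itself and leaves the tangential part of the gradient of g;
  along the edge the conormal is the position vector.\<close>

lemma first_variation_chart:
  fixes g :: "real^3 \<Rightarrow> real" and w :: "real^3 \<Rightarrow> real^3"
  assumes min: "minimal_surface S"
    and con: "\<And>p. p \<in> surface_boundary S \<Longrightarrow> exterior_conormal S p p"
    and C: "compact C" "C \<subseteq> W"
    and g: "\<And>x. x \<in> S \<Longrightarrow> (g has_derivative (\<lambda>h. w x \<bullet> h)) (at x within S)" and w: "continuous_on S w"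
    and supp: "\<And>x. x \<in> S \<Longrightarrow> x \<notin> \<psi> ` (C \<inter> half_plane) \<Longrightarrow> g x = 0 \<and> w x = 0"
  shows "(\<integral>y. (if y \<in> HD then Ja y * (tan_proj y (w (\<psi> y)) \<bullet> v) else 0) \<partial>lborel) =
    (\<integral>t. (if bpt t \<in> W then norm (E 1 (bpt t)) * (g (\<psi> (bpt t)) * (\<psi> (bpt t) \<bullet> v)) else 0) \<partial>lborel)"
proof -
  define dG where "dG y h = w (\<psi> y) \<bullet> d\<psi> y h" for y h
  define dE where "dE i y h = h $ 1 *\<^sub>R partial_deriv (E i) 1 y + h $ 2 *\<^sub>R partial_deriv (E i) 2 y" for i y and h :: "real^2"
  define dN where "dN y h = h $ 1 *\<^sub>R partial_deriv N 1 y + h $ 2 *\<^sub>R partial_deriv N 2 y" for y and h :: "real^2"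
  define K1 where "K1 y = g (\<psi> y) * (cross3 (E 2 y) (N y) \<bullet> v)" for y
  define K2 where "K2 y = g (\<psi> y) * (cross3 (N y) (E 1 y) \<bullet> v)" for y
  define D1 where "D1 y h = g (\<psi> y) * ((cross3 (E 2 y) (dN y h) + cross3 (dE 2 y h) (N y)) \<bullet> v) + dG y h * (cross3 (E 2 y) (N y) \<bullet> v)" for y h
  define D2 where "D2 y h = g (\<psi> y) * ((cross3 (N y) (dE 1 y h) + cross3 (dN y h) (E 1 y)) \<bullet> v) + dG y h * (cross3 (N y) (E 1 y) \<bullet> v)" for y h
  have dG: "((\<lambda>z. g (\<psi> z)) has_derivative dG y) (at y within HD)" if y: "y \<in> HD" for y
    unfolding dG_def[abs_def] by (rule has_derivative_compose_chart[OF y g[OF chart_in[OF y]]])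
  have dE: "(E i has_derivative dE i y) (at y within HD)" if "y \<in> HD" for y i
    unfolding dE_def[abs_def] using has_derivative_E[of y i] that by (auto intro: has_derivative_at_withinI)
  have dN: "(N has_derivative dN y) (at y within HD)" if "y \<in> HD" for y
    unfolding dN_def[abs_def] using has_derivative_N[of y] that by (auto intro: has_derivative_at_withinI)
  have d1: "(K1 has_derivative D1 y) (at y within HD)" if y: "y \<in> HD" for y
    unfolding K1_def[abs_def] D1_def[abs_def]
    by (rule has_derivative_mult[OF dG[OF y] has_derivative_inner_left[OF
        bounded_bilinear.FDERIV[OF bounded_bilinear_cross3 dE[OF y] dN[OF y]]]])
  have d2: "(K2 has_derivative D2 y) (at y within HD)" if y: "y \<in> HD" for y
    unfolding K2_def[abs_def] D2_def[abs_def]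
    by (rule has_derivative_mult[OF dG[OF y] has_derivative_inner_left[OF
        bounded_bilinear.FDERIV[OF bounded_bilinear_cross3 dN[OF y] dE[OF y]]]])
  have sub: "HD \<subseteq> W" by auto
  have cg: "continuous_on HD (\<lambda>y. g (\<psi> y))"
    using dG has_derivative_continuous continuous_on_eq_continuous_within by blast
  have cw: "continuous_on HD (\<lambda>y. w (\<psi> y))"
    by (rule continuous_on_compose2[OF w continuous_chart]) (use chart_in in auto)
  note cs = continuous_on_subset[OF continuous_E sub] continuous_on_subset[OF continuous_E2 sub]
    continuous_on_subset[OF continuous_N sub] continuous_on_subset[OF continuous_partial_N sub]
  have axe: "dN y (axis i 1) = partial_deriv N i y" "dE j y (axis i 1) = partial_deriv (E j) i y" for y i j
    using exhaust_2[of i] by (auto simp: dN_def dE_def axis_def)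
  have axG: "dG y (axis i 1) = w (\<psi> y) \<bullet> E i y" if "y \<in> HD" for y i
    using that by (simp add: dG_def d_axis)
  have c1: "continuous_on HD (\<lambda>y. D1 y (axis 1 1))"
  proof -
    have "continuous_on HD (\<lambda>y. g (\<psi> y) * ((cross3 (E 2 y) (partial_deriv N 1 y) + cross3 (partial_deriv (E 2) 1 y) (N y)) \<bullet> v)
        + (w (\<psi> y) \<bullet> E 1 y) * (cross3 (E 2 y) (N y) \<bullet> v))"
      by (intro continuous_on_add continuous_on_mult continuous_on_inner continuous_on_cross cs cg cw continuous_on_const)
    then show ?thesis by (rule continuous_on_eq) (simp add: D1_def axe axG)
  qed
  have c2: "continuous_on HD (\<lambda>y. D2 y (axis 2 1))"
  proof -
    have "continuous_on HD (\<lambda>y. g (\<psi> y) * ((cross3 (N y) (partial_deriv (E 1) 2 y) + cross3 (partial_deriv N 2 y) (E 1 y)) \<bullet> v)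
        + (w (\<psi> y) \<bullet> E 2 y) * (cross3 (N y) (E 1 y) \<bullet> v))"
      by (intro continuous_on_add continuous_on_mult continuous_on_inner continuous_on_cross cs cg cw continuous_on_const)
    then show ?thesis by (rule continuous_on_eq) (simp add: D2_def axe axG)
  qed
  have van: "g (\<psi> y) = 0 \<and> w (\<psi> y) = 0" if y: "y \<in> HD" "y \<notin> C" for y
  proof (rule supp[OF chart_in[OF y(1)]])
    show "\<psi> y \<notin> \<psi> ` (C \<inter> half_plane)"
    proof
      assume "\<psi> y \<in> \<psi> ` (C \<inter> half_plane)"
      then obtain z where "z \<in> C \<inter> half_plane" "\<psi> y = \<psi> z" by blast
      then have "y = z" using inj_onD[OF inj_on_chart] y C by blast
      then show False using \<open>z \<in> C \<inter> half_plane\<close> y by simp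
    qed
  qed
  have "(\<integral>y. (if y \<in> HD then D1 y (axis 1 1) + D2 y (axis 2 1) else 0) \<partial>lborel) = - (\<integral>t. (if bpt t \<in> W then K2 (bpt t) else 0) \<partial>lborel)"
    by (rule half_plane_divergence_local[OF open_W C d1 d2 c1 c2])
      (use van in \<open>auto simp: K1_def K2_def D1_def D2_def axG\<close>)
  moreover have "(if y \<in> HD then D1 y (axis 1 1) + D2 y (axis 2 1) else 0) = (if y \<in> HD then Ja y * (tan_proj y (w (\<psi> y)) \<bullet> v) else 0)" for y
  proof (cases "y \<in> HD")
    case True
    then have yW: "y \<in> W" by simp
    have "D1 y (axis 1 1) + D2 y (axis 2 1) = g (\<psi> y) * ((cross3 (partial_deriv (E 2) 1 y) (N y) + cross3 (E 2 y) (partial_deriv N 1 y)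
    + (cross3 (partial_deriv N 2 y) (E 1 y) + cross3 (N y) (partial_deriv (E 1) 2 y))) \<bullet> v)
      + ((w (\<psi> y) \<bullet> E 1 y) *\<^sub>R cross3 (E 2 y) (N y) + (w (\<psi> y) \<bullet> E 2 y) *\<^sub>R cross3 (N y) (E 1 y)) \<bullet> v"
      using True by (simp add: D1_def D2_def axe axG inner_add_left algebra_simps)
    then show ?thesis
      unfolding divergence_free[OF yW minimal_trace[OF min True]] tan_proj_cross[OF yW] using True by simp
  qed auto
  moreover have "- (if bpt t \<in> W then K2 (bpt t) else 0) = (if bpt t \<in> W then norm (E 1 (bpt t)) * (g (\<psi> (bpt t)) * (\<psi> (bpt t) \<bullet> v)) else 0)" for t
  proof (cases "bpt t \<in> W")
    case True
    then have H: "bpt t \<in> HD" using bpt_half_plane by simp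
    have "\<psi> (bpt t) \<in> surface_boundary S" using surface_boundary_chart_iff[OF surface_chart_axioms H] by simp
    then have "cross3 (E 1 (bpt t)) (N (bpt t)) = norm (E 1 (bpt t)) *\<^sub>R \<psi> (bpt t)"
      by (intro conormal_eq[OF H]) (use con in auto)
    then show ?thesis using True by (simp add: K2_def cross_skew[of "N (bpt t)" "E 1 (bpt t)"])
  qed simp
  ultimately show ?thesis by (simp flip: Bochner_Integration.integral_minus)
qed

end

section \<open>The index form in terms of continuous integrands\<close>

context compact_surface
begin

text \<open>The sign is chosen arbitrarily at each point. \<open>tinner\<close> is quadratic in the
  normal, so it is continuous in spite of this choice.\<close>

definition "unormal x = (SOME n. norm n = 1 \<and> tangent_plane S x = {v. v \<bullet> n = 0})"
definition "tinner x w v = w \<bullet> v - (w \<bullet> unormal x) * (v \<bullet> unormal x)"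

lemma tinner_chart:
  assumes c: "local_param S W \<psi>" and y: "y \<in> W \<inter> half_plane"
  shows "tinner (\<psi> y) w v = surface_chart.tan_proj \<psi> y w \<bullet> v"
proof -
  interpret surface_chart S W \<psi> using c by (simp add: surface_chart_def)
  have yW: "y \<in> W" using y by simp
  let ?n = "unormal (\<psi> y)"
  have n: "norm ?n = 1 \<and> tangent_plane S (\<psi> y) = {v. v \<bullet> ?n = 0}"
    unfolding unormal_def by (rule someI[of _ "N y"]) (use norm_N[OF yW] tangent_plane_chart[OF y] in simp)
  have "v \<bullet> ?n = 0" if "v \<bullet> N y = 0" for v using n tangent_plane_chart[OF y] that by blast
  note a = unit_normals_agree[OF norm_N[OF yW] conjunct1[OF n] this]
  have "w \<bullet> ?n = (?n \<bullet> N y) * (w \<bullet> N y)" for w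
    using arg_cong[OF a(1), of "\<lambda>z. w \<bullet> z"] by simp
  then have "(w \<bullet> ?n) * (v \<bullet> ?n) = (?n \<bullet> N y)\<^sup>2 * ((w \<bullet> N y) * (v \<bullet> N y))"
    by (simp add: power2_eq_square)
  then have "(w \<bullet> ?n) * (v \<bullet> ?n) = (w \<bullet> N y) * (v \<bullet> N y)" by (simp add: a(2))
  then show ?thesis by (simp add: tinner_def tan_proj_def inner_diff_left inner_commute[of v "N y"])
qed

lemma continuous_on_tinner:
  assumes w: "continuous_on S w" shows "continuous_on S (\<lambda>x. tinner x (w x) v)"
proof (rule continuous_on_surfaceI[OF embedded_S])
  fix W \<psi> assume c: "local_param S W \<psi>"
  interpret surface_chart S W \<psi> using c by (simp add: surface_chart_def)
  have "continuous_on HD (\<lambda>y. w (\<psi> y))" by (rule continuous_on_compose2[OF w continuous_chart]) (use chart_in in auto)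
  moreover have "continuous_on HD N" by (rule continuous_on_subset[OF continuous_N]) auto
  ultimately have "continuous_on HD (\<lambda>y. tan_proj y (w (\<psi> y)) \<bullet> v)"
    unfolding tan_proj_def by (intro continuous_intros)
  then show "continuous_on HD (\<lambda>y. tinner (\<psi> y) (w (\<psi> y)) v)"
    by (rule continuous_on_eq) (simp add: tinner_chart[OF c])
qed

lemma tinner_linear:
  "tinner x (w + w') v = tinner x w v + tinner x w' v" "tinner x (c *\<^sub>R w) v = c * tinner x w v" "tinner x 0 v = 0"
  by (simp_all add: tinner_def inner_add_left algebra_simps)

lemma tinner_sum: "tinner x (\<Sum>i\<in>I. w i) v = (\<Sum>i\<in>I. tinner x (w i) v)"
  by (induction I rule: infinite_finite_induct) (simp_all add: tinner_linear)

lemma second_form_continuous: "continuous_on S (second_form_norm2 S)"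
proof (rule continuous_on_surfaceI[OF embedded_S])
  fix W \<psi> assume c: "local_param S W \<psi>"
  interpret surface_chart S W \<psi> using c by (simp add: surface_chart_def)
  let ?g = "\<lambda>i j y. first_fundamental_form \<psi> y $ i $ j" and ?h = "\<lambda>i j y. second_fundamental_form \<psi> y $ i $ j"
  have cg: "continuous_on HD (?g i j)" for i j
    unfolding first_fundamental_form_def
    by (simp, intro continuous_on_inner continuous_on_subset[OF continuous_E]) auto
  have ch: "continuous_on HD (?h i j)" for i j
    unfolding second_fundamental_form_def
    by (simp, intro continuous_on_inner continuous_on_subset[OF continuous_E2] continuous_on_subset[OF continuous_N]) auto
  define d where "d y = (Ja y)\<^sup>2" for y
  have cd: "continuous_on HD d" unfolding d_def by (intro continuous_on_power continuous_on_subset[OF continuous_Ja]) auto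
  have d0: "d y \<noteq> 0" if "y \<in> HD" for y using EE_nonzero that by (simp add: d_def)
  \<comment> \<open>Cramer's rule for the matrix equation \<open>first_form_shape\<close>. The
    determinant d is nowhere zero, so the entries of the shape operator are continuous.\<close>
  have sh: "Sh y $ 1 $ j = (?g 2 2 y * ?h 1 j y - ?g 1 2 y * ?h 2 j y) / d y"
    "Sh y $ 2 $ j = (?g 1 1 y * ?h 2 j y - ?g 2 1 y * ?h 1 j y) / d y" if y: "y \<in> HD" for y j
  proof -
    have e: "?h i j y = ?g i 1 y * Sh y $ 1 $ j + ?g i 2 y * Sh y $ 2 $ j" for i
      using first_form_shape[of y] y matrix_mult2[of "first_fundamental_form \<psi> y" "Sh y" i j] by simp
    have dd: "d y = ?g 1 1 y * ?g 2 2 y - ?g 1 2 y * ?g 2 1 y"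
      unfolding d_def det_first_form[symmetric] det_2 ..
    show "Sh y $ 1 $ j = (?g 2 2 y * ?h 1 j y - ?g 1 2 y * ?h 2 j y) / d y"
      "Sh y $ 2 $ j = (?g 1 1 y * ?h 2 j y - ?g 2 1 y * ?h 1 j y) / d y"
      using d0[OF y] unfolding e[of 1] e[of 2] by (simp_all add: eq_divide_eq dd algebra_simps)
  qed
  have cs: "continuous_on HD (\<lambda>y. Sh y $ i $ j)" for i j
  proof -
    have c12: "continuous_on HD (\<lambda>y. (?g 2 2 y * ?h 1 j y - ?g 1 2 y * ?h 2 j y) / d y)"
      "continuous_on HD (\<lambda>y. (?g 1 1 y * ?h 2 j y - ?g 2 1 y * ?h 1 j y) / d y)"
      by (intro continuous_on_divide continuous_on_diff continuous_on_mult cg ch cd; use d0 in blast)+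
    have "continuous_on HD (\<lambda>y. Sh y $ 1 $ j)" by (rule continuous_on_eq[OF c12(1)]) (simp add: sh)
    moreover have "continuous_on HD (\<lambda>y. Sh y $ 2 $ j)" by (rule continuous_on_eq[OF c12(2)]) (simp add: sh)
    ultimately show ?thesis using exhaust_2[of i] by auto
  qed
  have "continuous_on HD (\<lambda>y. trace (Sh y ** Sh y))"
    unfolding trace2 matrix_mult2 by (intro continuous_on_add continuous_on_mult cs)
  then show "continuous_on HD (\<lambda>y. second_form_norm2 S (\<psi> y))"
    by (rule continuous_on_eq) (simp add: second_form_norm2_chart)
qed

lemma index_form_eq:
  assumes u: "u \<in> smooth_functions S"
  shows "index_form S u = aint (\<lambda>x. (norm (surface_gradient S u x))\<^sup>2 - second_form_norm2 S x * (u x)\<^sup>2) - lint (\<lambda>x. (u x)\<^sup>2)"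
    "continuous_on S (\<lambda>x. (norm (surface_gradient S u x))\<^sup>2)" "continuous_on S u"
proof -
  have z: "u x = 0" if "x \<notin> S" for x using u that by (auto simp: smooth_functions_def)
  show cu: "continuous_on S u"
    by (rule continuous_on_surfaceI[OF embedded_S]) (use surface_chart.smooth_function_chart(2)[OF _ u] in \<open>simp add: surface_chart_def\<close>)
  have "continuous_on S (surface_gradient S u)"
    by (rule continuous_on_surfaceI[OF embedded_S]) (use surface_chart.smooth_function_chart(1)[OF _ u] in \<open>simp add: surface_chart_def\<close>)
  then show cg: "continuous_on S (\<lambda>x. (norm (surface_gradient S u x))\<^sup>2)"
    by (intro continuous_intros)
  have tp: "tangent_plane S x = {}" if x: "x \<notin> S" for x
  proof -
    have "\<psi> y \<in> S" if "local_param S W \<psi>" "y \<in> W \<inter> half_plane" for W \<psi> y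
      using surface_chart.chart_in[of S W \<psi> y] that by (simp add: surface_chart_def)
    then show ?thesis using x unfolding tangent_plane_def by blast
  qed
  \<comment> \<open>Off S the tangent plane is empty, the description of the gradient has no
    solution, and its value is one fixed vector. The integrand is then constant off S, as
    \<open>aint_eqI\<close> allows.\<close>
  have g: "surface_gradient S u x = (THE v. False)" if "x \<notin> S" for x
    using tp[OF that] by (simp add: surface_gradient_def)
  have c: "continuous_on S (\<lambda>x. (norm (surface_gradient S u x))\<^sup>2 - second_form_norm2 S x * (u x)\<^sup>2)"
    by (intro continuous_intros cg second_form_continuous cu)
  have 1: "(\<integral>p. (norm (surface_gradient S u p))\<^sup>2 - second_form_norm2 S p * (u p)\<^sup>2 \<partial>area) =
    aint (\<lambda>x. (norm (surface_gradient S u x))\<^sup>2 - second_form_norm2 S x * (u x)\<^sup>2)"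
    by (rule aint_eqI(1)[OF c, where c = "(norm (THE v::real^3. False))\<^sup>2"]) (simp_all add: z g)
  have 2: "(\<integral>p. (u p)\<^sup>2 \<partial>len) = lint (\<lambda>x. (u x)\<^sup>2)"
    by (rule aint_eqI(2)[where c = 0]) (use cu z in \<open>auto intro!: continuous_intros\<close>)
  show "index_form S u = aint (\<lambda>x. (norm (surface_gradient S u x))\<^sup>2 - second_form_norm2 S x * (u x)\<^sup>2) - lint (\<lambda>x. (u x)\<^sup>2)"
    unfolding index_form_def 1 2 ..
qed

end

text \<open>Source of the cut-off functions: the square of the positive part is continuously
  differentiable, and the first variation formula involves first derivatives only.\<close>

lemma DERIV_max0_square: "((\<lambda>t::real. (max 0 t)\<^sup>2) has_real_derivative 2 * max 0 t) (at t)"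
proof -
  consider "t > 0" | "t < 0" | "t = 0" by linarith
  then show ?thesis
  proof cases
    case 1
    have "((\<lambda>t::real. t\<^sup>2) has_real_derivative 2 * max 0 t) (at t)" using 1 by (auto intro!: derivative_eq_intros)
    then show ?thesis
      by (rule has_field_derivative_transform_within_open[of _ _ _ "{0<..}"]) (use 1 in auto)
  next
    case 2
    have "((\<lambda>t::real. 0) has_real_derivative 2 * max 0 t) (at t)" using 2 by (auto intro!: derivative_eq_intros)
    then show ?thesis
      by (rule has_field_derivative_transform_within_open[of _ _ _ "{..<0}"]) (use 2 in auto)
  next
    case 3
    have "((\<lambda>h::real. (max 0 h)\<^sup>2 / h) \<longlongrightarrow> 0) (at 0)"
    proof (rule tendsto_sandwich[of "\<lambda>h. - \<bar>h\<bar>" _ _ "\<lambda>h. \<bar>h\<bar>"])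
      have "(max 0 h)\<^sup>2 / h = max 0 h" for h :: real by (auto simp: max_def power2_eq_square)
      then show "\<forall>\<^sub>F h in at 0. - \<bar>h\<bar> \<le> (max 0 h)\<^sup>2 / (h::real)" "\<forall>\<^sub>F h in at 0. (max 0 h)\<^sup>2 / (h::real) \<le> \<bar>h\<bar>"
        by (auto simp: max_def)
    qed (auto intro!: tendsto_eq_intros)
    then show ?thesis using 3 by (simp add: DERIV_def)
  qed
qed

section \<open>First variation on the whole surface and affine test functions\<close>

locale fb_surface =
  fixes S :: "(real^3) set"
  assumes fb: "free_boundary_minimal_surface S"
begin

sublocale compact_surface S
  by standard (use fb in \<open>auto simp: free_boundary_minimal_surface_def\<close>)

lemma minimal: "minimal_surface S" and connected_S: "connected S" and nonempty_S: "S \<noteq> {}"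
  and in_ball: "S \<subseteq> cball 0 1" and boundary_sphere: "surface_boundary S \<subseteq> sphere 0 1"
  and conormal: "p \<in> surface_boundary S \<Longrightarrow> exterior_conormal S p p"
  using fb by (auto simp: free_boundary_minimal_surface_def)

text \<open>Passage from the parameters to the measures on S. Since g and w vanish off the image of
  C, integrals over one chart are integrals over S and over its boundary.\<close>

lemma first_variation_local:
  assumes c: "local_param S W \<psi>" and C: "compact C" "C \<subseteq> W"
    and g: "\<And>x. x \<in> S \<Longrightarrow> (g has_derivative (\<lambda>h. w x \<bullet> h)) (at x within S)" and w: "continuous_on S w"
    and supp: "\<And>x. x \<in> S \<Longrightarrow> x \<notin> \<psi> ` (C \<inter> half_plane) \<Longrightarrow> g x = 0 \<and> w x = 0"
  shows "aint (\<lambda>x. tinner x (w x) v) = lint (\<lambda>x. g x * (x \<bullet> v))"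
proof -
  interpret surface_chart S W \<psi> using c by (simp add: surface_chart_def)
  have cg: "continuous_on S g" using g has_derivative_continuous continuous_on_eq_continuous_within by blast
  have sub: "\<psi> ` (C \<inter> half_plane) \<subseteq> \<psi> ` HD" using C by auto
  have "aint (\<lambda>x. tinner x (w x) v) = (\<integral>y. (if y \<in> HD then Ja y * tinner (\<psi> y) (w (\<psi> y)) v else 0) \<partial>lborel)"
  proof (rule aint_chart[OF c continuous_on_tinner[OF w]], rule AE_I2, intro impI)
    fix x assume "x \<in> S - \<psi> ` HD"
    then have "w x = 0" using supp[of x] sub by blast
    then show "tinner x (w x) v = 0" by (simp add: tinner_linear)
  qed
  also have "\<dots> = (\<integral>y. (if y \<in> HD then Ja y * (tan_proj y (w (\<psi> y)) \<bullet> v) else 0) \<partial>lborel)"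
    by (rule Bochner_Integration.integral_cong) (auto simp: tinner_chart[OF c])
  also have "\<dots> = (\<integral>t. (if bpt t \<in> W then norm (E 1 (bpt t)) * (g (\<psi> (bpt t)) * (\<psi> (bpt t) \<bullet> v)) else 0) \<partial>lborel)"
    by (rule first_variation_chart[OF minimal conormal C g w supp])
  also have "\<dots> = lint (\<lambda>x. g x * (x \<bullet> v))"
  proof (rule lint_chart[OF c, symmetric])
    show "continuous_on S (\<lambda>x. g x * (x \<bullet> v))" by (intro continuous_intros cg)
    have "g x = 0" if x: "x \<in> surface_boundary S" "x \<notin> (\<lambda>t. \<psi> (bpt t)) ` {t. bpt t \<in> W}" for x
    proof -
      have xS: "x \<in> S" using x boundary_subset by auto
      have "x \<notin> \<psi> ` (C \<inter> half_plane)"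
      proof
        assume "x \<in> \<psi> ` (C \<inter> half_plane)"
        then obtain y where y: "y \<in> HD" "x = \<psi> y" using C by auto
        then have "y $ 2 = 0" using surface_boundary_chart_iff[OF surface_chart_axioms y(1)] x(1) by simp
        then have "x = \<psi> (bpt (y $ 1))" "bpt (y $ 1) \<in> W" using y bpt_of[of y] by auto
        then show False using x(2) by blast
      qed
      then show ?thesis using supp[OF xS] by simp
    qed
    then show "AE x in len. x \<in> surface_boundary S - (\<lambda>t. \<psi> (bpt t)) ` {t. bpt t \<in> W} \<longrightarrow> g x * (x \<bullet> v) = 0" by simp
  qed
  finally show ?thesis .
qed

text \<open>Localization by cut-off functions. Instead of normalizing the cut-offs to a partition of
  unity, g is divided by their sum B, so that g is the sum of the products
  \<open>b p x * q x\<close>, each supported in one chart.\<close>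

lemma first_variation:
  assumes g: "\<And>x. x \<in> S \<Longrightarrow> (g has_derivative (\<lambda>h. w x \<bullet> h)) (at x within S)" and w: "continuous_on S w"
  shows "aint (\<lambda>x. tinner x (w x) v) = lint (\<lambda>x. g x * (x \<bullet> v))"
proof -
  have "\<exists>e W \<psi> C. e > 0 \<and> local_param S W \<psi> \<and> compact C \<and> C \<subseteq> W \<and> (\<forall>x\<in>S. dist x p < e \<longrightarrow> x \<in> \<psi> ` (C \<inter> half_plane))"
    if "p \<in> S" for p
  proof -
    obtain W \<psi> y where c: "local_param S W \<psi>" "y \<in> W \<inter> half_plane" "p = \<psi> y"
      using \<open>p \<in> S\<close> embedded_S unfolding embedded_surface_def by blast
    interpret surface_chart S W \<psi> using c by (simp add: surface_chart_def)
    obtain r where r: "r > 0" "cball y r \<subseteq> W" using open_W c(2) open_contains_cball by blast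
    obtain d where d: "d > 0" "\<And>x. x \<in> S \<Longrightarrow> dist x (\<psi> y) < d \<Longrightarrow> x \<in> \<psi> ` HD \<and> dist (inv_chart x) y < r"
      using near_image[OF c(2) r(1)] by metis
    have "x \<in> \<psi> ` (cball y r \<inter> half_plane)" if "x \<in> S" "dist x p < d" for x
    proof -
      have "x \<in> \<psi> ` HD" "dist (inv_chart x) y < r" using d(2)[of x] that c(3) by auto
      then have "inv_chart x \<in> cball y r \<inter> half_plane" "\<psi> (inv_chart x) = x"
        using inv_chart_in[of x] by (auto simp: dist_commute)
      then show ?thesis by force
    qed
    then show ?thesis using d(1) c(1) r(2) compact_cball by blast
  qed
  then have "\<forall>p\<in>S. \<exists>e W \<psi> C. e > 0 \<and> local_param S W \<psi> \<and> compact C \<and> C \<subseteq> W \<and> (\<forall>x\<in>S. dist x p < e \<longrightarrow> x \<in> \<psi> ` (C \<inter> half_plane))"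
    by blast
  from bchoice[OF this] obtain e where "\<forall>p\<in>S. \<exists>W \<psi> C. e p > 0 \<and> local_param S W \<psi> \<and> compact C \<and> C \<subseteq> W \<and> (\<forall>x\<in>S. dist x p < e p \<longrightarrow> x \<in> \<psi> ` (C \<inter> half_plane))"
    by blast
  from bchoice[OF this] obtain W where "\<forall>p\<in>S. \<exists>\<psi> C. e p > 0 \<and> local_param S (W p) \<psi> \<and> compact C \<and> C \<subseteq> W p \<and> (\<forall>x\<in>S. dist x p < e p \<longrightarrow> x \<in> \<psi> ` (C \<inter> half_plane))"
    by blast
  from bchoice[OF this] obtain \<psi> where "\<forall>p\<in>S. \<exists>C. e p > 0 \<and> local_param S (W p) (\<psi> p) \<and> compact C \<and> C \<subseteq> W p \<and> (\<forall>x\<in>S. dist x p < e p \<longrightarrow> x \<in> \<psi> p ` (C \<inter> half_plane))"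
    by blast
  from bchoice[OF this] obtain C where cov': "\<forall>p\<in>S. e p > 0 \<and> local_param S (W p) (\<psi> p) \<and> compact (C p) \<and> C p \<subseteq> W p \<and> (\<forall>x\<in>S. dist x p < e p \<longrightarrow> x \<in> \<psi> p ` (C p \<inter> half_plane))"
    by blast
  have cov: "\<And>p. p \<in> S \<Longrightarrow> e p > 0" "\<And>p. p \<in> S \<Longrightarrow> local_param S (W p) (\<psi> p)"
    "\<And>p. p \<in> S \<Longrightarrow> compact (C p)" "\<And>p. p \<in> S \<Longrightarrow> C p \<subseteq> W p"
    "\<And>p x. p \<in> S \<Longrightarrow> x \<in> S \<Longrightarrow> dist x p < e p \<Longrightarrow> x \<in> \<psi> p ` (C p \<inter> half_plane)"
    using cov' by blast+
  obtain P where P: "P \<subseteq> S" "finite P" "S \<subseteq> (\<Union>p\<in>P. ball p (e p))"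
    by (rule compactE_image[OF compact_S, of S "\<lambda>p. ball p (e p)"]) (use cov(1) in force)+
  \<comment> \<open>Positive exactly inside the ball of radius \<open>e p\<close> about p, within
    which S is covered by the compact part \<open>C p\<close> of one chart.\<close>
  define m where "m p x = max 0 ((e p)\<^sup>2 - (x - p) \<bullet> (x - p))" for p x :: "real^3"
  define b where "b p x = (m p x)\<^sup>2" for p x
  define db where "db p x = (- 4 * m p x) *\<^sub>R (x - p)" for p x
  have b: "(b p has_derivative (\<lambda>h. db p x \<bullet> h)) (at x within S)" for p x
  proof -
    have 1: "((\<lambda>x. (e p)\<^sup>2 - (x - p) \<bullet> (x - p)) has_derivative (\<lambda>h. - 2 * ((x - p) \<bullet> h))) (at x within S)"
      by (auto intro!: derivative_eq_intros simp: inner_commute)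
    have 2: "((\<lambda>t::real. (max 0 t)\<^sup>2) has_derivative (\<lambda>k. 2 * max 0 ((e p)\<^sup>2 - (x - p) \<bullet> (x - p)) * k)) (at ((e p)\<^sup>2 - (x - p) \<bullet> (x - p)))"
      using DERIV_max0_square unfolding has_field_derivative_def by auto
    show ?thesis unfolding b_def m_def db_def
      by (rule has_derivative_eq_rhs[OF has_derivative_compose[OF 1 2]]) (simp add: fun_eq_iff)
  qed
  have cb: "continuous_on S (b p)" "continuous_on S (db p)" for p
    unfolding b_def db_def m_def by (intro continuous_intros)+
  have far: "b p x = 0 \<and> db p x = 0" if "p \<in> P" "\<not> dist x p < e p" for p x
  proof -
    have "(e p)\<^sup>2 \<le> (dist x p)\<^sup>2" using that P(1) cov(1)[of p] by (intro power_mono) auto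
    then have "m p x = 0" by (simp add: m_def dist_norm power2_norm_eq_inner)
    then show ?thesis by (simp add: b_def db_def)
  qed
  define B where "B x = (\<Sum>p\<in>P. b p x)" for x
  define dB where "dB x = (\<Sum>p\<in>P. db p x)" for x
  have Bpos: "B x > 0" if x: "x \<in> S" for x
  proof -
    obtain p where p: "p \<in> P" "dist x p < e p" using P(3) x by (auto simp: dist_commute)
    have "(dist x p)\<^sup>2 < (e p)\<^sup>2" using p by (intro power_strict_mono) auto
    then have "b p x > 0" by (simp add: b_def m_def dist_norm power2_norm_eq_inner)
    then show ?thesis unfolding B_def using p P(2) by (intro sum_pos2) (auto simp: b_def)
  qed
  have dBd: "(B has_derivative (\<lambda>h. dB x \<bullet> h)) (at x within S)" for x
    unfolding B_def dB_def inner_sum_left by (rule has_derivative_sum) (rule b)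
  have cB: "continuous_on S B" "continuous_on S dB" unfolding B_def dB_def by (intro continuous_on_sum cb)+
  define q where "q x = g x / B x" for x
  define dq where "dq x = (1 / B x) *\<^sub>R w x - (g x / (B x * B x)) *\<^sub>R dB x" for x
  have dqd: "(q has_derivative (\<lambda>h. dq x \<bullet> h)) (at x within S)" if x: "x \<in> S" for x
    unfolding q_def[abs_def] dq_def
    by (rule has_derivative_eq_rhs[OF has_derivative_divide'[OF g[OF x] dBd]])
      (use Bpos[OF x] in \<open>auto simp: fun_eq_iff inner_diff_left field_simps\<close>)
  have cg: "continuous_on S g" using g has_derivative_continuous continuous_on_eq_continuous_within by blast
  have cq: "continuous_on S q" "continuous_on S dq" unfolding q_def dq_def
    by (intro continuous_intros cg cB w; use Bpos in force)+
  have loc: "aint (\<lambda>x. tinner x (b p x *\<^sub>R dq x + q x *\<^sub>R db p x) v) = lint (\<lambda>x. (b p x * q x) * (x \<bullet> v))" if p: "p \<in> P" for p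
  proof (rule first_variation_local)
    have pS: "p \<in> S" using p P by auto
    show "local_param S (W p) (\<psi> p)" "compact (C p)" "C p \<subseteq> W p" using cov pS by auto
    show "((\<lambda>x. b p x * q x) has_derivative (\<bullet>) (b p x *\<^sub>R dq x + q x *\<^sub>R db p x)) (at x within S)" if "x \<in> S" for x
      by (rule has_derivative_eq_rhs[OF has_derivative_mult[OF b dqd[OF that]]])
        (simp add: fun_eq_iff inner_add_left algebra_simps)
    show "continuous_on S (\<lambda>x. b p x *\<^sub>R dq x + q x *\<^sub>R db p x)" by (intro continuous_intros cb cq)
    show "b p x * q x = 0 \<and> b p x *\<^sub>R dq x + q x *\<^sub>R db p x = 0" if "x \<in> S" "x \<notin> \<psi> p ` (C p \<inter> half_plane)" for x
    proof -
      have "\<not> dist x p < e p" using cov(5)[OF pS that(1)] that(2) by blast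
      from far[OF p this] show ?thesis by simp
    qed
  qed
  have "aint (\<lambda>x. tinner x (w x) v) = aint (\<lambda>x. \<Sum>p\<in>P. tinner x (b p x *\<^sub>R dq x + q x *\<^sub>R db p x) v)"
  proof (rule int_cong(1))
    fix x assume x: "x \<in> S"
    have "(\<Sum>p\<in>P. b p x *\<^sub>R dq x + q x *\<^sub>R db p x) = B x *\<^sub>R dq x + q x *\<^sub>R dB x"
      by (simp add: sum.distrib B_def dB_def scaleR_sum_left scaleR_sum_right)
    also have "\<dots> = w x" using Bpos[OF x] by (simp add: dq_def q_def scaleR_diff_right)
    finally show "tinner x (w x) v = (\<Sum>p\<in>P. tinner x (b p x *\<^sub>R dq x + q x *\<^sub>R db p x) v)"
      by (simp flip: tinner_sum)
  qed
  also have "\<dots> = (\<Sum>p\<in>P. aint (\<lambda>x. tinner x (b p x *\<^sub>R dq x + q x *\<^sub>R db p x) v))"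
    by (rule int_sum(1)) (intro continuous_on_tinner continuous_intros cb cq)
  also have "\<dots> = (\<Sum>p\<in>P. lint (\<lambda>x. (b p x * q x) * (x \<bullet> v)))" by (rule sum.cong) (use loc in auto)
  also have "\<dots> = lint (\<lambda>x. \<Sum>p\<in>P. (b p x * q x) * (x \<bullet> v))"
    by (rule int_sum(2)[symmetric]) (intro continuous_intros cb cq)
  also have "\<dots> = lint (\<lambda>x. g x * (x \<bullet> v))"
  proof (rule int_cong(2))
    fix x assume x: "x \<in> S"
    have "(\<Sum>p\<in>P. (b p x * q x) * (x \<bullet> v)) = B x * q x * (x \<bullet> v)" by (simp add: B_def sum_distrib_right)
    then show "(\<Sum>p\<in>P. (b p x * q x) * (x \<bullet> v)) = g x * (x \<bullet> v)" using Bpos[OF x] by (simp add: q_def)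
  qed
  finally show ?thesis .
qed

text \<open>The first variation formula with g = 1, and with g the linear function
  \<open>x \<bullet> v\<close> itself.\<close>

lemma coordinate_identities:
  "lint (\<lambda>x. x \<bullet> v) = 0" "aint (\<lambda>x. tinner x v v) = lint (\<lambda>x. (x \<bullet> v)\<^sup>2)"
proof -
  have "aint (\<lambda>x. tinner x 0 v) = lint (\<lambda>x. 1 * (x \<bullet> v))"
    by (rule first_variation[where w = "\<lambda>x. 0"]) (auto intro!: continuous_intros)
  then show "lint (\<lambda>x. x \<bullet> v) = 0" by (simp add: tinner_linear zext_def[of "\<lambda>x. 0", abs_def])
  have "aint (\<lambda>x. tinner x v v) = lint (\<lambda>x. (x \<bullet> v) * (x \<bullet> v))"
    by (rule first_variation) (auto intro!: continuous_intros derivative_eq_intros simp: inner_commute)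
  then show "aint (\<lambda>x. tinner x v v) = lint (\<lambda>x. (x \<bullet> v)\<^sup>2)" by (simp add: power2_eq_square)
qed

text \<open>The gradient term equals the boundary integral of the square of
  \<open>x \<bullet> v\<close> and cancels it; the mixed term vanishes because the boundary integral
  of \<open>x \<bullet> v\<close> is 0. The curvature term and the constant survive.\<close>

lemma index_form_affine:
  assumes u: "u = (\<lambda>x. if x \<in> S then c + x \<bullet> v else 0)" "u \<in> smooth_functions S"
  shows "index_form S u = - aint (\<lambda>x. second_form_norm2 S x * (c + x \<bullet> v)\<^sup>2) - c\<^sup>2 * lint (\<lambda>x. 1)"
proof -
  have grad: "(norm (surface_gradient S u x))\<^sup>2 = tinner x v v" if x: "x \<in> S" for x
  proof -
    obtain W \<psi> y where c: "local_param S W \<psi>" "y \<in> W \<inter> half_plane" "x = \<psi> y"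
      using x embedded_S unfolding embedded_surface_def by blast
    interpret surface_chart S W \<psi> using c by (simp add: surface_chart_def)
    have d: "((\<lambda>x. c + x \<bullet> v) has_derivative (\<lambda>h. v \<bullet> h)) (at (\<psi> y))"
      by (auto intro!: derivative_eq_intros simp: inner_commute)
    have "surface_gradient S u (\<psi> y) = tan_proj y v"
      by (rule surface_gradient_ambient(1)[OF c(2) open_UNIV UNIV_I d]) (simp add: u)
    then show ?thesis
      using tan_proj_inner[of y v v] c(2)
      by (simp add: c(3) tinner_chart[OF c(1,2)] power2_norm_eq_inner tan_proj_def[of y v] inner_diff_left inner_diff_right inner_commute)
  qed
  have ct: "continuous_on S (\<lambda>x. tinner x v v)" by (intro continuous_on_tinner continuous_intros)
  have cA: "continuous_on S (\<lambda>x. second_form_norm2 S x * (c + x \<bullet> v)\<^sup>2)"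
    by (intro continuous_intros second_form_continuous)
  have "index_form S u = aint (\<lambda>x. tinner x v v - second_form_norm2 S x * (c + x \<bullet> v)\<^sup>2) - lint (\<lambda>x. (c + x \<bullet> v)\<^sup>2)"
    unfolding index_form_eq(1)[OF u(2)]
    by (intro arg_cong2[where f = "(-)"] int_cong) (simp_all add: grad, simp_all add: u(1))
  also have "\<dots> = lint (\<lambda>x. (x \<bullet> v)\<^sup>2) - aint (\<lambda>x. second_form_norm2 S x * (c + x \<bullet> v)\<^sup>2) - lint (\<lambda>x. (c + x \<bullet> v)\<^sup>2)"
    unfolding int_diff(1)[OF ct cA] coordinate_identities(2) ..
  also have "lint (\<lambda>x. (c + x \<bullet> v)\<^sup>2) = lint (\<lambda>x. c\<^sup>2 * 1 + ((2 * c) * (x \<bullet> v) + (x \<bullet> v)\<^sup>2))"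
    by (rule int_cong(2)) (simp add: power2_eq_square algebra_simps)
  also have "\<dots> = c\<^sup>2 * lint (\<lambda>x. 1) + ((2 * c) * lint (\<lambda>x. x \<bullet> v) + lint (\<lambda>x. (x \<bullet> v)\<^sup>2))"
    by (subst int_add(2), (intro continuous_intros)+, subst int_add(2), (intro continuous_intros)+, simp only: int_scale(2))
  finally show ?thesis by (simp add: coordinate_identities(1))
qed

text \<open>On the unit sphere 1 is the sum of the squared coordinates, whose boundary integrals are
  area integrals by \<open>coordinate_identities\<close>. Their sum is the integral of the trace of
  the tangential projection, which is 2. The length is thus twice the area, and in particular the
  boundary is not empty.\<close>

lemma length_pos: "lint (\<lambda>x. 1) > 0"
proof -
  have "lint (\<lambda>x. 1) = lint (\<lambda>x. \<Sum>b\<in>Basis. (x \<bullet> b)\<^sup>2)"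
  proof (rule lint_cong_boundary)
    fix x assume "x \<in> surface_boundary S"
    then have "norm x = 1" using boundary_sphere by auto
    then have "x \<bullet> x = 1" by (simp add: norm_eq_1)
    then show "1 = (\<Sum>b\<in>Basis. (x \<bullet> b)\<^sup>2)" by (subst (asm) euclidean_inner) (simp add: power2_eq_square)
  qed (intro continuous_intros)+
  also have "\<dots> = (\<Sum>b\<in>Basis. lint (\<lambda>x. (x \<bullet> b)\<^sup>2))" by (rule int_sum(2)) (intro continuous_intros)
  also have "\<dots> = (\<Sum>b\<in>Basis. aint (\<lambda>x. tinner x b b))" by (simp add: coordinate_identities(2))
  also have "\<dots> = aint (\<lambda>x. \<Sum>b\<in>Basis. tinner x b b)"
    by (rule int_sum(1)[symmetric]) (intro continuous_on_tinner continuous_intros)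
  also have "\<dots> = aint (\<lambda>x. 2)"
  proof (rule int_cong(1))
    fix x assume "x \<in> S"
    then obtain W \<psi> y where c: "local_param S W \<psi>" "y \<in> W \<inter> half_plane" "x = \<psi> y"
      using embedded_S unfolding embedded_surface_def by blast
    interpret surface_chart S W \<psi> using c by (simp add: surface_chart_def)
    have "(\<Sum>b\<in>Basis. tinner x b b) = (\<Sum>b\<in>Basis. 1 - (N y \<bullet> b) * (N y \<bullet> b))"
      unfolding c(3) by (rule sum.cong) (auto simp: tinner_chart[OF c(1,2)] tan_proj_def inner_diff_right inner_commute)
    also have "\<dots> = 3 - N y \<bullet> N y" by (subst euclidean_inner[of "N y"]) (simp add: sum_subtractf)
    also have "\<dots> = 2" using N_N c(2) by simp
    finally show "(\<Sum>b\<in>Basis. tinner x b b) = 2" .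
  qed
  also have "\<dots> > 0" using nonempty_S by (auto intro!: aint_pos continuous_intros)
  finally show ?thesis .
qed

end

section \<open>Rigidity of totally geodesic surfaces\<close>

context fb_surface
begin

text \<open>With zero shape operators the normal is locally constant, so by connectedness S lies in
  one affine plane. At a boundary point the position vector is the conormal, hence tangent, so this
  plane passes through the origin. Inside the open ball S is closed in the plane and, by invariance
  of domain, also open, hence all of the open disk.\<close>

lemma flat_if_totally_geodesic:
  assumes A0: "\<And>x. x \<in> S \<Longrightarrow> second_form_norm2 S x = 0"
  shows "flat_disk_through_origin S"
proof -
  \<comment> \<open>The last clause ranges over all n with the given tangent plane, so that a normal
    fixed later at one boundary point can be used at every point of S.\<close>
  have loc: "\<exists>T. openin (top_of_set S) T \<and> p \<in> T \<and> (\<forall>x\<in>T. tangent_plane S x = tangent_plane S p) \<and>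
      (\<forall>n. tangent_plane S p = {v. v \<bullet> n = 0} \<longrightarrow> (\<forall>x\<in>T. x \<bullet> n = p \<bullet> n))" if p: "p \<in> S" for p
  proof -
    obtain W \<psi> y where c: "local_param S W \<psi>" "y \<in> W \<inter> half_plane" "p = \<psi> y"
      using p embedded_S unfolding embedded_surface_def by blast
    interpret surface_chart S W \<psi> using c by (simp add: surface_chart_def)
    obtain r where r: "r > 0" "ball y r \<subseteq> W" using open_W c(2) openE by blast
    let ?K = "ball y r \<inter> half_plane"
    have sub: "?K \<subseteq> HD" using r by auto
    have conv: "convex ?K"
    proof -
      have "convex half_plane" unfolding half_plane_def
        using convex_halfspace_ge[of 0 "axis 2 1 :: real^2"] by (simp add: inner_axis')
      then show ?thesis by (intro convex_Int) auto
    qed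
    have Sh0: "Sh z = 0" if "z \<in> HD" for z
      using shape_trace_square(2)[of z] minimal_trace[OF minimal that] A0[OF chart_in[OF that]]
        second_form_norm2_chart[OF that] that by auto
    have "(N has_derivative (\<lambda>h. 0)) (at z within ?K)" if z: "z \<in> ?K" for z
    proof -
      have zW: "z \<in> W" "z \<in> HD" using z sub by auto
      have "(N has_derivative (\<lambda>v. - d\<psi> z (Sh z *v v))) (at z within ?K)"
        using has_derivative_N_shape[OF zW(1)] by (rule has_derivative_at_withinI)
      then show ?thesis
        by (rule has_derivative_eq_rhs) (simp add: Sh0[OF zW(2)] fun_eq_iff linear_0[OF linear_d[OF zW(1)]])
    qed
    from has_derivative_zero_constant[OF conv this] obtain n0 where n0: "\<forall>z\<in>?K. N z = n0" by blast
    have yK: "y \<in> ?K" using c r by simp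
    have cn: "\<psi> z \<bullet> n0 = \<psi> y \<bullet> n0" if z: "z \<in> ?K" for z
    proof -
      have "((\<lambda>z. \<psi> z \<bullet> n0) has_derivative (\<lambda>h. 0)) (at z within ?K)" if z: "z \<in> ?K" for z
      proof -
        have zW: "z \<in> W" "N z = n0" using z r n0 by auto
        have "((\<lambda>z. \<psi> z \<bullet> n0) has_derivative (\<lambda>h. d\<psi> z h \<bullet> n0)) (at z within ?K)"
          by (rule has_derivative_inner_left[OF has_derivative_at_withinI[OF has_derivative_chart[OF zW(1)]]])
        then show ?thesis
          by (rule has_derivative_eq_rhs) (simp add: fun_eq_iff d_eq[OF zW(1)] inner_add_left zW(2)[symmetric] N_E)
      qed
      from has_derivative_zero_constant[OF conv this] show ?thesis using z yK by metis
    qed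
    have op: "openin (top_of_set S) (\<psi> ` ?K)"
      using local_param_restrict[OF c(1) open_ball r(2)] by (simp add: local_param_def)
    show ?thesis
    proof (intro exI[of _ "\<psi> ` ?K"] conjI ballI allI impI op)
      show "p \<in> \<psi> ` ?K" using yK c(3) by simp
      fix x assume "x \<in> \<psi> ` ?K"
      then obtain z where z: "z \<in> ?K" "x = \<psi> z" by blast
      show tp: "tangent_plane S x = tangent_plane S p"
        using z sub yK n0 c(3) tangent_plane_chart[of z] tangent_plane_chart[of y] by (simp add: subset_iff)
      fix n assume n: "tangent_plane S p = {v. v \<bullet> n = 0}"
      have yW: "y \<in> W" using c by simp
      have "v \<bullet> n = 0" if "v \<bullet> n0 = 0" for v
      proof -
        have "v \<in> tangent_plane S p" using tangent_plane_chart[OF c(2)] that n0 yK c(3) by auto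
        then show ?thesis using n by auto
      qed
      then have "(n - (n \<bullet> n0) *\<^sub>R n0) \<bullet> n = 0"
        using N_N[OF yW] n0 yK by (intro \<open>\<And>v. v \<bullet> n0 = 0 \<Longrightarrow> v \<bullet> n = 0\<close>) (simp add: inner_diff_left)
      moreover have "(n - (n \<bullet> n0) *\<^sub>R n0) \<bullet> n0 = 0" using N_N[OF yW] n0 yK by (simp add: inner_diff_left)
      ultimately have "(n - (n \<bullet> n0) *\<^sub>R n0) \<bullet> (n - (n \<bullet> n0) *\<^sub>R n0) = 0" by (simp add: inner_diff_right)
      then have "n = (n \<bullet> n0) *\<^sub>R n0" by simp
      then show "x \<bullet> n = p \<bullet> n" using cn[OF z(1)] z(2) c(3) by (metis inner_scaleR_right)
    qed
  qed
  have "tangent_plane S constant_on S"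
  proof (rule locally_constant_imp_constant[OF connected_S])
    fix a assume "a \<in> S"
    from loc[OF this] show "\<exists>T. openin (top_of_set S) T \<and> a \<in> T \<and> (\<forall>x\<in>T. tangent_plane S x = tangent_plane S a)"
      by (elim exE conjE) (intro exI conjI)
  qed
  then obtain P where P: "\<And>x. x \<in> S \<Longrightarrow> tangent_plane S x = P" unfolding constant_on_def by blast
  have "surface_boundary S \<noteq> {}"
  proof
    assume e: "surface_boundary S = {}"
    have "lint (\<lambda>x. 1) = lint (\<lambda>x. 0)" by (rule lint_cong_boundary) (use e in auto)
    then show False using length_pos by (simp add: zext_def[of "\<lambda>x. 0", abs_def])
  qed
  then obtain p where p: "p \<in> surface_boundary S" by blast
  then have pS: "p \<in> S" using boundary_subset by auto
  obtain W \<psi> y where c: "local_param S W \<psi>" "y \<in> W \<inter> half_plane" "p = \<psi> y"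
    using pS embedded_S unfolding embedded_surface_def by blast
  interpret surface_chart S W \<psi> using c by (simp add: surface_chart_def)
  have yW: "y \<in> W" using c by simp
  define n where "n = N y"
  have nn: "norm n = 1" unfolding n_def by (rule norm_N[OF yW])
  have Pn: "P = {v. v \<bullet> n = 0}" using P[OF pS] tangent_plane_chart[OF c(2)] c(3) by (simp add: n_def)
  have y2: "y $ 2 = 0" using surface_boundary_chart_iff[OF surface_chart_axioms c(2)] p c(3) by simp
  have "cross3 (E 1 y) (N y) = norm (E 1 y) *\<^sub>R p"
    using conormal_eq[OF c(2) y2, of p] conormal[OF p] c(3) by simp
  then have "norm (E 1 y) * (p \<bullet> n) = 0" by (metis dot_cross_self(3) inner_scaleR_left n_def)
  then have pn: "p \<bullet> n = 0" using E1_nonzero[OF yW] by simp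
  have "(\<lambda>x. x \<bullet> n) constant_on S"
  proof (rule locally_constant_imp_constant[OF connected_S])
    fix a assume a: "a \<in> S"
    obtain T where T: "openin (top_of_set S) T" "a \<in> T"
      "\<And>n. tangent_plane S a = {v. v \<bullet> n = 0} \<Longrightarrow> \<forall>x\<in>T. x \<bullet> n = a \<bullet> n"
      using loc[OF a] by metis
    have "tangent_plane S a = {v. v \<bullet> n = 0}" using P[OF a] Pn by simp
    from T(3)[OF this] T(1,2) show "\<exists>T. openin (top_of_set S) T \<and> a \<in> T \<and> (\<forall>x\<in>T. x \<bullet> n = a \<bullet> n)"
      by metis
  qed
  then have xn: "x \<bullet> n = 0" if "x \<in> S" for x using pn pS that unfolding constant_on_def by metis
  have SP: "S \<subseteq> P" using xn Pn by auto
  have subP: "subspace P" unfolding Pn using subspace_hyperplane[of n] by (simp add: inner_commute)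
  have dimP: "dim P = 2"
  proof -
    have "n \<noteq> 0" using nn by auto
    from dim_hyperplane[OF this] show ?thesis by (simp add: Pn inner_commute)
  qed
  \<comment> \<open>Invariance of domain between planes: a parametrization restricted to the open
    half plane is a continuous injection of an open planar set into P.\<close>
  have intr: "\<exists>T. openin (top_of_set P) T \<and> \<psi>' z \<in> T \<and> T \<subseteq> S"
    if h: "local_param S W' \<psi>'" "z \<in> W'" "z $ 2 > 0" for W' \<psi>' z
  proof -
    interpret C: surface_chart S W' \<psi>' using h by (simp add: surface_chart_def)
    let ?U = "W' \<inter> {z. z $ 2 > 0}"
    have sub: "?U \<subseteq> C.HD" by (auto simp: half_plane_def)
    have op: "open ?U" using C.open_W by (intro open_Int open_Collect_less continuous_intros)
    have "openin (top_of_set P) (\<psi>' ` ?U)"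
    proof (rule invariance_of_domain_subspaces[of UNIV])
      show "openin (top_of_set UNIV) ?U" using op by simp
      show "continuous_on ?U \<psi>'" "inj_on \<psi>' ?U"
        by (rule continuous_on_subset[OF C.continuous_chart sub], rule inj_on_subset[OF C.inj_on_chart sub])
      show "\<psi>' \<in> ?U \<rightarrow> P" using C.chart_in sub SP by auto
    qed (use subP dimP in auto)
    then show ?thesis using h C.chart_in sub by blast
  qed
  \<comment> \<open>If q had norm 1, a slightly longer multiple of it would still belong to T,
    although S lies in the closed ball.\<close>
  have small: "norm q < 1" if T: "openin (top_of_set P) T" "q \<in> T" "T \<subseteq> S" for T q
  proof (rule ccontr)
    assume "\<not> norm q < 1"
    moreover have "norm q \<le> 1" using T in_ball by auto
    ultimately have q1: "norm q = 1" by simp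
    obtain e where e: "e > 0" "\<And>x. x \<in> P \<Longrightarrow> dist x q < e \<Longrightarrow> x \<in> T"
      using T(1,2) unfolding openin_euclidean_subtopology_iff by blast
    have "q \<in> P" using T SP by auto
    then have "(1 + e/2) *\<^sub>R q \<in> P" using subP by (simp add: subspace_scale)
    moreover have "dist ((1 + e/2) *\<^sub>R q) q < e" using e q1 by (simp add: dist_norm scaleR_add_left)
    ultimately have "(1 + e/2) *\<^sub>R q \<in> cball 0 1" using e T in_ball by blast
    then show False using q1 e by simp
  qed
  let ?B = "P \<inter> ball 0 1"
  have cl: "closedin (top_of_set ?B) (S \<inter> ball 0 1)"
  proof -
    have "S \<inter> ball 0 1 = ?B \<inter> S" using SP by auto
    then show ?thesis using closed_S by (simp add: closedin_closed_Int)
  qed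
  have op: "openin (top_of_set ?B) (S \<inter> ball 0 1)"
  proof (subst openin_subopen, intro ballI)
    fix x assume x: "x \<in> S \<inter> ball 0 1"
    obtain W' \<psi>' z where h: "local_param S W' \<psi>'" "z \<in> W' \<inter> half_plane" "x = \<psi>' z"
      using x embedded_S unfolding embedded_surface_def by blast
    have "z $ 2 \<noteq> 0"
    proof
      assume "z $ 2 = 0"
      then have "x \<in> surface_boundary S" using h unfolding surface_boundary_def by blast
      then show False using x boundary_sphere by auto
    qed
    then have "z $ 2 > 0" using h by (simp add: half_plane_def)
    then obtain T where T: "openin (top_of_set P) T" "x \<in> T" "T \<subseteq> S" using intr[OF h(1)] h by blast
    obtain V where V: "open V" "T = P \<inter> V" using T(1) openin_open by blast
    have "openin (top_of_set ?B) (?B \<inter> V)" using V(1) by (rule openin_open_Int)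
    then show "\<exists>T. openin (top_of_set ?B) T \<and> x \<in> T \<and> T \<subseteq> S \<inter> ball 0 1"
      using V T x SP by (intro exI[of _ "?B \<inter> V"]) auto
  qed
  have ne: "S \<inter> ball 0 1 \<noteq> {}"
  proof -
    obtain z where z: "z \<in> HD" "z $ 2 > 0" using interior_point_near[OF c(2) zero_less_one] by blast
    obtain T where T: "openin (top_of_set P) T" "\<psi> z \<in> T" "T \<subseteq> S" using intr[OF c(1)] z by blast
    then have "norm (\<psi> z) < 1" using small by blast
    then show ?thesis using T by auto
  qed
  have "connected ?B" by (intro convex_connected convex_Int subspace_imp_convex[OF subP] convex_ball)
  then have eqB: "S \<inter> ball 0 1 = ?B" using op cl ne unfolding connected_clopen by blast
  have "S = P \<inter> cball 0 1"
  proof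
    show "S \<subseteq> P \<inter> cball 0 1" using SP in_ball by auto
    show "P \<inter> cball 0 1 \<subseteq> S"
    proof
      fix x assume x: "x \<in> P \<inter> cball 0 1"
      \<comment> \<open>The bounding circle is reached by closedness, as the limit of scaled points
        in the open disk.\<close>
      have "(\<lambda>k. (1 - 1 / real (Suc k)) *\<^sub>R x) \<longlonglongrightarrow> (1 - 0) *\<^sub>R x"
        by (intro tendsto_intros LIMSEQ_Suc lim_1_over_n)
      moreover have "(1 - 1 / real (Suc k)) *\<^sub>R x \<in> S" for k
      proof -
        have "norm ((1 - 1 / real (Suc k)) *\<^sub>R x) = (1 - 1 / real (Suc k)) * norm x" by simp
        also have "\<dots> \<le> (1 - 1 / real (Suc k)) * 1" using x by (intro mult_left_mono) auto
        also have "\<dots> < 1" by simp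
        finally have "(1 - 1 / real (Suc k)) *\<^sub>R x \<in> ?B" using x subP by (auto simp: subspace_scale)
        then show ?thesis using eqB by blast
      qed
      ultimately show "x \<in> S" using closed_S closed_sequentially[of S "\<lambda>k. (1 - 1 / real (Suc k)) *\<^sub>R x"] by auto
    qed
  qed
  then show ?thesis using subP dimP unfolding flat_disk_through_origin_def by blast
qed

text \<open>Differentiating \<open>\<psi> z \<bullet> v = 0\<close> once makes v normal to the
  surface; differentiating again makes all second derivatives orthogonal to the normal. Openness of
  U is what permits differentiating the relation.\<close>

lemma planar_piece_second_form:
  assumes c: "local_param S W \<psi>" and U: "open U" "U \<subseteq> W \<inter> half_plane" "y \<in> U"
    and v: "v \<noteq> 0" "\<And>z. z \<in> U \<Longrightarrow> \<psi> z \<bullet> v = 0"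
  shows "second_form_norm2 S (\<psi> y) = 0"
proof -
  interpret surface_chart S W \<psi> using c by (simp add: surface_chart_def)
  have UW: "z \<in> W" if "z \<in> U" for z using U that by auto
  have yW: "y \<in> W" "y \<in> HD" using U by auto
  have E: "E i z \<bullet> v = 0" if z: "z \<in> U" for i z
  proof -
    have "E i z \<bullet> v = partial_deriv (\<lambda>z. \<psi> z \<bullet> v) i z" by (rule partial_deriv_inner[OF smooth UW[OF z], symmetric])
    also have "\<dots> = partial_deriv (\<lambda>z. 0) i z" by (rule partial_deriv_cong[OF U(1) z]) (use v in auto)
    also have "\<dots> = 0" by (rule partial_deriv_eqI[where f' = "\<lambda>h. 0", simplified]) simp
    finally show ?thesis .
  qed
  have E2: "partial_deriv (E j) i y \<bullet> v = 0" for i j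
  proof -
    have "partial_deriv (E j) i y \<bullet> v = partial_deriv (\<lambda>z. E j z \<bullet> v) i y" by (rule partial_deriv_inner[OF smooth_E yW(1), symmetric])
    also have "\<dots> = partial_deriv (\<lambda>z. 0) i y" by (rule partial_deriv_cong[OF U(1,3)]) (use E in auto)
    also have "\<dots> = 0" by (rule partial_deriv_eqI[where f' = "\<lambda>h. 0", simplified]) simp
    finally show ?thesis .
  qed
  have "v - (v \<bullet> N y) *\<^sub>R N y = 0"
    by (rule eq_zero_if_orthogonal[OF yW(1)])
      (use E[OF U(3)] N_N[OF yW(1)] N_E in \<open>simp_all add: inner_diff_left inner_commute[of v]\<close>)
  then have vN: "v = (v \<bullet> N y) *\<^sub>R N y" by simp
  then have "v \<bullet> N y \<noteq> 0" using v(1) by (metis scaleR_zero_left)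
  moreover have "(v \<bullet> N y) * (partial_deriv (E j) i y \<bullet> N y) = 0" for i j
    using E2[of j i] arg_cong[OF vN, of "\<lambda>w. partial_deriv (E j) i y \<bullet> w"] by simp
  ultimately have h: "partial_deriv (E j) i y \<bullet> N y = 0" for i j by simp
  have "partial_deriv N i y = 0" for i
    by (rule eq_zero_if_orthogonal[OF yW(1)]) (use partial_N_N[OF yW(1)] partial_N_E[OF yW(1)] h in auto)
  then have z: "d\<psi> y (Sh y *v v) = 0" for v
    using has_derivative_unique[OF has_derivative_N_shape[OF yW(1)] has_derivative_N[OF yW(1)]]
    by (simp add: fun_eq_iff)
  then have "Sh y *v v = 0" for v
    using injD[OF inj_d[OF yW(1)], of "Sh y *v v" 0] z[of v] linear_0[OF linear_d[OF yW(1)]] by simp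
  then have "Sh y = 0" by (simp add: matrix_eq)
  then show ?thesis using second_form_norm2_chart[OF yW(2)] by (simp add: trace2)
qed

lemma second_form_nonneg: "x \<in> S \<Longrightarrow> second_form_norm2 S x \<ge> 0"
proof -
  assume "x \<in> S"
  then obtain W \<psi> y where c: "local_param S W \<psi>" "y \<in> W \<inter> half_plane" "x = \<psi> y"
    using embedded_S unfolding embedded_surface_def by blast
  interpret surface_chart S W \<psi> using c by (simp add: surface_chart_def)
  show ?thesis
    using shape_trace_square(1)[of y] minimal_trace[OF minimal c(2)] second_form_norm2_chart[OF c(2)] c by simp
qed

text \<open>A nonzero constant is paid for by the boundary length. For c = 0 the curvature is
  nonzero on some open set of parameters; if \<open>x \<bullet> v\<close> vanished on all of it, the
  piece would be planar and its curvature zero.\<close>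

lemma index_form_affine_neg:
  assumes nf: "\<not> flat_disk_through_origin S" and u: "u = (\<lambda>x. if x \<in> S then c + x \<bullet> v else 0)" "u \<in> smooth_functions S"
    and nz: "c \<noteq> 0 \<or> v \<noteq> 0"
  shows "index_form S u < 0"
proof -
  let ?F = "\<lambda>x. second_form_norm2 S x * (c + x \<bullet> v)\<^sup>2"
  have nn: "aint ?F \<ge> 0" by (rule int_nonneg(1)) (use second_form_nonneg in auto)
  have eq: "index_form S u = - aint ?F - c\<^sup>2 * lint (\<lambda>x. 1)" by (rule index_form_affine[OF u])
  show ?thesis
  proof (cases "c = 0")
    case False
    then have "c\<^sup>2 * lint (\<lambda>x. 1) > 0" using length_pos by simp
    then show ?thesis using eq nn by simp
  next
    case True
    then have v: "v \<noteq> 0" using nz by simp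
    obtain x where x: "x \<in> S" "second_form_norm2 S x \<noteq> 0" using flat_if_totally_geodesic nf by blast
    obtain W \<psi> y where c: "local_param S W \<psi>" "y \<in> W \<inter> half_plane" "x = \<psi> y"
      using x embedded_S unfolding embedded_surface_def by blast
    interpret surface_chart S W \<psi> using c by (simp add: surface_chart_def)
    have "continuous_on HD (\<lambda>z. second_form_norm2 S (\<psi> z))"
      by (rule continuous_on_compose2[OF second_form_continuous continuous_chart]) (use chart_in in auto)
    then obtain U where U: "open U" "U \<noteq> {}" "U \<subseteq> HD" "\<And>z. z \<in> U \<Longrightarrow> second_form_norm2 S (\<psi> z) > 0"
      using HD_positive_on_open[OF c(2)] x c(3) second_form_nonneg[OF x(1)] by (metis order_le_less)
    obtain z where z: "z \<in> U" "\<psi> z \<bullet> v \<noteq> 0"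
      using planar_piece_second_form[OF c(1) U(1,3) _ v] U(2,4) by (metis all_not_in_conv less_irrefl)
    have "aint ?F > 0"
    proof (rule aint_pos[of _ "\<psi> z"])
      show "continuous_on S ?F" by (intro continuous_intros second_form_continuous)
      show "\<psi> z \<in> S" using chart_in U z by blast
      show "?F (\<psi> z) > 0" using U(4)[OF z(1)] z(2) True by simp
    qed (use second_form_nonneg in auto)
    then show ?thesis using eq True by simp
  qed
qed

end

section \<open>Index bounds from linear algebra\<close>

text \<open>A nonzero vector in the kernel of L would have index form 0 instead of a negative value.
  Hence L is injective and its range has full dimension.\<close>

lemma surface_index_ge:
  fixes L :: "'e::euclidean_space \<Rightarrow> real^3 \<Rightarrow> real"
  assumes L: "linear L" "\<And>q. L q \<in> smooth_functions S" "\<And>q. q \<noteq> 0 \<Longrightarrow> index_form S (L q) < 0"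
    and z: "index_form S 0 = 0"
  shows "enat DIM('e) \<le> surface_index S"
proof -
  have inj: "inj L"
    unfolding linear_injective_0[OF L(1)] using L(3) z by (metis less_irrefl)
  have ind: "independent (L ` Basis)"
    by (rule linear_independent_injective_image[OF L(1) independent_Basis]) (use inj in \<open>auto intro: inj_on_subset\<close>)
  have sp: "range L = span (L ` Basis)" using linear_span_image[OF L(1), of Basis] by simp
  have "card (L ` Basis) = DIM('e)" by (rule card_image) (use inj in \<open>auto intro: inj_on_subset\<close>)
  then have d: "dim (range L) = DIM('e)" unfolding sp using dim_span_eq_card_independent[OF ind] by simp
  have "subspace (range L) \<and> (\<exists>B. finite B \<and> range L = span B) \<and>
            range L \<subseteq> smooth_functions S \<and> (\<forall>u\<in>range L. u \<noteq> 0 \<longrightarrow> index_form S u < 0)"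
  proof (intro conjI ballI impI)
    show "subspace (range L)" unfolding sp by (rule subspace_span)
    show "\<exists>B. finite B \<and> range L = span B" using sp by (intro exI[of _ "L ` Basis"]) auto
    show "range L \<subseteq> smooth_functions S" using L(2) by auto
    fix u assume "u \<in> range L" "u \<noteq> 0"
    then obtain q where "u = L q" "q \<noteq> 0" using linear_0[OF L(1)] by blast
    then show "index_form S u < 0" using L(3) by simp
  qed
  then have "enat (dim (range L)) \<in> {enat (dim V) | V. subspace V \<and> (\<exists>B. finite B \<and> V = span B) \<and>
            V \<subseteq> smooth_functions S \<and> (\<forall>u\<in>V. u \<noteq> 0 \<longrightarrow> index_form S u < 0)}"
    by (intro CollectI exI[of _ "range L"]) simp
  then show ?thesis unfolding surface_index_def d by (rule Sup_upper)
qed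

text \<open>A space V on which the form is negative definite meets the kernel of \<Lambda>
  trivially, so \<Lambda> is injective on it. As \<Lambda> is additive and homogeneous on smooth
  functions only, it is replaced by a globally linear map h that agrees with it on a basis of V,
  hence on V.\<close>

lemma surface_index_le:
  fixes \<Lambda> :: "(real^3 \<Rightarrow> real) \<Rightarrow> 'e::euclidean_space"
  assumes add: "\<And>u v. u \<in> smooth_functions S \<Longrightarrow> v \<in> smooth_functions S \<Longrightarrow> \<Lambda> (u + v) = \<Lambda> u + \<Lambda> v"
    and sc: "\<And>c u. u \<in> smooth_functions S \<Longrightarrow> \<Lambda> (c *\<^sub>R u) = c *\<^sub>R \<Lambda> u"
    and nn: "\<And>u. u \<in> smooth_functions S \<Longrightarrow> \<Lambda> u = 0 \<Longrightarrow> index_form S u \<ge> 0"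
  shows "surface_index S \<le> enat DIM('e)"
  unfolding surface_index_def
proof (rule Sup_least)
  fix k assume "k \<in> {enat (dim V) | V. subspace V \<and> (\<exists>B. finite B \<and> V = span B) \<and>
            V \<subseteq> smooth_functions S \<and> (\<forall>u\<in>V. u \<noteq> 0 \<longrightarrow> index_form S u < 0)}"
  then have "\<exists>V. k = enat (dim V) \<and> subspace V \<and> (\<exists>B. finite B \<and> V = span B) \<and>
            V \<subseteq> smooth_functions S \<and> (\<forall>u\<in>V. u \<noteq> 0 \<longrightarrow> index_form S u < 0)"
    by (rule CollectD)
  then obtain V where V0: "k = enat (dim V) \<and> subspace V \<and> (\<exists>B. finite B \<and> V = span B) \<and>
            V \<subseteq> smooth_functions S \<and> (\<forall>u\<in>V. u \<noteq> 0 \<longrightarrow> index_form S u < 0)"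
    by (rule exE)
  then have V: "k = enat (dim V)" "subspace V" "V \<subseteq> smooth_functions S"
    and Vneg: "\<And>u. u \<in> V \<Longrightarrow> u \<noteq> 0 \<Longrightarrow> index_form S u < 0" by simp_all
  obtain B where B: "B \<subseteq> V" "independent B" "V \<subseteq> span B" "card B = dim V"
    using real_vector.basis_exists[of V] by metis
  have spB: "span B = V" using B V(2) by (simp add: span_minimal subset_antisym)
  obtain h where h: "linear h" "\<forall>x\<in>B. h x = \<Lambda> x" using linear_independent_extend[OF B(2), of \<Lambda>] by blast
  have z0: "0 \<in> V" using V(2) subspace_0 by blast
  have l0: "\<Lambda> 0 = 0" using sc[of 0 0] z0 V(3) by auto
  have "u \<in> V \<and> h u = \<Lambda> u" if "u \<in> span B" for u
    using that
  proof (induction rule: span_induct_alt)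
    case base
    have "h 0 = \<Lambda> 0" by (simp only: l0 linear_0[OF h(1)])
    then show ?case using z0 by (intro conjI)
  next
    case (step c x y)
    then have m: "x \<in> V" "c *\<^sub>R x \<in> V" "y \<in> V" using B(1) V(2) by (auto simp: subspace_scale)
    have "\<Lambda> (c *\<^sub>R x + y) = \<Lambda> (c *\<^sub>R x) + \<Lambda> y" by (rule add) (use m V(3) in auto)
    moreover have "\<Lambda> (c *\<^sub>R x) = c *\<^sub>R \<Lambda> x" by (rule sc) (use m V(3) in auto)
    moreover have "h (c *\<^sub>R x + y) = h (c *\<^sub>R x) + h y" "h (c *\<^sub>R x) = c *\<^sub>R h x"
      by (rule linear_add[OF h(1)], rule linear_scale[OF h(1)])
    moreover have "h x = \<Lambda> x" "h y = \<Lambda> y" using h(2) step by auto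
    ultimately have "h (c *\<^sub>R x + y) = \<Lambda> (c *\<^sub>R x + y)" by (simp only:)
    then show ?case using subspace_add[OF V(2) m(2,3)] by (intro conjI)
  qed
  then have hl: "h u = \<Lambda> u" if "u \<in> V" for u using that spB by blast
  have inj: "inj_on h (span B)"
    unfolding spB
  proof (rule inj_onI)
    fix u v assume uv: "u \<in> V" "v \<in> V" "h u = h v"
    then have d: "u - v \<in> V" using V(2) by (simp add: subspace_diff)
    have "h (u - v) = 0" using uv linear_diff[OF h(1)] by simp
    then have "index_form S (u - v) \<ge> 0" using nn[of "u - v"] hl[OF d] d V(3) by auto
    then have "u - v = 0" using Vneg[OF d] by (meson not_le)
    then show "u = v" by simp
  qed
  have "independent (h ` B)" by (rule linear_independent_injective_image[OF h(1) B(2) inj])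
  then have "card (h ` B) \<le> DIM('e)" using independent_bound by blast
  moreover have "card (h ` B) = card B"
    by (rule card_image) (rule inj_on_subset[OF inj span_superset])
  ultimately show "k \<le> enat DIM('e)" using V(1) B(4) by simp
qed

section \<open>Affine test functions and the lower bounds\<close>

lemma Ck_on_const: "Ck_on k W (\<lambda>x::'a::euclidean_space. c :: 'b::real_normed_vector)"
proof (induction k arbitrary: c)
  case (Suc k)
  have "frechet_derivative (\<lambda>x::'a. c) (at x) = (\<lambda>v. 0)" for x
    by (rule frechet_derivative_at[symmetric]) simp
  then show ?case using Suc by simp
qed simp

lemma smooth_on_affine: "smooth_on W (\<lambda>x::real^3. c + x \<bullet> v)"
  unfolding smooth_on_def
proof
  fix k
  show "Ck_on k W (\<lambda>x::real^3. c + x \<bullet> v)"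
  proof (cases k)
    case 0 then show ?thesis by (simp, intro continuous_intros)
  next
    case (Suc m)
    have d: "((\<lambda>x::real^3. c + x \<bullet> v) has_derivative (\<lambda>h. h \<bullet> v)) (at x)" for x
      by (auto intro!: derivative_eq_intros)
    have "frechet_derivative (\<lambda>x::real^3. c + x \<bullet> v) (at x) = (\<lambda>h. h \<bullet> v)" for x
      by (rule frechet_derivative_at[symmetric, OF d])
    then show ?thesis using d Suc Ck_on_const by (auto simp: differentiable_def)
  qed
qed

lemma affine_smooth_functions: "(\<lambda>x. if x \<in> S then c + x \<bullet> v else 0) \<in> smooth_functions S"
  unfolding smooth_functions_def
  by (auto intro!: exI[of _ UNIV] exI[of _ "\<lambda>x. c + x \<bullet> v"] smooth_on_affine)

context fb_surface
begin

text \<open>Zero is one of the affine test functions, so the formula for them applies and the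
  gradient, a description, need not be evaluated separately.\<close>

lemma index_form_zero: "index_form S 0 = 0"
proof -
  have e: "(0 :: real^3 \<Rightarrow> real) = (\<lambda>x. if x \<in> S then 0 + x \<bullet> 0 else 0)" by (simp add: fun_eq_iff)
  have "index_form S 0 = - aint (\<lambda>x. second_form_norm2 S x * (0 + x \<bullet> (0 :: real^3))\<^sup>2) - 0\<^sup>2 * lint (\<lambda>x. 1)"
    by (rule index_form_affine[OF e]) (subst e, rule affine_smooth_functions)
  then show ?thesis by (simp add: zext_def[of "\<lambda>x. 0", abs_def])
qed

lemma index_form_const_neg:
  assumes "c \<noteq> 0" shows "index_form S (\<lambda>x. if x \<in> S then c else 0) < 0"
proof -
  have "index_form S (\<lambda>x. if x \<in> S then c + x \<bullet> 0 else 0) = - aint (\<lambda>x. second_form_norm2 S x * (c + x \<bullet> 0)\<^sup>2) - c\<^sup>2 * lint (\<lambda>x. 1)"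
    by (rule index_form_affine[OF refl affine_smooth_functions])
  moreover have "aint (\<lambda>x. second_form_norm2 S x * (c + x \<bullet> 0)\<^sup>2) \<ge> 0"
    by (rule int_nonneg(1)) (use second_form_nonneg in auto)
  moreover have "c\<^sup>2 * lint (\<lambda>x. 1) > 0" using length_pos assms by simp
  ultimately show ?thesis by (simp cong: if_cong)
qed

lemma index_ge_1: "1 \<le> surface_index S"
proof -
  have "enat DIM(real) \<le> surface_index S"
  proof (rule surface_index_ge[of "\<lambda>c x. if x \<in> S then c else 0"])
    show "linear (\<lambda>c x. if x \<in> S then c else (0::real))"
      by (rule linearI) (auto simp: fun_eq_iff scaleR_fun_def)
    show "(\<lambda>x. if x \<in> S then c else 0) \<in> smooth_functions S" for c
      using affine_smooth_functions[of S c 0] by (simp cong: if_cong)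
  qed (use index_form_const_neg index_form_zero in auto)
  then show ?thesis by (simp add: one_enat_def)
qed

lemma index_ge_4:
  assumes "\<not> flat_disk_through_origin S" shows "4 \<le> surface_index S"
proof -
  have "enat DIM(real \<times> (real^3)) \<le> surface_index S"
  proof (rule surface_index_ge[of "\<lambda>q x. if x \<in> S then fst q + x \<bullet> snd q else 0"])
    show "linear (\<lambda>q x. if x \<in> S then fst q + x \<bullet> snd q else (0::real))"
      by (rule linearI) (auto simp: fun_eq_iff scaleR_fun_def inner_add_right algebra_simps)
    show "index_form S (\<lambda>x. if x \<in> S then fst q + x \<bullet> snd q else 0) < 0" if "q \<noteq> 0" for q
      by (rule index_form_affine_neg[OF assms refl affine_smooth_functions]) (use that in \<open>auto simp: prod_eq_iff\<close>)
  qed (use affine_smooth_functions index_form_zero in auto)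
  then show ?thesis by (simp add: numeral_eq_enat)
qed

end

section \<open>One-dimensional inequalities\<close>

text \<open>Both quotients by \<open>x - x0\<close> converge, that of h to a nonzero limit. The
  numerator contains f twice, and the factor left over tends to 0.\<close>

lemma jacobi_boundary_continuous:
  fixes f h h' :: "real \<Rightarrow> real"
  assumes f: "(f has_real_derivative f0) (at x0 within X)" and h: "(h has_real_derivative h0) (at x0 within X)"
    and c: "(h' \<longlongrightarrow> h' x0) (at x0 within X)" and z: "h x0 = 0" "f x0 = 0" "h0 \<noteq> 0"
  shows "((\<lambda>x. h' x * (f x)\<^sup>2 / h x) \<longlongrightarrow> 0) (at x0 within X)"
proof -
  have fl: "((\<lambda>x. f x / (x - x0)) \<longlongrightarrow> f0) (at x0 within X)" and hl: "((\<lambda>x. h x / (x - x0)) \<longlongrightarrow> h0) (at x0 within X)"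
    using f h z by (auto simp: has_field_derivative_iff)
  have f0: "(f \<longlongrightarrow> 0) (at x0 within X)"
    using DERIV_continuous[OF f] z by (simp add: continuous_within)
  have "((\<lambda>x. h' x * f x * (f x / (x - x0)) / (h x / (x - x0))) \<longlongrightarrow> h' x0 * 0 * f0 / h0) (at x0 within X)"
    by (intro tendsto_intros c f0 fl hl z)
  then have "((\<lambda>x. h' x * f x * (f x / (x - x0)) / (h x / (x - x0))) \<longlongrightarrow> 0) (at x0 within X)" by simp
  then show ?thesis
  proof (rule Lim_transform_eventually)
    show "\<forall>\<^sub>F x in at x0 within X. h' x * f x * (f x / (x - x0)) / (h x / (x - x0)) = h' x * (f x)\<^sup>2 / h x"
      by (auto simp: eventually_at power2_eq_square intro!: exI[of _ 1])
  qed
qed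

text \<open>Jacobi's transformation: where h is positive, the integrand is the derivative of
  \<open>h' * f^2 / h\<close> plus the square of \<open>f' - h' / h * f\<close>, because h solves
  the equation with potential V. Only boundary values remain after dropping the square.\<close>

lemma jacobi_comparison:
  fixes f f' h h' V :: "real \<Rightarrow> real"
  assumes ab: "a < b"
    and f: "\<And>x. x \<in> {a..b} \<Longrightarrow> (f has_real_derivative f' x) (at x within {a..b})" and cf: "continuous_on {a..b} f'"
    and h: "\<And>x. x \<in> {a..b} \<Longrightarrow> (h has_real_derivative h' x) (at x within {a..b})" and ch: "continuous_on {a..b} h'"
    and h': "\<And>x. x \<in> {a<..<b} \<Longrightarrow> (h' has_real_derivative - V x * h x) (at x)"
    and cV: "continuous_on {a..b} V"
    and pos: "\<And>x. x \<in> {a<..<b} \<Longrightarrow> h x > 0"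
    and endp: "\<And>x. x \<in> {a, b} \<Longrightarrow> h x = 0 \<Longrightarrow> f x = 0 \<and> h' x \<noteq> 0"
  shows "h' b * (f b)\<^sup>2 / h b - h' a * (f a)\<^sup>2 / h a \<le> integral {a..b} (\<lambda>x. (f' x)\<^sup>2 - V x * (f x)\<^sup>2)"
proof -
  \<comment> \<open>At an end point where h vanishes, division by zero gives the value 0, which by
    \<open>jacobi_boundary_continuous\<close> is also the limit. Thus B is continuous on the closed
    interval.\<close>
  define B where "B x = h' x * (f x)\<^sup>2 / h x" for x
  define k where "k x = (f' x)\<^sup>2 - V x * (f x)\<^sup>2" for x
  have cof: "continuous_on {a..b} f" using f DERIV_continuous continuous_on_eq_continuous_within by blast
  have coh: "continuous_on {a..b} h" using h DERIV_continuous continuous_on_eq_continuous_within by blast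
  have ck: "continuous_on {a..b} k" unfolding k_def by (intro continuous_intros cf cV cof)
  have cB: "continuous_on {a..b} B"
    unfolding continuous_on_eq_continuous_within
  proof
    fix x assume x: "x \<in> {a..b}"
    show "continuous (at x within {a..b}) B"
    proof (cases "h x = 0")
      case True
      then have "x \<in> {a, b}" using pos[of x] x by force
      then have z: "f x = 0" "h' x \<noteq> 0" using endp True by auto
      have "(h' \<longlongrightarrow> h' x) (at x within {a..b})" using ch x continuous_on_def by blast
      from jacobi_boundary_continuous[OF f[OF x] h[OF x] this True z]
      show ?thesis using True by (simp add: continuous_within B_def[abs_def])
    next
      case False
      have "continuous (at x within {a..b}) f" "continuous (at x within {a..b}) h" "continuous (at x within {a..b}) h'"
        using cof coh ch x continuous_on_eq_continuous_within by blast+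
      then show ?thesis unfolding B_def using False by (intro continuous_intros)
    qed
  qed
  define H where "H x = integral {a..x} k - B x" for x
  have cH: "continuous_on {a..b} H"
    unfolding H_def by (intro continuous_on_diff cB indefinite_integral_continuous_1 integrable_continuous_real ck)
  have "H a \<le> H b"
  proof (rule DERIV_nonneg_imp_increasing_open[OF less_imp_le[OF ab] _ cH])
    fix x assume x: "a < x" "x < b"
    have xi: "x \<in> {a..b}" "x \<in> {a<..<b}" using x by auto
    have atx: "at x within {a..b} = at x" using x at_within_Icc_at by blast
    have 1: "((\<lambda>u. integral {a..u} k) has_real_derivative k x) (at x)"
      using integral_has_real_derivative[OF ck xi(1)] atx by simp
    have df: "(f has_real_derivative f' x) (at x)" and dh: "(h has_real_derivative h' x) (at x)"
      using f[OF xi(1)] h[OF xi(1)] atx by auto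
    have hp: "h x > 0" using pos xi by auto
    have 2: "(B has_real_derivative ((- V x * h x * (f x)\<^sup>2 + h' x * (2 * f x * f' x)) * h x - h' x * (f x)\<^sup>2 * h' x) / (h x)\<^sup>2) (at x)"
      unfolding B_def using hp h'[OF xi(2)] df dh
      by (auto intro!: derivative_eq_intros simp: power2_eq_square algebra_simps)
    have eq: "((- V x * h x * (f x)\<^sup>2 + h' x * (2 * f x * f' x)) * h x - h' x * (f x)\<^sup>2 * h' x) / (h x)\<^sup>2
        = k x - (f' x - h' x / h x * f x)\<^sup>2"
      using hp by (simp add: k_def power2_eq_square field_simps)
    have "(H has_real_derivative (k x - (k x - (f' x - h' x / h x * f x)\<^sup>2))) (at x)"
      unfolding H_def using DERIV_diff[OF 1 2[unfolded eq]] .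
    then show "\<exists>y. (H has_real_derivative y) (at x) \<and> 0 \<le> y" by (intro exI conjI) (assumption, simp)
  qed
  then show ?thesis by (simp add: H_def B_def k_def[abs_def])
qed

text \<open>Comparison with \<open>sin (k * (x - a))\<close>, which is positive between two zeros at
  distance \<open>pi / k\<close>.\<close>

lemma dirichlet_inequality:
  fixes g g' :: "real \<Rightarrow> real"
  assumes k: "k > 0" and g: "\<And>x. (g has_real_derivative g' x) (at x)" and c: "continuous_on UNIV g'"
    and z: "g a = 0" "g (a + pi / k) = 0"
  shows "integral {a..a + pi/k} (\<lambda>x. k\<^sup>2 * (g x)\<^sup>2) \<le> integral {a..a + pi/k} (\<lambda>x. (g' x)\<^sup>2)"
proof -
  let ?b = "a + pi/k"
  let ?h = "\<lambda>x. sin (k * (x - a))" and ?h' = "\<lambda>x. k * cos (k * (x - a))"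
  have cg: "continuous_on A g" for A using g DERIV_continuous continuous_at_imp_continuous_on by blast
  have cg': "continuous_on A g'" for A using c continuous_on_subset by blast
  have "?h' ?b * (g ?b)\<^sup>2 / ?h ?b - ?h' a * (g a)\<^sup>2 / ?h a \<le> integral {a..?b} (\<lambda>x. (g' x)\<^sup>2 - k\<^sup>2 * (g x)\<^sup>2)"
  proof (rule jacobi_comparison)
    show "a < ?b" using k by simp
    show "(g has_real_derivative g' x) (at x within {a..?b})" for x using g has_field_derivative_at_within by blast
    show "(?h has_real_derivative ?h' x) (at x within {a..?b})" for x by (auto intro!: derivative_eq_intros)
    show "(?h' has_real_derivative - k\<^sup>2 * ?h x) (at x)" for x
      by (auto intro!: derivative_eq_intros simp: power2_eq_square)
    show "?h x > 0" if "x \<in> {a<..<?b}" for x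
    proof (rule sin_gt_zero)
      show "0 < k * (x - a)" using that k by simp
      have "x - a < pi / k" using that by auto
      then show "k * (x - a) < pi" using k by (simp add: field_simps)
    qed
    show "g x = 0 \<and> ?h' x \<noteq> 0" if "x \<in> {a, ?b}" for x using that z k by auto
  qed (auto intro!: continuous_intros cg')
  moreover have "integral {a..?b} (\<lambda>x. (g' x)\<^sup>2 - k\<^sup>2 * (g x)\<^sup>2) = integral {a..?b} (\<lambda>x. (g' x)\<^sup>2) - integral {a..?b} (\<lambda>x. k\<^sup>2 * (g x)\<^sup>2)"
    by (rule Henstock_Kurzweil_Integration.integral_diff; intro integrable_continuous_real continuous_intros cg cg')
  ultimately show ?thesis using z by simp
qed

lemma periodic_integral_shift:
  fixes F :: "real \<Rightarrow> real"
  assumes c: "continuous_on UNIV F" and p: "\<And>x. F (x + 2 * pi) = F x"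
  shows "integral {a..a + 2 * pi} F = integral {b..b + 2 * pi} F"
proof -
  have main: "integral {a..a + 2 * pi} F = integral {b..b + 2 * pi} F" if ab: "a \<le> b" for a b
  proof -
    have i: "F integrable_on {x..y}" for x y by (intro integrable_continuous_real continuous_on_subset[OF c]) auto
    have "integral {a..b} F + integral {b..b + 2*pi} F = integral {a..b + 2 * pi} F"
      using ab by (intro Henstock_Kurzweil_Integration.integral_combine i) auto
    moreover have "integral {a..a + 2 * pi} F + integral {a + 2 * pi..b + 2*pi} F = integral {a..b + 2 * pi} F"
      using ab by (intro Henstock_Kurzweil_Integration.integral_combine i) auto
    moreover have "integral {a + 2 * pi..b + 2*pi} F = integral {a..b} F"
    proof -
      have "integral {a + 2 * pi..b + 2*pi} F = integral {a..b} (\<lambda>x. F (x + 2 * pi))"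
        using integral_shift_Icc_real[of a b F "2*pi"] by (simp add: o_def add.commute)
      then show ?thesis using p by simp
    qed
    ultimately show ?thesis by linarith
  qed
  show ?thesis using main[of a b] main[of b a] by linarith
qed

section \<open>Fourier modes on the circle\<close>

lemma integral_cos_sin_pi:
  "integral {-pi..pi} (\<lambda>x. cos x) = 0" "integral {-pi..pi} (\<lambda>x. sin x) = 0"
  "integral {-pi..pi} (\<lambda>x. cos x * cos x) = pi" "integral {-pi..pi} (\<lambda>x. sin x * sin x) = pi"
  "integral {-pi..pi} (\<lambda>x. sin x * cos x) = 0"
proof -
  have FTC: "integral {-pi..pi} f = F pi - F (-pi)" if "\<And>x. (F has_real_derivative f x) (at x)" for F f :: "real \<Rightarrow> real"
    by (rule integral_unique, rule fundamental_theorem_of_calculus)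
      (auto simp flip: has_real_derivative_iff_has_vector_derivative intro: has_field_derivative_at_within[OF that])
  show "integral {-pi..pi} (\<lambda>x. cos x) = 0" by (subst FTC[of sin]) (auto intro!: derivative_eq_intros)
  show "integral {-pi..pi} (\<lambda>x. sin x) = 0" by (subst FTC[of "\<lambda>x. - cos x"]) (auto intro!: derivative_eq_intros)
  have sq: "(1 + (cos x * cos x - sin x * sin x)) / 2 = cos x * cos x" "(1 - (cos x * cos x - sin x * sin x)) / 2 = sin x * sin x" for x :: real
  proof -
    have a: "sin x * sin x = 1 - cos x * cos x" using sin_cos_squared_add3[of x] by linarith
    show "(1 + (cos x * cos x - sin x * sin x)) / 2 = cos x * cos x" unfolding a by simp
    show "(1 - (cos x * cos x - sin x * sin x)) / 2 = sin x * sin x" unfolding a by simp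
  qed
  have sc: "((\<lambda>x. sin x * cos x) has_real_derivative cos x * cos x - sin x * sin x) (at x)" for x
    by (auto intro!: derivative_eq_intros)
  have d: "((\<lambda>x. (x + sin x * cos x) / 2) has_real_derivative cos x * cos x) (at x)" for x
    by (rule DERIV_cong[OF DERIV_cdivide[OF DERIV_add[OF DERIV_ident sc]] sq(1)])
  have d': "((\<lambda>x. (x - sin x * cos x) / 2) has_real_derivative sin x * sin x) (at x)" for x
    by (rule DERIV_cong[OF DERIV_cdivide[OF DERIV_diff[OF DERIV_ident sc]] sq(2)])
  show "integral {-pi..pi} (\<lambda>x. cos x * cos x) = pi" by (subst FTC[OF d]) simp
  show "integral {-pi..pi} (\<lambda>x. sin x * sin x) = pi" by (subst FTC[OF d']) simp
  show "integral {-pi..pi} (\<lambda>x. sin x * cos x) = 0"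
    by (subst FTC[of "\<lambda>x. sin x * sin x / 2"]) (auto intro!: derivative_eq_intros)
qed

lemma integral_lin3:
  fixes F G H :: "real \<Rightarrow> real"
  assumes "continuous_on {a..b} F" "continuous_on {a..b} G" "continuous_on {a..b} H"
  shows "integral {a..b} (\<lambda>x. r * F x + s * G x + t * H x) = r * integral {a..b} F + s * integral {a..b} G + t * integral {a..b} H"
proof -
  have i: "F integrable_on {a..b}" "G integrable_on {a..b}" "H integrable_on {a..b}"
    using assms integrable_continuous_real by blast+
  have "((\<lambda>x. r * F x + s * G x + t * H x) has_integral (r * integral {a..b} F + s * integral {a..b} G + t * integral {a..b} H)) {a..b}"
    by (intro has_integral_add has_integral_mult_right integrable_integral i)
  then show ?thesis by (rule integral_unique)
qed

lemma trig_poly_integrals: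
  fixes g :: "real \<Rightarrow> real" and A B C :: real
  assumes c: "continuous_on {-pi..pi} g"
  defines "l \<equiv> \<lambda>x. A + B * cos x + C * sin x"
  shows "integral {-pi..pi} (\<lambda>x. g x * l x) = A * integral {-pi..pi} g
      + B * integral {-pi..pi} (\<lambda>x. g x * cos x) + C * integral {-pi..pi} (\<lambda>x. g x * sin x)"
    "integral {-pi..pi} (\<lambda>x. (l x)\<^sup>2) = 2 * pi * A\<^sup>2 + pi * B\<^sup>2 + pi * C\<^sup>2"
    "integral {-pi..pi} (\<lambda>x. (g x - l x)\<^sup>2) = integral {-pi..pi} (\<lambda>x. (g x)\<^sup>2)
      - 2 * (A * integral {-pi..pi} g + B * integral {-pi..pi} (\<lambda>x. g x * cos x) + C * integral {-pi..pi} (\<lambda>x. g x * sin x))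
      + 2 * pi * A\<^sup>2 + pi * B\<^sup>2 + pi * C\<^sup>2"
proof -
  note ci = continuous_intros c
  have 1: "integral {-pi..pi} (\<lambda>x. f x * l x) = A * integral {-pi..pi} f
      + B * integral {-pi..pi} (\<lambda>x. f x * cos x) + C * integral {-pi..pi} (\<lambda>x. f x * sin x)"
    if "continuous_on {-pi..pi} f" for f
    using integral_lin3[of "-pi" pi f "\<lambda>x. f x * cos x" "\<lambda>x. f x * sin x" A B C] that
    by (simp add: l_def algebra_simps continuous_intros)
  show 2: "integral {-pi..pi} (\<lambda>x. g x * l x) = A * integral {-pi..pi} g
      + B * integral {-pi..pi} (\<lambda>x. g x * cos x) + C * integral {-pi..pi} (\<lambda>x. g x * sin x)"
    by (rule 1[OF c])
  have cl: "continuous_on {-pi..pi} l" unfolding l_def by (intro continuous_intros)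
  have L0: "integral {-pi..pi} l = 2 * pi * A"
    using 1[of "\<lambda>x. 1"] by (simp add: integral_cos_sin_pi)
  have Lc: "integral {-pi..pi} (\<lambda>x. l x * cos x) = pi * B"
  proof -
    have "(\<lambda>x::real. cos x * sin x) = (\<lambda>x. sin x * cos x)" "(\<lambda>x. cos x * l x) = (\<lambda>x. l x * cos x)"
      by (simp_all add: mult.commute)
    then show ?thesis using 1[of cos] by (simp add: integral_cos_sin_pi continuous_intros)
  qed
  have Ls: "integral {-pi..pi} (\<lambda>x. l x * sin x) = pi * C"
  proof -
    have "(\<lambda>x. sin x * l x) = (\<lambda>x. l x * sin x)" by (simp add: mult.commute)
    then show ?thesis using 1[of sin] by (simp add: integral_cos_sin_pi continuous_intros)
  qed
  show 3: "integral {-pi..pi} (\<lambda>x. (l x)\<^sup>2) = 2 * pi * A\<^sup>2 + pi * B\<^sup>2 + pi * C\<^sup>2"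
    using 1[OF cl, unfolded L0 Lc Ls] by (simp add: power2_eq_square algebra_simps)
  have "integral {-pi..pi} (\<lambda>x. (g x - l x)\<^sup>2) = integral {-pi..pi} (\<lambda>x. 1 * (g x)\<^sup>2 + (-2) * (g x * l x) + 1 * (l x)\<^sup>2)"
    by (rule Henstock_Kurzweil_Integration.integral_cong) (simp add: power2_eq_square algebra_simps)
  also have "\<dots> = integral {-pi..pi} (\<lambda>x. (g x)\<^sup>2) - 2 * integral {-pi..pi} (\<lambda>x. g x * l x) + integral {-pi..pi} (\<lambda>x. (l x)\<^sup>2)"
    by (subst integral_lin3) (auto intro!: continuous_intros c cl)
  finally show "integral {-pi..pi} (\<lambda>x. (g x - l x)\<^sup>2) = integral {-pi..pi} (\<lambda>x. (g x)\<^sup>2)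
      - 2 * (A * integral {-pi..pi} g + B * integral {-pi..pi} (\<lambda>x. g x * cos x) + C * integral {-pi..pi} (\<lambda>x. g x * sin x))
      + 2 * pi * A\<^sup>2 + pi * B\<^sup>2 + pi * C\<^sup>2"
    unfolding 2 3 by simp
qed

text \<open>Integrate the square of the difference between g and its first Fourier
  polynomial.\<close>

lemma bessel_inequality:
  fixes g :: "real \<Rightarrow> real"
  assumes c: "continuous_on {-pi..pi} g"
    and m: "integral {-pi..pi} g = 2 * pi * m" and p: "integral {-pi..pi} (\<lambda>x. g x * cos x) = pi * p"
    and q: "integral {-pi..pi} (\<lambda>x. g x * sin x) = pi * q"
  shows "2 * pi * m\<^sup>2 + pi * p\<^sup>2 + pi * q\<^sup>2 \<le> integral {-pi..pi} (\<lambda>x. (g x)\<^sup>2)"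
proof -
  have "0 \<le> integral {-pi..pi} (\<lambda>x. (g x - (m + p * cos x + q * sin x))\<^sup>2)"
    by (rule Henstock_Kurzweil_Integration.integral_nonneg) (auto intro!: integrable_continuous_real continuous_intros c)
  then show ?thesis unfolding trig_poly_integrals(3)[OF c] m p q by (simp add: power2_eq_square algebra_simps)
qed

text \<open>
  Modulo \<open>span {1, cos, sin}\<close> a periodic function can be made to vanish at four points spaced by
  \<open>pi / 2\<close>: interpolation at three of them is always possible, and the intermediate value theorem
  provides a position of the points for which the fourth condition holds too.  The Dirichlet
  inequality on the four quarters then gives the second eigenvalue.
\<close>

lemma wirtinger_second:
  fixes g g' :: "real \<Rightarrow> real"
  assumes g: "\<And>x. (g has_real_derivative g' x) (at x)" and c: "continuous_on UNIV g'"
    and per: "\<And>x. g (x + 2 * pi) = g x"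
    and m: "integral {-pi..pi} g = 2 * pi * m" and p: "integral {-pi..pi} (\<lambda>x. g x * cos x) = pi * p"
    and q: "integral {-pi..pi} (\<lambda>x. g x * sin x) = pi * q"
  shows "4 * integral {-pi..pi} (\<lambda>x. (g x)\<^sup>2) - 8 * pi * m\<^sup>2 - 3 * pi * (p\<^sup>2 + q\<^sup>2) \<le> integral {-pi..pi} (\<lambda>x. (g' x)\<^sup>2)"
proof -
  have cg: "continuous_on X g" for X using g DERIV_continuous continuous_at_imp_continuous_on by blast
  have cg': "continuous_on X g'" for X using c continuous_on_subset by blast
  have per': "g' (x + 2 * pi) = g' x" for x
  proof -
    have "((\<lambda>x. g (x + 2 * pi)) has_real_derivative g' (x + 2 * pi)) (at x)"
      using DERIV_shift[of g "g' (x + 2*pi)" x "2 * pi"] g by (simp add: add.commute)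
    then show ?thesis using g[of x] per DERIV_unique by (metis (no_types, lifting) ext)
  qed
  \<comment> \<open>The one obstruction to interpolating the four values by a combination of 1, cos
    and sin. A quarter turn reverses its sign, so it vanishes somewhere in between.\<close>
  define Dl where "Dl t = g t - g (t + pi/2) + g (t + pi) - g (t + 3*pi/2)" for t
  have cD: "continuous_on {0..pi/2} Dl" unfolding Dl_def
    by (intro continuous_intros continuous_on_compose2[OF cg[of UNIV]]) auto
  have D1: "Dl (pi/2) = - Dl 0"
    using per[of 0] by (simp add: Dl_def)
  obtain t where t: "Dl t = 0"
  proof (cases "Dl 0 \<le> 0")
    case True
    have "\<exists>x. 0 \<le> x \<and> x \<le> pi/2 \<and> Dl x = 0" by (rule IVT'[OF True _ _ cD]) (use D1 True in auto)
    then show ?thesis using that by blast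
  next
    case False
    have "\<exists>x. 0 \<le> x \<and> x \<le> pi/2 \<and> Dl x = 0" by (rule IVT2'[OF _ _ _ cD]) (use D1 False in auto)
    then show ?thesis using that by blast
  qed
  \<comment> \<open>Interpolation coefficients in the basis centred at t. The condition
    \<open>Dl t = 0\<close> says that the second pair of opposite points has the same mean A as the
    first pair.\<close>
  define A where "A = (g t + g (t + pi)) / 2"
  define U where "U = (g t - g (t + pi)) / 2"
  define V where "V = (g (t + pi/2) - g (t + 3*pi/2)) / 2"
  define B where "B = U * cos t - V * sin t"
  define C where "C = U * sin t + V * cos t"
  define l where "l x = A + B * cos x + C * sin x" for x
  have l_alt: "l x = A + U * cos (x - t) + V * sin (x - t)" for x
    by (simp add: l_def B_def C_def cos_diff sin_diff algebra_simps)
  define l' where "l' x = - B * sin x + C * cos x" for x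
  define G where "G x = g x - l x" for x
  define G' where "G' x = g' x - l' x" for x
  have dl: "(l has_real_derivative l' x) (at x)" for x
    unfolding l_def[abs_def] l'_def by (auto intro!: derivative_eq_intros)
  have dG: "(G has_real_derivative G' x) (at x)" for x
    unfolding G_def[abs_def] G'_def by (intro DERIV_diff g dl)
  have cG': "continuous_on X G'" for X unfolding G'_def l'_def by (intro continuous_intros cg')
  have cG: "continuous_on X G" for X unfolding G_def l_def by (intro continuous_intros cg)
  have At: "A = (g (t + pi/2) + g (t + 3*pi/2)) / 2" using t by (simp add: A_def Dl_def)
  have z0: "G t = 0" by (simp add: G_def l_alt A_def U_def field_simps)
  have z1: "G (t + pi/2) = 0" by (simp add: G_def l_alt At V_def field_simps)
  have z2: "G (t + pi) = 0" by (simp add: G_def l_alt A_def U_def field_simps)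
  have c3: "cos (3 * pi / 2) = 0" "sin (3 * pi / 2) = - 1"
    using cos_add[of pi "pi/2"] sin_add[of pi "pi/2"] by (simp_all add: field_simps)
  have z3: "G (t + 3*pi/2) = 0" using c3 by (simp add: G_def l_alt At V_def field_simps)
  have z4: "G (t + 2*pi) = 0" using z0 per by (simp add: G_def l_def)
  have per_sq: "integral {t..t + 2*pi} (\<lambda>x. (f x)\<^sup>2) = integral {-pi..pi} (\<lambda>x. (f x)\<^sup>2)"
    if "continuous_on UNIV f" "\<And>x. f (x + 2 * pi) = f x" for f :: "real \<Rightarrow> real"
    using periodic_integral_shift[of "\<lambda>x. (f x)\<^sup>2" t "-pi"] that by (simp add: continuous_intros)
  have quarter: "4 * integral {a..b} (\<lambda>x. (G x)\<^sup>2) \<le> integral {a..b} (\<lambda>x. (G' x)\<^sup>2)"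
    if "G a = 0" "G b = 0" "b = a + pi/2" for a b
    using dirichlet_inequality[of 2 G G' a] dG cG' that by simp
  have comb: "integral {t..t+2*pi} F = integral {t..t+pi/2} F + integral {t+pi/2..t+pi} F + integral {t+pi..t+3*pi/2} F + integral {t+3*pi/2..t+2*pi} F"
    if cF: "continuous_on UNIV F" for F :: "real \<Rightarrow> real"
  proof -
    have i: "F integrable_on {x..y}" for x y by (intro integrable_continuous_real continuous_on_subset[OF cF]) auto
    have "integral {t..t+pi/2} F + integral {t+pi/2..t+pi} F = integral {t..t+pi} F"
      "integral {t..t+pi} F + integral {t+pi..t+3*pi/2} F = integral {t..t+3*pi/2} F"
      "integral {t..t+3*pi/2} F + integral {t+3*pi/2..t+2*pi} F = integral {t..t+2*pi} F"
      by (intro Henstock_Kurzweil_Integration.integral_combine i; simp)+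
    then show ?thesis by linarith
  qed
  have "4 * integral {t..t+2*pi} (\<lambda>x. (G x)\<^sup>2) \<le> integral {t..t+2*pi} (\<lambda>x. (G' x)\<^sup>2)"
    unfolding comb[of "\<lambda>x. (G x)\<^sup>2", OF continuous_on_power[OF cG]] comb[of "\<lambda>x. (G' x)\<^sup>2", OF continuous_on_power[OF cG']]
    using quarter[OF z0 z1] quarter[OF z1 z2] quarter[OF z2 z3] quarter[OF z3 z4] by (simp add: field_simps)
  then have main: "4 * integral {-pi..pi} (\<lambda>x. (G x)\<^sup>2) \<le> integral {-pi..pi} (\<lambda>x. (G' x)\<^sup>2)"
    using per_sq[OF cG] per_sq[OF cG'] per per' by (simp add: G_def G'_def l_def l'_def)
  have I1: "integral {-pi..pi} (\<lambda>x. (G x)\<^sup>2) = integral {-pi..pi} (\<lambda>x. (g x)\<^sup>2) - 2 * (A * (2*pi*m) + B * (pi * p) + C * (pi * q))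
      + 2 * pi * A\<^sup>2 + pi * B\<^sup>2 + pi * C\<^sup>2"
    using trig_poly_integrals(3)[OF cg, of A B C] by (simp add: G_def l_def m p q)
  have parts: "integral {-pi..pi} (\<lambda>x. g' x * u x) = - integral {-pi..pi} (\<lambda>x. g x * u' x)"
    if u: "\<And>x. (u has_real_derivative u' x) (at x)" "u pi = u (-pi)" "continuous_on {-pi..pi} u'" for u u'
  proof -
    have cu: "continuous_on {-pi..pi} u" using u(1) DERIV_continuous continuous_at_imp_continuous_on by blast
    have gp: "g pi = g (-pi)" using per[of "-pi"] by simp
    have "((\<lambda>x. g' x * u x + g x * u' x) has_integral (g pi * u pi - g (-pi) * u (-pi))) {-pi..pi}"
    proof (rule fundamental_theorem_of_calculus)
      fix x :: real
      have "((\<lambda>x. g x * u x) has_real_derivative g' x * u x + g x * u' x) (at x within {-pi..pi})"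
        by (rule has_field_derivative_at_within, rule DERIV_cong[OF DERIV_mult[OF g u(1)]]) (simp add: algebra_simps)
      then show "((\<lambda>x. g x * u x) has_vector_derivative g' x * u x + g x * u' x) (at x within {-pi..pi})"
        by (simp add: has_real_derivative_iff_has_vector_derivative)
    qed simp
    then have "integral {-pi..pi} (\<lambda>x. g' x * u x + g x * u' x) = 0" using u(2) gp by (simp add: integral_unique)
    moreover have "integral {-pi..pi} (\<lambda>x. g' x * u x + g x * u' x) = integral {-pi..pi} (\<lambda>x. g' x * u x) + integral {-pi..pi} (\<lambda>x. g x * u' x)"
      by (rule Henstock_Kurzweil_Integration.integral_add; intro integrable_continuous_real continuous_intros cg cg' cu u(3))
    ultimately show ?thesis by simp
  qed
  have i0: "integral {-pi..pi} g' = 0" using parts[of "\<lambda>x. 1" "\<lambda>x. 0"] by simp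
  have ic: "integral {-pi..pi} (\<lambda>x. g' x * cos x) = pi * q"
    using parts[of cos "\<lambda>x. - sin x"] by (simp add: q continuous_intros)
  have isn: "integral {-pi..pi} (\<lambda>x. g' x * sin x) = - pi * p"
    using parts[of sin cos] by (simp add: p continuous_intros)
  have I2: "integral {-pi..pi} (\<lambda>x. (G' x)\<^sup>2) = integral {-pi..pi} (\<lambda>x. (g' x)\<^sup>2) - 2 * (C * (pi * q) + (- B) * (- pi * p)) + pi * C\<^sup>2 + pi * B\<^sup>2"
    using trig_poly_integrals(3)[OF cg', of 0 C "- B"] by (simp add: G'_def l'_def i0 ic isn add.commute)
  \<comment> \<open>The inequality for G is the claimed one with these squares added to the smaller
    side; they measure how far the interpolation coefficients are from the Fourier
    coefficients.\<close>
  have "0 \<le> 3 * pi * ((B - p)\<^sup>2 + (C - q)\<^sup>2) + 8 * pi * (A - m)\<^sup>2" by simp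
  then show ?thesis using main unfolding I1 I2 by (simp add: power2_eq_square algebra_simps)
qed

section \<open>Energy inequalities in polar coordinates\<close>

locale polar_function =
  fixes \<alpha> \<beta> :: real and G Gs Gt :: "real \<Rightarrow> real \<Rightarrow> real"
  assumes \<alpha>\<beta>: "\<alpha> < \<beta>"
    and dGs: "\<And>s t. s \<in> {\<alpha>..\<beta>} \<Longrightarrow> ((\<lambda>s. G s t) has_real_derivative Gs s t) (at s within {\<alpha>..\<beta>})"
    and dGt: "\<And>s t. s \<in> {\<alpha>..\<beta>} \<Longrightarrow> ((\<lambda>t. G s t) has_real_derivative Gt s t) (at t)"
    and cG: "continuous_on ({\<alpha>..\<beta>} \<times> UNIV) (\<lambda>(s, t). G s t)"
    and cGs: "continuous_on ({\<alpha>..\<beta>} \<times> UNIV) (\<lambda>(s, t). Gs s t)"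
    and cGt: "continuous_on ({\<alpha>..\<beta>} \<times> UNIV) (\<lambda>(s, t). Gt s t)"
    and periodic: "\<And>s t. s \<in> {\<alpha>..\<beta>} \<Longrightarrow> G s (t + 2 * pi) = G s t"
begin

definition "I s = integral {-pi..pi} (\<lambda>t. (G s t)\<^sup>2)"
definition "C s = integral {-pi..pi} (\<lambda>t. G s t * Gs s t)"
definition "K s = integral {-pi..pi} (\<lambda>t. (Gs s t)\<^sup>2)"
definition "L s = integral {-pi..pi} (\<lambda>t. (Gt s t)\<^sup>2)"
definition "m s = integral {-pi..pi} (\<lambda>t. G s t) / (2 * pi)"
definition "p s = integral {-pi..pi} (\<lambda>t. G s t * cos t) / pi"
definition "q s = integral {-pi..pi} (\<lambda>t. G s t * sin t) / pi"
definition "m' s = integral {-pi..pi} (\<lambda>t. Gs s t) / (2 * pi)"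
definition "p' s = integral {-pi..pi} (\<lambda>t. Gs s t * cos t) / pi"
definition "q' s = integral {-pi..pi} (\<lambda>t. Gs s t * sin t) / pi"

abbreviation "R \<equiv> {\<alpha>..\<beta>} \<times> {-pi..pi}"

lemma cont2: "continuous_on R (\<lambda>x. G (fst x) (snd x))" "continuous_on R (\<lambda>x. Gs (fst x) (snd x))"
   "continuous_on R (\<lambda>x. Gt (fst x) (snd x))"
  using cG cGs cGt continuous_on_subset[of "{\<alpha>..\<beta>} \<times> UNIV" _ R] by (auto simp: case_prod_beta')

lemma slice: assumes "s \<in> {\<alpha>..\<beta>}"
  shows "continuous_on A (\<lambda>t. G s t)" "continuous_on A (\<lambda>t. Gs s t)" "continuous_on A (\<lambda>t. Gt s t)"
proof -
  have c: "continuous_on A (\<lambda>t. (s, t))" by (intro continuous_intros)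
  show "continuous_on A (\<lambda>t. G s t)" "continuous_on A (\<lambda>t. Gs s t)" "continuous_on A (\<lambda>t. Gt s t)"
    using continuous_on_compose2[OF cG c] continuous_on_compose2[OF cGs c] continuous_on_compose2[OF cGt c] assms
    by (auto simp: image_subset_iff)
qed

lemma param_continuous:
  assumes "continuous_on R (\<lambda>x. F (fst x) (snd x))"
  shows "continuous_on {\<alpha>..\<beta>} (\<lambda>s. integral {-pi..pi} (F s :: real \<Rightarrow> real))"
  using integral_continuous_on_param[of "{\<alpha>..\<beta>}" "-pi" pi F] assms by (simp add: case_prod_beta')

lemma param_derivative:
  assumes d: "\<And>s t. s \<in> {\<alpha>..\<beta>} \<Longrightarrow> ((\<lambda>s. F s t) has_real_derivative F' s t) (at s within {\<alpha>..\<beta>})"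
    and c: "\<And>s. s \<in> {\<alpha>..\<beta>} \<Longrightarrow> continuous_on {-pi..pi} (F s)"
    and c': "continuous_on R (\<lambda>x. F' (fst x) (snd x))" and s: "s \<in> {\<alpha>..\<beta>}"
  shows "((\<lambda>s. integral {-pi..pi} (F s)) has_real_derivative integral {-pi..pi} (F' s)) (at s within {\<alpha>..\<beta>})"
  using leibniz_rule_field_derivative[of "{\<alpha>..\<beta>}" "-pi" pi F F' s] d c c' s
  by (simp add: case_prod_beta' integrable_continuous_real)

lemma derivatives:
  assumes s: "s \<in> {\<alpha>..\<beta>}"
  shows "(I has_real_derivative 2 * C s) (at s within {\<alpha>..\<beta>})"
    "(m has_real_derivative m' s) (at s within {\<alpha>..\<beta>})"
    "(p has_real_derivative p' s) (at s within {\<alpha>..\<beta>})"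
    "(q has_real_derivative q' s) (at s within {\<alpha>..\<beta>})"
proof -
  have "((\<lambda>s. integral {-pi..pi} (\<lambda>t. (G s t)\<^sup>2)) has_real_derivative integral {-pi..pi} (\<lambda>t. 2 * (G s t * Gs s t))) (at s within {\<alpha>..\<beta>})"
    by (rule param_derivative[OF _ _ _ s])
      (auto intro!: derivative_eq_intros dGs continuous_intros slice cont2)
  then show "(I has_real_derivative 2 * C s) (at s within {\<alpha>..\<beta>})" by (simp add: I_def[abs_def] C_def)
  have "((\<lambda>s. integral {-pi..pi} (\<lambda>t. G s t)) has_real_derivative integral {-pi..pi} (\<lambda>t. Gs s t)) (at s within {\<alpha>..\<beta>})"
    by (rule param_derivative[OF _ _ _ s]) (auto intro!: derivative_eq_intros dGs continuous_intros slice cont2)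
  then show "(m has_real_derivative m' s) (at s within {\<alpha>..\<beta>})"
    unfolding m_def[abs_def] m'_def by (rule DERIV_cdivide)
  have "((\<lambda>s. integral {-pi..pi} (\<lambda>t. G s t * cos t)) has_real_derivative integral {-pi..pi} (\<lambda>t. Gs s t * cos t)) (at s within {\<alpha>..\<beta>})"
    by (rule param_derivative[OF _ _ _ s]) (auto intro!: derivative_eq_intros dGs continuous_intros slice cont2)
  then show "(p has_real_derivative p' s) (at s within {\<alpha>..\<beta>})"
    unfolding p_def[abs_def] p'_def by (rule DERIV_cdivide)
  have "((\<lambda>s. integral {-pi..pi} (\<lambda>t. G s t * sin t)) has_real_derivative integral {-pi..pi} (\<lambda>t. Gs s t * sin t)) (at s within {\<alpha>..\<beta>})"
    by (rule param_derivative[OF _ _ _ s]) (auto intro!: derivative_eq_intros dGs continuous_intros slice cont2)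
  then show "(q has_real_derivative q' s) (at s within {\<alpha>..\<beta>})"
    unfolding q_def[abs_def] q'_def by (rule DERIV_cdivide)
qed

lemma continuity:
  "continuous_on {\<alpha>..\<beta>} I" "continuous_on {\<alpha>..\<beta>} C" "continuous_on {\<alpha>..\<beta>} K" "continuous_on {\<alpha>..\<beta>} L"
  "continuous_on {\<alpha>..\<beta>} m" "continuous_on {\<alpha>..\<beta>} p" "continuous_on {\<alpha>..\<beta>} q"
  "continuous_on {\<alpha>..\<beta>} m'" "continuous_on {\<alpha>..\<beta>} p'" "continuous_on {\<alpha>..\<beta>} q'"
  unfolding I_def[abs_def] C_def[abs_def] K_def[abs_def] L_def[abs_def] m_def[abs_def] p_def[abs_def] q_def[abs_def]
    m'_def[abs_def] p'_def[abs_def] q'_def[abs_def]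
  by (intro continuous_on_divide continuous_on_const param_continuous; auto intro!: continuous_intros cont2)+

text \<open>Bessel's inequality for \<open>Gs s t - w * G s t\<close>. The number w is free: when it
  is chosen as a suitable function of s, the terms with \<open>C s\<close> and \<open>I s\<close>
  combine to a derivative up to an error controlled by \<open>energy_t\<close>, while the mean and
  the first modes keep their exact share.\<close>

lemma energy_s:
  assumes s: "s \<in> {\<alpha>..\<beta>}"
  shows "2 * w * C s - w\<^sup>2 * I s + 2 * pi * (m' s - w * m s)\<^sup>2 + pi * (p' s - w * p s)\<^sup>2 + pi * (q' s - w * q s)\<^sup>2 \<le> K s"
proof -
  let ?H = "\<lambda>t. Gs s t - w * G s t"
  note c = slice[OF s]
  have lin: "integral {-pi..pi} (\<lambda>t. Gs s t * f t - w * (G s t * f t)) = integral {-pi..pi} (\<lambda>t. Gs s t * f t) - w * integral {-pi..pi} (\<lambda>t. G s t * f t)"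
    if "continuous_on {-pi..pi} f" for f
    using integral_lin3[of "-pi" pi "\<lambda>t. Gs s t * f t" "\<lambda>t. G s t * f t" "\<lambda>t. 0" 1 "-w" 0] that
    by (simp add: continuous_intros c)
  have "2 * pi * (m' s - w * m s)\<^sup>2 + pi * (p' s - w * p s)\<^sup>2 + pi * (q' s - w * q s)\<^sup>2 \<le> integral {-pi..pi} (\<lambda>t. (?H t)\<^sup>2)"
  proof (rule bessel_inequality)
    show "continuous_on {-pi..pi} ?H" by (intro continuous_intros c)
    show "integral {-pi..pi} ?H = 2 * pi * (m' s - w * m s)"
    proof -
      have "integral {-pi..pi} ?H = integral {-pi..pi} (Gs s) - w * integral {-pi..pi} (G s)"
        using lin[of "\<lambda>t. 1"] by simp
      then show ?thesis by (simp add: m_def m'_def right_diff_distrib)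
    qed
    show "integral {-pi..pi} (\<lambda>t. ?H t * cos t) = pi * (p' s - w * p s)"
    proof -
      have "integral {-pi..pi} (\<lambda>t. ?H t * cos t) = integral {-pi..pi} (\<lambda>t. Gs s t * cos t) - w * integral {-pi..pi} (\<lambda>t. G s t * cos t)"
        using lin[OF continuous_on_cos[OF continuous_on_id]] by (simp add: left_diff_distrib mult.assoc)
      then show ?thesis by (simp add: p_def p'_def right_diff_distrib)
    qed
    show "integral {-pi..pi} (\<lambda>t. ?H t * sin t) = pi * (q' s - w * q s)"
    proof -
      have "integral {-pi..pi} (\<lambda>t. ?H t * sin t) = integral {-pi..pi} (\<lambda>t. Gs s t * sin t) - w * integral {-pi..pi} (\<lambda>t. G s t * sin t)"
        using lin[OF continuous_on_sin[OF continuous_on_id]] by (simp add: left_diff_distrib mult.assoc)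
      then show ?thesis by (simp add: q_def q'_def right_diff_distrib)
    qed
  qed
  also have "integral {-pi..pi} (\<lambda>t. (?H t)\<^sup>2) = integral {-pi..pi} (\<lambda>t. 1 * (Gs s t)\<^sup>2 + (- 2 * w) * (G s t * Gs s t) + w\<^sup>2 * (G s t)\<^sup>2)"
    by (rule Henstock_Kurzweil_Integration.integral_cong) (simp add: power2_eq_square algebra_simps)
  also have "\<dots> = K s - 2 * w * C s + w\<^sup>2 * I s"
    by (subst integral_lin3) (auto intro!: continuous_intros c simp: K_def C_def I_def)
  finally show ?thesis by simp
qed

text \<open>The angular constant is 4 on the remainder, 1 on the first modes and 0 on the mean.
  Against 4 times \<open>I s\<close> the modes therefore have to give back \<open>3 * pi\<close> and
  \<open>8 * pi\<close>.\<close>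

lemma energy_t:
  assumes s: "s \<in> {\<alpha>..\<beta>}"
  shows "4 * I s - 8 * pi * (m s)\<^sup>2 - 3 * pi * ((p s)\<^sup>2 + (q s)\<^sup>2) \<le> L s"
  unfolding I_def L_def
  by (rule wirtinger_second[OF dGt[OF s] slice(3)[OF s] periodic[OF s]]) (simp_all add: m_def p_def q_def)

lemma energy_0:
  assumes s: "s \<in> {\<alpha>..\<beta>}"
  shows "2 * pi * (m s)\<^sup>2 + pi * (p s)\<^sup>2 + pi * (q s)\<^sup>2 \<le> I s"
  unfolding I_def by (rule bessel_inequality[OF slice(1)[OF s]]) (simp_all add: m_def p_def q_def)

text \<open>The integrand dominates the derivative of \<open>I s - 2 * pi * (m s)^2\<close>, the
  circle integral without the share of the mean. Integration starts at a positive \<delta> because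
  polar coordinates are singular at the centre.\<close>

lemma disk_energy:
  assumes d: "0 < \<delta>" "\<alpha> \<le> \<delta>" "\<delta> < \<beta>" and mb: "m \<beta> = 0"
  shows "I \<beta> - (I \<delta> - 2 * pi * (m \<delta>)\<^sup>2) \<le> integral {\<delta>..\<beta>} (\<lambda>s. s * K s + L s / s)"
proof -
  let ?f = "\<lambda>s. 2 * C s - 2 * pi * (2 * m s * m' s)"
  have sub: "{\<delta>..\<beta>} \<subseteq> {\<alpha>..\<beta>}" using d by auto
  note cs = continuity[THEN continuous_on_subset, OF sub]
  have "(?f has_integral ((I \<beta> - 2 * pi * (m \<beta>)\<^sup>2) - (I \<delta> - 2 * pi * (m \<delta>)\<^sup>2))) {\<delta>..\<beta>}"
  proof (rule fundamental_theorem_of_calculus)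
    fix s assume s: "s \<in> {\<delta>..\<beta>}"
    then have s': "s \<in> {\<alpha>..\<beta>}" using sub by auto
    have "((\<lambda>s. I s - 2 * pi * (m s)\<^sup>2) has_real_derivative ?f s) (at s within {\<delta>..\<beta>})"
      using has_field_derivative_subset[OF derivatives(1)[OF s'] sub] has_field_derivative_subset[OF derivatives(2)[OF s'] sub]
      by (auto intro!: derivative_eq_intros)
    then show "((\<lambda>s. I s - 2 * pi * (m s)\<^sup>2) has_vector_derivative ?f s) (at s within {\<delta>..\<beta>})"
      by (simp add: has_real_derivative_iff_has_vector_derivative)
  qed (use d in simp)
  then have eq: "integral {\<delta>..\<beta>} ?f = I \<beta> - (I \<delta> - 2 * pi * (m \<delta>)\<^sup>2)" using mb by (simp add: integral_unique)
  have "integral {\<delta>..\<beta>} ?f \<le> integral {\<delta>..\<beta>} (\<lambda>s. s * K s + L s / s)"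
  proof (rule integral_le)
    show "?f integrable_on {\<delta>..\<beta>}" by (intro integrable_continuous_real continuous_intros cs)
    show "(\<lambda>s. s * K s + L s / s) integrable_on {\<delta>..\<beta>}"
      by (intro integrable_continuous_real continuous_intros cs) (use d in auto)
    fix s assume s: "s \<in> {\<delta>..\<beta>}"
    then have s': "s \<in> {\<alpha>..\<beta>}" and sp: "s > 0" using sub d by auto
    \<comment> \<open>\<open>1 / s\<close> is the logarithmic derivative of s, the radial profile of
      the linear functions on the plane, for which the form of the disk is 0.\<close>
    have e1: "2 * (1/s) * C s - (1/s)\<^sup>2 * I s + 2 * pi * (m' s - (1/s) * m s)\<^sup>2 \<le> K s"
      using energy_s[OF s', of "1/s"] by (smt (verit) pi_gt_zero zero_le_mult_iff zero_le_power2)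
    have e2: "I s - 2 * pi * (m s)\<^sup>2 \<le> L s" using energy_t[OF s'] energy_0[OF s'] by (simp add: algebra_simps)
    have e3: "s * (2 * (1/s) * C s - (1/s)\<^sup>2 * I s + 2 * pi * (m' s - (1/s) * m s)\<^sup>2) \<le> s * K s"
      using e1 sp by (intro mult_left_mono) auto
    have e4: "(I s - 2 * pi * (m s)\<^sup>2) / s \<le> L s / s" using e2 sp by (simp add: divide_right_mono)
    have "s * (2 * (1/s) * C s - (1/s)\<^sup>2 * I s + 2 * pi * (m' s - (1/s) * m s)\<^sup>2) + (I s - 2 * pi * (m s)\<^sup>2) / s
       = ?f s + 2 * pi * s * (m' s)\<^sup>2"
      using sp by (simp add: power2_eq_square field_simps)
    moreover have "2 * pi * s * (m' s)\<^sup>2 \<ge> 0" using sp by simp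
    ultimately show "?f s \<le> s * K s + L s / s" using e3 e4 by linarith
  qed
  then show ?thesis using eq by simp
qed

end

section \<open>The groups of angular modes on the catenoid\<close>

lemma cosh_tanh_facts:
  "1 - (tanh s)\<^sup>2 = 1 / (cosh s)\<^sup>2" for s :: real
proof -
  have "cosh s \<noteq> 0" using cosh_real_pos[of s] by linarith
  then have "1 - (tanh s)\<^sup>2 = ((cosh s)\<^sup>2 - (sinh s)\<^sup>2) / (cosh s)\<^sup>2"
    by (simp add: tanh_def power_divide diff_divide_distrib)
  then show ?thesis by (simp add: hyperbolic_pythagoras)
qed

locale catenoid_function = polar_function "-T" T G Gs Gt for T G Gs Gt +
  assumes T: "T > 0" "T * tanh T = 1"
begin

abbreviation "\<sigma> s \<equiv> 1 - (tanh s)\<^sup>2"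

text \<open>The comparison function is the Jacobi field of dilations. Its zeros are the two ends
  because \<open>T * tanh T = 1\<close>, and between them it is positive. At the ends its slope is
  nonzero and the mean is 0, so no boundary terms remain.\<close>

lemma mean_mode:
  assumes z: "m T = 0" "m (-T) = 0"
  shows "0 \<le> integral {-T..T} (\<lambda>s. (m' s)\<^sup>2 - 2 * \<sigma> s * (m s)\<^sup>2)"
proof -
  let ?h = "\<lambda>s. 1 - s * tanh s" and ?h' = "\<lambda>s. - (tanh s + s * \<sigma> s)"
  have dt: "(tanh has_real_derivative \<sigma> s) (at s within X)" for s :: real and X
    by (auto intro!: derivative_eq_intros)
  have "?h' T * (m T)\<^sup>2 / ?h T - ?h' (-T) * (m (-T))\<^sup>2 / ?h (-T) \<le> integral {-T..T} (\<lambda>s. (m' s)\<^sup>2 - 2 * \<sigma> s * (m s)\<^sup>2)"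
  proof (rule jacobi_comparison)
    show "-T < T" using T by simp
    show "(m has_real_derivative m' x) (at x within {-T..T})" if "x \<in> {-T..T}" for x by (rule derivatives(2)[OF that])
    show "continuous_on {-T..T} m'" by (rule continuity)
    show "(?h has_real_derivative ?h' x) (at x within {-T..T})" for x
      by (auto intro!: derivative_eq_intros dt simp: algebra_simps)
    show "continuous_on {-T..T} ?h'" by (intro continuous_intros) auto
    show "(?h' has_real_derivative - (2 * \<sigma> x) * ?h x) (at x)" for x
      by (auto intro!: derivative_eq_intros dt simp: power2_eq_square algebra_simps)
    show "continuous_on {-T..T} (\<lambda>s. 2 * \<sigma> s)" by (intro continuous_intros) auto
    show "?h x > 0" if x: "x \<in> {-T<..<T}" for x
    proof -
      have "x * tanh x = \<bar>x\<bar> * tanh \<bar>x\<bar>" by (simp add: abs_if)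
      also have "\<dots> \<le> \<bar>x\<bar> * tanh T"
      proof (rule mult_left_mono)
        show "tanh \<bar>x\<bar> \<le> tanh T" unfolding tanh_real_le_iff using x by auto
      qed simp
      also have "\<dots> < T * tanh T" using x T by (intro mult_strict_right_mono) auto
      finally show ?thesis using T by simp
    qed
    have tT: "tanh T > 0" using T by simp
    have s0: "\<sigma> T > 0" unfolding cosh_tanh_facts by simp
    have "tanh T + T * \<sigma> T > 0" using tT s0 T by (simp add: add_pos_pos)
    then show "m x = 0 \<and> ?h' x \<noteq> 0" if "x \<in> {-T, T}" for x using that z by auto
  qed
  then show ?thesis using z by simp
qed

text \<open>The comparison function is the profile of a rotation field about a horizontal axis. The
  potential is lowered by 1 because the angular derivative of a first mode contributes the square of
  its coefficient once more. The function vanishes at 0, where f does, and at T its logarithmic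
  derivative is exactly \<open>tanh T\<close>.\<close>

lemma first_mode_half:
  fixes f f' :: "real \<Rightarrow> real"
  assumes f: "\<And>x. x \<in> {0..T} \<Longrightarrow> (f has_real_derivative f' x) (at x within {0..T})" and cf: "continuous_on {0..T} f'" and z: "f 0 = 0"
  shows "tanh T * (f T)\<^sup>2 \<le> integral {0..T} (\<lambda>s. (f' s)\<^sup>2 - (2 * \<sigma> s - 1) * (f s)\<^sup>2)"
proof -
  let ?h = "\<lambda>s. s / cosh s + sinh s" and ?h' = "\<lambda>s. 1 / cosh s - s * sinh s / (cosh s)\<^sup>2 + cosh s"
  have c0: "cosh x \<noteq> (0::real)" for x using cosh_real_pos[of x] by linarith
  have cp: "cosh x > (0::real)" for x by (rule cosh_real_pos)
  have "?h' T * (f T)\<^sup>2 / ?h T - ?h' 0 * (f 0)\<^sup>2 / ?h 0 \<le> integral {0..T} (\<lambda>s. (f' s)\<^sup>2 - (2 * \<sigma> s - 1) * (f s)\<^sup>2)"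
  proof (rule jacobi_comparison)
    show "0 < T" by (rule T)
    show "(f has_real_derivative f' x) (at x within {0..T})" if "x \<in> {0..T}" for x by (rule f[OF that])
    show "(?h has_real_derivative ?h' x) (at x within {0..T})" for x
      by (rule derivative_eq_intros refl c0 | simp)+ (simp add: c0 field_simps power2_eq_square)
    show "continuous_on {0..T} ?h'" by (intro continuous_intros) (use c0 in auto)
    show "(?h' has_real_derivative - (2 * \<sigma> x - 1) * ?h x) (at x)" for x
    proof -
      have "(?h' has_real_derivative (- sinh x / (cosh x)\<^sup>2 - ((sinh x + x * cosh x) * (cosh x)\<^sup>2 - x * sinh x * (2 * cosh x * sinh x)) / ((cosh x)\<^sup>2)\<^sup>2 + sinh x)) (at x)"
        by (rule derivative_eq_intros refl c0 | simp add: c0)+ (simp add: c0 field_simps power2_eq_square)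
      moreover have "(- sinh x / (cosh x)\<^sup>2 - ((sinh x + x * cosh x) * (cosh x)\<^sup>2 - x * sinh x * (2 * cosh x * sinh x)) / ((cosh x)\<^sup>2)\<^sup>2 + sinh x) = - (2 * \<sigma> x - 1) * ?h x"
      proof -
        have s2: "sinh x * sinh x = cosh x * cosh x - 1" using cosh_square_eq[of x] by (simp add: power2_eq_square)
        define c where "c = cosh x"
        define s where "s = sinh x"
        have c: "c \<noteq> 0" and s2': "s * s = c * c - 1" using c0 s2 by (auto simp: c_def s_def)
        have xs: "x * s * (2 * c * s) = 2 * c * x * (c * c - 1)" unfolding s2'[symmetric] by simp
        show ?thesis unfolding cosh_tanh_facts c_def[symmetric] s_def[symmetric] xs
          using c by (simp add: field_simps power2_eq_square)
      qed
      ultimately show ?thesis by simp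
    qed
    show "continuous_on {0..T} (\<lambda>s. 2 * \<sigma> s - 1)" by (intro continuous_intros) auto
    show "?h x > 0" if "x \<in> {0<..<T}" for x using that cp by (auto intro!: add_pos_pos)
    have "?h T > 0" using T cp by (auto intro!: add_pos_pos)
    then show "f x = 0 \<and> ?h' x \<noteq> 0" if "x \<in> {0, T}" "?h x = 0" for x using that z by auto
  qed (rule cf)
  moreover have "?h' T = tanh T * ?h T"
  proof -
    have t: "T * sinh T = cosh T" using T c0[of T] by (simp add: tanh_def field_simps)
    have "?h' T = 1 / cosh T - cosh T / (cosh T)\<^sup>2 + cosh T" unfolding t by simp
    then have 1: "?h' T = cosh T" using c0 by (simp add: power2_eq_square)
    have "tanh T * ?h T = (T * sinh T + (sinh T)\<^sup>2 * cosh T) / (cosh T)\<^sup>2"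
      using c0 by (simp add: tanh_def field_simps power2_eq_square)
    also have "T * sinh T + (sinh T)\<^sup>2 * cosh T = cosh T * (cosh T)\<^sup>2"
      unfolding t cosh_square_eq by (simp add: algebra_simps)
    also have "cosh T * (cosh T)\<^sup>2 / (cosh T)\<^sup>2 = cosh T" using c0[of T] by simp
    finally show ?thesis using 1 by simp
  qed
  moreover have "?h T \<noteq> 0" using T cp[of T] by (metis add_pos_pos divide_pos_pos less_irrefl sinh_real_pos_iff)
  ultimately show ?thesis using z by simp
qed

text \<open>The comparison function changes sign at the neck, so each half is treated separately,
  the negative one after reflection.\<close>

lemma first_mode:
  fixes f f' :: "real \<Rightarrow> real"
  assumes f: "\<And>x. x \<in> {-T..T} \<Longrightarrow> (f has_real_derivative f' x) (at x within {-T..T})" and cf: "continuous_on {-T..T} f'" and z: "f 0 = 0"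
  shows "tanh T * ((f T)\<^sup>2 + (f (-T))\<^sup>2) \<le> integral {-T..T} (\<lambda>s. (f' s)\<^sup>2 - (2 * \<sigma> s - 1) * (f s)\<^sup>2)"
proof -
  let ?k = "\<lambda>s. (f' s)\<^sup>2 - (2 * \<sigma> s - 1) * (f s)\<^sup>2"
  have cof: "continuous_on {-T..T} f" using f DERIV_continuous continuous_on_eq_continuous_within by blast
  have ck: "continuous_on {-T..T} ?k" by (intro continuous_intros cf cof) auto
  have 1: "tanh T * (f T)\<^sup>2 \<le> integral {0..T} ?k"
  proof (rule first_mode_half)
    show "(f has_real_derivative f' x) (at x within {0..T})" if "x \<in> {0..T}" for x
      by (rule has_field_derivative_subset[OF f]) (use that T in auto)
    show "continuous_on {0..T} f'" by (rule continuous_on_subset[OF cf]) (use T in auto)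
  qed (rule z)
  have 2: "tanh T * (f (-T))\<^sup>2 \<le> integral {0..T} (\<lambda>s. (- f' (-s))\<^sup>2 - (2 * \<sigma> s - 1) * (f (-s))\<^sup>2)"
  proof (rule first_mode_half)
    show "((\<lambda>x. f (- x)) has_real_derivative - f' (-x)) (at x within {0..T})" if x: "x \<in> {0..T}" for x
    proof -
      have a: "(uminus has_real_derivative -1) (at x within {0..T})" by (auto intro!: derivative_eq_intros)
      have b: "(f has_real_derivative f' (-x)) (at (-x) within uminus ` {0..T})"
        by (rule has_field_derivative_subset[OF f]) (use x T in auto)
      show ?thesis using DERIV_image_chain[OF b a] by (simp add: o_def)
    qed
    show "continuous_on {0..T} (\<lambda>x. - f' (- x))"
      by (intro continuous_on_minus continuous_on_compose2[OF cf]) (use T in \<open>auto intro!: continuous_intros\<close>)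
  qed (simp add: z)
  have "integral {0..T} (\<lambda>s. (- f' (-s))\<^sup>2 - (2 * \<sigma> s - 1) * (f (-s))\<^sup>2) = integral {0..T} (\<lambda>s. ?k (- s))" by simp
  also have "\<dots> = integral {-T..0} ?k" using Henstock_Kurzweil_Integration.integral_reflect_real[of 0 "-T" ?k] by simp
  finally have 3: "tanh T * (f (-T))\<^sup>2 \<le> integral {-T..0} ?k" using 2 by simp
  have "integral {-T..0} ?k + integral {0..T} ?k = integral {-T..T} ?k"
    using T integrable_continuous_real[OF ck] by (intro Henstock_Kurzweil_Integration.integral_combine) auto
  then show ?thesis using 1 3 by (simp add: algebra_simps)
qed

text \<open>The Riccati function tanh has derivative \<sigma>, and at the ends it takes the value
  \<open>tanh T\<close> with which the boundary integral is weighted. The mean and first modes are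
  taken out of this estimate and handled by their own comparison functions.\<close>

lemma catenoid_energy:
  assumes mz: "m T = 0" "m (-T) = 0" and pz: "p 0 = 0" "q 0 = 0"
  shows "tanh T * (I T + I (-T)) \<le> integral {-T..T} (\<lambda>s. K s + L s - 2 * \<sigma> s * I s)"
proof -
  note cs = continuity
  let ?A = "\<lambda>s. (m' s)\<^sup>2 - 2 * \<sigma> s * (m s)\<^sup>2"
  let ?B = "\<lambda>f f' s. (f' s)\<^sup>2 - (2 * \<sigma> s - 1) * (f s)\<^sup>2"
  let ?D = "\<lambda>s. \<sigma> s * I s + tanh s * (2 * C s)
     - 2 * pi * (\<sigma> s * (m s)\<^sup>2 + tanh s * (2 * m s * m' s)) - pi * (\<sigma> s * (p s)\<^sup>2 + tanh s * (2 * p s * p' s))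
     - pi * (\<sigma> s * (q s)\<^sup>2 + tanh s * (2 * q s * q' s))"
  \<comment> \<open>tanh times the share of \<open>I s\<close> that belongs to the remainder;
    \<open>?D\<close> is its derivative.\<close>
  let ?E = "\<lambda>s. tanh s * I s - 2 * pi * (tanh s * (m s)\<^sup>2) - pi * (tanh s * (p s)\<^sup>2) - pi * (tanh s * (q s)\<^sup>2)"
  have dt: "(tanh has_real_derivative \<sigma> s) (at s within X)" for s :: real and X
    by (auto intro!: derivative_eq_intros)
  have "(?D has_integral (?E T - ?E (-T))) {-T..T}"
  proof (rule fundamental_theorem_of_calculus)
    fix s assume s: "s \<in> {-T..T}"
    have "(?E has_real_derivative ?D s) (at s within {-T..T})"
      using derivatives[OF s] dt[of s "{-T..T}"] by (auto intro!: derivative_eq_intros simp: algebra_simps)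
    then show "(?E has_vector_derivative ?D s) (at s within {-T..T})"
      by (simp add: has_real_derivative_iff_has_vector_derivative)
  qed (use T in simp)
  then have iD: "integral {-T..T} ?D = tanh T * (I T + I (-T)) - pi * (tanh T * ((p T)\<^sup>2 + (p (-T))\<^sup>2)) - pi * (tanh T * ((q T)\<^sup>2 + (q (-T))\<^sup>2))"
    using mz by (simp add: integral_unique algebra_simps)
  have cA: "continuous_on {-T..T} ?A" "continuous_on {-T..T} (?B p p')" "continuous_on {-T..T} (?B q q')" "continuous_on {-T..T} ?D"
    by (intro continuous_intros cs; simp)+
  let ?F = "\<lambda>s. 1 * ?D s + (2 * pi) * ?A s + pi * (?B p p' s + ?B q q' s)"
  have iF: "integral {-T..T} ?F = integral {-T..T} ?D + 2 * pi * integral {-T..T} ?A + pi * (integral {-T..T} (?B p p') + integral {-T..T} (?B q q'))"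
  proof -
    have "integral {-T..T} ?F = 1 * integral {-T..T} ?D + (2 * pi) * integral {-T..T} ?A + pi * integral {-T..T} (\<lambda>s. ?B p p' s + ?B q q' s)"
      by (rule integral_lin3) (intro continuous_on_add cA)+
    moreover have "integral {-T..T} (\<lambda>s. ?B p p' s + ?B q q' s) = integral {-T..T} (?B p p') + integral {-T..T} (?B q q')"
      by (rule Henstock_Kurzweil_Integration.integral_add; intro integrable_continuous_real cA)
    ultimately show ?thesis by simp
  qed
  have "integral {-T..T} ?F \<le> integral {-T..T} (\<lambda>s. K s + L s - 2 * \<sigma> s * I s)"
  proof (rule integral_le)
    show "?F integrable_on {-T..T}" by (intro integrable_continuous_real continuous_on_add continuous_on_mult_left cA)
    show "(\<lambda>s. K s + L s - 2 * \<sigma> s * I s) integrable_on {-T..T}"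
      by (intro integrable_continuous_real continuous_intros cs) auto
    fix s assume s: "s \<in> {-T..T}"
    define w where "w = tanh s"
    have w2: "w\<^sup>2 \<ge> 0" by simp
    \<comment> \<open>The surplus on the remainder: \<open>4 - 3 * \<sigma> s - w^2\<close> is
      \<open>1 + 2 * w^2\<close>, because \<sigma> is \<open>1 - w^2\<close>.\<close>
    have e3: "(1 + 2 * w\<^sup>2) * (I s - 2 * pi * (m s)\<^sup>2 - pi * (p s)\<^sup>2 - pi * (q s)\<^sup>2) \<ge> 0"
      using energy_0[OF s] w2 by (intro mult_nonneg_nonneg) auto
    show "?F s \<le> K s + L s - 2 * \<sigma> s * I s"
      using energy_s[OF s, of w] energy_t[OF s] e3 unfolding w_def[symmetric]
      by (simp add: power2_eq_square algebra_simps)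
  qed
  moreover have "0 \<le> 2 * pi * integral {-T..T} ?A" using mean_mode[OF mz] by simp
  moreover have "pi * (tanh T * ((p T)\<^sup>2 + (p (-T))\<^sup>2)) \<le> pi * integral {-T..T} (?B p p')"
    by (intro mult_left_mono first_mode derivatives continuity pz) auto
  moreover have "pi * (tanh T * ((q T)\<^sup>2 + (q (-T))\<^sup>2)) \<le> pi * integral {-T..T} (?B q q')"
    by (intro mult_left_mono first_mode derivatives continuity pz) auto
  ultimately show ?thesis unfolding iF iD by (simp add: algebra_simps)
qed

end

section \<open>Surfaces of revolution\<close>

lemma Ck_on_mono: "Ck_on (Suc k) W f \<Longrightarrow> Ck_on k W f"
proof (induction k arbitrary: f)
  case 0
  then show ?case by (auto intro!: continuous_at_imp_continuous_on differentiable_imp_continuous_within)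
next
  case (Suc k)
  then show ?case by simp
qed

lemma Ck_on_add:
  assumes "open W" "Ck_on k W f" "Ck_on k W g"
  shows "Ck_on k W (\<lambda>x. f x + g x)"
  using assms(2,3)
proof (induction k arbitrary: f g)
  case 0
  then show ?case by (simp add: continuous_on_add)
next
  case (Suc k)
  have d: "((\<lambda>x. f x + g x) has_derivative (\<lambda>v. frechet_derivative f (at x) v + frechet_derivative g (at x) v)) (at x)" if "x \<in> W" for x
    using Suc.prems that by (auto intro!: has_derivative_add simp: frechet_derivative_works[symmetric])
  show ?case unfolding Ck_on.simps
  proof (intro conjI ballI allI)
    show "(\<lambda>x. f x + g x) differentiable at x" if "x \<in> W" for x using d[OF that] by (rule differentiableI)
    show "Ck_on k W (\<lambda>x. frechet_derivative (\<lambda>x. f x + g x) (at x) v)" for v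
    proof (subst Ck_on_cong[OF assms(1)])
      show "frechet_derivative (\<lambda>x. f x + g x) (at y) v = frechet_derivative f (at y) v + frechet_derivative g (at y) v" if "y \<in> W" for y
        using frechet_derivative_at[OF d[OF that]] by (simp add: fun_eq_iff)
      show "Ck_on k W (\<lambda>y. frechet_derivative f (at y) v + frechet_derivative g (at y) v)"
        using Suc.prems by (intro Suc.IH) auto
    qed
  qed
qed

text \<open>The product rule brings in f and g themselves one order lower, whence the appeal to
  \<open>Ck_on_mono\<close>.\<close>

lemma Ck_on_scaleR:
  assumes "open W" "Ck_on k W f" "Ck_on k W g"
  shows "Ck_on k W (\<lambda>x. f x *\<^sub>R g x)"
  using assms(2,3)
proof (induction k arbitrary: f g)
  case 0
  then show ?case by (simp add: continuous_on_scaleR)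
next
  case (Suc k)
  have d: "((\<lambda>x. f x *\<^sub>R g x) has_derivative (\<lambda>v. f x *\<^sub>R frechet_derivative g (at x) v + frechet_derivative f (at x) v *\<^sub>R g x)) (at x)" if "x \<in> W" for x
    using Suc.prems that by (auto intro!: has_derivative_scaleR simp: frechet_derivative_works[symmetric])
  show ?case unfolding Ck_on.simps
  proof (intro conjI ballI allI)
    show "(\<lambda>x. f x *\<^sub>R g x) differentiable at x" if "x \<in> W" for x using d[OF that] by (rule differentiableI)
    show "Ck_on k W (\<lambda>x. frechet_derivative (\<lambda>x. f x *\<^sub>R g x) (at x) v)" for v
    proof (subst Ck_on_cong[OF assms(1)])
      show "frechet_derivative (\<lambda>x. f x *\<^sub>R g x) (at y) v = f y *\<^sub>R frechet_derivative g (at y) v + frechet_derivative f (at y) v *\<^sub>R g y" if "y \<in> W" for y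
        using frechet_derivative_at[OF d[OF that]] by (simp add: fun_eq_iff)
      show "Ck_on k W (\<lambda>y. f y *\<^sub>R frechet_derivative g (at y) v + frechet_derivative f (at y) v *\<^sub>R g y)"
        using Suc.prems Ck_on_mono[OF Suc.prems(1)] Ck_on_mono[OF Suc.prems(2)]
        by (intro Ck_on_add[OF assms(1)] Suc.IH) auto
    qed
  qed
qed

text \<open>The whole sequence of derivatives is carried along, together with a constant factor r
  that absorbs the chain rule; this makes the induction on the order close.\<close>

lemma smooth_on_coordinate:
  fixes D :: "nat \<Rightarrow> real \<Rightarrow> real"
  assumes D: "\<And>n x. (D n has_real_derivative D (Suc n) x) (at x)"
  shows "smooth_on W (\<lambda>y::real^2. D 0 (b + c * y $ i))"
proof -
  have d: "((\<lambda>y::real^2. r * D n (b + c * y $ i)) has_derivative (\<lambda>v. r * (c * v $ i * D (Suc n) (b + c * y $ i)))) (at y)" for r n y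
    by (intro has_derivative_mult_right DERIV_compose_FDERIV[OF D])
      (auto intro!: derivative_eq_intros bounded_linear_imp_has_derivative bounded_linear_vec_nth)
  have "Ck_on k W (\<lambda>y::real^2. r * D n (b + c * y $ i))" for k r n
  proof (induction k arbitrary: r n)
    case 0
    then show ?case using d[of r n]
      by (auto intro!: continuous_at_imp_continuous_on differentiable_imp_continuous_within differentiableI)
  next
    case (Suc k)
    have "(\<lambda>y. frechet_derivative (\<lambda>y::real^2. r * D n (b + c * y $ i)) (at y) v) = (\<lambda>y. (r * c * v $ i) * D (Suc n) (b + c * y $ i))" for v
      by (rule ext, subst frechet_derivative_at[OF d, symmetric]) simp
    then show ?case using Suc differentiableI[OF d] by simp
  qed
  from this[of _ 1 0] show ?thesis by (simp add: smooth_on_def)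
qed

lemma smooth_on_cos_sin: "smooth_on W (\<lambda>y::real^2. cos (b + c * y $ i))" "smooth_on W (\<lambda>y::real^2. sin (b + c * y $ i))"
proof -
  \<comment> \<open>Each derivative of the cosine is a shift by \<open>pi / 2\<close>, which gives
    the whole sequence in closed form.\<close>
  have D: "((\<lambda>x. cos (x + real n * (pi / 2))) has_real_derivative cos (x + real (Suc n) * (pi / 2))) (at x)" for n x
  proof -
    have "x + real (Suc n) * (pi / 2) = (x + real n * (pi / 2)) + pi / 2" by (simp add: field_simps)
    then have "cos (x + real (Suc n) * (pi / 2)) = cos ((x + real n * (pi / 2)) + pi / 2)" by (rule arg_cong)
    also have "\<dots> = - sin (x + real n * (pi / 2))" by (subst cos_add) simp
    finally show ?thesis by (auto intro!: derivative_eq_intros)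
  qed
  from smooth_on_coordinate[where D = "\<lambda>n x. cos (x + real n * (pi / 2))", OF D]
  show *: "smooth_on W (\<lambda>y::real^2. cos (b + c * y $ i))" for b by simp
  have "sin x = cos (x - pi / 2)" for x :: real by (simp add: cos_diff)
  then have "sin (b + c * y $ i) = cos (b - pi / 2 + c * y $ i)" for y :: "real^2" by (simp add: algebra_simps)
  with *[of "b - pi / 2"] show "smooth_on W (\<lambda>y::real^2. sin (b + c * y $ i))" by presburger
qed

section \<open>Rotating frames, profile curves and their charts\<close>

locale frame =
  fixes e1 e2 :: "real^3"
  assumes e: "e1 \<bullet> e1 = 1" "e2 \<bullet> e2 = 1" "e1 \<bullet> e2 = 0"
begin

definition "e3 = cross3 e1 e2"
definition "er t = cos t *\<^sub>R e1 + sin t *\<^sub>R e2"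
definition "et t = cos t *\<^sub>R e2 - sin t *\<^sub>R e1"

lemma e3: "e3 \<bullet> e3 = 1" "e3 \<bullet> e1 = 0" "e3 \<bullet> e2 = 0" "e1 \<bullet> e3 = 0" "e2 \<bullet> e3 = 0"
proof -
  have "(norm e3)\<^sup>2 = 1" unfolding e3_def using norm_cross_dot[of e1 e2] e by (simp add: norm_eq_sqrt_inner)
  then show "e3 \<bullet> e3 = 1" by (simp add: dot_square_norm)
  show "e3 \<bullet> e1 = 0" "e3 \<bullet> e2 = 0" "e1 \<bullet> e3 = 0" "e2 \<bullet> e3 = 0" by (simp_all add: e3_def dot_cross_self)
qed

lemma e': "e2 \<bullet> e1 = 0" using e by (simp add: inner_commute)

lemma er_et:
  "er t \<bullet> er t = 1" "et t \<bullet> et t = 1" "er t \<bullet> et t = 0" "et t \<bullet> er t = 0"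
  "er t \<bullet> e3 = 0" "et t \<bullet> e3 = 0" "e3 \<bullet> er t = 0" "e3 \<bullet> et t = 0"
  using e e' e3 by (simp_all add: er_def et_def inner_simps power2_eq_square[symmetric])

lemma er_e: "er t \<bullet> e1 = cos t" "er t \<bullet> e2 = sin t"
  using e e' by (simp_all add: er_def inner_simps)

lemma derivative_er: "(er has_vector_derivative et t) (at t within A)"
  and derivative_et: "(et has_vector_derivative - er t) (at t within A)"
  unfolding er_def[abs_def] et_def[abs_def] by (auto intro!: derivative_eq_intros)

lemma continuous_er: "continuous_on A f \<Longrightarrow> continuous_on A (\<lambda>x. er (f x))"
  and continuous_et: "continuous_on A f \<Longrightarrow> continuous_on A (\<lambda>x. et (f x))"
  for f :: "'b::t2_space \<Rightarrow> real"
  unfolding er_def et_def by (auto intro!: continuous_intros)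

end

text \<open>The function \<sigma> recovers the profile parameter from the point, continuously on S.
  It supplies one coordinate of every inverse chart, and it stays continuous where the profile meets
  the axis, as \<open>norm\<close> does on the disk.\<close>

locale revolution = frame +
  fixes S :: "(real^3) set" and \<rho> \<rho>' z z' :: "real \<Rightarrow> real" and \<sigma> :: "real^3 \<Rightarrow> real" and J :: "real set"
  assumes d\<rho>: "\<And>s. (\<rho> has_real_derivative \<rho>' s) (at s)" and dz: "\<And>s. (z has_real_derivative z' s) (at s)"
    and smooth_\<rho>: "\<And>b c W. smooth_on W (\<lambda>y::real^2. \<rho> (b + c * y $ 2))"
    and smooth_z: "\<And>b c W. smooth_on W (\<lambda>y::real^2. z (b + c * y $ 2))"
    and regular: "\<And>s. (\<rho>' s)\<^sup>2 + (z' s)\<^sup>2 > 0"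
    and S: "S = (\<lambda>(s, t). \<rho> s *\<^sub>R er t + z s *\<^sub>R e3) ` (J \<times> UNIV)"
    and \<sigma>: "continuous_on S \<sigma>" "\<And>s t. s \<in> J \<Longrightarrow> \<sigma> (\<rho> s *\<^sub>R er t + z s *\<^sub>R e3) = s"
begin

definition "X s t = \<rho> s *\<^sub>R er t + z s *\<^sub>R e3"
definition "Xs s t = \<rho>' s *\<^sub>R er t + z' s *\<^sub>R e3"
definition "Xt s t = \<rho> s *\<^sub>R et t"
definition "speed s = sqrt ((\<rho>' s)\<^sup>2 + (z' s)\<^sup>2)"

text \<open>
  The parameters are \<open>s = b + c y\<^sub>2\<close> and \<open>t = - c y\<^sub>1\<close> with \<open>c = \<plusminus>1\<close>: charts from both ends of the profile
  are then coherently oriented.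
\<close>

definition "chart b c (y::real^2) = X (b + c * y $ 2) (- (c * y $ 1))"
definition "chart_domain d t0 = {y::real^2. \<bar>y $ 1 - t0\<bar> < pi \<and> y $ 2 < d}"

lemma X_in: "s \<in> J \<Longrightarrow> X s t \<in> S" and \<sigma>_X: "s \<in> J \<Longrightarrow> \<sigma> (X s t) = s"
  using \<sigma>(2) by (auto simp: S X_def)

lemma X_cases: assumes "x \<in> S" obtains s t where "s \<in> J" "x = X s t"
  using assms by (auto simp: S X_def)

lemma inner_X: "Xs s t \<bullet> Xs s t = (speed s)\<^sup>2" "Xt s t \<bullet> Xt s t = (\<rho> s)\<^sup>2" "Xs s t \<bullet> Xt s t = 0" "Xt s t \<bullet> Xs s t = 0"
  by (simp_all add: Xs_def Xt_def speed_def inner_simps er_et e3 power2_eq_square)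

lemma speed_pos: "speed s > 0" using regular by (simp add: speed_def)

lemma derivative_X_s: "((\<lambda>s. X s t) has_vector_derivative Xs s t) (at s within A)"
  unfolding X_def Xs_def
  by (rule has_vector_derivative_eq_rhs[OF has_vector_derivative_add[OF
        has_vector_derivative_scaleR[OF has_field_derivative_at_within[OF d\<rho>] has_vector_derivative_const]
        has_vector_derivative_scaleR[OF has_field_derivative_at_within[OF dz] has_vector_derivative_const]]]) simp

lemma derivative_X_t: "(X s has_vector_derivative Xt s t) (at t within A)"
  unfolding X_def[abs_def] Xt_def
  by (rule has_vector_derivative_eq_rhs[OF has_vector_derivative_add[OF
        has_vector_derivative_scaleR[OF DERIV_const derivative_er] has_vector_derivative_const]]) simp

lemma X_periodic: "X s (t + 2 * pi) = X s t"
  by (simp add: X_def er_def)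

lemma continuous_profile: "continuous_on A \<rho>" "continuous_on A z"
  using d\<rho> dz by (auto intro!: continuous_at_imp_continuous_on DERIV_isCont)

lemma continuous_X:
  fixes f g :: "'b::t2_space \<Rightarrow> real"
  assumes "continuous_on A f" "continuous_on A g" shows "continuous_on A (\<lambda>x. X (f x) (g x))"
  unfolding X_def
  by (intro continuous_intros continuous_er assms continuous_on_compose2[OF continuous_profile(1) assms(1)]
      continuous_on_compose2[OF continuous_profile(2) assms(1)]) auto

lemma continuous_Xt:
  fixes f g :: "'b::t2_space \<Rightarrow> real"
  assumes "continuous_on A f" "continuous_on A g" shows "continuous_on A (\<lambda>x. Xt (f x) (g x))"
  unfolding Xt_def
  by (intro continuous_intros continuous_et assms continuous_on_compose2[OF continuous_profile(1) assms(1)]) auto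

lemma derivative_chart:
  "(chart b c has_derivative (\<lambda>v. (c * v $ 2) *\<^sub>R Xs (b + c * y $ 2) (- (c * y $ 1)) - (c * v $ 1) *\<^sub>R Xt (b + c * y $ 2) (- (c * y $ 1)))) (at y)"
proof -
  have n: "((\<lambda>y::real^2. y $ i) has_derivative (\<lambda>v. v $ i)) (at y)" for i
    by (rule bounded_linear_imp_has_derivative[OF bounded_linear_vec_nth])
  have l: "((\<lambda>y::real^2. b + c * y $ 2) has_derivative (\<lambda>v. c * v $ 2)) (at y)" "((\<lambda>y::real^2. - (c * y $ 1)) has_derivative (\<lambda>v. - (c * v $ 1))) (at y)"
    by (auto intro!: derivative_eq_intros n)
  have er: "((\<lambda>y::real^2. er (- (c * y $ 1))) has_derivative (\<lambda>v. (- (c * v $ 1)) *\<^sub>R et (- (c * y $ 1)))) (at y)"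
    using has_derivative_compose[OF l(2) derivative_er[unfolded has_vector_derivative_def, of _ UNIV]] by simp
  note r = DERIV_compose_FDERIV[OF d\<rho> l(1)] and z = DERIV_compose_FDERIV[OF dz l(1)]
  show ?thesis unfolding chart_def[abs_def] X_def
    by (rule has_derivative_eq_rhs[OF has_derivative_add[OF has_derivative_scaleR[OF r er] has_derivative_scaleR[OF z has_derivative_const]]])
      (simp add: fun_eq_iff Xs_def Xt_def algebra_simps)
qed

lemma smooth_chart: "smooth_on W (chart b c)" if "open W"
proof -
  have "Ck_on k W (\<lambda>y. \<rho> (b + c * y $ 2) *\<^sub>R (cos (0 + (-c) * y $ 1) *\<^sub>R e1 + sin (0 + (-c) * y $ 1) *\<^sub>R e2) + z (b + c * y $ 2) *\<^sub>R e3)" for k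
    using smooth_\<rho>[of W b c] smooth_z[of W b c] smooth_on_cos_sin[of W 0 "-c" 1]
    unfolding smooth_on_def by (intro Ck_on_add Ck_on_scaleR Ck_on_const that) auto
  then show ?thesis by (simp add: smooth_on_def chart_def[abs_def] X_def er_def)
qed

lemma open_chart_domain: "open (chart_domain d t0)"
proof -
  have "chart_domain d t0 = {y. \<bar>y $ 1 - t0\<bar> < pi} \<inter> {y. y $ 2 < d}" by (auto simp: chart_domain_def)
  also have "open \<dots>" by (intro open_Int open_Collect_less continuous_intros)
  finally show ?thesis .
qed

text \<open>The projection to the plane of rotation as a complex number, so that \<open>Arg\<close>
  can serve as the angular coordinate.\<close>

definition "angle x = Complex (x \<bullet> e1) (x \<bullet> e2)"

lemma angle_X: "angle (X s t) = of_real (\<rho> s) * cis t"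
  by (simp add: angle_def X_def inner_simps er_e e3 complex_eq_iff)

text \<open>A chart starts at the end b of the profile and runs inward, in direction c, for a
  parameter length d. Positivity of \<rho> is asked for all \<open>y < d\<close>, negative y
  included, because a parametrization must be an immersion also on the collar outside the half
  plane.\<close>

definition "admissible b c d \<longleftrightarrow> c * c = 1 \<and> (\<forall>y. 0 \<le> y \<and> y < d \<longrightarrow> b + c * y \<in> J)
  \<and> (\<forall>s\<in>J. c * (s - b) \<ge> 0) \<and> (\<forall>y<d. \<rho> (b + c * y) > 0)"

text \<open>The angular range is an open interval of length \<open>2 * pi\<close>, so exactly one
  meridian is missing: the one on which \<open>t + c * t0\<close> is an odd multiple of pi.\<close>

lemma chart_image_iff:
  assumes a: "admissible b c d" and s: "s \<in> J"
  shows "X s t \<in> chart b c ` (chart_domain d t0 \<inter> half_plane) \<longleftrightarrow> c * (s - b) < d \<and> cos (t + c * t0) \<noteq> -1"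
proof
  have c: "c * c = 1" and J: "\<And>y. 0 \<le> y \<Longrightarrow> y < d \<Longrightarrow> b + c * y \<in> J" and nn: "c * (s - b) \<ge> 0"
    and pos: "\<And>y. y < d \<Longrightarrow> \<rho> (b + c * y) > 0" using a s by (auto simp: admissible_def)
  have c1: "\<bar>c\<bar> = 1" using c by (auto simp: square_eq_1_iff)
  show "c * (s - b) < d \<and> cos (t + c * t0) \<noteq> -1" if "X s t \<in> chart b c ` (chart_domain d t0 \<inter> half_plane)"
  proof -
    from that obtain y where "X s t = chart b c y" "y \<in> chart_domain d t0 \<inter> half_plane" by (rule imageE)
    then have y: "X s t = X (b + c * y $ 2) (- (c * y $ 1))" "\<bar>y $ 1 - t0\<bar> < pi" "y $ 2 < d" "y $ 2 \<ge> 0"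
      by (simp_all add: chart_def chart_domain_def half_plane_def)
    have "s = b + c * y $ 2" using \<sigma>_X[OF s, of t] \<sigma>_X[OF J[OF y(4,3)]] y(1) by simp
    then have s2: "c * (s - b) = y $ 2" using c by (simp add: mult.assoc[symmetric])
    have p: "\<rho> s > 0" using pos[OF y(3)] \<open>s = _\<close> by simp
    have "of_real (\<rho> s) * cis t = of_real (\<rho> s) * cis (- (c * y $ 1))"
      using y(1) \<open>s = _\<close> by (metis angle_X)
    then have ct: "cis t = cis (- (c * y $ 1))" using p by simp
    have "cis (t + c * t0) = cis (c * (t0 - y $ 1))"
      by (simp add: cis_mult[symmetric] ct) (simp add: cis_mult algebra_simps)
    then have "cos (t + c * t0) = cos \<bar>c * (t0 - y $ 1)\<bar>" by (metis cos_abs_real cis.sel(1))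
    moreover have "cos pi < cos \<bar>c * (t0 - y $ 1)\<bar>"
      by (rule cos_monotone_0_pi) (use y(2) c1 in \<open>auto simp: abs_mult abs_minus_commute\<close>)
    ultimately show ?thesis using s2 y by simp
  qed
  show "X s t \<in> chart b c ` (chart_domain d t0 \<inter> half_plane)" if "c * (s - b) < d \<and> cos (t + c * t0) \<noteq> -1"
  proof -
    define r where "r = Arg (cis (t + c * t0))"
    have r: "cis r = cis (t + c * t0)" unfolding r_def by (metis cis_Arg cis_neq_zero sgn_cis)
    have "r \<noteq> pi" using that r by (metis cis.sel(1) cos_pi)
    then have r': "\<bar>r\<bar> < pi" using Arg_bounded[of "cis (t + c * t0)"] unfolding r_def by auto
    let ?y = "vector [t0 - c * r, c * (s - b)] :: real^2"
    have "- (c * (t0 - c * r)) = - c * t0 + (c * c) * r" by (simp add: algebra_simps)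
    then have "cis (- (c * (t0 - c * r))) = cis (- c * t0) * cis r" using c by (simp add: cis_mult)
    also have "\<dots> = cis t" unfolding r by (simp add: cis_mult)
    finally have "er (- (c * (t0 - c * r))) = er t" unfolding er_def by (metis cis.sel)
    moreover have "b + c * (c * (s - b)) = s" using c by (simp add: mult.assoc[symmetric])
    ultimately have "X s t = chart b c ?y" by (simp add: chart_def X_def)
    moreover have "?y \<in> chart_domain d t0 \<inter> half_plane"
      using that nn r' c1 by (simp add: chart_domain_def half_plane_def abs_mult)
    ultimately show ?thesis by blast
  qed
qed

lemma nonpos_Reals_cis: "r > 0 \<Longrightarrow> of_real r * cis t \<in> \<real>\<^sub>\<le>\<^sub>0 \<longleftrightarrow> cos t = -1"
proof -
  assume r: "r > 0"
  have "cos t = -1" if "cos t \<le> 0" "sin t = 0"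
    using sin_cos_squared_add[of t] that by (auto simp: power2_eq_1_iff)
  moreover have "sin t = 0" if "cos t = -1" using sin_cos_squared_add[of t] that by simp
  ultimately show ?thesis using r by (auto simp: complex_nonpos_Reals_iff mult_le_0_iff)
qed

text \<open>The inverse is explicit, with \<sigma> for the second coordinate and \<open>Arg\<close>
  for the first. The image is cut out of S by a strict inequality on \<sigma> and by avoiding the
  branch cut of \<open>Arg\<close>; this shows at once that it is open and that the inverse is
  continuous on it.\<close>

lemma local_param_chart:
  assumes a: "admissible b c d"
  shows "local_param S (chart_domain d t0) (chart b c)"
proof -
  let ?W = "chart_domain d t0" let ?\<psi> = "chart b c" let ?H = "?W \<inter> half_plane"
  \<comment> \<open>The rotation moves the missing meridian onto the negative real axis, the branch
    cut of \<open>Arg\<close>.\<close>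
  let ?w = "\<lambda>x. cis (c * t0) * angle x"
  let ?\<phi> = "\<lambda>x. vector [t0 - c * Arg (?w x), c * (\<sigma> x - b)] :: real^2"
  have c: "c * c = 1" and J: "\<And>y. 0 \<le> y \<Longrightarrow> y < d \<Longrightarrow> b + c * y \<in> J"
    and pos: "\<And>y. y < d \<Longrightarrow> \<rho> (b + c * y) > 0" using a by (auto simp: admissible_def)
  have wX: "?w (X s t) = of_real (\<rho> s) * cis (t + c * t0)" for s t
    by (simp add: angle_X cis_mult[symmetric])
  have cw: "continuous_on A ?w" for A
    unfolding angle_def complex_eq_cancel_iff2 Complex_eq by (intro continuous_intros)
  have sub: "?\<psi> ` ?H \<subseteq> S"
    using J X_in by (auto simp: chart_def chart_domain_def half_plane_def)
  have im: "?\<psi> ` ?H = {x \<in> S. c * (\<sigma> x - b) < d \<and> ?w x \<notin> \<real>\<^sub>\<le>\<^sub>0}"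
  proof (rule set_eqI)
    fix x
    show "x \<in> ?\<psi> ` ?H \<longleftrightarrow> x \<in> {x \<in> S. c * (\<sigma> x - b) < d \<and> ?w x \<notin> \<real>\<^sub>\<le>\<^sub>0}"
    proof (cases "x \<in> S")
      case True
      then obtain s t where st: "s \<in> J" "x = X s t" by (rule X_cases)
      have "\<rho> s > 0" if "c * (s - b) < d"
        using pos[OF that] c by (simp add: mult.assoc[symmetric])
      then show ?thesis unfolding st(2) chart_image_iff[OF a st(1)] wX
        using X_in[OF st(1)] \<sigma>_X[OF st(1)] nonpos_Reals_cis[of "\<rho> s" "t + c * t0", folded wX] by auto
    qed (use sub in auto)
  qed
  have inv: "?\<phi> (?\<psi> y) = y" if y: "y \<in> ?H" for y
  proof -
    have y': "\<bar>y $ 1 - t0\<bar> < pi" "y $ 2 < d" "y $ 2 \<ge> 0" using y by (auto simp: chart_domain_def half_plane_def)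
    have "?w (?\<psi> y) = of_real (\<rho> (b + c * y $ 2)) * exp (\<i> * of_real (c * (t0 - y $ 1)))"
      unfolding chart_def wX by (simp add: cis_conv_exp algebra_simps)
    moreover have "\<bar>c * (t0 - y $ 1)\<bar> < pi" using y' c by (auto simp: abs_mult abs_minus_commute square_eq_1_iff)
    ultimately have "Arg (?w (?\<psi> y)) = c * (t0 - y $ 1)"
      using pos[OF y'(2)] by (intro Arg_unique[where r = "\<rho> (b + c * y $ 2)"]) auto
    then show ?thesis
      using c by (simp add: vec_eq_iff forall_2 chart_def \<sigma>_X[OF J[OF y'(3,2)]] mult.assoc[symmetric])
  qed
  have cont: "continuous_on (?\<psi> ` ?H) ?\<phi>"
  proof -
    have 1: "continuous_on (?\<psi> ` ?H) (\<lambda>x. Arg (?w x))"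
      by (rule continuous_on_compose2[OF continuous_at_imp_continuous_on[of "- \<real>\<^sub>\<le>\<^sub>0" Arg] cw])
        (auto intro: continuous_at_Arg simp: im)
    have 2: "continuous_on (?\<psi> ` ?H) \<sigma>" by (rule continuous_on_subset[OF \<sigma>(1) sub])
    show ?thesis unfolding vector2_eq
      by (intro continuous_on_add continuous_on_scaleR continuous_on_diff continuous_on_mult_left continuous_on_const 1 2)
  qed
  have inj: "inj (frechet_derivative ?\<psi> (at y))" if y: "y \<in> ?W" for y
  proof (rule injI)
    fix v w
    let ?s = "b + c * y $ 2" let ?t = "- (c * y $ 1)"
    assume "frechet_derivative ?\<psi> (at y) v = frechet_derivative ?\<psi> (at y) w"
    then have eq: "(c * v $ 2) *\<^sub>R Xs ?s ?t - (c * v $ 1) *\<^sub>R Xt ?s ?t = (c * w $ 2) *\<^sub>R Xs ?s ?t - (c * w $ 1) *\<^sub>R Xt ?s ?t" (is "?l = ?r")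
      by (simp add: frechet_derivative_at[OF derivative_chart, symmetric])
    have "?l \<bullet> Xs ?s ?t = ?r \<bullet> Xs ?s ?t" "?l \<bullet> Xt ?s ?t = ?r \<bullet> Xt ?s ?t" using eq by simp_all
    then have "c * v $ 2 = c * w $ 2" "c * v $ 1 = c * w $ 1"
      using speed_pos[of ?s] pos[of "y $ 2"] y by (simp_all add: inner_simps inner_X chart_domain_def)
    then show "v = w" using c by (auto simp: vec_eq_iff forall_2)
  qed
  have "openin (top_of_set S) (S \<inter> (\<lambda>x. (c * (\<sigma> x - b), ?w x)) -` ({..<d} \<times> - \<real>\<^sub>\<le>\<^sub>0))"
    by (intro continuous_openin_preimage_gen open_Times continuous_intros cw \<sigma>(1)) (auto simp: open_Compl)
  also have "S \<inter> (\<lambda>x. (c * (\<sigma> x - b), ?w x)) -` ({..<d} \<times> - \<real>\<^sub>\<le>\<^sub>0) = ?\<psi> ` ?H" unfolding im by auto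
  finally have "openin (top_of_set S) (?\<psi> ` ?H)" .
  moreover have "homeomorphism ?H (?\<psi> ` ?H) ?\<psi> ?\<phi>"
  proof (rule homeomorphismI)
    show "continuous_on ?H ?\<psi>"
      by (rule continuous_on_subset[OF smooth_on_imp_continuous_on[OF smooth_chart[OF open_chart_domain[of d t0]]]]) simp
    show "continuous_on (?\<psi> ` ?H) ?\<phi>" by (rule cont)
    show "?\<phi> ` (?\<psi> ` ?H) \<subseteq> ?H" unfolding image_image using inv by (simp add: image_subset_iff)
    show "?\<psi> (?\<phi> x) = x" if "x \<in> ?\<psi> ` ?H" for x
      using that by (rule imageE) (metis inv)
  qed (simp_all only: order_refl inv)
  ultimately show ?thesis
    unfolding local_param_def using smooth_chart[OF open_chart_domain] open_chart_domain inj
    by (intro conjI ballI exI[of _ ?\<phi>]) assumption+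
qed

end

section \<open>Integration on surfaces of revolution\<close>

lemma lborel_integral_interval:
  fixes f :: "real \<Rightarrow> real"
  assumes f: "continuous_on {a..b} f" and A: "{a<..<b} \<subseteq> A" "A \<subseteq> {a..b}" "A \<in> sets borel"
  shows "(\<integral>x. (if x \<in> A then f x else 0) \<partial>lborel) = integral {a..b} f"
proof -
  have i: "set_integrable lborel A f"
    by (rule set_integrable_subset[OF borel_integrable_atLeastAtMost'[OF f]]) (use A in auto)
  have "(\<integral>x. (if x \<in> A then f x else 0) \<partial>lborel) = (LINT x:A|lborel. f x)"
    unfolding set_lebesgue_integral_def by (rule Bochner_Integration.integral_cong) auto
  also have "\<dots> = integral A f" by (rule set_borel_integral_eq_integral(2)[OF i])
  also have "\<dots> = integral {a..b} f"
  proof (rule integral_spike_set)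
    show "negligible {x \<in> A - {a..b}. f x \<noteq> 0}" by (rule negligible_subset[OF negligible_empty]) (use A in blast)
    show "negligible {x \<in> {a..b} - A. f x \<noteq> 0}"
    proof (rule negligible_subset[of "{a, b}"])
      have "x = a \<or> x = b" if "x \<in> {a..b}" "x \<notin> A" for x
        using that A(1) greaterThanLessThan_iff[of x a b] by force
      then show "{x \<in> {a..b} - A. f x \<noteq> 0} \<subseteq> {a, b}" by blast
    qed simp
  qed
  finally show ?thesis .
qed

text \<open>The parameters run from the outer end \<beta> inward, hence
  \<open>\<beta> - y $ 2\<close>. Which edges of the strip are included is immaterial for the
  integral.\<close>

lemma lborel_integral_strip:
  fixes h :: "real \<Rightarrow> real \<Rightarrow> real"
  assumes h: "continuous_on ({\<alpha>..\<beta>} \<times> {-pi..pi}) (\<lambda>x. h (fst x) (snd x))" and le: "\<alpha> \<le> \<beta>"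
  shows "(\<integral>(y::real^2). (if \<bar>y $ 1\<bar> < pi \<and> 0 \<le> y $ 2 \<and> y $ 2 < \<beta> - \<alpha> then h (\<beta> - y $ 2) (y $ 1) else 0) \<partial>lborel)
     = integral {\<alpha>..\<beta>} (\<lambda>s. integral {-pi..pi} (h s))"
proof -
  let ?R = "{y::real^2. \<bar>y $ 1\<bar> < pi \<and> 0 \<le> y $ 2 \<and> y $ 2 < \<beta> - \<alpha>}"
  let ?Q = "cbox (vector [-pi, 0]) (vector [pi, \<beta> - \<alpha>]) :: (real^2) set"
  let ?H = "\<lambda>y::real^2. h (\<beta> - y $ 2) (y $ 1)"
  let ?g = "\<lambda>y. if \<bar>y $ 1\<bar> < pi \<and> 0 \<le> y $ 2 \<and> y $ 2 < \<beta> - \<alpha> then ?H y else 0"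
  let ?k = "\<lambda>s. integral {-pi..pi} (h s)"
  have RQ: "?R \<subseteq> ?Q" by (auto simp: mem_box_cart forall_2)
  have R: "?R \<in> sets borel"
  proof -
    have "?R = {y. \<bar>y $ 1\<bar> < pi} \<inter> {y. 0 \<le> y $ 2} \<inter> {y. y $ 2 < \<beta> - \<alpha>}" by auto
    moreover have "open {y::real^2. \<bar>y $ 1\<bar> < pi}" "closed {y::real^2. 0 \<le> y $ 2}" "open {y::real^2. y $ 2 < \<beta> - \<alpha>}"
      by (intro open_Collect_less closed_Collect_le continuous_intros)+
    ultimately show ?thesis by (simp add: borel_closed borel_open sets.Int)
  qed
  have "continuous_on ?Q ?H"
    using continuous_on_compose2[OF h, of ?Q "\<lambda>y. (\<beta> - y $ 2, y $ 1)"]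
    by (force intro!: continuous_intros simp: mem_box_cart forall_2)
  then have "set_integrable lborel ?Q ?H"
    unfolding set_integrable_def by (intro borel_integrable_compact compact_cbox)
  then have "set_integrable lborel ?R ?H" by (rule set_integrable_subset) (use R RQ in auto)
  moreover have "(\<lambda>y. indicator ?R y *\<^sub>R ?H y) = ?g" by (auto simp: fun_eq_iff)
  ultimately have i: "integrable lborel ?g" by (simp add: set_integrable_def)
  have inner: "(\<integral>a. ?g (vector [a, b]) \<partial>lborel) = (if 0 \<le> b \<and> b < \<beta> - \<alpha> then ?k (\<beta> - b) else 0)" for b
  proof (cases "0 \<le> b \<and> b < \<beta> - \<alpha>")
    case True
    have c: "continuous_on {-pi..pi} (h (\<beta> - b))"
      using continuous_on_compose2[OF h, of "{-pi..pi}" "\<lambda>t. (\<beta> - b, t)"] True by (force intro!: continuous_intros)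
    have "(\<integral>a. ?g (vector [a, b]) \<partial>lborel) = (\<integral>a. (if a \<in> {-pi<..<pi} then h (\<beta> - b) a else 0) \<partial>lborel)"
      by (rule Bochner_Integration.integral_cong) (use True in auto)
    also have "\<dots> = ?k (\<beta> - b)" by (rule lborel_integral_interval[OF c]) auto
    finally show ?thesis using True by simp
  qed auto
  have k: "continuous_on {\<alpha>..\<beta>} ?k"
    using integral_continuous_on_param[of "{\<alpha>..\<beta>}" "-pi" pi h] h by (simp add: case_prod_beta')
  have "integral\<^sup>L lborel ?g = (\<integral>b. (if 0 \<le> b \<and> b < \<beta> - \<alpha> then ?k (\<beta> - b) else 0) \<partial>lborel)"
    unfolding Fubini_real2(2)[OF i] inner ..
  also have "\<dots> = (\<integral>s. (if s \<in> {\<alpha><..\<beta>} then ?k s else 0) \<partial>lborel)"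
    by (subst lborel_integral_real_affine[of "-1" _ \<beta>]) (auto intro!: Bochner_Integration.integral_cong)
  also have "\<dots> = integral {\<alpha>..\<beta>} ?k" by (rule lborel_integral_interval[OF k]) auto
  finally show ?thesis .
qed

lemma AE_coordinate: "AE y in lborel. (y::real^2) $ i \<noteq> r"
proof -
  have "negligible {y::real^2. y \<bullet> axis i 1 = r}" by (rule negligible_standard_hyperplane) (auto simp: Basis_vec_def)
  moreover have "{y::real^2. y \<bullet> axis i 1 = r} = {y. y $ i = r}" by (simp add: inner_axis)
  moreover have "closed {y::real^2. y $ i = r}" by (intro closed_Collect_eq continuous_intros)
  ultimately have "{y::real^2. y $ i = r} \<in> null_sets lborel"
    by (simp add: negligible_iff_null_sets null_sets_completion_iff borel_closed)
  from AE_not_in[OF this] show ?thesis by simp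
qed

context compact_surface
begin

text \<open>Null sets on the surface may be tested in the parameters, where they will be single
  points or coordinate lines.\<close>

lemma AE_area_chart:
  assumes c: "local_param S W \<psi>" and P: "{x. \<not> P x} \<in> sets borel" and n: "AE y in lborel. y \<in> W \<inter> half_plane \<longrightarrow> P (\<psi> y)"
  shows "AE x in area. x \<in> \<psi> ` (W \<inter> half_plane) \<longrightarrow> P x"
proof -
  interpret surface_chart S W \<psi> using c by (simp add: surface_chart_def)
  let ?B = "\<psi> ` HD \<inter> {x. \<not> P x}"
  have B: "?B \<in> sets borel" using chart_borel(1)[OF c] P by simp
  have "emeasure area ?B = (\<integral>\<^sup>+y. ennreal (if y \<in> HD \<and> \<psi> y \<in> ?B then Ja y else 0) \<partial>lborel)"
    unfolding area_chart_eq[OF c B Int_lower1] by (rule emeasure_pushed_density[OF area_chart_facts B])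
  also have "\<dots> = (\<integral>\<^sup>+(y::real^2). 0 \<partial>lborel)"
    by (rule nn_integral_cong_AE) (use n in \<open>eventually_elim, auto\<close>)
  finally have "?B \<in> null_sets area" using B by (simp add: null_sets_def)
  from AE_not_in[OF this] show ?thesis by eventually_elim auto
qed

lemma AE_len_chart:
  assumes c: "local_param S W \<psi>" and P: "{x. \<not> P x} \<in> sets borel" and n: "AE t in lborel. bpt t \<in> W \<longrightarrow> P (\<psi> (bpt t))"
  shows "AE x in len. x \<in> (\<lambda>t. \<psi> (bpt t)) ` {t. bpt t \<in> W} \<longrightarrow> P x"
proof -
  interpret surface_chart S W \<psi> using c by (simp add: surface_chart_def)
  let ?I = "(\<lambda>t. \<psi> (bpt t)) ` {t. bpt t \<in> W}"
  let ?B = "?I \<inter> {x. \<not> P x}"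
  have B: "?B \<in> sets borel" using chart_borel(2)[OF c] P by simp
  have "emeasure len ?B = (\<integral>\<^sup>+t. ennreal (if t \<in> BD \<and> \<psi> (bpt t) \<in> ?B then norm (E 1 (bpt t)) else 0) \<partial>lborel)"
    unfolding len_chart_eq[OF c B Int_lower1] by (rule emeasure_pushed_density[OF length_chart_facts B])
  also have "\<dots> = (\<integral>\<^sup>+(t::real). 0 \<partial>lborel)"
    by (rule nn_integral_cong_AE) (use n in \<open>eventually_elim, auto\<close>)
  finally have "?B \<in> null_sets len" using B by (simp add: null_sets_def)
  from AE_not_in[OF this] show ?thesis by eventually_elim auto
qed

lemma surface_gradient_derivative:
  assumes u: "u \<in> smooth_functions S"
  shows "continuous_on S (surface_gradient S u)"
    "x \<in> S \<Longrightarrow> (u has_derivative (\<lambda>h. surface_gradient S u x \<bullet> h)) (at x within S)"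
proof -
  show "continuous_on S (surface_gradient S u)"
    by (rule continuous_on_surfaceI[OF embedded_S])
      (simp add: surface_chart.smooth_function_chart(1)[OF _ u] surface_chart_def)
  assume "x \<in> S"
  then obtain W \<psi> y where c: "local_param S W \<psi>" and y: "y \<in> W \<inter> half_plane" "x = \<psi> y"
    using embedded_S unfolding embedded_surface_def by blast
  interpret surface_chart S W \<psi> using c by (simp add: surface_chart_def)
  show "(u has_derivative (\<lambda>h. surface_gradient S u x \<bullet> h)) (at x within S)"
    unfolding y(2) by (rule has_derivative_within_surface[OF y(1) bounded_linear_inner_right smooth_function_chart(4)[OF u y(1)]])
qed

end

context revolution
begin

lemma frechet_chart:
  "frechet_derivative (chart b c) (at y) v = (c * v $ 2) *\<^sub>R Xs (b + c * y $ 2) (- (c * y $ 1)) - (c * v $ 1) *\<^sub>R Xt (b + c * y $ 2) (- (c * y $ 1))"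
  by (simp add: frechet_derivative_at[OF derivative_chart, symmetric])

lemma partials_chart:
  "partial_deriv (chart b c) 1 y = (- c) *\<^sub>R Xt (b + c * y $ 2) (- (c * y $ 1))"
  "partial_deriv (chart b c) 2 y = c *\<^sub>R Xs (b + c * y $ 2) (- (c * y $ 1))"
  by (simp_all add: partial_deriv_def frechet_chart axis_def)

lemma norm_X: "norm (Xs s t) = speed s" "norm (Xt s t) = \<bar>\<rho> s\<bar>"
  using inner_X[of s t] speed_pos[of s] by (simp_all add: norm_eq_sqrt_inner)

lemma area_element:
  assumes "c * c = 1"
  shows "norm (cross3 (partial_deriv (chart b c) 1 y) (partial_deriv (chart b c) 2 y)) = speed (b + c * y $ 2) * \<bar>\<rho> (b + c * y $ 2)\<bar>"
proof -
  let ?s = "b + c * y $ 2" let ?t = "- (c * y $ 1)"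
  have "(norm (cross3 (Xt ?s ?t) (Xs ?s ?t)))\<^sup>2 = (speed ?s * \<bar>\<rho> ?s\<bar>)\<^sup>2"
    using norm_cross_dot[of "Xt ?s ?t" "Xs ?s ?t"] by (simp only: inner_X norm_X mult.commute[of "speed ?s"]) simp
  then have "norm (cross3 (Xt ?s ?t) (Xs ?s ?t)) = speed ?s * \<bar>\<rho> ?s\<bar>"
    by (rule power2_eq_imp_eq) (use speed_pos[of ?s] in auto)
  then show ?thesis using abs_mult_self_eq[of c] assms by (simp add: partials_chart cross_mult_left cross_mult_right mult.assoc[symmetric])
qed

end

text \<open>A single chart from the end \<beta> is to cover S up to a null set: it misses one
  meridian and whatever lies over \<alpha>. The radius over \<alpha> may be 0, which admits the
  centre of the disk.\<close>

locale compact_revolution = revolution e1 e2 S \<rho> \<rho>' z z' \<sigma> "{\<alpha>..\<beta>}" + compact_surface S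
  for e1 e2 S \<rho> \<rho>' z z' \<sigma> \<alpha> \<beta> +
  assumes \<alpha>\<beta>: "\<alpha> < \<beta>" and cont': "continuous_on UNIV \<rho>'" "continuous_on UNIV z'"
    and outer: "admissible \<beta> (-1) (\<beta> - \<alpha>)" and \<rho>_nonneg: "\<rho> \<alpha> \<ge> 0"
begin

abbreviation "main_image \<equiv> chart \<beta> (-1) ` (chart_domain (\<beta> - \<alpha>) 0 \<inter> half_plane)"

lemma \<rho>: "s \<in> {\<alpha>..\<beta>} \<Longrightarrow> \<rho> s \<ge> 0" "s \<in> {\<alpha><..\<beta>} \<Longrightarrow> \<rho> s > 0"
proof -
  show p: "\<rho> s > 0" if "s \<in> {\<alpha><..\<beta>}" for s
    using outer that unfolding admissible_def by (auto dest!: spec[of _ "\<beta> - s"])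
  show "\<rho> s \<ge> 0" if "s \<in> {\<alpha>..\<beta>}" using that \<rho>_nonneg p[of s] by (cases "s = \<alpha>") auto
qed

lemma cos_eq_minus_one_iff:
  assumes "\<bar>x - t0\<bar> < pi" "t0 = 0 \<or> t0 = pi" "cos x = -1"
  shows "x = pi"
proof -
  have "cos (x - pi) = 1" using assms by (simp add: cos_diff)
  then obtain n :: int where n: "x - pi = of_int n * 2 * pi" using cos_one_2pi_int by blast
  have "\<bar>x - pi\<bar> < 2 * pi" using assms(1,2) by auto
  then have "\<bar>of_int n * (2 * pi)\<bar> < 1 * (2 * pi)" using n by (simp add: mult.assoc)
  then have "\<bar>real_of_int n\<bar> < 1" unfolding abs_mult by (simp add: mult_less_cancel_right_pos)
  then have "n = 0" by (metis of_int_abs of_int_less_1_iff zabs_less_one_iff)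
  then show ?thesis using n by simp
qed

text \<open>What another chart covers beyond the main one lies over \<alpha> or on one meridian, and
  both are coordinate lines in its parameters. The two values of t0 together cover every
  angle.\<close>

lemma AE_main_image:
  assumes a: "admissible b c d" and t0: "t0 = 0 \<or> t0 = pi"
  shows "AE x in area. x \<in> chart b c ` (chart_domain d t0 \<inter> half_plane) \<longrightarrow> x \<in> main_image"
proof (rule AE_area_chart[OF local_param_chart[OF a]])
  show "{x. x \<notin> main_image} \<in> sets borel"
    using chart_borel(1)[OF local_param_chart[OF outer, of 0]] by (simp add: Compl_eq[symmetric])
  have c: "c = 1 \<or> c = -1" and J: "\<And>y. 0 \<le> y \<Longrightarrow> y < d \<Longrightarrow> b + c * y \<in> {\<alpha>..\<beta>}"
    using a by (auto simp: admissible_def square_eq_1_iff)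
  show "AE y in lborel. y \<in> chart_domain d t0 \<inter> half_plane \<longrightarrow> chart b c y \<in> main_image"
    using AE_coordinate[of 1 pi] AE_coordinate[of 2 "c * (\<alpha> - b)"]
  proof eventually_elim
    case (elim y)
    show ?case
    proof
      assume y: "y \<in> chart_domain d t0 \<inter> half_plane"
      have "b + c * y $ 2 \<noteq> \<alpha>" using elim(2) c by auto
      moreover have s: "b + c * y $ 2 \<in> {\<alpha>..\<beta>}" using y by (intro J) (auto simp: chart_domain_def half_plane_def)
      moreover have "cos (- (c * y $ 1)) \<noteq> -1"
        using cos_eq_minus_one_iff[of "y $ 1" t0] elim(1) t0 y c by (auto simp: chart_domain_def)
      ultimately show "chart b c y \<in> main_image"
        unfolding chart_def[of b c] chart_image_iff[OF outer s] by auto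
    qed
  qed
qed

lemma aint_polar:
  assumes F: "continuous_on S F" and ae: "AE x in area. x \<in> S \<longrightarrow> x \<in> main_image"
  shows "aint F = integral {\<alpha>..\<beta>} (\<lambda>s. integral {-pi..pi} (\<lambda>t. speed s * \<rho> s * F (X s t)))"
proof -
  have EE: "surface_chart.EE (chart \<beta> (-1)) y = cross3 (partial_deriv (chart \<beta> (-1)) 1 y) (partial_deriv (chart \<beta> (-1)) 2 y)" for y
    by (rule surface_chart.EE_def) (use local_param_chart[OF outer] in \<open>simp add: surface_chart_def\<close>)
  have cs: "continuous_on UNIV speed" unfolding speed_def[abs_def] by (intro continuous_intros cont')
  have "continuous_on ({\<alpha>..\<beta>} \<times> {-pi..pi}) (\<lambda>x. speed (fst x) * \<rho> (fst x) * F (X (fst x) (snd x)))"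
    by (intro continuous_on_mult continuous_on_compose2[OF cs] continuous_on_compose2[OF continuous_profile(1)]
        continuous_on_compose2[OF F continuous_X] continuous_intros) (auto intro: X_in)
  from lborel_integral_strip[OF this] \<alpha>\<beta>
  have "integral {\<alpha>..\<beta>} (\<lambda>s. integral {-pi..pi} (\<lambda>t. speed s * \<rho> s * F (X s t)))
    = (\<integral>(y::real^2). (if \<bar>y $ 1\<bar> < pi \<and> 0 \<le> y $ 2 \<and> y $ 2 < \<beta> - \<alpha> then speed (\<beta> - y $ 2) * \<rho> (\<beta> - y $ 2) * F (X (\<beta> - y $ 2) (y $ 1)) else 0) \<partial>lborel)"
    by simp
  also have "\<dots> = (\<integral>y. (if y \<in> chart_domain (\<beta> - \<alpha>) 0 \<inter> half_plane then norm (surface_chart.EE (chart \<beta> (-1)) y) * F (chart \<beta> (-1) y) else 0) \<partial>lborel)"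
    by (rule Bochner_Integration.integral_cong)
      (use \<rho>(1) in \<open>auto simp: chart_domain_def half_plane_def EE area_element chart_def\<close>)
  also have "\<dots> = aint F"
    by (rule aint_chart[OF local_param_chart[OF outer] F, symmetric]) (use ae in \<open>eventually_elim, auto\<close>)
  finally show ?thesis ..
qed

text \<open>The vanishing condition on F removes all boundary components except the circle over b.
  The chart with \<open>t0 = 0\<close> misses one point of this circle, and the chart with
  \<open>t0 = pi\<close> shows that the point has length 0.\<close>

lemma lint_circle:
  assumes a: "admissible b c d" and d: "d > 0" and F: "continuous_on S F"
    and z: "\<And>x. x \<in> surface_boundary S \<Longrightarrow> x \<notin> range (X b) \<Longrightarrow> F x = 0"
  shows "lint F = \<rho> b * integral {-pi..pi} (\<lambda>t. F (X b t))"
proof -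
  have c: "c = 1 \<or> c = -1" and J: "\<And>y. 0 \<le> y \<Longrightarrow> y < d \<Longrightarrow> b + c * y \<in> {\<alpha>..\<beta>}" and p: "\<rho> b > 0"
    using a d unfolding admissible_def by (auto simp: square_eq_1_iff dest!: spec[of _ 0])
  have b: "b \<in> {\<alpha>..\<beta>}" using J[of 0] d by simp
  have cF: "continuous_on A (\<lambda>t. F (X b (f t)))" if "continuous_on A f" for A and f :: "real \<Rightarrow> real"
    by (intro continuous_on_compose2[OF F continuous_X] that continuous_on_const) (auto intro: X_in[OF b])
  let ?I = "\<lambda>t0. (\<lambda>t. chart b c (bpt t)) ` {t. bpt t \<in> chart_domain d t0}"
  have I: "X b t \<in> ?I t0 \<longleftrightarrow> cos (t + c * t0) \<noteq> -1" for t t0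
  proof -
    interpret surface_chart S "chart_domain d t0" "chart b c"
      using local_param_chart[OF a] by (simp add: surface_chart_def)
    have "X b t \<in> ?I t0 \<longleftrightarrow> X b t \<in> chart b c ` (chart_domain d t0 \<inter> half_plane)"
    proof
      assume "X b t \<in> ?I t0" then show "X b t \<in> chart b c ` (chart_domain d t0 \<inter> half_plane)"
        using bpt_half_plane by auto
    next
      assume "X b t \<in> chart b c ` (chart_domain d t0 \<inter> half_plane)"
      then obtain y where y: "X b t = chart b c y" "y \<in> chart_domain d t0 \<inter> half_plane" by (rule imageE)
      then have "\<sigma> (X b t) = b + c * y $ 2"
        unfolding y(1) chart_def by (intro \<sigma>_X J) (auto simp: chart_domain_def half_plane_def)
      then have "y $ 2 = 0" using \<sigma>_X[OF b, of t] c by auto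
      from bpt_of[OF this] show "X b t \<in> ?I t0" using y by (intro image_eqI[of _ _ "y $ 1"]) auto
    qed
    then show ?thesis using chart_image_iff[OF a b, of t t0] d by simp
  qed
  have "AE x in len. x \<in> ?I pi \<longrightarrow> x \<in> ?I 0"
  proof (rule AE_len_chart[OF local_param_chart[OF a]])
    show "{x. x \<notin> ?I 0} \<in> sets borel"
      using chart_borel(2)[OF local_param_chart[OF a, of 0]] by (simp add: Compl_eq[symmetric])
    show "AE t in lborel. bpt t \<in> chart_domain d pi \<longrightarrow> chart b c (bpt t) \<in> ?I 0"
      using AE_lborel_singleton[of pi]
    proof eventually_elim
      case (elim t)
      have "chart b c (bpt t) = X b (- (c * t))" by (simp add: chart_def)
      moreover have "X b (- (c * t)) \<in> ?I 0" if "bpt t \<in> chart_domain d pi"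
        by (simp only: I) (use that cos_eq_minus_one_iff[of t pi] elim c in \<open>auto simp: chart_domain_def\<close>)
      ultimately show ?case by (intro impI) (simp only:)
    qed
  qed
  then have "AE x in len. x \<in> surface_boundary S - ?I 0 \<longrightarrow> F x = 0"
  proof eventually_elim
    case (elim x)
    show ?case
    proof (cases "x \<in> range (X b)")
      case True
      then obtain t where t: "x = X b t" by auto
      have "x \<in> ?I 0" if "cos t = -1"
        using elim c that unfolding t I by (auto simp: cos_add cos_diff)
      then show ?thesis using I[of t 0] t by auto
    qed (use z in auto)
  qed
  from lint_chart[OF local_param_chart[OF a] F this]
  have "lint F = (\<integral>t. (if bpt t \<in> chart_domain d 0 then norm (partial_deriv (chart b c) 1 (bpt t)) * F (chart b c (bpt t)) else 0) \<partial>lborel)" .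
  also have "\<dots> = (\<integral>t. (if t \<in> {-pi<..<pi} then \<rho> b * F (X b (- (c * t))) else 0) \<partial>lborel)"
    by (rule Bochner_Integration.integral_cong)
      (use d c p in \<open>auto simp: chart_domain_def partials_chart chart_def norm_X\<close>)
  also have "\<dots> = integral {-pi..pi} (\<lambda>t. \<rho> b * F (X b (- (c * t))))"
    by (rule lborel_integral_interval) (auto intro!: continuous_intros cF)
  also have "\<dots> = integral {-pi..pi} (\<lambda>t. \<rho> b * F (X b t))"
    using c Henstock_Kurzweil_Integration.integral_reflect_real[of pi "-pi" "\<lambda>t. \<rho> b * F (X b t)"] by auto
  finally show ?thesis by simp
qed

text \<open>\<open>Xs\<close> and \<open>Xt\<close> form an orthogonal basis of the tangent plane,
  of lengths \<open>speed s\<close> and \<open>\<rho> s\<close>. After multiplication by the area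
  element, both weights become 1 in a conformal parametrization.\<close>

lemma gradient_energy:
  assumes s: "s \<in> {\<alpha><..\<beta>}" and u: "u \<in> smooth_functions S"
    and v: "v = surface_gradient S u (X s t)"
  shows "speed s * \<rho> s * (norm v)\<^sup>2 = \<rho> s / speed s * (v \<bullet> Xs s t)\<^sup>2 + speed s / \<rho> s * (v \<bullet> Xt s t)\<^sup>2"
proof -
  let ?y = "vector [t, \<beta> - s] :: real^2"
  interpret surface_chart S "chart_domain (\<beta> - \<alpha>) t" "chart \<beta> (-1)"
    using local_param_chart[OF outer] by (simp add: surface_chart_def)
  have y: "?y \<in> HD" using s by (simp add: chart_domain_def half_plane_def)
  have cy: "chart \<beta> (-1) ?y = X s t" by (simp add: chart_def)
  have "v \<bullet> N ?y = 0" using smooth_function_chart(3)[OF u y] by (simp add: v cy)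
  then obtain w where "v = frechet_derivative (chart \<beta> (-1)) (at ?y) w" using range_d[of ?y] y by auto
  then obtain p q where v': "v = p *\<^sub>R Xs s t + q *\<^sub>R Xt s t" by (auto simp: frechet_chart intro: that[of "- w $ 2" "w $ 1"])
  have "(norm v)\<^sup>2 = p\<^sup>2 * (speed s)\<^sup>2 + q\<^sup>2 * (\<rho> s)\<^sup>2"
    unfolding power2_norm_eq_inner v' by (simp add: inner_simps inner_X power2_eq_square)
  moreover have "v \<bullet> Xs s t = p * (speed s)\<^sup>2" "v \<bullet> Xt s t = q * (\<rho> s)\<^sup>2"
    by (simp_all add: v' inner_simps inner_X)
  ultimately show ?thesis using speed_pos[of s] \<rho>(2)[OF s] by (simp add: field_simps power2_eq_square)
qed

lemma polar_function_smooth: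
  assumes u: "u \<in> smooth_functions S"
  shows "polar_function \<alpha> \<beta> (\<lambda>s t. u (X s t)) (\<lambda>s t. surface_gradient S u (X s t) \<bullet> Xs s t) (\<lambda>s t. surface_gradient S u (X s t) \<bullet> Xt s t)"
proof
  note g = surface_gradient_derivative[OF u]
  have cu: "continuous_on S u" by (rule index_form_eq(3)[OF u])
  have cX: "continuous_on ({\<alpha>..\<beta>} \<times> UNIV) (\<lambda>x. X (fst x) (snd x))"
    by (intro continuous_X continuous_intros)
  have im: "(\<lambda>x. X (fst x) (snd x)) ` ({\<alpha>..\<beta>} \<times> UNIV) \<subseteq> S" by (auto intro: X_in)
  have cXs: "continuous_on ({\<alpha>..\<beta>} \<times> (UNIV::real set)) (\<lambda>x. Xs (fst x) (snd x))"
    unfolding Xs_def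
    by (intro continuous_on_add continuous_on_scaleR continuous_er continuous_on_const continuous_on_compose2[OF cont'(1)]
        continuous_on_compose2[OF cont'(2)] continuous_on_fst continuous_on_snd continuous_on_id) auto
  show "continuous_on ({\<alpha>..\<beta>} \<times> UNIV) (\<lambda>(s, t). u (X s t))"
    using continuous_on_compose2[OF cu cX im] by (simp add: case_prod_beta')
  show "continuous_on ({\<alpha>..\<beta>} \<times> UNIV) (\<lambda>(s, t). surface_gradient S u (X s t) \<bullet> Xs s t)"
    unfolding case_prod_beta' by (rule continuous_on_inner[OF continuous_on_compose2[OF g(1) cX im] cXs])
  show "continuous_on ({\<alpha>..\<beta>} \<times> UNIV) (\<lambda>(s, t). surface_gradient S u (X s t) \<bullet> Xt s t)"
    unfolding case_prod_beta'
    by (rule continuous_on_inner[OF continuous_on_compose2[OF g(1) cX im] continuous_Xt]) (intro continuous_intros)+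
  fix s t assume s: "s \<in> {\<alpha>..\<beta>}"
  have d: "((\<lambda>r. u (f r)) has_real_derivative surface_gradient S u (f r) \<bullet> f') (at r within A)"
    if f: "(f has_vector_derivative f') (at r within A)" "f ` A \<subseteq> S" "f r \<in> S" for f f' r and A :: "real set"
  proof -
    have "((\<lambda>r. u (f r)) has_derivative (\<lambda>h. surface_gradient S u (f r) \<bullet> (h *\<^sub>R f'))) (at r within A)"
      by (rule has_derivative_in_compose[OF f(1)[unfolded has_vector_derivative_def] has_derivative_subset[OF g(2)[OF f(3)] f(2)]])
    then show ?thesis by (simp add: has_field_derivative_def mult.commute[of _ "_ \<bullet> _"])
  qed
  show "((\<lambda>s. u (X s t)) has_real_derivative surface_gradient S u (X s t) \<bullet> Xs s t) (at s within {\<alpha>..\<beta>})"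
    by (rule d[OF derivative_X_s]) (use s X_in in auto)
  show "((\<lambda>t. u (X s t)) has_real_derivative surface_gradient S u (X s t) \<bullet> Xt s t) (at t)"
    by (rule d[OF derivative_X_t]) (use s X_in in auto)
  show "u (X s (t + 2 * pi)) = u (X s t)" by (simp add: X_periodic)
qed (rule \<alpha>\<beta>)

end

section \<open>The critical catenoid\<close>

lemma strict_mono_tanh_mult: "0 < x \<Longrightarrow> x < y \<Longrightarrow> x * tanh x < y * tanh (y::real)"
  by (intro mult_strict_mono) auto

lemma catenoid_T: "catenoid_T > 0" "catenoid_T * tanh catenoid_T = 1"
proof -
  \<comment> \<open>The estimates on exp give \<open>tanh 2 \<ge> 1 / 2\<close>, so that
    \<open>x * tanh x\<close> reaches 1 between 0 and 2.\<close>
  have "exp 2 * exp (-2) = (1::real)" by (simp add: exp_add[symmetric])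
  moreover have e: "exp 2 \<ge> (3::real)" using exp_ge_add_one_self[of 2] by simp
  ultimately have "exp 2 \<ge> 3 * exp (-2 :: real)"
    using mult_mono[OF e e] by (smt (verit) exp_gt_zero mult_le_cancel_left_pos mult.commute mult_less_cancel_right2)
  then have "tanh (2::real) \<ge> 1 / 2"
    using exp_gt_zero[of "2::real"] exp_gt_zero[of "-2::real"] unfolding tanh_altdef by (simp add: field_simps add_pos_pos)
  then have "\<exists>x. 0 \<le> x \<and> x \<le> 2 \<and> x * tanh x = (1::real)"
    by (intro IVT') (auto intro!: continuous_intros)
  then obtain x :: real where x: "0 \<le> x" "x * tanh x = 1" by blast
  then have "0 < x" by (cases "x = 0") auto
  have "0 < catenoid_T \<and> catenoid_T * tanh catenoid_T = 1" unfolding catenoid_T_def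
  proof (rule theI)
    show "0 < x \<and> x * tanh x = 1" using x \<open>0 < x\<close> by simp
    show "y = x" if "0 < y \<and> y * tanh y = 1" for y
      using that x \<open>0 < x\<close> strict_mono_tanh_mult[of x y] strict_mono_tanh_mult[of y x] by (cases x y rule: linorder_cases) auto
  qed
  then show "catenoid_T > 0" "catenoid_T * tanh catenoid_T = 1" by simp_all
qed

abbreviation "cT \<equiv> catenoid_T"
abbreviation "ca \<equiv> catenoid_a"

lemma catenoid_sinh: "cT * sinh cT = cosh cT"
  using catenoid_T(2) cosh_real_pos[of cT] by (simp add: tanh_def field_simps)

text \<open>The radius \<open>ca * cosh cT\<close> of the boundary circles is
  \<open>tanh cT\<close>, the very weight that occurs in \<open>catenoid_energy\<close>; the last
  identity puts these circles on the unit sphere.\<close>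

lemma catenoid_a: "ca > 0" "ca * cosh cT = tanh cT" "(ca * cosh cT)\<^sup>2 + (ca * cT)\<^sup>2 = 1"
proof -
  have T: "cT > 0" and c: "cosh cT > 0" using catenoid_T by auto
  show "ca > 0" using T c by (simp add: catenoid_a_def)
  have 1: "ca * cosh cT = 1 / cT" "ca * cT = 1 / cosh cT" using T c by (simp_all add: catenoid_a_def)
  show "ca * cosh cT = tanh cT" unfolding 1 using catenoid_T T by (simp add: field_simps)
  then have "ca * cosh cT = sinh cT / cosh cT" by (simp add: tanh_def)
  then show "(ca * cosh cT)\<^sup>2 + (ca * cT)\<^sup>2 = 1"
    unfolding 1(2) using c by (simp only: power_divide add_divide_distrib[symmetric] cosh_square_eq[symmetric]) (simp add: cosh_square_eq add_nonneg_eq_0_iff)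
qed

context frame
begin

lemma partials_rotating:
  assumes f: "(f has_real_derivative f') (at (b + c * (y::real^2) $ 2))" and g: "(g has_real_derivative g') (at (b + c * y $ 2))"
  shows "partial_deriv (\<lambda>y. k *\<^sub>R (f (b + c * y $ 2) *\<^sub>R er (- (c * y $ 1)) + g (b + c * y $ 2) *\<^sub>R e3)) 1 y = (- k * c * f (b + c * y $ 2)) *\<^sub>R et (- (c * y $ 1))"
    "partial_deriv (\<lambda>y. k *\<^sub>R (f (b + c * y $ 2) *\<^sub>R er (- (c * y $ 1)) + g (b + c * y $ 2) *\<^sub>R e3)) 2 y = (k * c) *\<^sub>R (f' *\<^sub>R er (- (c * y $ 1)) + g' *\<^sub>R e3)"
    "partial_deriv (\<lambda>y. k *\<^sub>R (f (b + c * y $ 2) *\<^sub>R et (- (c * y $ 1)))) 1 y = (k * c * f (b + c * y $ 2)) *\<^sub>R er (- (c * y $ 1))"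
    "partial_deriv (\<lambda>y. k *\<^sub>R (f (b + c * y $ 2) *\<^sub>R et (- (c * y $ 1)))) 2 y = (k * c * f') *\<^sub>R et (- (c * y $ 1))"
proof -
  have n: "((\<lambda>y::real^2. y $ i) has_derivative (\<lambda>v. v $ i)) (at y)" for i
    by (rule bounded_linear_imp_has_derivative[OF bounded_linear_vec_nth])
  have l: "((\<lambda>y::real^2. b + c * y $ 2) has_derivative (\<lambda>v. c * v $ 2)) (at y)" "((\<lambda>y::real^2. - (c * y $ 1)) has_derivative (\<lambda>v. - (c * v $ 1))) (at y)"
    by (auto intro!: derivative_eq_intros n)
  note der = has_derivative_compose[OF l(2) derivative_er[unfolded has_vector_derivative_def, of _ UNIV]]
  note det = has_derivative_compose[OF l(2) derivative_et[unfolded has_vector_derivative_def, of _ UNIV]]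
  note r = DERIV_compose_FDERIV[OF f l(1)] and z = DERIV_compose_FDERIV[OF g l(1)]
  note d1 = has_derivative_scaleR_right[OF has_derivative_add[OF has_derivative_scaleR[OF r der] has_derivative_scaleR[OF z has_derivative_const]], of k]
  note d2 = has_derivative_scaleR_right[OF has_derivative_scaleR[OF r det], of k]
  show "partial_deriv (\<lambda>y. k *\<^sub>R (f (b + c * y $ 2) *\<^sub>R er (- (c * y $ 1)) + g (b + c * y $ 2) *\<^sub>R e3)) 1 y = (- k * c * f (b + c * y $ 2)) *\<^sub>R et (- (c * y $ 1))"
    "partial_deriv (\<lambda>y. k *\<^sub>R (f (b + c * y $ 2) *\<^sub>R er (- (c * y $ 1)) + g (b + c * y $ 2) *\<^sub>R e3)) 2 y = (k * c) *\<^sub>R (f' *\<^sub>R er (- (c * y $ 1)) + g' *\<^sub>R e3)"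
    "partial_deriv (\<lambda>y. k *\<^sub>R (f (b + c * y $ 2) *\<^sub>R et (- (c * y $ 1)))) 1 y = (k * c * f (b + c * y $ 2)) *\<^sub>R er (- (c * y $ 1))"
    "partial_deriv (\<lambda>y. k *\<^sub>R (f (b + c * y $ 2) *\<^sub>R et (- (c * y $ 1)))) 2 y = (k * c * f') *\<^sub>R et (- (c * y $ 1))"
    by (subst partial_deriv_eqI[OF d1] partial_deriv_eqI[OF d2], simp add: axis_def algebra_simps)+
qed

end

interpretation cat: revolution "axis 1 1" "axis 2 1" critical_catenoid "\<lambda>s. ca * cosh s" "\<lambda>s. ca * sinh s" "\<lambda>s. ca * s" "\<lambda>s. ca"
  "\<lambda>x. x $ 3 / ca" "{-cT..cT}"
proof -
  interpret frame "axis 1 1" "axis 2 1" by unfold_locales (simp_all add: inner_axis_axis)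
  have e3: "e3 = axis 3 1" by (simp add: e3_def cross_basis)
  have X: "(ca * cosh s) *\<^sub>R er t + (ca * s) *\<^sub>R e3 = ca *\<^sub>R vector [cosh s * cos t, cosh s * sin t, s]" for s t
    unfolding e3 er_def by (simp add: vec_eq_iff forall_3 axis_def)
  show "revolution (axis 1 1) (axis 2 1) critical_catenoid (\<lambda>s. ca * cosh s) (\<lambda>s. ca * sinh s) (\<lambda>s. ca * s) (\<lambda>s. ca)
    (\<lambda>x. x $ 3 / ca) {-cT..cT}"
  proof
    show "((\<lambda>s. ca * cosh s) has_real_derivative ca * sinh s) (at s)" "((\<lambda>s. ca * s) has_real_derivative ca) (at s)" for s
      by (auto intro!: derivative_eq_intros)
    have "((\<lambda>s. ca * (if even n then cosh s else sinh s)) has_real_derivative ca * (if even (Suc n) then cosh s else sinh s)) (at s)" for n s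
      by (auto intro!: derivative_eq_intros)
    from smooth_on_coordinate[where D = "\<lambda>n s. ca * (if even n then cosh s else sinh s)", OF this]
    show "smooth_on W (\<lambda>y::real^2. ca * cosh (b + c * y $ 2))" for W b c by simp
    have "((\<lambda>s. if n = 0 then ca * s else if n = 1 then ca else 0) has_real_derivative (if Suc n = 0 then ca * s else if Suc n = 1 then ca else 0)) (at s)" for n s
      by (cases "n = 0"; cases "n = 1") (auto intro!: derivative_eq_intros)
    from smooth_on_coordinate[where D = "\<lambda>n s. if n = 0 then ca * s else if n = 1 then ca else 0", OF this]
    show "smooth_on W (\<lambda>y::real^2. ca * (b + c * y $ 2))" for W b c by simp
    show "(ca * sinh s)\<^sup>2 + ca\<^sup>2 > 0" for s using catenoid_a by (simp add: add_nonneg_pos)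
    show "critical_catenoid = (\<lambda>(s, t). (ca * cosh s) *\<^sub>R er t + (ca * s) *\<^sub>R e3) ` ({-cT..cT} \<times> UNIV)"
    proof -
      have "\<exists>r\<in>{0..<2*pi}. cos t = cos r \<and> sin t = sin r" for t :: real
        by (rule sincos_total_2pi[of "cos t" "sin t"]) auto
      then have "ca *\<^sub>R vector [cosh s * cos t, cosh s * sin t, s] \<in> critical_catenoid" if "s \<in> {-cT..cT}" for s t
        unfolding critical_catenoid_def using that by (smt (verit) mem_Collect_eq)
      then show ?thesis unfolding X by (auto simp: critical_catenoid_def)
    qed
    show "continuous_on critical_catenoid (\<lambda>x. x $ 3 / ca)" using catenoid_a by (auto intro!: continuous_intros)
    show "((ca * cosh s) *\<^sub>R er t + (ca * s) *\<^sub>R e3) $ 3 / ca = s" for s t unfolding X using catenoid_a by simp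
  qed
qed

text \<open>Speed and radius coincide, so the parametrization is conformal and the Dirichlet energy
  is the Euclidean one in s and t.\<close>

lemma catenoid_speed: "cat.speed s = ca * cosh s"
proof -
  have "(ca * sinh s)\<^sup>2 + ca\<^sup>2 = (ca * cosh s)\<^sup>2" by (simp add: power_mult_distrib cosh_square_eq algebra_simps)
  then show ?thesis using catenoid_a by (simp add: cat.speed_def)
qed

lemma catenoid_admissible: "cat.admissible cT (-1) (cT + cT)" "cat.admissible (-cT) 1 (cT + cT)"
  using catenoid_T catenoid_a by (auto simp: cat.admissible_def)

text \<open>A chart from one end reaches every circle except the opposite boundary circle, so the
  end is chosen according to s.\<close>

lemma catenoid_chart_at:
  assumes "s \<in> {-cT..cT}"
  obtains b c where "(b, c) = (cT, -1) \<or> (b, c) = (-cT, 1)" "cat.admissible b c (cT + cT)"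
    "\<And>t t0. cat.X s t \<in> cat.chart b c ` (cat.chart_domain (cT + cT) t0 \<inter> half_plane) \<longleftrightarrow> cos (t + c * t0) \<noteq> -1"
proof (cases "s = -cT")
  case True
  then show ?thesis using that[of "-cT" 1] catenoid_admissible(2) cat.chart_image_iff[OF catenoid_admissible(2) assms] catenoid_T by simp
next
  case False
  then show ?thesis using that[of cT "-1"] assms catenoid_admissible(1) cat.chart_image_iff[OF catenoid_admissible(1) assms] by simp
qed

lemma catenoid_chart_around:
  assumes "x \<in> critical_catenoid"
  obtains b c t0 where "(b, c) = (cT, -1) \<or> (b, c) = (-cT, 1)" "surface_chart critical_catenoid (cat.chart_domain (cT + cT) t0) (cat.chart b c)"
    "x \<in> cat.chart b c ` (cat.chart_domain (cT + cT) t0 \<inter> half_plane)"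
proof -
  obtain s t where s: "s \<in> {-cT..cT}" and x: "x = cat.X s t" using assms by (rule cat.X_cases)
  obtain b c where bc: "(b, c) = (cT, -1) \<or> (b, c) = (-cT, 1)" and a: "cat.admissible b c (cT + cT)"
    and i: "\<And>t t0. cat.X s t \<in> cat.chart b c ` (cat.chart_domain (cT + cT) t0 \<inter> half_plane) \<longleftrightarrow> cos (t + c * t0) \<noteq> -1"
    using catenoid_chart_at[OF s] by metis
  show ?thesis
  proof (rule that[OF bc])
    show "surface_chart critical_catenoid (cat.chart_domain (cT + cT) (- c * t)) (cat.chart b c)"
      using cat.local_param_chart[OF a] by (simp add: surface_chart_def)
    show "x \<in> cat.chart b c ` (cat.chart_domain (cT + cT) (- c * t) \<inter> half_plane)"
      unfolding x i using bc by auto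
  qed
qed

interpretation cat: compact_revolution "axis 1 1" "axis 2 1" critical_catenoid "\<lambda>s. ca * cosh s" "\<lambda>s. ca * sinh s" "\<lambda>s. ca * s" "\<lambda>s. ca"
  "\<lambda>x. x $ 3 / ca" "-cT" cT
proof
  have "critical_catenoid = (\<lambda>(s, t). cat.X s t) ` ({-cT..cT} \<times> {0..2 * pi})"
  proof
    show "(\<lambda>(s, t). cat.X s t) ` ({-cT..cT} \<times> {0..2 * pi}) \<subseteq> critical_catenoid" using cat.X_in by auto
    show "critical_catenoid \<subseteq> (\<lambda>(s, t). cat.X s t) ` ({-cT..cT} \<times> {0..2 * pi})"
    proof
      fix x assume "x \<in> critical_catenoid"
      then obtain s t where st: "s \<in> {-cT..cT}" "x = cat.X s t" by (rule cat.X_cases)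
      obtain r where "0 \<le> r" "r < 2 * pi" "cos t = cos r" "sin t = sin r"
        by (rule sincos_total_2pi[of "cos t" "sin t"]) auto
      then show "x \<in> (\<lambda>(s, t). cat.X s t) ` ({-cT..cT} \<times> {0..2 * pi})"
        using st by (intro image_eqI[of _ _ "(s, r)"]) (auto simp: cat.X_def cat.er_def)
    qed
  qed
  moreover have "continuous_on A (\<lambda>(s, t). cat.X s t)" for A
    unfolding case_prod_beta' by (intro cat.continuous_X continuous_intros)
  ultimately show "compact critical_catenoid"
    by (metis compact_continuous_image compact_Times compact_Icc)
  show "embedded_surface critical_catenoid"
    unfolding embedded_surface_def by (metis catenoid_chart_around surface_chart_def)
  show "-cT < cT" using catenoid_T by simp
  show "cat.admissible cT (-1) (cT - -cT)" using catenoid_admissible(1) by simp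
qed (use catenoid_a catenoid_T in \<open>auto intro!: continuous_intros\<close>)

text \<open>Both fundamental forms are diagonal in these coordinates, and the diagonal entries of
  the second are opposite. Only the square of h, the radial component of the normal, enters the
  norm, so the sign of \<open>N y\<close> can be left open.\<close>

lemma catenoid_curvature:
  assumes c: "c * c = 1" and s: "surface_chart critical_catenoid (cat.chart_domain d t0) (cat.chart b c)" and y: "y \<in> cat.chart_domain d t0"
  shows "trace (shape_operator (cat.chart b c) y) = 0"
    "trace (shape_operator (cat.chart b c) y ** shape_operator (cat.chart b c) y) = 2 / (ca\<^sup>2 * (cosh (b + c * y $ 2)) ^ 4)"
proof -
  interpret surface_chart critical_catenoid "cat.chart_domain d t0" "cat.chart b c" by (rule s)
  let ?s = "b + c * y $ 2" let ?t = "- (c * y $ 1)"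
  let ?r = "ca * cosh ?s"
  have r: "?r > 0" using catenoid_a by simp
  have E1: "E 1 = (\<lambda>y. (-c) *\<^sub>R ((ca * cosh (b + c * y $ 2)) *\<^sub>R cat.et (- (c * y $ 1))))"
    by (rule ext) (simp add: cat.partials_chart cat.Xt_def)
  have E2: "E 2 = (\<lambda>y. c *\<^sub>R ((ca * sinh (b + c * y $ 2)) *\<^sub>R cat.er (- (c * y $ 1)) + ca *\<^sub>R cat.e3))"
    by (rule ext) (simp add: cat.partials_chart cat.Xs_def)
  have d: "((\<lambda>s. ca * cosh s) has_real_derivative ca * sinh s) (at s)" "((\<lambda>s. ca * sinh s) has_real_derivative ca * cosh s) (at s)" "((\<lambda>s. ca) has_real_derivative 0) (at s)" for s
    by (auto intro!: derivative_eq_intros)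
  have EE: "partial_deriv (E 1) 1 y = - ?r *\<^sub>R cat.er ?t" "partial_deriv (E 1) 2 y = - (ca * sinh ?s) *\<^sub>R cat.et ?t"
    "partial_deriv (E 2) 1 y = - (ca * sinh ?s) *\<^sub>R cat.et ?t" "partial_deriv (E 2) 2 y = ?r *\<^sub>R cat.er ?t"
    unfolding E1 E2 cat.partials_rotating[OF d(1) d(3)] cat.partials_rotating[OF d(2) d(3)] using c by (simp_all add: mult.assoc[symmetric])
  have etN: "cat.et ?t \<bullet> N y = 0"
    using N_E(2)[of 1 y] r c unfolding E1 by auto
  have f: "first_fundamental_form (cat.chart b c) y $ i $ j = (if i = j then ?r\<^sup>2 else 0)" for i j
    using c exhaust_2[of i] exhaust_2[of j] cat.inner_X[of ?s ?t]
    by (auto simp: first_fundamental_form_def cat.partials_chart catenoid_speed mult.assoc[symmetric])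
  define h where "h = cat.er ?t \<bullet> N y"
  have sf: "second_fundamental_form (cat.chart b c) y $ 1 $ 1 = - ?r * h" "second_fundamental_form (cat.chart b c) y $ 2 $ 2 = ?r * h"
    "second_fundamental_form (cat.chart b c) y $ 1 $ 2 = 0" "second_fundamental_form (cat.chart b c) y $ 2 $ 1 = 0"
    using etN by (simp_all add: second_fundamental_form_def EE h_def)
  have Sh: "?r\<^sup>2 * Sh y $ i $ j = second_fundamental_form (cat.chart b c) y $ i $ j" for i j
    using arg_cong[OF first_form_shape[OF y], of "\<lambda>A. A $ i $ j"] exhaust_2[of i] by (auto simp: matrix_mult2 f)
  have S: "Sh y $ 1 $ 1 = - h / ?r" "Sh y $ 2 $ 2 = h / ?r" "Sh y $ 1 $ 2 = 0" "Sh y $ 2 $ 1 = 0"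
  proof -
    have aux: "A = q / R" if "R\<^sup>2 * A = R * q" "R > 0" for A q R :: real
      using that by (simp add: field_simps power2_eq_square)
    show "Sh y $ 1 $ 1 = - h / ?r" by (rule aux[OF _ r]) (use Sh[of 1 1] sf in simp)
    show "Sh y $ 2 $ 2 = h / ?r" by (rule aux[OF _ r]) (use Sh[of 2 2] sf in simp)
    show "Sh y $ 1 $ 2 = 0" "Sh y $ 2 $ 1 = 0" using Sh[of 1 2] Sh[of 2 1] r unfolding sf by auto
  qed
  show "trace (Sh y) = 0" by (simp add: trace2 S)
  have h2: "h\<^sup>2 = 1 / (cosh ?s)\<^sup>2"
  proof -
    \<comment> \<open>The explicit unit normal of the catenoid; \<open>N y\<close> agrees with it up
      to a sign.\<close>
    let ?n = "(1 / cosh ?s) *\<^sub>R (cat.er ?t - sinh ?s *\<^sub>R cat.e3)"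
    have "?n \<bullet> ?n = (1 + (sinh ?s)\<^sup>2) / (cosh ?s)\<^sup>2"
      by (simp add: inner_simps cat.er_et cat.e3 power2_eq_square field_simps)
    also have "1 + (sinh ?s)\<^sup>2 = (cosh ?s)\<^sup>2" by (simp add: cosh_square_eq)
    also have "(cosh ?s)\<^sup>2 / (cosh ?s)\<^sup>2 = 1" using cosh_real_pos[of ?s] by simp
    finally have nn: "norm ?n = 1" by (simp only: norm_eq_sqrt_inner real_sqrt_one)
    have "v \<bullet> ?n = 0" if v: "v \<bullet> N y = 0" for v
    proof -
      obtain w where "v = frechet_derivative (cat.chart b c) (at y) w" using v range_d[OF y] by auto
      then show ?thesis
        by (simp add: cat.frechet_chart cat.Xs_def cat.Xt_def inner_simps cat.er_et cat.e3)
    qed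
    from unit_normals_agree[OF norm_N[OF y] nn this]
    obtain k where n: "?n = k *\<^sub>R N y" "k\<^sup>2 = 1" by blast
    have "cat.er ?t \<bullet> ?n = 1 / cosh ?s" by (simp add: inner_simps cat.er_et)
    moreover have "cat.er ?t \<bullet> ?n = k * h" unfolding n(1) h_def by simp
    ultimately have "(1 / cosh ?s)\<^sup>2 = k\<^sup>2 * h\<^sup>2" by (simp add: power_mult_distrib[symmetric])
    then have "(1 / cosh ?s)\<^sup>2 = h\<^sup>2" unfolding n(2) by simp
    then show ?thesis by (simp add: power_divide)
  qed
  have "trace (Sh y ** Sh y) = 2 * h\<^sup>2 / ?r\<^sup>2"
    by (simp add: trace2 matrix_mult2 S power2_eq_square)
  also have "\<dots> = 2 / (ca\<^sup>2 * (cosh ?s) ^ 4)"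
    using r unfolding h2 by (simp add: power_mult_distrib power2_eq_square power4_eq_xxxx)
  finally show "trace (Sh y ** Sh y) = 2 / (ca\<^sup>2 * (cosh ?s) ^ 4)" .
qed

text \<open>Traces of shape operators agree in absolute value for all parametrizations around a
  point, so vanishing in the charts of revolution settles every other one.\<close>

lemma catenoid_minimal: "minimal_surface critical_catenoid"
  unfolding minimal_surface_def
proof (intro allI impI ballI)
  fix W \<psi> y assume p: "local_param critical_catenoid W \<psi>" and y: "y \<in> W \<inter> half_plane"
  then have c1: "surface_chart critical_catenoid W \<psi>" by (simp add: surface_chart_def)
  have "\<psi> y \<in> critical_catenoid" using surface_chart.chart_in[OF c1 y] .
  then obtain b c t0 where bc: "(b, c) = (cT, -1) \<or> (b, c) = (-cT, 1)"
    and c2: "surface_chart critical_catenoid (cat.chart_domain (cT + cT) t0) (cat.chart b c)"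
    and i: "\<psi> y \<in> cat.chart b c ` (cat.chart_domain (cT + cT) t0 \<inter> half_plane)" by (rule catenoid_chart_around)
  from i obtain y' where y': "\<psi> y = cat.chart b c y'" "y' \<in> cat.chart_domain (cT + cT) t0 \<inter> half_plane" by (rule imageE)
  have "c * c = 1" using bc by auto
  then have "trace (shape_operator (cat.chart b c) y') = 0" using catenoid_curvature(1)[OF _ c2] y'(2) by simp
  then show "trace (shape_operator \<psi> y) = 0"
    using shape_traces_invariant(1)[OF c1 c2 y y'(2) y'(1)] by simp
qed

lemma catenoid_second_form:
  assumes s: "s \<in> {-cT..cT}" shows "second_form_norm2 critical_catenoid (cat.X s t) = 2 / (ca\<^sup>2 * (cosh s) ^ 4)"
proof -
  obtain b c t0 where bc: "(b, c) = (cT, -1) \<or> (b, c) = (-cT, 1)"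
    and ch: "surface_chart critical_catenoid (cat.chart_domain (cT + cT) t0) (cat.chart b c)"
    and i: "cat.X s t \<in> cat.chart b c ` (cat.chart_domain (cT + cT) t0 \<inter> half_plane)"
    using catenoid_chart_around[OF cat.X_in[OF s]] by metis
  from i obtain y where y: "cat.X s t = cat.chart b c y" "y \<in> cat.chart_domain (cT + cT) t0 \<inter> half_plane" by (rule imageE)
  have "b + c * y $ 2 \<in> {-cT..cT}" using bc y(2) by (auto simp: cat.chart_domain_def half_plane_def)
  then have "b + c * y $ 2 = s" using y(1) cat.\<sigma>_X[OF s, of t] cat.\<sigma>_X by (metis cat.chart_def)
  then show ?thesis unfolding y(1) surface_chart.second_form_norm2_chart[OF ch y(2)]
    using catenoid_curvature(2)[OF _ ch] y(2) bc by auto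
qed

lemma catenoid_boundary:
  assumes "x \<in> surface_boundary critical_catenoid" obtains t where "x = cat.X cT t" | t where "x = cat.X (-cT) t"
proof -
  obtain s t where s: "s \<in> {-cT..cT}" and x: "x = cat.X s t" using assms cat.boundary_subset by (blast elim: cat.X_cases)
  obtain b c t0 where bc: "(b, c) = (cT, -1) \<or> (b, c) = (-cT, 1)"
    and ch: "surface_chart critical_catenoid (cat.chart_domain (cT + cT) t0) (cat.chart b c)"
    and i: "x \<in> cat.chart b c ` (cat.chart_domain (cT + cT) t0 \<inter> half_plane)"
    using catenoid_chart_around[OF cat.X_in[OF s]] x by metis
  from i obtain y where y: "x = cat.chart b c y" "y \<in> cat.chart_domain (cT + cT) t0 \<inter> half_plane" by (rule imageE)
  have "y $ 2 = 0" using surface_boundary_chart_iff[OF ch y(2)] assms y(1) by simp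
  then have "x = cat.X b (- (c * y $ 1))" by (simp add: y(1) cat.chart_def)
  then show ?thesis using that bc by auto
qed

lemma catenoid_norm: "(norm (cat.X s t))\<^sup>2 = (ca * cosh s)\<^sup>2 + (ca * s)\<^sup>2"
  unfolding power2_norm_eq_inner by (simp add: cat.X_def inner_simps cat.er_et cat.e3 power2_eq_square)

lemma catenoid_conormal:
  fixes b c :: real
  assumes bc: "(b, c) = (cT, -1) \<or> (b, c) = (-cT, 1)"
  shows "norm (cat.X b t) = 1" "exterior_conormal critical_catenoid (cat.X b t) (cat.X b t)"
proof -
  have T: "cT > 0" by (rule catenoid_T)
  show n: "norm (cat.X b t) = 1"
    by (rule power2_eq_imp_eq) (use bc catenoid_norm[of b t] catenoid_a(3) in auto)
  have a: "cat.admissible b c (cT + cT)" using bc catenoid_admissible by auto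
  \<comment> \<open>Since \<open>cT * sinh cT = cosh cT\<close>, the position vector at the boundary
    is \<open>- c * cT\<close> times \<open>Xs\<close>. It is therefore the image of the outward
    parameter vector of length cT, and its unit length is the normalization required.\<close>
  let ?y = "bpt (- c * t)" let ?w = "vector [0, - cT] :: real^2"
  have cc: "c * c = 1" using bc by auto
  have XX: "cat.X b t = (- c * cT) *\<^sub>R cat.Xs b t"
    unfolding cat.X_def cat.Xs_def using bc by (auto simp: catenoid_sinh[symmetric] scaleR_add_right mult_ac)
  have t: "c * (c * t) = t" using cc by (simp only: mult.assoc[symmetric] mult_1)
  have ch: "cat.chart b c ?y = cat.X b t" "partial_deriv (cat.chart b c) 1 ?y = (-c) *\<^sub>R cat.Xt b t"
    "frechet_derivative (cat.chart b c) (at ?y) ?w = (- c * cT) *\<^sub>R cat.Xs b t"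
    by (simp_all add: t cat.chart_def cat.partials_chart cat.frechet_chart)
  show "exterior_conormal critical_catenoid (cat.X b t) (cat.X b t)"
    unfolding exterior_conormal_def
  proof (intro exI conjI)
    show "local_param critical_catenoid (cat.chart_domain (cT + cT) (- c * t)) (cat.chart b c)" by (rule cat.local_param_chart[OF a])
    show "?y \<in> cat.chart_domain (cT + cT) (- c * t)" using T by (simp add: cat.chart_domain_def)
    show "cat.X b t \<bullet> partial_deriv (cat.chart b c) 1 ?y = 0" unfolding ch(2) XX by (simp add: cat.inner_X)
    show "cat.X b t = frechet_derivative (cat.chart b c) (at ?y) ?w" unfolding ch(3) by (rule XX)
  qed (use n T ch in simp_all)
qed

lemma catenoid_free_boundary: "free_boundary_minimal_surface critical_catenoid"
  unfolding free_boundary_minimal_surface_def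
proof (intro conjI)
  show "critical_catenoid \<noteq> {}" using cat.X_in[of 0 0] catenoid_T by auto
  show "connected critical_catenoid"
    unfolding cat.S cat.X_def[symmetric] case_prod_beta'
    by (intro connected_continuous_image connected_Times cat.continuous_X continuous_intros) auto
  show "critical_catenoid \<subseteq> cball 0 1"
  proof
    fix x assume "x \<in> critical_catenoid"
    then obtain s t where s: "s \<in> {-cT..cT}" and x: "x = cat.X s t" by (rule cat.X_cases)
    have "cosh \<bar>s\<bar> \<le> cosh cT" using s by (subst cosh_real_nonneg_le_iff) auto
    then have "(norm x)\<^sup>2 \<le> (ca * cosh cT)\<^sup>2 + (ca * cT)\<^sup>2"
      unfolding x catenoid_norm using s catenoid_a
      by (intro add_mono power_mono mult_left_mono abs_le_square_iff[THEN iffD1]) (auto simp: abs_mult)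
    then show "x \<in> cball 0 1" using power2_le_imp_le[of "norm x" 1] catenoid_a(3) by simp
  qed
  show "surface_boundary critical_catenoid \<subseteq> sphere 0 1"
    using catenoid_conormal(1)[of cT "-1"] catenoid_conormal(1)[of "-cT" 1] by (auto elim!: catenoid_boundary)
  show "\<forall>p\<in>surface_boundary critical_catenoid. exterior_conormal critical_catenoid p p"
    using catenoid_conormal(2)[of cT "-1"] catenoid_conormal(2)[of "-cT" 1] by (auto elim!: catenoid_boundary)
qed (rule cat.compact_S cat.embedded_S catenoid_minimal)+

lemma catenoid_orientable: "orientable_surface critical_catenoid"
proof -
  define \<A> where "\<A> = {(cat.chart_domain (cT + cT) t0, cat.chart b c) |t0 b c. (b, c) = (cT, -1) \<or> (b, c) = (-cT, 1)}"
  show ?thesis unfolding orientable_surface_def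
  proof (intro exI[of _ \<A>] conjI)
    show "\<forall>(W, \<psi>)\<in>\<A>. local_param critical_catenoid W \<psi>"
      using cat.local_param_chart catenoid_admissible unfolding \<A>_def by auto
    show "critical_catenoid \<subseteq> (\<Union>(W, \<psi>)\<in>\<A>. \<psi> ` (W \<inter> half_plane))"
    proof
      fix x assume "x \<in> critical_catenoid"
      then obtain b c t0 where "(b, c) = (cT, -1) \<or> (b, c) = (-cT, 1)"
        "x \<in> cat.chart b c ` (cat.chart_domain (cT + cT) t0 \<inter> half_plane)" by (rule catenoid_chart_around)
      then show "x \<in> (\<Union>(W, \<psi>)\<in>\<A>. \<psi> ` (W \<inter> half_plane))"
        by (intro UN_I[of "(cat.chart_domain (cT + cT) t0, cat.chart b c)"]) (auto simp: \<A>_def)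
    qed
    have "\<exists>M::real^2^2. 0 < det M \<and> (\<forall>v. frechet_derivative (cat.chart b1 c1) (at y1) v = frechet_derivative (cat.chart b2 c2) (at y2) (M *v v))"
      if bc: "(b1, c1) = (cT, -1) \<or> (b1, c1) = (-cT, 1)" "(b2, c2) = (cT, -1) \<or> (b2, c2) = (-cT, 1)"
        and y: "y1 \<in> cat.chart_domain (cT + cT) t1 \<inter> half_plane" "y2 \<in> cat.chart_domain (cT + cT) t2 \<inter> half_plane"
        and eq: "cat.chart b1 c1 y1 = cat.chart b2 c2 y2" for b1 c1 b2 c2 y1 y2 t1 t2
    proof -
      let ?s1 = "b1 + c1 * y1 $ 2" let ?s2 = "b2 + c2 * y2 $ 2" let ?u1 = "- (c1 * y1 $ 1)" let ?u2 = "- (c2 * y2 $ 1)"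
      have "?s1 \<in> {-cT..cT}" "?s2 \<in> {-cT..cT}" using bc y by (auto simp: cat.chart_domain_def half_plane_def)
      then have s: "?s1 = ?s2" using eq cat.\<sigma>_X unfolding cat.chart_def by metis
      have "of_real (ca * cosh ?s2) * cis ?u1 = of_real (ca * cosh ?s2) * cis ?u2"
        using eq s unfolding cat.chart_def by (metis cat.angle_X)
      then have "cis ?u1 = cis ?u2" using catenoid_a by simp
      then have u: "cat.er ?u1 = cat.er ?u2" "cat.et ?u1 = cat.et ?u2" unfolding cat.er_def cat.et_def by (metis cis.sel)+
      \<comment> \<open>Both coordinates of a chart carry the factor c, so the derivative of a
        transition map is the identity or a half turn. The determinant is 1 in either case.\<close>
      let ?M = "(\<chi> i j. if i = j then c1 * c2 else 0) :: real^2^2"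
      have M: "(?M *v v) $ i = c1 * c2 * v $ i" for v :: "real^2" and i
        using exhaust_2[of i] by (auto simp: matrix_vector_mult_def sum_2)
      have c: "c1 * c1 = 1" "c2 * c2 = 1" using bc by auto
      have "det ?M = (c1 * c1) * (c2 * c2)" by (simp add: det_2)
      moreover have "frechet_derivative (cat.chart b1 c1) (at y1) v = frechet_derivative (cat.chart b2 c2) (at y2) (?M *v v)" for v
      proof -
        have k: "c2 * (c1 * c2 * v $ i) = c1 * v $ i" for i using c by (metis mult.assoc mult.commute mult_1)
        show ?thesis unfolding cat.frechet_chart M s cat.Xs_def cat.Xt_def u k ..
      qed
      moreover have "0 < det ?M" using \<open>det ?M = _\<close> c by simp
      ultimately show ?thesis by (intro exI[of _ ?M] conjI allI)
    qed
    note key = this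
    show "\<forall>(W1, \<psi>1)\<in>\<A>. \<forall>(W2, \<psi>2)\<in>\<A>. \<forall>y1\<in>W1 \<inter> half_plane. \<forall>y2\<in>W2 \<inter> half_plane.
             \<psi>1 y1 = \<psi>2 y2 \<longrightarrow>
             (\<exists>M::real^2^2. 0 < det M \<and>
                (\<forall>v. frechet_derivative \<psi>1 (at y1) v = frechet_derivative \<psi>2 (at y2) (M *v v)))"
    proof (intro ballI)
      fix P1 assume "P1 \<in> \<A>"
      then obtain t1 b1 c1 where P1: "P1 = (cat.chart_domain (cT + cT) t1, cat.chart b1 c1)" and bc1: "(b1, c1) = (cT, -1) \<or> (b1, c1) = (-cT, 1)"
        unfolding \<A>_def by blast
      show "case P1 of (W1, \<psi>1) \<Rightarrow> \<forall>(W2, \<psi>2)\<in>\<A>. \<forall>y1\<in>W1 \<inter> half_plane. \<forall>y2\<in>W2 \<inter> half_plane.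
             \<psi>1 y1 = \<psi>2 y2 \<longrightarrow>
             (\<exists>M::real^2^2. 0 < det M \<and>
                (\<forall>v. frechet_derivative \<psi>1 (at y1) v = frechet_derivative \<psi>2 (at y2) (M *v v)))"
        unfolding P1 split
      proof (intro ballI)
        fix P2 assume "P2 \<in> \<A>"
        then obtain t2 b2 c2 where P2: "P2 = (cat.chart_domain (cT + cT) t2, cat.chart b2 c2)" and bc2: "(b2, c2) = (cT, -1) \<or> (b2, c2) = (-cT, 1)"
          unfolding \<A>_def by blast
        show "case P2 of (W2, \<psi>2) \<Rightarrow> \<forall>y1\<in>cat.chart_domain (cT + cT) t1 \<inter> half_plane. \<forall>y2\<in>W2 \<inter> half_plane.
             cat.chart b1 c1 y1 = \<psi>2 y2 \<longrightarrow>
             (\<exists>M::real^2^2. 0 < det M \<and>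
                (\<forall>v. frechet_derivative (cat.chart b1 c1) (at y1) v = frechet_derivative \<psi>2 (at y2) (M *v v)))"
          unfolding P2 split by (intro ballI impI) (rule key[OF bc1 bc2])
      qed
    qed
  qed
qed

text \<open>A flat disk contains the origin, which the catenoid avoids.\<close>

lemma catenoid_not_flat: "\<not> flat_disk_through_origin critical_catenoid"
proof
  assume "flat_disk_through_origin critical_catenoid"
  then have "0 \<in> critical_catenoid" unfolding flat_disk_through_origin_def using subspace_0 by force
  then obtain s t where "0 = cat.X s t" by (rule cat.X_cases)
  then have "(ca * cosh s)\<^sup>2 + (ca * s)\<^sup>2 = 0" by (metis catenoid_norm norm_zero power_zero_numeral)
  then show False using catenoid_a cosh_real_pos[of s] by (simp add: sum_power2_eq_zero_iff)
qed

text \<open>Every point lies in one of the four charts given by the two ends and the centres 0 and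
  pi, and each of these is covered by the main chart up to a null set.\<close>

lemma catenoid_main_image: "AE x in area_measure critical_catenoid. x \<in> critical_catenoid \<longrightarrow> x \<in> cat.main_image"
proof -
  note a = catenoid_admissible
  note A = cat.AE_main_image[OF a(1), of 0] cat.AE_main_image[OF a(1), of pi] cat.AE_main_image[OF a(2), of 0] cat.AE_main_image[OF a(2), of pi]
  show ?thesis using A(1)[OF disjI1[OF refl]] A(2)[OF disjI2[OF refl]] A(3)[OF disjI1[OF refl]] A(4)[OF disjI2[OF refl]]
  proof eventually_elim
    case (elim x)
    show ?case
    proof
      assume "x \<in> critical_catenoid"
      then obtain s t where s: "s \<in> {-cT..cT}" and x: "x = cat.X s t" by (rule cat.X_cases)
      obtain b c where bc: "(b, c) = (cT, -1) \<or> (b, c) = (-cT, 1)"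
        and i: "\<And>t t0. cat.X s t \<in> cat.chart b c ` (cat.chart_domain (cT + cT) t0 \<inter> half_plane) \<longleftrightarrow> cos (t + c * t0) \<noteq> -1"
        using catenoid_chart_at[OF s] by metis
      have "cos (t + c * 0) \<noteq> -1 \<or> cos (t + c * pi) \<noteq> -1" using bc by (auto simp: cos_add cos_diff)
      then have "x \<in> cat.chart b c ` (cat.chart_domain (cT + cT) 0 \<inter> half_plane) \<or> x \<in> cat.chart b c ` (cat.chart_domain (cT + cT) pi \<inter> half_plane)"
        unfolding x i .
      then show "x \<in> cat.main_image" using bc elim by auto
    qed
  qed
qed

text \<open>In the conformal coordinates the curvature term acquires the weight
  \<open>2 * (1 - (tanh s)^2)\<close>, which makes the area integral the one in
  \<open>catenoid_energy\<close>; the boundary integral is \<open>tanh cT\<close> times the circle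
  integrals at both ends.\<close>

lemma catenoid_index_nonneg:
  assumes u: "u \<in> smooth_functions critical_catenoid"
    and m: "integral {-pi..pi} (\<lambda>t. u (cat.X cT t)) = 0" "integral {-pi..pi} (\<lambda>t. u (cat.X (-cT) t)) = 0"
    and pq: "integral {-pi..pi} (\<lambda>t. u (cat.X 0 t) * cos t) = 0" "integral {-pi..pi} (\<lambda>t. u (cat.X 0 t) * sin t) = 0"
  shows "index_form critical_catenoid u \<ge> 0"
proof -
  let ?g = "surface_gradient critical_catenoid u"
  let ?A = "second_form_norm2 critical_catenoid"
  let ?F = "\<lambda>x. (norm (?g x))\<^sup>2 - ?A x * (u x)\<^sup>2"
  interpret pf: catenoid_function cT "\<lambda>s t. u (cat.X s t)" "\<lambda>s t. ?g (cat.X s t) \<bullet> cat.Xs s t" "\<lambda>s t. ?g (cat.X s t) \<bullet> cat.Xt s t"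
    using cat.polar_function_smooth[OF u] catenoid_T by (simp add: catenoid_function_def catenoid_function_axioms_def)
  note ix = cat.index_form_eq[OF u]
  have "cat.aint ?F = integral {-cT..cT} (\<lambda>s. integral {-pi..pi} (\<lambda>t. cat.speed s * (ca * cosh s) * ?F (cat.X s t)))"
    by (rule cat.aint_polar[OF _ catenoid_main_image]) (intro continuous_intros ix cat.second_form_continuous)
  also have "\<dots> = integral {-cT..cT} (\<lambda>s. pf.K s + pf.L s - 2 * (1 - (tanh s)\<^sup>2) * pf.I s)"
  \<comment> \<open>\<open>gradient_energy\<close> is available only away from the inner end of the
    profile; the two end points do not affect the integral.\<close>
  proof (rule integral_spike[of "{-cT, cT}"])
    show "pf.K s + pf.L s - 2 * (1 - (tanh s)\<^sup>2) * pf.I s = integral {-pi..pi} (\<lambda>t. cat.speed s * (ca * cosh s) * ?F (cat.X s t))"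
      if s: "s \<in> {-cT..cT} - {-cT, cT}" for s
    proof -
      have s': "s \<in> {-cT<..<cT}" "s \<in> {-cT<..cT}" "s \<in> {-cT..cT}" using s by auto
      have r: "ca * cosh s > 0" using catenoid_a by simp
      have "cat.speed s * (ca * cosh s) * ?F (cat.X s t) = 1 * (?g (cat.X s t) \<bullet> cat.Xs s t)\<^sup>2 + 1 * (?g (cat.X s t) \<bullet> cat.Xt s t)\<^sup>2 + (- 2 * (1 - (tanh s)\<^sup>2)) * (u (cat.X s t))\<^sup>2" for t
      proof -
        have e: "cat.speed s * (ca * cosh s) * (norm (?g (cat.X s t)))\<^sup>2 = (?g (cat.X s t) \<bullet> cat.Xs s t)\<^sup>2 + (?g (cat.X s t) \<bullet> cat.Xt s t)\<^sup>2"
          using cat.gradient_energy[OF _ u refl, of s t] s' r catenoid_a(1) by (simp add: catenoid_speed)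
        have "cat.speed s * (ca * cosh s) * ?A (cat.X s t) = 2 * (1 - (tanh s)\<^sup>2)"
          unfolding catenoid_second_form[OF s'(3)] catenoid_speed cosh_tanh_facts using catenoid_a cosh_real_pos[of s]
          by (simp add: field_simps power2_eq_square power4_eq_xxxx)
        then have f: "cat.speed s * (ca * cosh s) * (?A (cat.X s t) * (u (cat.X s t))\<^sup>2) = 2 * (1 - (tanh s)\<^sup>2) * (u (cat.X s t))\<^sup>2"
          by (simp only: mult.assoc[symmetric])
        have "cat.speed s * (ca * cosh s) * ?F (cat.X s t) = cat.speed s * (ca * cosh s) * (norm (?g (cat.X s t)))\<^sup>2 - cat.speed s * (ca * cosh s) * (?A (cat.X s t) * (u (cat.X s t))\<^sup>2)"
          by (rule right_diff_distrib)
        then show ?thesis unfolding e f by (simp only: mult_1 mult_minus_left add_uminus_conv_diff)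
      qed
      moreover have "integral {-pi..pi} (\<lambda>t. 1 * (?g (cat.X s t) \<bullet> cat.Xs s t)\<^sup>2 + 1 * (?g (cat.X s t) \<bullet> cat.Xt s t)\<^sup>2 + (- 2 * (1 - (tanh s)\<^sup>2)) * (u (cat.X s t))\<^sup>2)
        = 1 * pf.K s + 1 * pf.L s + (- 2 * (1 - (tanh s)\<^sup>2)) * pf.I s"
        unfolding pf.K_def pf.L_def pf.I_def
        by (rule integral_lin3) (intro continuous_on_power pf.slice s')+
      ultimately show ?thesis by (simp only: mult_1 mult_minus_left add_uminus_conv_diff)
    qed
  qed simp
  also have "\<dots> \<ge> tanh cT * (pf.I cT + pf.I (-cT))"
    by (rule pf.catenoid_energy) (simp_all add: pf.m_def pf.p_def pf.q_def m pq)
  finally have area: "cat.aint ?F \<ge> tanh cT * (pf.I cT + pf.I (-cT))" .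
  \<comment> \<open>For k = 1 and k = -1 the weight is 1 on the boundary circle over
    \<open>k * cT\<close> and 0 on the other one. It splits the boundary integral into the two
    circles while the integrands stay continuous on S.\<close>
  let ?h = "\<lambda>k x. (u x)\<^sup>2 * ((1 + k * (x $ 3 / ca / cT)) / 2)"
  have ch: "continuous_on critical_catenoid (?h k)" for k
    using catenoid_a catenoid_T by (intro continuous_intros ix) auto
  have z: "cat.X s t $ 3 / ca / cT = s / cT" if "s \<in> {-cT..cT}" for s t using cat.\<sigma>_X[OF that] by simp
  have pm: "cT \<in> {-cT..cT}" "-cT \<in> {-cT..cT}" using catenoid_T by auto
  have l1: "cat.lint (?h 1) = tanh cT * pf.I cT"
  proof -
    have "cat.lint (?h 1) = (ca * cosh cT) * integral {-pi..pi} (\<lambda>t. ?h 1 (cat.X cT t))"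
    proof (rule cat.lint_circle[OF catenoid_admissible(1) _ ch])
      show "?h 1 x = 0" if "x \<in> surface_boundary critical_catenoid" "x \<notin> range (cat.X cT)" for x
        using that(1) by (rule catenoid_boundary) (use that(2) z[OF pm(2)] catenoid_T in auto)
    qed (use catenoid_T in simp)
    moreover have "?h 1 (cat.X cT t) = (u (cat.X cT t))\<^sup>2" for t unfolding z[OF pm(1)] using catenoid_T by simp
    ultimately show ?thesis by (simp only: catenoid_a(2) pf.I_def)
  qed
  have l2: "cat.lint (?h (-1)) = tanh cT * pf.I (-cT)"
  proof -
    have "cat.lint (?h (-1)) = (ca * cosh (-cT)) * integral {-pi..pi} (\<lambda>t. ?h (-1) (cat.X (-cT) t))"
    proof (rule cat.lint_circle[OF catenoid_admissible(2) _ ch])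
      show "?h (-1) x = 0" if "x \<in> surface_boundary critical_catenoid" "x \<notin> range (cat.X (-cT))" for x
        using that(1) by (rule catenoid_boundary) (use that(2) z[OF pm(1)] catenoid_T in auto)
    qed (use catenoid_T in simp)
    moreover have "?h (-1) (cat.X (-cT) t) = (u (cat.X (-cT) t))\<^sup>2" for t unfolding z[OF pm(2)] using catenoid_T by simp
    ultimately show ?thesis by (simp only: catenoid_a(2) pf.I_def cosh_minus)
  qed
  have "cat.lint (\<lambda>x. (u x)\<^sup>2) = cat.lint (\<lambda>x. ?h 1 x + ?h (-1) x)"
    by (rule arg_cong[where f = cat.lint]) (simp add: fun_eq_iff field_simps)
  also have "\<dots> = cat.lint (?h 1) + cat.lint (?h (-1))" by (rule cat.int_add(2)[OF ch ch])
  finally have "cat.lint (\<lambda>x. (u x)\<^sup>2) = tanh cT * (pf.I cT + pf.I (-cT))" unfolding l1 l2 by (simp only: distrib_left)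
  then show ?thesis using area unfolding ix(1) by simp
qed

lemma catenoid_index: "surface_index critical_catenoid = 4"
proof (rule antisym)
  interpret fb_surface critical_catenoid using catenoid_free_boundary by (simp add: fb_surface_def)
  show "4 \<le> surface_index critical_catenoid" by (rule index_ge_4[OF catenoid_not_flat])
  let ?i = "\<lambda>u s f. integral {-pi..pi} (\<lambda>t. u (cat.X s t) * f t)"
  let ?\<Lambda> = "\<lambda>u. ((?i u cT (\<lambda>t. 1), ?i u (-cT) (\<lambda>t. 1)), (?i u 0 cos, ?i u 0 sin))"
  have c: "continuous_on {-pi..pi} (\<lambda>t. u (cat.X s t) * f t)"
    if "u \<in> smooth_functions critical_catenoid" "s \<in> {-cT..cT}" "continuous_on {-pi..pi} f" for u s f
    by (intro continuous_on_mult that continuous_on_compose2[OF cat.index_form_eq(3)[OF that(1)]] cat.continuous_X continuous_intros)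
      (use that cat.X_in in auto)
  have add: "?i (u + v) s f = ?i u s f + ?i v s f"
    if "u \<in> smooth_functions critical_catenoid" "v \<in> smooth_functions critical_catenoid" "s \<in> {-cT..cT}" "continuous_on {-pi..pi} f" for u v s f
  proof -
    have "?i (u + v) s f = integral {-pi..pi} (\<lambda>t. u (cat.X s t) * f t + v (cat.X s t) * f t)"
      by (simp add: plus_fun_apply distrib_right)
    also have "\<dots> = ?i u s f + ?i v s f"
      by (intro Henstock_Kurzweil_Integration.integral_add integrable_continuous_real c that)
    finally show ?thesis .
  qed
  have sc: "?i (k *\<^sub>R u) s f = k *\<^sub>R ?i u s f" for k s f and u :: "real^3 \<Rightarrow> real"
    by (simp add: scaleR_fun_def mult.assoc)
  have s: "cT \<in> {-cT..cT}" "-cT \<in> {-cT..cT}" "0 \<in> {-cT..cT}" using catenoid_T by auto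
  have "surface_index critical_catenoid \<le> enat DIM((real \<times> real) \<times> (real \<times> real))"
  proof (rule surface_index_le[where \<Lambda> = ?\<Lambda>])
    fix u v assume uv: "u \<in> smooth_functions critical_catenoid" "v \<in> smooth_functions critical_catenoid"
    show "?\<Lambda> (u + v) = ?\<Lambda> u + ?\<Lambda> v"
      unfolding plus_prod_def fst_conv snd_conv
      by (intro arg_cong2[where f = Pair] add uv s continuous_intros)
  next
    fix k u assume "u \<in> smooth_functions critical_catenoid"
    show "?\<Lambda> (k *\<^sub>R u) = k *\<^sub>R ?\<Lambda> u" by (simp only: sc scaleR_Pair)
  next
    fix u assume u: "u \<in> smooth_functions critical_catenoid" and "?\<Lambda> u = 0"
    then have "?i u cT (\<lambda>t. 1) = 0" "?i u (-cT) (\<lambda>t. 1) = 0" "?i u 0 cos = 0" "?i u 0 sin = 0" by (simp_all only: zero_prod_def prod.inject)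
    then show "index_form critical_catenoid u \<ge> 0" by (intro catenoid_index_nonneg[OF u]) simp_all
  qed
  also have "\<dots> = 4" by (simp add: numeral_eq_enat)
  finally show "surface_index critical_catenoid \<le> 4" .
qed

section \<open>The flat disk\<close>

locale flat_disk = fb_surface S + frame e1 e2 for S e1 e2 +
  assumes S_eq: "S = span {e1, e2} \<inter> cball 0 1"
begin

lemma norm_er: "norm (er t) = 1"
  using er_et(1)[of t] by (simp add: norm_eq_sqrt_inner)

text \<open>The disk as a surface of revolution whose profile runs along a radius; polar coordinates
  of a point are the modulus and \<open>Arg\<close> of its complex coordinate.\<close>

sublocale revolution e1 e2 S "\<lambda>s. s" "\<lambda>s. 1" "\<lambda>s. 0" "\<lambda>s. 0" norm "{0..1}"
proof
  show "smooth_on W (\<lambda>y::real^2. b + c * y $ 2)" for W b c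
  proof -
    have "((\<lambda>s. if n = 0 then s else if n = 1 then 1 else 0 :: real) has_real_derivative (if Suc n = 0 then s else if Suc n = 1 then 1 else 0)) (at s)" for n s
      by (cases "n = 0"; cases "n = 1") (auto intro!: derivative_eq_intros)
    from smooth_on_coordinate[where D = "\<lambda>n s. if n = 0 then s else if n = 1 then 1 else 0", OF this] show ?thesis by simp
  qed
  show "smooth_on W (\<lambda>y::real^2. 0 :: real)" for W :: "(real^2) set" by (simp add: smooth_on_def Ck_on_const)
  show "S = (\<lambda>(s, t). s *\<^sub>R er t + 0 *\<^sub>R e3) ` ({0..1} \<times> UNIV)"
  proof
    show "(\<lambda>(s, t). s *\<^sub>R er t + 0 *\<^sub>R e3) ` ({0..1} \<times> UNIV) \<subseteq> S"
      unfolding S_eq by (auto simp: norm_er) (simp add: er_def span_add span_mul span_base)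
    show "S \<subseteq> (\<lambda>(s, t). s *\<^sub>R er t + 0 *\<^sub>R e3) ` ({0..1} \<times> UNIV)"
    proof
      fix x assume x: "x \<in> S"
      then obtain p q where pq: "x = p *\<^sub>R e1 + q *\<^sub>R e2"
        unfolding S_eq by (auto simp: span_insert[of e1] span_singleton algebra_simps)
      let ?w = "Complex p q"
      have "x = norm ?w *\<^sub>R er (Arg ?w)"
        unfolding pq er_def using rcis_cmod_Arg[of ?w] by (auto simp: rcis_def complex_eq_iff scaleR_add_right)
      moreover from this have "norm ?w \<le> 1" using x norm_er[of "Arg ?w"] by (metis IntD2 S_eq abs_norm_cancel mem_cball_0 mult_1_right norm_scaleR)
      ultimately show "x \<in> (\<lambda>(s, t). s *\<^sub>R er t + 0 *\<^sub>R e3) ` ({0..1} \<times> UNIV)"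
        by (intro image_eqI[of _ _ "(norm ?w, Arg ?w)"]) auto
    qed
  qed
  show "norm (s *\<^sub>R er t + 0 *\<^sub>R e3) = s" if "s \<in> {0..1}" for s t using that by (simp add: norm_er)
qed (auto intro!: continuous_intros derivative_eq_intros)

sublocale compact_revolution e1 e2 S "\<lambda>s. s" "\<lambda>s. 1" "\<lambda>s. 0" "\<lambda>s. 0" norm 0 1
  by unfold_locales (auto simp: admissible_def intro!: continuous_intros)

lemma speed: "speed s = 1" by (simp add: speed_def)

text \<open>Such points have an open neighbourhood of parameters on which the surface lies in the
  plane orthogonal to \<open>e3\<close>. Centre and boundary circle are left out, being irrelevant
  for the integral.\<close>

lemma second_form_interior:
  assumes s: "s \<in> {0<..<1}" shows "second_form_norm2 S (X s t) = 0"
proof -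
  let ?U = "chart_domain (1 - 0) t \<inter> {y. 0 < y $ 2}"
  have "second_form_norm2 S (chart 1 (-1) (vector [t, 1 - s])) = 0"
  proof (rule planar_piece_second_form[OF local_param_chart[OF outer]])
    show "open ?U" by (intro open_Int open_chart_domain open_Collect_less continuous_intros)
    show "?U \<subseteq> chart_domain (1 - 0) t \<inter> half_plane" by (auto simp: half_plane_def)
    show "vector [t, 1 - s] \<in> ?U" using s by (simp add: chart_domain_def)
    show "e3 \<noteq> 0" using e3(1) by auto
    show "chart 1 (-1) z \<bullet> e3 = 0" for z by (simp add: chart_def X_def er_et)
  qed
  then show ?thesis by (simp add: chart_def)
qed

text \<open>Polar charts miss the centre. Some other parametrization around it, injective on its
  domain, shows that this single point has area 0.\<close>

lemma AE_disk: "AE x in area. x \<in> S \<longrightarrow> x \<in> main_image"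
proof -
  have 0: "0 \<in> S" by (simp add: S_eq span_zero)
  then obtain W \<psi> y0 where c: "local_param S W \<psi>" and y0: "y0 \<in> W \<inter> half_plane" "0 = \<psi> y0"
    using embedded_S unfolding embedded_surface_def by blast
  interpret c: surface_chart S W \<psi> using c by (simp add: surface_chart_def)
  have "AE x in area. x \<in> \<psi> ` (W \<inter> half_plane) \<longrightarrow> x \<noteq> 0"
  proof (rule AE_area_chart[OF c])
    show "AE y in lborel. y \<in> W \<inter> half_plane \<longrightarrow> \<psi> y \<noteq> 0"
      using AE_lborel_singleton[of y0]
    proof eventually_elim
      case (elim y)
      then show ?case using inj_onD[OF c.inj_on_chart _ _ y0(1), of y] y0(2) by auto
    qed
  qed simp
  then show ?thesis using AE_main_image[OF outer disjI1[OF refl]] AE_main_image[OF outer disjI2[OF refl]]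
  proof eventually_elim
    case (elim x)
    show ?case
    proof
      assume "x \<in> S"
      then obtain s t where s: "s \<in> {0..1}" and x: "x = X s t" by (rule X_cases)
      have "x \<noteq> 0" using elim(1) y0 by blast
      then have "s \<noteq> 0" using x by (auto simp: X_def)
      moreover have "cos t \<noteq> -1 \<or> cos (t - pi) \<noteq> -1" by (auto simp: cos_diff)
      ultimately have "x \<in> chart 1 (-1) ` (chart_domain (1 - 0) 0 \<inter> half_plane) \<or> x \<in> chart 1 (-1) ` (chart_domain (1 - 0) pi \<inter> half_plane)"
        unfolding x chart_image_iff[OF outer s] using s by auto
      then show "x \<in> main_image" using elim by blast
    qed
  qed
qed

lemma disk_index_nonneg:
  assumes u: "u \<in> smooth_functions S" and m: "integral {-pi..pi} (\<lambda>t. u (X 1 t)) = 0"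
  shows "index_form S u \<ge> 0"
proof -
  let ?g = "surface_gradient S u"
  let ?F = "\<lambda>x. (norm (?g x))\<^sup>2 - second_form_norm2 S x * (u x)\<^sup>2"
  interpret pf: polar_function 0 1 "\<lambda>s t. u (X s t)" "\<lambda>s t. ?g (X s t) \<bullet> Xs s t" "\<lambda>s t. ?g (X s t) \<bullet> Xt s t"
    by (rule polar_function_smooth[OF u])
  note ix = index_form_eq[OF u]
  have cF: "continuous_on S ?F" by (intro continuous_intros ix second_form_continuous)
  let ?\<phi> = "\<lambda>s. integral {-pi..pi} (\<lambda>t. speed s * s * ?F (X s t))"
  let ?\<phi>' = "\<lambda>s. s * pf.K s + pf.L s / s"
  have eq: "?\<phi> s = ?\<phi>' s" if s: "s \<in> {0<..<1}" for s
  proof -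
    have "speed s * s * ?F (X s t) = s * (?g (X s t) \<bullet> Xs s t)\<^sup>2 + (1 / s) * (?g (X s t) \<bullet> Xt s t)\<^sup>2 + 0 * (0::real)" for t
      using gradient_energy[OF _ u refl, of s t] s second_form_interior[OF s, of t] by (simp add: speed)
    moreover have "integral {-pi..pi} (\<lambda>t. s * (?g (X s t) \<bullet> Xs s t)\<^sup>2 + (1 / s) * (?g (X s t) \<bullet> Xt s t)\<^sup>2 + 0 * (0::real)) = s * pf.K s + (1 / s) * pf.L s + 0 * integral {-pi..pi} (\<lambda>t. 0)"
      unfolding pf.K_def pf.L_def
      by (rule integral_lin3) (use s in \<open>auto intro!: continuous_intros pf.slice\<close>)
    ultimately show ?thesis by simp
  qed
  have "continuous_on ({0..1} \<times> {-pi..pi}) (\<lambda>x. speed (fst x) * fst x * ?F (X (fst x) (snd x)))"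
    unfolding speed
    by (intro continuous_on_mult continuous_on_compose2[OF cF continuous_X] continuous_intros) (auto intro: X_in)
  then have "continuous_on {0..1} ?\<phi>"
    using integral_continuous_on_param[of "{0..1}" "-pi" pi "\<lambda>s t. speed s * s * ?F (X s t)"] by (simp add: case_prod_beta')
  then have i: "?\<phi> integrable_on {0..1}" by (rule integrable_continuous_real)
  \<comment> \<open>The term \<open>pf.L s / s\<close> looks singular at the centre, but away from
    the end points the integrand coincides with \<open>?\<phi>\<close>, which is continuous on the
    closed interval.\<close>
  have i': "?\<phi>' integrable_on {0..1}"
    by (rule integrable_spike[OF i, of "{0, 1}"]) (use eq in \<open>auto simp: less_le\<close>)
  have "aint ?F = integral {0..1} ?\<phi>" by (rule aint_polar[OF cF AE_disk])
  also have "\<dots> = integral {0..1} ?\<phi>'"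
    by (rule integral_spike[of "{0, 1}"]) (use eq in \<open>auto simp: less_le\<close>)
  finally have area: "aint ?F = integral {0..1} ?\<phi>'" .
  have K0: "pf.K s \<ge> 0" "pf.L s \<ge> 0" if "s \<in> {0..1}" for s
    unfolding pf.K_def pf.L_def
    by (intro Henstock_Kurzweil_Integration.integral_nonneg integrable_continuous_real continuous_intros pf.slice that; simp)+
  let ?f = "\<lambda>\<delta>. pf.I 1 - (pf.I \<delta> - 2 * pi * (pf.m \<delta>)\<^sup>2)"
  \<comment> \<open>\<open>disk_energy\<close> applies from every positive \<delta>; continuity of
    \<open>pf.I\<close> and \<open>pf.m\<close> carries the bound to the centre.\<close>
  have "?f 0 \<le> aint ?F"
  proof (rule continuous_le_on_closure[of "{0<..<1}" ?f 0])
    show "continuous_on (closure {0<..<1}) ?f" by (simp, intro continuous_intros pf.continuity)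
    show "(0::real) \<in> closure {0<..<1}" by simp
    show "?f \<delta> \<le> aint ?F" if d: "\<delta> \<in> {0<..<1}" for \<delta>
    proof -
      have "?f \<delta> \<le> integral {\<delta>..1} ?\<phi>'"
        by (rule pf.disk_energy) (use d m in \<open>auto simp: pf.m_def\<close>)
      also have "\<dots> \<le> integral {0..1} ?\<phi>'"
        by (rule integral_subset_le) (use d K0 in \<open>auto intro!: integrable_on_subinterval[OF i'] i' add_nonneg_nonneg\<close>)
      finally show ?thesis unfolding area .
    qed
  qed
  \<comment> \<open>At the centre u does not depend on the angle and equals its own mean, so no
    inner boundary term is left.\<close>
  moreover have "pf.I 0 - 2 * pi * (pf.m 0)\<^sup>2 = 0"
  proof -
    have "X 0 t = 0" for t by (simp add: X_def)
    then show ?thesis unfolding pf.I_def pf.m_def by (simp add: power2_eq_square)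
  qed
  moreover have "lint (\<lambda>x. (u x)\<^sup>2) = 1 * integral {-pi..pi} (\<lambda>t. (u (X 1 t))\<^sup>2)"
  proof (rule lint_circle[OF outer])
    show "(u x)\<^sup>2 = 0" if x: "x \<in> surface_boundary S" "x \<notin> range (X 1)" for x
    proof -
      obtain s t where st: "s \<in> {0..1}" "x = X s t" using x(1) boundary_subset by (blast elim: X_cases)
      have "norm x = 1" using fb x(1) unfolding free_boundary_minimal_surface_def by auto
      then have "s = 1" using \<sigma>_X[OF st(1), of t] st(2) by simp
      then show ?thesis using x(2) st(2) by auto
    qed
  qed (auto intro!: continuous_intros ix)
  ultimately show ?thesis unfolding ix(1) pf.I_def by simp
qed

lemma disk_index: "surface_index S = 1"
proof (rule antisym)
  show "1 \<le> surface_index S" by (rule index_ge_1)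
  let ?\<Lambda> = "\<lambda>u. integral {-pi..pi} (\<lambda>t. u (X 1 t) :: real)"
  have c: "continuous_on {-pi..pi} (\<lambda>t. u (X 1 t))" if "u \<in> smooth_functions S" for u
    by (intro continuous_on_compose2[OF index_form_eq(3)[OF that]] continuous_X continuous_intros) (auto intro: X_in)
  have "surface_index S \<le> enat DIM(real)"
  proof (rule surface_index_le[where \<Lambda> = ?\<Lambda>])
    fix u v assume uv: "u \<in> smooth_functions S" "v \<in> smooth_functions S"
    have "?\<Lambda> (u + v) = integral {-pi..pi} (\<lambda>t. u (X 1 t) + v (X 1 t))" by (simp add: plus_fun_apply)
    also have "\<dots> = ?\<Lambda> u + ?\<Lambda> v"
      by (intro Henstock_Kurzweil_Integration.integral_add integrable_continuous_real c uv)
    finally show "?\<Lambda> (u + v) = ?\<Lambda> u + ?\<Lambda> v" .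
  next
    fix k u assume "u \<in> smooth_functions S"
    show "?\<Lambda> (k *\<^sub>R u) = k *\<^sub>R ?\<Lambda> u" by (simp add: scaleR_fun_def)
  qed (rule disk_index_nonneg)
  then show "surface_index S \<le> 1" by (simp add: one_enat_def)
qed

end

lemma (in fb_surface) flat_disk_index:
  assumes "flat_disk_through_origin S" shows "surface_index S = 1"
proof -
  obtain P where P: "subspace P" "dim P = 2" "S = P \<inter> cball 0 1"
    using assms unfolding flat_disk_through_origin_def by blast
  obtain B where B: "pairwise orthogonal B" "\<And>x. x \<in> B \<Longrightarrow> norm x = 1" "card B = dim P" "span B = P"
    using orthonormal_basis_subspace[OF P(1)] by metis
  then obtain e1 e2 where e: "B = {e1, e2}" "e1 \<noteq> e2" unfolding P(2) by (auto simp: card_2_iff)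
  interpret flat_disk S e1 e2
  proof
    show "e1 \<bullet> e1 = 1" "e2 \<bullet> e2 = 1" using B(2) e by (auto simp: norm_eq_1)
    show "e1 \<bullet> e2 = 0" using B(1) e by (auto simp: pairwise_def orthogonal_def)
    show "S = span {e1, e2} \<inter> cball 0 1" using P(3) B(4) e by simp
  qed
  show ?thesis by (rule disk_index)
qed

theorem theorem1p1:
  shows "(\<forall>\<Sigma>. free_boundary_minimal_surface \<Sigma> \<and> orientable_surface \<Sigma> \<longrightarrow>
            (flat_disk_through_origin \<Sigma> \<and> surface_index \<Sigma> = 1) \<or>
            (\<not> flat_disk_through_origin \<Sigma> \<and> 4 \<le> surface_index \<Sigma>)) \<and>
         free_boundary_minimal_surface critical_catenoid \<and>
         orientable_surface critical_catenoid \<and>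
         surface_index critical_catenoid = 4"
proof (intro conjI allI impI)
  fix \<Sigma> assume "free_boundary_minimal_surface \<Sigma> \<and> orientable_surface \<Sigma>"
  then interpret fb_surface \<Sigma> by (simp add: fb_surface_def)
  show "(flat_disk_through_origin \<Sigma> \<and> surface_index \<Sigma> = 1) \<or>
            (\<not> flat_disk_through_origin \<Sigma> \<and> 4 \<le> surface_index \<Sigma>)"
    using flat_disk_index index_ge_4 by blast
qed (rule catenoid_free_boundary catenoid_orientable catenoid_index)+

end
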